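(* Let $\Gamma$ be an infinite subgroup of $\mathrm{PC}_{\mathbf{Proj}}(\mathbf{P}^1)$ with Property FW. Then there exist an integer $n\ge 1$ and subgroups $W\le\Lambda\le\Gamma$, with $W$ finite and normal in $\Gamma$, and $\Lambda$ normal of finite index in $\Gamma$, such that there is an injective group homomorphism $\Lambda/W\to \mathrm{PSL}_2(\mathbf{R})^n$ for which, for each $i=1,\dots,n$, the composite $\Lambda\to\Lambda/W\to\mathrm{PSL}_2(\mathbf{R})^n\to\mathrm{PSL}_2(\mathbf{R})$ with the $i$-th coordinate projection has Zariski-dense image.
   Context: $\mathbf{P}^1=\mathbf{R}\cup\{\infty\}$ denotes the real projective line, with its usual topology (a circle) and the action of $\mathrm{PGL}_2(\mathbf{R})$ by homographies $x\mapsto\frac{ax+b}{cx+d}$. $\mathrm{PC}(\mathbf{P}^1)$ is the group of piecewise continuous self-transformations of $\mathbf{P}^1$: its elements are represented by maps $f:\mathbf{P}^1\to\mathbf{P}^1$, continuous outside a finite subset, for which there exists another such map $g:\mathbf{P}^1\to\mathbf{P}^1$ such that $f\circ g$ and $g\circ f$ coincide with the identity outside a finite subset; two such maps are identified if they coincide outside a finite subset. The group law is composition. $\mathrm{PC}_{\mathbf{Proj}}(\mathbf{P}^1)$ is the subgroup of $\mathrm{PC}(\mathbf{P}^1)$ of those elements represented by a map $f$ such that for all but finitely many $x\in\mathbf{P}^1$ there exist a neighborhood $V$ of $x$ and $g\in\mathrm{PGL}_2(\mathbf{R})$ such that $f(x')=g(x')$ for all $x'\in V$. A (discrete) group $\Gamma$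 has Property FW if for every $\Gamma$-set $E$ and every subset $X\subset E$ such that $X\triangle\gamma X$ is finite for every $\gamma\in\Gamma$, there exists a $\Gamma$-invariant subset $X'\subset E$ such that $X\triangle X'$ is finite. Here $\triangle$ denotes symmetric difference. *)

theory Defs
  imports "HOL-Analysis.Analysis" "HOL-Algebra.Group_Action" "HOL-Algebra.Product_Groups"
begin

section \<open>The real projective line and homographies\<close>

text \<open>\<^term>\<open>None\<close> is the point at infinity.\<close>

definition P1 :: "real option topology" where
  "P1 = Alexandroff_compactification euclideanreal"

text \<open>The homography x \<open>\<mapsto>\<close> (a x + b) / (c x + d) attached to the matrix with rows (a, b) and (c, d).
  It depends only on the matrix up to scalars, so the elements of \<open>PGL\<^sub>2(\<real>)\<close>, as
  transformations of the projective line, are the \<open>homography A\<close> with \<open>det A \<noteq> 0\<close>.\<close>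

definition homography :: "real^2^2 \<Rightarrow> real option \<Rightarrow> real option" where
  "homography A x = (case x of
      Some t \<Rightarrow> if A$2$1 * t + A$2$2 = 0 then None
                else Some ((A$1$1 * t + A$1$2) / (A$2$1 * t + A$2$2))
    | None \<Rightarrow> if A$2$1 = 0 then None else Some (A$1$1 / A$2$1))"

section \<open>Piecewise continuous self-transformations\<close>

definition pw_continuous :: "(real option \<Rightarrow> real option) \<Rightarrow> bool" where
  "pw_continuous f \<longleftrightarrow> (\<exists>S. finite S \<and> continuous_map (subtopology P1 (- S)) P1 f)"

definition PC_maps :: "(real option \<Rightarrow> real option) set" where
  "PC_maps = {f. pw_continuous f \<and>
     (\<exists>g. pw_continuous g \<and> (\<forall>\<^sub>F x in cofinite. f (g x) = x) \<and> (\<forall>\<^sub>F x in cofinite. g (f x) = x))}"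

definition PC_rel :: "((real option \<Rightarrow> real option) \<times> (real option \<Rightarrow> real option)) set" where
  "PC_rel = {(f, g). f \<in> PC_maps \<and> g \<in> PC_maps \<and> (\<forall>\<^sub>F x in cofinite. f x = g x)}"

definition PC :: "(real option \<Rightarrow> real option) set monoid" where
  "PC = \<lparr>carrier = PC_maps // PC_rel,
         monoid.mult = (\<lambda>A B. \<Union>f\<in>A. \<Union>g\<in>B. PC_rel `` {f \<circ> g}),
         one = PC_rel `` {id}\<rparr>"

abbreviation PC_restrict :: "(real option \<Rightarrow> real option) set set \<Rightarrow> (real option \<Rightarrow> real option) set monoid"
  where "PC_restrict H \<equiv> PC\<lparr>carrier := H\<rparr>"

definition pw_projective :: "(real option \<Rightarrow> real option) \<Rightarrow> bool" where
  "pw_projective f \<longleftrightarrow> (\<forall>\<^sub>F x in cofinite. \<exists>V A. openin P1 V \<and> x \<in> V \<and> det A \<noteq> 0 \<and>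
     (\<forall>y\<in>V. f y = homography A y))"

definition PC_Proj :: "(real option \<Rightarrow> real option) set set" where
  "PC_Proj = {c \<in> carrier PC. \<exists>f\<in>c. pw_projective f}"

section \<open>Property FW\<close>

definition FW_on :: "'e itself \<Rightarrow> ('g, 'm) monoid_scheme \<Rightarrow> bool" where
  "FW_on _ G \<longleftrightarrow> (\<forall>(E :: 'e set) \<phi> X. group_action G E \<phi> \<and> X \<subseteq> E \<and>
       (\<forall>\<gamma>\<in>carrier G. finite (sym_diff X (\<phi> \<gamma> ` X))) \<longrightarrow>
     (\<exists>X'\<subseteq>E. (\<forall>\<gamma>\<in>carrier G. \<phi> \<gamma> ` X' = X') \<and> finite (sym_diff X X')))"

text \<open>The definition of Property FW quantifies over all \<open>G\<close>-sets, which cannot be done directly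
  inside a formula. The type chosen here loses nothing: \<open>property_FW_imp_FW_on\<close> below
  derives the condition for \<open>G\<close>-sets in an arbitrary type.\<close>

definition property_FW :: "('g, 'm) monoid_scheme \<Rightarrow> bool" where
  "property_FW G \<longleftrightarrow> FW_on TYPE('g \<times> 'g \<times> nat) G"

section \<open>\<open>PSL\<^sub>2(\<real>)\<close> and its Zariski topology\<close>

definition SL2 :: "(real^2^2) monoid" where
  "SL2 = \<lparr>carrier = {A. det A = 1}, monoid.mult = (**), one = mat 1\<rparr>"

definition PSL2 :: "(real^2^2) set monoid" where
  "PSL2 = SL2 Mod {mat 1, - mat 1}"

text \<open>The regular functions on \<open>PSL\<^sub>2 = SL\<^sub>2/{\<plusminus>1}\<close> are those whose pullback to \<open>SL\<^sub>2\<close> is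
  the restriction of a polynomial in the matrix entries.\<close>

definition regular_PSL2 :: "((real^2^2) set \<Rightarrow> real) \<Rightarrow> bool" where
  "regular_PSL2 F \<longleftrightarrow> (\<exists>p. real_polynomial_function p \<and>
     (\<forall>A\<in>carrier SL2. F ({mat 1, - mat 1} #>\<^bsub>SL2\<^esub> A) = p A))"

definition Zariski_closed_PSL2 :: "(real^2^2) set set \<Rightarrow> bool" where
  "Zariski_closed_PSL2 Z \<longleftrightarrow>
     (\<exists>\<F>. (\<forall>F\<in>\<F>. regular_PSL2 F) \<and> Z = {x \<in> carrier PSL2. \<forall>F\<in>\<F>. F x = 0})"

definition Zariski_dense_PSL2 :: "(real^2^2) set set \<Rightarrow> bool" where
  "Zariski_dense_PSL2 S \<longleftrightarrow> S \<subseteq> carrier PSL2 \<and>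
     (\<forall>Z. Zariski_closed_PSL2 Z \<and> S \<subseteq> Z \<longrightarrow> Z = carrier PSL2)"

section \<open>Property FW does not depend on the type of the \<open>G\<close>-sets\<close>

lemma group_actionI:
  fixes G (structure)
  assumes "group G"
    and cl: "\<And>\<gamma> x. \<gamma> \<in> carrier G \<Longrightarrow> x \<in> E \<Longrightarrow> \<phi> \<gamma> x \<in> E"
    and ext: "\<And>\<gamma>. \<gamma> \<in> carrier G \<Longrightarrow> \<phi> \<gamma> \<in> extensional E"
    and one: "\<And>x. x \<in> E \<Longrightarrow> \<phi> \<one> x = x"
    and mul: "\<And>\<gamma> \<delta> x. \<gamma> \<in> carrier G \<Longrightarrow> \<delta> \<in> carrier G \<Longrightarrow> x \<in> E \<Longrightarrow> \<phi> (\<gamma> \<otimes> \<delta>) x = \<phi> \<gamma> (\<phi> \<delta> x)"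
  shows "group_action G E \<phi>"
proof -
  interpret group G by fact
  have bij: "\<phi> \<gamma> \<in> Bij E" if g: "\<gamma> \<in> carrier G" for \<gamma>
  proof -
    have "bij_betw (\<phi> \<gamma>) E E"
    proof (rule bij_betw_byWitness[where f' = "\<phi> (inv \<gamma>)"])
      show "\<forall>a\<in>E. \<phi> (inv \<gamma>) (\<phi> \<gamma> a) = a" "\<forall>a\<in>E. \<phi> \<gamma> (\<phi> (inv \<gamma>) a) = a"
        using g one by (simp_all flip: mul)
    qed (use g cl in auto)
    then show ?thesis using ext[OF g] by (simp add: Bij_def)
  qed
  have "\<phi> \<in> hom G (BijGroup E)"
  proof (rule homI)
    fix \<gamma> \<delta> assume g: "\<gamma> \<in> carrier G" "\<delta> \<in> carrier G"
    show "\<phi> (\<gamma> \<otimes> \<delta>) = \<phi> \<gamma> \<otimes>\<^bsub>BijGroup E\<^esub> \<phi> \<delta>"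
      using g bij ext[of "\<gamma> \<otimes> \<delta>"] mul
      by (auto simp: BijGroup_def compose_def fun_eq_iff extensional_def)
  qed (simp add: bij BijGroup_def)
  then show ?thesis
    by (intro group_action.intro group_hom.intro group_hom_axioms.intro group_BijGroup \<open>group G\<close>)
qed

theorem property_FW_imp_FW_on:
  fixes G :: "('g, 'm) monoid_scheme" (structure)
  assumes FW: "property_FW G"
  shows "FW_on TYPE('e) G"
  unfolding FW_on_def
proof (intro allI impI, elim conjE)
  fix E :: "'e set" and \<phi> X
  assume act: "group_action G E \<phi>" and XE: "X \<subseteq> E"
    and fin: "\<forall>\<gamma>\<in>carrier G. finite (sym_diff X (\<phi> \<gamma> ` X))"
  interpret group_action G E \<phi> by fact
  interpret group G using group_hom group_hom.axioms(1) by blast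
  define D where "D \<delta> = sym_diff X (\<phi> \<delta> ` X)" for \<delta>
  define E' where "E' = (\<Union>\<gamma>\<in>carrier G. \<Union>\<delta>\<in>carrier G. \<phi> \<gamma> ` D \<delta>)"
  have DE: "D \<delta> \<subseteq> E" if "\<delta> \<in> carrier G" for \<delta>
    using that XE element_image by (fastforce simp: D_def)
  have cmp: "\<phi> \<gamma> (\<phi> \<delta> x) = \<phi> (\<gamma> \<otimes> \<delta>) x" if "\<gamma> \<in> carrier G" "\<delta> \<in> carrier G" "x \<in> E" for \<gamma> \<delta> x
    using composition_rule[of x \<gamma> \<delta>] that by simp
  have one: "\<phi> \<one> x = x" if "x \<in> E" for x
    using that id_eq_one by (metis restrict_apply')
  have E'E: "E' \<subseteq> E"
    using DE element_image unfolding E'_def by (smt (verit) UN_iff image_iff subsetD subsetI)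
  have cl: "\<phi> \<gamma> x \<in> E'" if g: "\<gamma> \<in> carrier G" and x: "x \<in> E'" for \<gamma> x
  proof -
    obtain \<gamma>' \<delta> y where *: "\<gamma>' \<in> carrier G" "\<delta> \<in> carrier G" "y \<in> D \<delta>" "x = \<phi> \<gamma>' y"
      using x unfolding E'_def by auto
    then have "\<phi> \<gamma> x = \<phi> (\<gamma> \<otimes> \<gamma>') y" using cmp g DE by blast
    moreover have "\<gamma> \<otimes> \<gamma>' \<in> carrier G" using g * by simp
    ultimately show ?thesis using * unfolding E'_def by blast
  qed
  have DE': "D \<delta> \<subseteq> E'" if d: "\<delta> \<in> carrier G" for \<delta>
  proof
    fix x assume x: "x \<in> D \<delta>"
    then have "x \<in> E" using DE[OF d] by blast
    then have "\<phi> \<one> x = x" by (rule one)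
    then have "x \<in> \<phi> \<one> ` D \<delta>" using x by (metis imageI)
    with d show "x \<in> E'" unfolding E'_def by blast
  qed
  define r where "r = (\<lambda>(\<gamma>, \<delta>, n). \<phi> \<gamma> (from_nat_into (D \<delta>) n))"
  have rex: "\<exists>t. r t = x" if x: "x \<in> E'" for x
  proof -
    obtain \<gamma>' \<delta> y where *: "\<gamma>' \<in> carrier G" "\<delta> \<in> carrier G" "y \<in> D \<delta>" "x = \<phi> \<gamma>' y"
      using x unfolding E'_def by auto
    have "countable (D \<delta>)" using fin * unfolding D_def by (meson countable_finite)
    then obtain n where "from_nat_into (D \<delta>) n = y" using * from_nat_into_surj by metis
    then have "r (\<gamma>', \<delta>, n) = x" using * by (simp add: r_def)
    then show ?thesis by blast
  qed
  define j where "j x = (SOME t. r t = x)" for x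
  have rj: "r (j x) = x" if "x \<in> E'" for x
    unfolding j_def using rex[OF that] by (rule someI_ex)
  define F where "F = j ` E'"
  define \<psi> where "\<psi> \<gamma> = (\<lambda>t\<in>F. j (\<phi> \<gamma> (r t)))" for \<gamma>
  have \<psi>j: "\<psi> \<gamma> (j x) = j (\<phi> \<gamma> x)" if "x \<in> E'" for \<gamma> x
    using that rj by (simp add: \<psi>_def F_def)
  have actF: "group_action G F \<psi>"
  proof (rule group_actionI)
    show "group G" by unfold_locales
    fix \<gamma> \<delta> t assume g: "\<gamma> \<in> carrier G" "\<delta> \<in> carrier G" and t: "t \<in> F"
    then obtain x where x: "x \<in> E'" "t = j x" by (auto simp: F_def)
    show "\<psi> (\<gamma> \<otimes> \<delta>) t = \<psi> \<gamma> (\<psi> \<delta> t)"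
      using x g E'E cl by (simp add: \<psi>j) (metis cmp subsetD)
  next
    fix \<gamma> t assume g: "\<gamma> \<in> carrier G" and t: "t \<in> F"
    then show "\<psi> \<gamma> t \<in> F" using cl \<psi>j by (auto simp: F_def)
  next
    fix t assume t: "t \<in> F"
    then show "\<psi> \<one> t = t" using one E'E \<psi>j by (auto simp: F_def)
  qed (auto simp: \<psi>_def)
  define X0 where "X0 = j ` (X \<inter> E')"
  have "finite (sym_diff X0 (\<psi> \<gamma> ` X0))" if g: "\<gamma> \<in> carrier G" for \<gamma>
  proof -
    have "sym_diff X0 (\<psi> \<gamma> ` X0) \<subseteq> j ` D \<gamma>"
    proof
      fix t assume "t \<in> sym_diff X0 (\<psi> \<gamma> ` X0)"
      then consider "t \<in> X0" "t \<notin> \<psi> \<gamma> ` X0" | "t \<notin> X0" "t \<in> \<psi> \<gamma> ` X0" by blast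
      then show "t \<in> j ` D \<gamma>"
      proof cases
        case 1
        then obtain x where x: "x \<in> X" "x \<in> E'" "t = j x" by (auto simp: X0_def)
        have "x \<notin> \<phi> \<gamma> ` X"
        proof
          assume "x \<in> \<phi> \<gamma> ` X"
          then obtain y where y: "y \<in> X" "x = \<phi> \<gamma> y" by blast
          then have "y = \<phi> (inv \<gamma>) x"
            using g XE cmp[of "inv \<gamma>" \<gamma> y] one by auto
          then have "y \<in> E'" using cl x g by auto
          then have "t \<in> \<psi> \<gamma> ` X0" using y x \<psi>j[of y \<gamma>] unfolding X0_def by (metis IntI imageI)
          with 1 show False by blast
        qed
        then show ?thesis using x by (auto simp: D_def)
      next
        case 2
        then obtain y where y: "y \<in> X" "y \<in> E'" "t = j (\<phi> \<gamma> y)" by (auto simp: X0_def \<psi>j)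
        then have "\<phi> \<gamma> y \<notin> X" using 2 cl g unfolding X0_def by blast
        then show ?thesis using y by (auto simp: D_def)
      qed
    qed
    moreover have "finite (j ` D \<gamma>)" using fin g by (simp add: D_def)
    ultimately show ?thesis by (rule finite_subset)
  qed
  moreover have "X0 \<subseteq> F" by (auto simp: X0_def F_def)
  ultimately obtain Y where Y: "Y \<subseteq> F" "\<forall>\<gamma>\<in>carrier G. \<psi> \<gamma> ` Y = Y" "finite (sym_diff X0 Y)"
    using FW[unfolded property_FW_def FW_on_def, rule_format, of F \<psi> X0] actF by (smt (verit))
  define X' where "X' = (X - E') \<union> r ` Y"
  have rY: "r ` Y \<subseteq> E'" using Y(1) rj by (auto simp: F_def)
  have sub: "\<phi> \<gamma> ` X' \<subseteq> X'" if g: "\<gamma> \<in> carrier G" for \<gamma>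
  proof
    fix z assume "z \<in> \<phi> \<gamma> ` X'"
    then consider x where "x \<in> X" "x \<notin> E'" "z = \<phi> \<gamma> x" | t where "t \<in> Y" "z = \<phi> \<gamma> (r t)"
      unfolding X'_def by blast
    then show "z \<in> X'"
    proof cases
      case 1
      have "x = \<phi> (inv \<gamma>) z" using g XE 1 cmp[of "inv \<gamma>" \<gamma> x] one by auto
      then have z: "z \<notin> E'" using cl[of "inv \<gamma>" z] g 1 by auto
      then have "z \<notin> D \<gamma>" using DE' g by blast
      then have "z \<in> X" using 1 by (auto simp: D_def)
      with z show ?thesis by (simp add: X'_def)
    next
      case 2
      obtain x where x: "x \<in> E'" "t = j x" using 2 Y(1) by (auto simp: F_def)
      then have "\<psi> \<gamma> t = j z" "z \<in> E'" using 2 rj \<psi>j cl g by auto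
      then have "r (\<psi> \<gamma> t) = z" using rj by simp
      moreover have "\<psi> \<gamma> t \<in> Y" using Y(2) g 2 by blast
      ultimately show ?thesis unfolding X'_def by blast
    qed
  qed
  have X'E: "X' \<subseteq> E" using XE rY E'E by (auto simp: X'_def)
  have inv: "\<phi> \<gamma> ` X' = X'" if g: "\<gamma> \<in> carrier G" for \<gamma>
  proof
    show "X' \<subseteq> \<phi> \<gamma> ` X'"
    proof
      fix x assume x: "x \<in> X'"
      then have "x = \<phi> \<gamma> (\<phi> (inv \<gamma>) x)" using g X'E cmp[of \<gamma> "inv \<gamma>" x] one by auto
      moreover have "\<phi> (inv \<gamma>) x \<in> X'" using sub[of "inv \<gamma>"] g x by auto
      ultimately show "x \<in> \<phi> \<gamma> ` X'" by blast
    qed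
  qed (rule sub[OF g])
  have "sym_diff X X' \<subseteq> r ` sym_diff X0 Y"
  proof
    fix x assume "x \<in> sym_diff X X'"
    then consider "x \<in> X" "x \<in> E'" "x \<notin> r ` Y" | "x \<notin> X" "x \<in> r ` Y"
      unfolding X'_def by blast
    then show "x \<in> r ` sym_diff X0 Y"
    proof cases
      case 1
      then have "j x \<in> X0 - Y" using rj unfolding X0_def by (metis DiffI IntI imageI)
      then show ?thesis using rj[OF 1(2)] by (metis UnI1 imageI)
    next
      case 2
      then obtain t where t: "t \<in> Y" "x = r t" by blast
      then have "t \<notin> X0" using 2 rj by (auto simp: X0_def)
      then show ?thesis using t by blast
    qed
  qed
  then have "finite (sym_diff X X')" using Y(3) by (meson finite_imageI finite_subset)
  with X'E inv show "\<exists>X'\<subseteq>E. (\<forall>\<gamma>\<in>carrier G. \<phi> \<gamma> ` X' = X') \<and> finite (sym_diff X X')"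
    by (intro exI[of _ X'] conjI ballI)
qed

section \<open>The group structure of \<open>PC\<close>\<close>

lemma topspace_P1 [simp]: "topspace P1 = UNIV"
  by (simp add: P1_def) (metis UNIV_option_conv)

lemma openin_P1_Compl_finite: "finite S \<Longrightarrow> openin P1 (- S)"
proof -
  assume "finite S"
  moreover have "t1_space P1"
    unfolding P1_def by (simp add: Hausdorff_imp_t1_space)
  ultimately have "closedin P1 S"
    by (simp add: t1_space_closedin_finite)
  then show ?thesis by (simp add: closedin_def Compl_eq_Diff_UNIV)
qed

lemma PC_maps_eventually_compose:
  assumes "g \<in> PC_maps" and "\<forall>\<^sub>F x in cofinite. P x"
  shows "\<forall>\<^sub>F x in cofinite. P (g x)"
proof -
  obtain h where h: "\<forall>\<^sub>F x in cofinite. h (g x) = x"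
    using assms(1) unfolding PC_maps_def by auto
  have "{x. \<not> P (g x)} \<subseteq> {x. h (g x) \<noteq> x} \<union> h ` {y. \<not> P y}" by force
  then show ?thesis
    using h assms(2) unfolding eventually_cofinite by (meson finite_Un finite_imageI finite_subset)
qed

lemma pw_continuous_cong:
  assumes "pw_continuous f" and e: "\<forall>\<^sub>F x in cofinite. f x = f' x"
  shows "pw_continuous f'"
proof -
  obtain S where S: "finite S" "continuous_map (subtopology P1 (- S)) P1 f"
    using assms unfolding pw_continuous_def by blast
  let ?S = "S \<union> {x. f x \<noteq> f' x}"
  have "continuous_map (subtopology P1 (- ?S)) P1 f"
    using S(2) by (rule continuous_map_from_subtopology_mono) auto
  then have "continuous_map (subtopology P1 (- ?S)) P1 f'"
    by (rule continuous_map_eq) auto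
  moreover have "finite ?S" using S e by (simp add: eventually_cofinite)
  ultimately show ?thesis unfolding pw_continuous_def by blast
qed

lemma pw_continuous_compose:
  assumes "pw_continuous f" "pw_continuous g" "g \<in> PC_maps"
  shows "pw_continuous (f \<circ> g)"
proof -
  obtain S where S: "finite S" "continuous_map (subtopology P1 (- S)) P1 f"
    using assms unfolding pw_continuous_def by blast
  obtain T where T: "finite T" "continuous_map (subtopology P1 (- T)) P1 g"
    using assms unfolding pw_continuous_def by blast
  let ?T = "T \<union> {x. g x \<in> S}"
  have "\<forall>\<^sub>F x in cofinite. x \<notin> S" using S by (simp add: eventually_cofinite)
  from PC_maps_eventually_compose[OF assms(3) this]
  have fin: "finite ?T" using T by (simp add: eventually_cofinite)
  have "continuous_map (subtopology P1 (- ?T)) P1 g"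
    using T(2) by (rule continuous_map_from_subtopology_mono) auto
  then have "continuous_map (subtopology P1 (- ?T)) (subtopology P1 (- S)) g"
    by (auto simp: continuous_map_in_subtopology)
  then have "continuous_map (subtopology P1 (- ?T)) P1 (f \<circ> g)"
    using S(2) by (rule continuous_map_compose)
  with fin show ?thesis unfolding pw_continuous_def by blast
qed

lemma PC_maps_inverse:
  assumes "f \<in> PC_maps"
  obtains g where "g \<in> PC_maps" "\<forall>\<^sub>F x in cofinite. f (g x) = x" "\<forall>\<^sub>F x in cofinite. g (f x) = x"
  using assms unfolding PC_maps_def by blast

lemma PC_maps_compose:
  assumes f: "f \<in> PC_maps" and g: "g \<in> PC_maps"
  shows "f \<circ> g \<in> PC_maps"
proof -
  obtain f' where f': "f' \<in> PC_maps" "\<forall>\<^sub>F x in cofinite. f (f' x) = x" "\<forall>\<^sub>F x in cofinite. f' (f x) = x"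
    using PC_maps_inverse[OF f] .
  obtain g' where g': "g' \<in> PC_maps" "\<forall>\<^sub>F x in cofinite. g (g' x) = x" "\<forall>\<^sub>F x in cofinite. g' (g x) = x"
    using PC_maps_inverse[OF g] .
  have pw: "pw_continuous h" if "h \<in> PC_maps" for h using that by (simp add: PC_maps_def)
  have "\<forall>\<^sub>F x in cofinite. f (g (g' (f' x))) = x"
    using PC_maps_eventually_compose[OF f'(1) g'(2)] f'(2) by eventually_elim simp
  moreover have "\<forall>\<^sub>F x in cofinite. g' (f' (f (g x))) = x"
    using PC_maps_eventually_compose[OF g f'(3)] g'(3) by eventually_elim simp
  moreover have "pw_continuous (f \<circ> g)" "pw_continuous (g' \<circ> f')"
    using pw_continuous_compose pw f g f' g' by auto
  ultimately show ?thesis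
    unfolding PC_maps_def by (auto intro!: exI[of _ "g' \<circ> f'"])
qed

lemma id_PC_maps: "id \<in> PC_maps"
proof -
  have "pw_continuous id"
    unfolding pw_continuous_def by (intro exI[of _ "{}"]) (simp add: Compl_eq_Diff_UNIV flip: topspace_P1)
  then show ?thesis unfolding PC_maps_def by (auto intro!: exI[of _ id])
qed

lemma equiv_PC_rel: "equiv PC_maps PC_rel"
proof (rule equivI)
  show "PC_rel \<subseteq> PC_maps \<times> PC_maps" by (auto simp: PC_rel_def)
  show "refl_on PC_maps PC_rel" by (auto simp: PC_rel_def refl_on_def)
  show "sym PC_rel" by (auto simp: PC_rel_def sym_def eq_commute)
  show "trans PC_rel"
  proof (rule transI)
    fix f g h assume "(f, g) \<in> PC_rel" "(g, h) \<in> PC_rel"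
    then show "(f, h) \<in> PC_rel"
      unfolding PC_rel_def by (auto elim: eventually_elim2)
  qed
qed

lemma PC_mult:
  assumes f: "f \<in> PC_maps" and g: "g \<in> PC_maps"
  shows "PC_rel `` {f} \<otimes>\<^bsub>PC\<^esub> PC_rel `` {g} = PC_rel `` {f \<circ> g}"
proof -
  have "congruent2 PC_rel PC_rel (\<lambda>f g. PC_rel `` {f \<circ> g})"
  proof (rule congruent2I')
    fix f f' g g' assume r: "(f, f') \<in> PC_rel" "(g, g') \<in> PC_rel"
    have "\<forall>\<^sub>F x in cofinite. f (g x) = f' (g x)"
      using r PC_maps_eventually_compose[of g "\<lambda>x. f x = f' x"] unfolding PC_rel_def by auto
    moreover have "\<forall>\<^sub>F x in cofinite. g x = g' x" using r unfolding PC_rel_def by auto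
    ultimately have "\<forall>\<^sub>F x in cofinite. (f \<circ> g) x = (f' \<circ> g') x"
      by eventually_elim simp
    then have "(f \<circ> g, f' \<circ> g') \<in> PC_rel"
      using r PC_maps_compose unfolding PC_rel_def by auto
    then show "PC_rel `` {f \<circ> g} = PC_rel `` {f' \<circ> g'}"
      by (rule equiv_class_eq[OF equiv_PC_rel])
  qed
  then show ?thesis
    using UN_equiv_class2[OF equiv_PC_rel equiv_PC_rel _ f g] by (simp add: PC_def)
qed

lemma PC_carrierE:
  assumes "c \<in> carrier PC"
  obtains f where "f \<in> PC_maps" "c = PC_rel `` {f}"
  using assms by (auto simp: PC_def elim: quotientE)

lemma PC_class_in_carrier: "f \<in> PC_maps \<Longrightarrow> PC_rel `` {f} \<in> carrier PC"
  by (simp add: PC_def quotientI)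

lemma PC_inverse_class:
  assumes "f \<in> PC_maps" "g \<in> PC_maps" "\<forall>\<^sub>F x in cofinite. g (f x) = x"
  shows "PC_rel `` {g} \<otimes>\<^bsub>PC\<^esub> PC_rel `` {f} = \<one>\<^bsub>PC\<^esub>"
proof -
  have "(g \<circ> f, id) \<in> PC_rel"
    using assms PC_maps_compose id_PC_maps unfolding PC_rel_def by auto
  then show ?thesis
    using PC_mult[OF assms(2,1)] equiv_class_eq[OF equiv_PC_rel] by (simp add: PC_def)
qed

theorem group_PC: "group PC"
proof (rule groupI)
  have one: "\<one>\<^bsub>PC\<^esub> = PC_rel `` {id}" by (simp add: PC_def)
  show "\<one>\<^bsub>PC\<^esub> \<in> carrier PC" using PC_class_in_carrier id_PC_maps one by simp
  fix a assume a: "a \<in> carrier PC"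
  then obtain f where f: "f \<in> PC_maps" "a = PC_rel `` {f}" by (rule PC_carrierE)
  show "\<one>\<^bsub>PC\<^esub> \<otimes>\<^bsub>PC\<^esub> a = a" using f PC_mult id_PC_maps one by simp
  obtain g where g: "g \<in> PC_maps" "\<forall>\<^sub>F x in cofinite. g (f x) = x"
    using PC_maps_inverse[OF f(1)] .
  show "\<exists>y\<in>carrier PC. y \<otimes>\<^bsub>PC\<^esub> a = \<one>\<^bsub>PC\<^esub>"
    using PC_inverse_class[OF f(1) g] PC_class_in_carrier[OF g(1)] f(2) by blast
  fix b assume b: "b \<in> carrier PC"
  then obtain g where g: "g \<in> PC_maps" "b = PC_rel `` {g}" by (rule PC_carrierE)
  show "a \<otimes>\<^bsub>PC\<^esub> b \<in> carrier PC"
    using f g by (simp add: PC_mult PC_class_in_carrier PC_maps_compose)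
  fix c assume "c \<in> carrier PC"
  then obtain h where h: "h \<in> PC_maps" "c = PC_rel `` {h}" by (rule PC_carrierE)
  show "a \<otimes>\<^bsub>PC\<^esub> b \<otimes>\<^bsub>PC\<^esub> c = a \<otimes>\<^bsub>PC\<^esub> (b \<otimes>\<^bsub>PC\<^esub> c)"
    using f g h by (simp add: PC_mult PC_maps_compose comp_assoc)
qed

lemma homography_mult:
  assumes "det B \<noteq> 0"
  shows "homography (A ** B) x = homography A (homography B x)"
proof (cases x)
  case None
  have eq: "(A ** B)$i$1 = A$i$1 * B$1$1 + A$i$2 * B$2$1" for i
    by (simp add: matrix_matrix_mult_def sum_2)
  show ?thesis
  proof (cases "B$2$1 = 0")
    case True
    then have "B$1$1 \<noteq> 0" using assms by (auto simp: det_2)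
    with True None show ?thesis unfolding homography_def by (simp add: eq)
  next
    case False
    have "A$i$1 * (B$1$1 / B$2$1) + A$i$2 = (A$i$1 * B$1$1 + A$i$2 * B$2$1) / B$2$1" for i
      using False by (simp add: field_simps)
    with False None show ?thesis unfolding homography_def by (simp add: eq)
  qed
next
  case (Some t)
  let ?d = "B$2$1 * t + B$2$2" and ?n = "B$1$1 * t + B$1$2"
  have eq: "(A ** B)$i$1 * t + (A ** B)$i$2 = A$i$1 * ?n + A$i$2 * ?d" for i
    by (simp add: matrix_matrix_mult_def sum_2 algebra_simps)
  show ?thesis
  proof (cases "?d = 0")
    case True
    have "?n \<noteq> 0"
    proof
      assume "?n = 0"
      then have "B$1$1 * ?d - B$2$1 * ?n = 0" "B$1$2 * ?d - B$2$2 * ?n = 0" using True by simp_all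
      then have "det B = 0 " "det B * t = 0"
        by (simp_all add: det_2 algebra_simps)
      with assms show False by simp
    qed
    with True Some show ?thesis unfolding homography_def by (simp add: eq)
  next
    case False
    have "A$i$1 * (?n / ?d) + A$i$2 = (A$i$1 * ?n + A$i$2 * ?d) / ?d" for i
      using False by (simp add: field_simps)
    with False Some show ?thesis unfolding homography_def by (simp add: eq)
  qed
qed

lemma homography_mat_1: "homography (mat 1) x = x"
  by (cases x) (simp_all add: homography_def mat_def)

lemma pw_projective_cong:
  assumes f: "pw_projective f" and e: "\<forall>\<^sub>F x in cofinite. f x = f' x"
  shows "pw_projective f'"
proof -
  let ?S = "{x. f x \<noteq> f' x}"
  have S: "openin P1 (- ?S)" using e by (intro openin_P1_Compl_finite) (simp add: eventually_cofinite)
  show ?thesis using f e unfolding pw_projective_def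
  proof eventually_elim
    case (elim x)
    then obtain V A where V: "openin P1 V" "x \<in> V" "det A \<noteq> 0" "\<forall>y\<in>V. f y = homography A y" by blast
    then show ?case using elim S
      by (intro exI[of _ "V \<inter> - ?S"] exI[of _ A]) auto
  qed
qed

lemma pw_continuous_openin_vimage:
  assumes "pw_continuous g"
  shows "\<exists>S. finite S \<and> (\<forall>V. openin P1 V \<longrightarrow> openin P1 {x \<in> - S. g x \<in> V})"
proof -
  obtain S where S: "finite S" "continuous_map (subtopology P1 (- S)) P1 g"
    using assms unfolding pw_continuous_def by blast
  have "openin P1 {x \<in> - S. g x \<in> V}" if "openin P1 V" for V
  proof -
    have "openin (subtopology P1 (- S)) {x \<in> - S. g x \<in> V}"
      using openin_continuous_map_preimage[OF S(2) that] by simp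
    then show ?thesis
      using openin_P1_Compl_finite[OF S(1)] openin_trans_full by blast
  qed
  with S show ?thesis by blast
qed

lemma pw_projective_compose:
  assumes f: "pw_projective f" and g: "pw_projective g" "g \<in> PC_maps"
  shows "pw_projective (f \<circ> g)"
proof -
  obtain S where S: "finite S" "\<And>V. openin P1 V \<Longrightarrow> openin P1 {x \<in> - S. g x \<in> V}"
    using pw_continuous_openin_vimage g(2) unfolding PC_maps_def by blast
  have "\<forall>\<^sub>F x in cofinite. x \<notin> S" using S by (simp add: eventually_cofinite)
  with g(1) PC_maps_eventually_compose[OF g(2) f[unfolded pw_projective_def]]
  show ?thesis unfolding pw_projective_def
  proof eventually_elim
    case (elim x)
    obtain V A where V: "openin P1 V" "x \<in> V" "det A \<noteq> 0" "\<forall>y\<in>V. g y = homography A y"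
      using elim by blast
    obtain W B where W: "openin P1 W" "g x \<in> W" "det B \<noteq> 0" "\<forall>y\<in>W. f y = homography B y"
      using elim by blast
    let ?U = "V \<inter> {x \<in> - S. g x \<in> W}"
    have "openin P1 ?U" "x \<in> ?U" using V W S elim by auto
    moreover have "\<forall>y\<in>?U. (f \<circ> g) y = homography (B ** A) y"
      using V W by (auto simp: homography_mult)
    moreover have "det (B ** A) \<noteq> 0" using V W by (simp add: det_mul)
    ultimately show ?case by blast
  qed
qed

lemma pw_projective_inverse:
  assumes f: "pw_projective f" and g: "g \<in> PC_maps"
    and fg: "\<forall>\<^sub>F x in cofinite. f (g x) = x"
  shows "pw_projective g"
proof -
  let ?T = "{x. f (g x) \<noteq> x}"
  obtain S where S: "finite S" "\<And>V. openin P1 V \<Longrightarrow> openin P1 {x \<in> - S. g x \<in> V}"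
    using pw_continuous_openin_vimage g unfolding PC_maps_def by blast
  have T: "openin P1 (- ?T)" using fg by (intro openin_P1_Compl_finite) (simp add: eventually_cofinite)
  have "\<forall>\<^sub>F x in cofinite. x \<notin> S" using S by (simp add: eventually_cofinite)
  with fg PC_maps_eventually_compose[OF g f[unfolded pw_projective_def]]
  show ?thesis unfolding pw_projective_def
  proof eventually_elim
    case (elim x)
    obtain V A where V: "openin P1 V" "g x \<in> V" "det A \<noteq> 0" "\<forall>y\<in>V. f y = homography A y"
      using elim by blast
    obtain B where B: "A ** B = mat 1" "B ** A = mat 1"
      using V(3) by (auto simp: invertible_det_nz[symmetric] invertible_def)
    let ?U = "{x \<in> - S. g x \<in> V} \<inter> - ?T"
    have "openin P1 ?U" "x \<in> ?U" using V S T elim by auto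
    moreover have "g y = homography B y" if "y \<in> ?U" for y
    proof -
      have "y = homography A (g y)" using that V by auto
      then have "homography B y = homography (B ** A) (g y)"
        using homography_mult[OF V(3)] by metis
      then show ?thesis by (simp add: B homography_mat_1)
    qed
    moreover have "det B \<noteq> 0" using B by (metis det_I det_mul mult_zero_right zero_neq_one)
    ultimately show ?case by blast
  qed
qed

theorem subgroup_PC_Proj: "subgroup PC_Proj PC"
proof -
  interpret group PC by (rule group_PC)
  have I: "PC_rel `` {f} \<in> PC_Proj" if "f \<in> PC_maps" "pw_projective f" for f
  proof -
    have "f \<in> PC_rel `` {f}" using that by (simp add: PC_rel_def)
    then show ?thesis using that PC_class_in_carrier unfolding PC_Proj_def by blast
  qed
  have E: "\<exists>f\<in>PC_maps. pw_projective f \<and> c = PC_rel `` {f}" if "c \<in> PC_Proj" for c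
  proof -
    obtain h f where h: "h \<in> PC_maps" "c = PC_rel `` {h}" "f \<in> c" "pw_projective f"
      using \<open>c \<in> PC_Proj\<close> unfolding PC_Proj_def by (auto elim: PC_carrierE)
    then have "(h, f) \<in> PC_rel" by simp
    then have "f \<in> PC_maps" "c = PC_rel `` {f}"
      using h equiv_class_eq[OF equiv_PC_rel] by (auto simp: PC_rel_def)
    with h show ?thesis by blast
  qed
  have "openin P1 UNIV" using openin_topspace[of P1] by simp
  then have "pw_projective id"
    unfolding pw_projective_def
    by (intro always_eventually allI exI[of _ UNIV] exI[of _ "mat 1"])
      (auto simp: homography_mat_1)
  then have one: "\<one>\<^bsub>PC\<^esub> \<in> PC_Proj" using I id_PC_maps by (simp add: PC_def)
  show ?thesis
  proof (rule subgroupI)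
    show "PC_Proj \<subseteq> carrier PC" by (auto simp: PC_Proj_def)
    show "PC_Proj \<noteq> {}" using one by blast
    fix a assume "a \<in> PC_Proj"
    then obtain f where f: "f \<in> PC_maps" "pw_projective f" "a = PC_rel `` {f}" using E by blast
    obtain g where g: "g \<in> PC_maps" "\<forall>\<^sub>F x in cofinite. f (g x) = x" "\<forall>\<^sub>F x in cofinite. g (f x) = x"
      using PC_maps_inverse[OF f(1)] .
    have "inv\<^bsub>PC\<^esub> a = PC_rel `` {g}"
      using PC_inverse_class[OF f(1) g(1,3)] f(1,3) g(1) PC_class_in_carrier by (intro inv_equality) auto
    then show "inv\<^bsub>PC\<^esub> a \<in> PC_Proj" using I g pw_projective_inverse[OF f(2) g(1,2)] by simp
    fix b assume "b \<in> PC_Proj"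
    then obtain h where h: "h \<in> PC_maps" "pw_projective h" "b = PC_rel `` {h}" using E by blast
    show "a \<otimes>\<^bsub>PC\<^esub> b \<in> PC_Proj"
      using f h by (simp add: PC_mult I PC_maps_compose pw_projective_compose)
  qed
qed

section \<open>The group structure of \<open>PSL2\<close>\<close>

lemma group_SL2: "group SL2"
proof (rule groupI)
  fix A :: "real^2^2" assume "A \<in> carrier SL2"
  then have A: "det A = 1" by (simp add: SL2_def)
  then obtain B where B: "B ** A = mat 1"
    by (metis invertible_def invertible_det_nz zero_neq_one)
  then have "det B = 1" using A by (metis det_I det_mul mult.right_neutral)
  then show "\<exists>B\<in>carrier SL2. B \<otimes>\<^bsub>SL2\<^esub> A = \<one>\<^bsub>SL2\<^esub>" using B by (auto simp: SL2_def)
qed (auto simp: SL2_def det_mul matrix_mul_assoc)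

theorem group_PSL2: "group PSL2"
proof -
  interpret group SL2 by (rule group_SL2)
  have m: "- mat 1 ** A = - A" "A ** - mat 1 = - A" for A :: "real^2^2"
    by (simp_all add: vec_eq_iff forall_2 sum_2 matrix_matrix_mult_def mat_def)
  have d: "det (- mat 1 :: real^2^2) = 1" by (simp add: det_2 mat_def)
  have "subgroup {mat 1, - mat 1} SL2"
  proof (rule subgroupI)
    fix a assume a: "a \<in> {mat 1, - mat 1 :: real^2^2}"
    have "inv\<^bsub>SL2\<^esub> a = a" using a d m by (intro inv_equality) (auto simp: SL2_def)
    then show "inv\<^bsub>SL2\<^esub> a \<in> {mat 1, - mat 1}" using a by simp
  qed (auto simp: SL2_def d m)
  then have "{mat 1, - mat 1} \<lhd> SL2"
    by (rule normalI) (auto simp: r_coset_def l_coset_def SL2_def m)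
  then show ?thesis unfolding PSL2_def by (rule normal.factorgroup_is_group)
qed

end

theory Submission
  imports Defs "HOL-Real_Asymp.Real_Asymp"
begin

text \<open>An element of \<open>\<Gamma>\<close> is a piecewise projective map up to finite sets. It does not act on points, but
  it has a germ at each side of each point of the circle, and this germ is a homography. So the group
  acts on the set of sides of points (\<open>piecewise_group_PC\<close>). The projective structure of the circle
  is the rule that glues the two sides of each point by the identity, and each element respects all
  but finitely many of these gluings. Property FW therefore gives an invariant set of gluings that
  differs from the standard one at finitely many points only (\<open>gluing_exists\<close>). For this regluing,
  which turns the circle into finitely many projective intervals and circles, \<open>\<Gamma>\<close> acts without any
  breakpoints, and a subgroup of finite index preserves each component.

  On a component one chooses projective coordinates \<open>\<beta>\<close> by continuation from a base side along a
  spanning tree of its pieces (\<open>component_exists\<close>). A count of the ends shows that at most one gluing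
  is left over. It closes the component to a circle, with a holonomy \<open>h\<close>. Read in these coordinates, an
  element acts on the component by a homography \<open>R \<gamma>\<close> that is unique up to powers of \<open>h\<close>.

  If \<open>h\<close> is trivial, \<open>R\<close> is a homomorphism to \<open>PGL\<^sub>2\<close>, and it determines the germ at the base side up
  to finitely many choices. If \<open>h\<close> is nontrivial, \<open>R\<close> takes values in the normalizer of the group
  generated by \<open>h\<close>, which is solvable. As abelian groups with Property FW are finite
  (\<open>FW_imp_finite\<close>), \<open>R \<gamma>\<close> is a power of \<open>h\<close> for all elements of a subgroup of finite index. Such
  elements act on the line that unrolls the circle, and Property FW, applied to the upper half of a
  discrete invariant subset of the line, bounds these powers. So only finitely many germs occur in this case
  (\<open>finite_germs_nontrivial_holonomy\<close>).

  This gives finitely many homomorphisms to \<open>PSL\<^sub>2\<close> on a normal subgroup \<open>\<Lambda>\<close> of finite index, and a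
  subset of \<open>\<Lambda>\<close> on which all of them take finitely many values is finite, because a trivial germ
  spreads over a component (\<open>projective_representations\<close>). Keep those with infinite image. Their
  images are Zariski dense (\<open>FW_infinite_image_dense\<close>): the image has Property FW and is infinite,
  so it is not solvable up to finite index, and in dimension 2 this leaves only dense groups. Their
  joint kernel \<open>W\<close> is finite. It consists of the elements of \<open>\<Lambda>\<close> with finite conjugacy class
  (\<open>finite_class_iff_kernel\<close>), since dense groups have trivial centralizers, and this description
  shows that \<open>W\<close> is normal in \<open>\<Gamma>\<close>.\<close>

section \<open>Subgroups of finite index and Property FW\<close>

abbreviation FW_subgroup :: "('g, 'm) monoid_scheme \<Rightarrow> 'g set \<Rightarrow> bool" where
  "FW_subgroup G L \<equiv> property_FW (G\<lparr>carrier := L\<rparr>)"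

text \<open>Finiteness of the index by a finite set of representatives of left cosets. It is stated for
  subsets of one group, so that subgroups of subgroups need no change of the ambient group.\<close>

definition fin_index :: "('g, 'm) monoid_scheme \<Rightarrow> 'g set \<Rightarrow> 'g set \<Rightarrow> bool" where
  "fin_index G H K \<longleftrightarrow> (\<exists>T. finite T \<and> T \<subseteq> K \<and> (\<forall>x\<in>K. \<exists>t\<in>T. inv\<^bsub>G\<^esub> t \<otimes>\<^bsub>G\<^esub> x \<in> H))"

context group
begin

lemma subgroup_props:
  assumes "subgroup H G"
  shows "\<And>x. x \<in> H \<Longrightarrow> x \<in> carrier G" "\<And>x y. x \<in> H \<Longrightarrow> y \<in> H \<Longrightarrow> x \<otimes> y \<in> H"
    "\<And>x. x \<in> H \<Longrightarrow> inv x \<in> H" "\<one> \<in> H"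
  by (fact subgroup.mem_carrier[OF assms] subgroup.m_closed[OF assms]
      subgroup.m_inv_closed[OF assms] subgroup.one_closed[OF assms])+

lemma inv_mult_cancel [simp]: "x \<in> carrier G \<Longrightarrow> y \<in> carrier G \<Longrightarrow> inv x \<otimes> (x \<otimes> y) = y"
  "x \<in> carrier G \<Longrightarrow> y \<in> carrier G \<Longrightarrow> x \<otimes> (inv x \<otimes> y) = y"
  by (simp_all flip: m_assoc)

text \<open>A finite invariant that separates the cosets bounds the index. Most invariants below are tuples
  of choices made for finitely many components or coset representatives.\<close>

lemma fin_indexI:
  assumes "K \<subseteq> carrier G" "finite (f ` K)" "\<And>x y. x \<in> K \<Longrightarrow> y \<in> K \<Longrightarrow> f x = f y \<Longrightarrow> inv x \<otimes> y \<in> H"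
  shows "fin_index G H K"
proof -
  obtain T where T: "T \<subseteq> K" "finite T" "f ` K = f ` T"
    using finite_subset_image[OF assms(2) subset_refl] by metis
  have "\<exists>t\<in>T. inv t \<otimes> x \<in> H" if x: "x \<in> K" for x
  proof -
    have "f x \<in> f ` T" using x T(3) by blast
    then obtain t where "t \<in> T" "f t = f x" by force
    then show ?thesis using assms(3)[of t x] x T(1) by blast
  qed
  then show ?thesis unfolding fin_index_def using T by blast
qed

lemma fin_indexE:
  assumes "fin_index G H K" "subgroup H G" "K \<subseteq> carrier G"
  obtains f :: "'a \<Rightarrow> 'a" where "finite (f ` K)"
    "\<forall>x\<in>K. \<forall>y\<in>K. f x = f y \<longrightarrow> inv x \<otimes> y \<in> H"
proof -
  obtain T where T: "finite T" "T \<subseteq> K" "\<forall>x\<in>K. \<exists>t\<in>T. inv t \<otimes> x \<in> H"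
    using assms(1) unfolding fin_index_def by blast
  then obtain f where f: "\<forall>x\<in>K. f x \<in> T \<and> inv (f x) \<otimes> x \<in> H" by metis
  show thesis
  proof (rule that[of f])
    show "finite (f ` K)" using f T(1) by (meson finite_subset image_subsetI)
    show "\<forall>x\<in>K. \<forall>y\<in>K. f x = f y \<longrightarrow> inv x \<otimes> y \<in> H"
    proof (intro ballI impI)
      fix x y assume xy: "x \<in> K" "y \<in> K" "f x = f y"
      have c: "x \<in> carrier G" "y \<in> carrier G" "f x \<in> carrier G" using xy f T assms(3) by blast+
      have "inv (inv (f x) \<otimes> x) \<otimes> (inv (f y) \<otimes> y) \<in> H"
        using f xy(1,2) subgroup_props(2,3)[OF assms(2)] by metis
      moreover have "inv (inv (f x) \<otimes> x) \<otimes> (inv (f y) \<otimes> y) = inv x \<otimes> y"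
        using c xy(3) by (simp add: inv_mult_group m_assoc)
      ultimately show "inv x \<otimes> y \<in> H" by simp
    qed
  qed
qed

lemma fin_index_trans:
  assumes "fin_index G A B" "fin_index G B K" "K \<subseteq> carrier G" "B \<subseteq> K" "subgroup K G"
  shows "fin_index G A K"
proof -
  obtain T where T: "finite T" "T \<subseteq> B" "\<forall>x\<in>B. \<exists>t\<in>T. inv t \<otimes> x \<in> A"
    using assms(1) unfolding fin_index_def by blast
  obtain S where S: "finite S" "S \<subseteq> K" "\<forall>x\<in>K. \<exists>t\<in>S. inv t \<otimes> x \<in> B"
    using assms(2) unfolding fin_index_def by blast
  define U where "U = (\<lambda>(s, t). s \<otimes> t) ` (S \<times> T)"
  have "\<exists>u\<in>U. inv u \<otimes> x \<in> A" if x: "x \<in> K" for x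
  proof -
    obtain s where s: "s \<in> S" "inv s \<otimes> x \<in> B" using S x by blast
    obtain t where t: "t \<in> T" "inv t \<otimes> (inv s \<otimes> x) \<in> A" using T s by blast
    have "s \<in> carrier G" "t \<in> carrier G" "x \<in> carrier G" using s t S T x assms(3,4) by blast+
    then have "inv (s \<otimes> t) \<otimes> x \<in> A" using t by (simp add: inv_mult_group m_assoc)
    then show ?thesis using s t unfolding U_def by force
  qed
  moreover have "finite U" using S(1) T(1) by (simp add: U_def)
  moreover have "U \<subseteq> K"
    using subgroup_props(2)[OF assms(5)] S(2) T(2) assms(4) unfolding U_def by (clarsimp simp: subset_iff)
  ultimately show ?thesis unfolding fin_index_def by (intro exI[of _ U] conjI ballI)
qed

lemma fin_index_refl: "subgroup K G \<Longrightarrow> fin_index G K K"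
  using subgroup_props[of K] finite_subset[of "(\<lambda>_. 0 :: nat) ` K" "{0}"]
  by (intro fin_indexI[where f = "\<lambda>_. 0 :: nat"]) auto

lemma fin_index_Int:
  assumes "fin_index G A K" "fin_index G B K" "subgroup A G" "subgroup B G" "K \<subseteq> carrier G"
  shows "fin_index G (A \<inter> B) K"
proof -
  obtain f :: "'a \<Rightarrow> 'a" where f: "finite (f ` K)" "\<forall>x\<in>K. \<forall>y\<in>K. f x = f y \<longrightarrow> inv x \<otimes> y \<in> A"
    using fin_indexE[OF assms(1,3,5)] .
  obtain g :: "'a \<Rightarrow> 'a" where g: "finite (g ` K)" "\<forall>x\<in>K. \<forall>y\<in>K. g x = g y \<longrightarrow> inv x \<otimes> y \<in> B"
    using fin_indexE[OF assms(2,4,5)] .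
  have "finite ((\<lambda>x. (f x, g x)) ` K)"
    by (rule finite_subset[OF _ finite_cartesian_product[OF f(1) g(1)]]) auto
  then show ?thesis
    by (rule fin_indexI[OF assms(5)]) (use f g in auto)
qed

lemma fin_index_INT:
  assumes "finite V" "subgroup K G" "\<And>v. v \<in> V \<Longrightarrow> subgroup (M v) G \<and> M v \<subseteq> K \<and> fin_index G (M v) K"
  shows "subgroup (K \<inter> (\<Inter>v\<in>V. M v)) G \<and> fin_index G (K \<inter> (\<Inter>v\<in>V. M v)) K"
  using assms(1,3)
proof (induction V rule: finite_induct)
  case empty
  then show ?case using assms(2) fin_index_refl by simp
next
  case (insert v V)
  have "K \<inter> (\<Inter>v\<in>insert v V. M v) = (K \<inter> (\<Inter>v\<in>V. M v)) \<inter> M v" by blast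
  then show ?case
    using insert fin_index_Int[of "K \<inter> (\<Inter>v\<in>V. M v)" K "M v"] subgroup.subset[OF assms(2)]
    by (simp add: subgroups_Inter_pair)
qed

text \<open>The normal core: finitely many conjugates of \<^term>\<open>H\<close> occur, one for each coset.\<close>

lemma fin_index_normal_core:
  assumes "fin_index G H K" "subgroup H G" "subgroup K G" "H \<subseteq> K"
  obtains N where "subgroup N G" "N \<subseteq> H" "fin_index G N K"
    "\<And>k x. k \<in> K \<Longrightarrow> x \<in> N \<Longrightarrow> k \<otimes> x \<otimes> inv k \<in> N"
proof -
  note K = subgroup_props[OF assms(3)] and H = subgroup_props[OF assms(2)]
  have KG: "K \<subseteq> carrier G" using K(1) by blast
  obtain f :: "'a \<Rightarrow> 'a" where f: "finite (f ` K)" "\<forall>x\<in>K. \<forall>y\<in>K. f x = f y \<longrightarrow> inv x \<otimes> y \<in> H"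
    using fin_indexE[OF assms(1,2) KG] .
  obtain T where T: "finite T" "T \<subseteq> K" "\<forall>x\<in>K. \<exists>t\<in>T. inv t \<otimes> x \<in> H"
    using assms(1) unfolding fin_index_def by blast
  define N where "N = {x \<in> K. \<forall>k\<in>K. inv k \<otimes> x \<otimes> k \<in> H}"
  have split: "inv k \<otimes> (x \<otimes> y) \<otimes> k = (inv k \<otimes> x \<otimes> k) \<otimes> (inv k \<otimes> y \<otimes> k)"
    if "k \<in> carrier G" "x \<in> carrier G" "y \<in> carrier G" for k x y
    using that by (simp add: m_assoc)
  have "subgroup N G"
  proof (rule subgroupI)
    show "N \<subseteq> carrier G" using K(1) by (auto simp: N_def)
    have "\<one> \<in> N" using K(1,4) H(4) by (auto simp: N_def)
    then show "N \<noteq> {}" by blast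
    fix a assume a: "a \<in> N"
    have "inv k \<otimes> inv a \<otimes> k \<in> H" if "k \<in> K" for k
    proof -
      have "inv (inv k \<otimes> a \<otimes> k) \<in> H" using a that by (simp add: N_def H(3))
      moreover have "k \<in> carrier G" "a \<in> carrier G" using a that K(1) by (auto simp: N_def)
      ultimately show ?thesis by (simp add: inv_mult_group m_assoc)
    qed
    then show "inv a \<in> N" using a by (simp add: N_def K(3))
    fix b assume b: "b \<in> N"
    have "inv k \<otimes> (a \<otimes> b) \<otimes> k \<in> H" if "k \<in> K" for k
      using split[of k a b] a b that by (simp add: N_def H(2) K(1))
    then show "a \<otimes> b \<in> N" using a b by (simp add: N_def K(2))
  qed
  moreover have "N \<subseteq> H"
  proof
    fix x assume "x \<in> N"
    then have "inv \<one> \<otimes> x \<otimes> \<one> \<in> H" "x \<in> carrier G" using K(1,4) unfolding N_def by blast+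
    then show "x \<in> H" by simp
  qed
  moreover have "fin_index G N K"
  proof (rule fin_indexI[OF KG, where f = "\<lambda>x. \<lambda>t\<in>T. f (x \<otimes> t)"])
    have "(\<lambda>x. \<lambda>t\<in>T. f (x \<otimes> t)) ` K \<subseteq> T \<rightarrow>\<^sub>E f ` K" using T(2) by (auto simp: K(2) subset_iff)
    then show "finite ((\<lambda>x. \<lambda>t\<in>T. f (x \<otimes> t)) ` K)"
      by (rule finite_subset) (simp add: finite_PiE T(1) f(1))
  next
    fix x y assume xy: "x \<in> K" "y \<in> K" "(\<lambda>t\<in>T. f (x \<otimes> t)) = (\<lambda>t\<in>T. f (y \<otimes> t))"
    have "inv k \<otimes> (inv x \<otimes> y) \<otimes> k \<in> H" if k: "k \<in> K" for k
    proof -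
      obtain t where t: "t \<in> T" "inv t \<otimes> k \<in> H" using T k by blast
      have "f (x \<otimes> t) = f (y \<otimes> t)" using xy(3) t by (metis restrict_apply')
      then have "inv (x \<otimes> t) \<otimes> (y \<otimes> t) \<in> H" using f(2) xy(1,2) t(1) T(2) by (simp add: K(2) subset_iff)
      then have *: "inv (inv t \<otimes> k) \<otimes> (inv (x \<otimes> t) \<otimes> (y \<otimes> t)) \<otimes> (inv t \<otimes> k) \<in> H" using t(2) by (simp add: H(2,3))
      have "x \<in> carrier G" "y \<in> carrier G" "t \<in> carrier G" "k \<in> carrier G" using xy(1,2) t(1) T(2) k K(1) by blast+
      then show ?thesis using * by (simp add: inv_mult_group m_assoc)
    qed
    then show "inv x \<otimes> y \<in> N" using xy by (simp add: N_def K(2,3))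
  qed
  moreover have "k \<otimes> x \<otimes> inv k \<in> N" if kx: "k \<in> K" "x \<in> N" for k x
  proof -
    have x: "x \<in> K" using kx by (simp add: N_def)
    have "inv l \<otimes> (k \<otimes> x \<otimes> inv k) \<otimes> l \<in> H" if l: "l \<in> K" for l
    proof -
      have "inv (inv k \<otimes> l) \<otimes> x \<otimes> (inv k \<otimes> l) \<in> H" using kx l by (simp add: N_def K(2,3))
      then show ?thesis using kx(1) x l K(1) by (simp add: inv_mult_group m_assoc)
    qed
    then show ?thesis using kx x by (simp add: N_def K(2,3))
  qed
  ultimately show thesis by (intro that[of N])
qed

lemma group_restrict: "subgroup L G \<Longrightarrow> group (G\<lparr>carrier := L\<rparr>)"
  by (rule subgroup.subgroup_is_group) (auto intro: is_group)

text \<open>Actions are given here by functions whose values matter on \<^term>\<open>E\<close> only, and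
  commensuration is required on one side only: the other side is the condition for \<open>\<gamma>\<inverse>\<close>.\<close>

lemma FW_transfix:
  fixes a :: "'a \<Rightarrow> 'e \<Rightarrow> 'e"
  assumes L: "subgroup L G" and FW: "FW_subgroup G L"
    and cl: "\<And>\<gamma> x. \<gamma> \<in> L \<Longrightarrow> x \<in> E \<Longrightarrow> a \<gamma> x \<in> E"
    and one: "\<And>x. x \<in> E \<Longrightarrow> a \<one> x = x"
    and mul: "\<And>\<gamma> \<delta> x. \<gamma> \<in> L \<Longrightarrow> \<delta> \<in> L \<Longrightarrow> x \<in> E \<Longrightarrow> a (\<gamma> \<otimes> \<delta>) x = a \<gamma> (a \<delta> x)"
    and XE: "X \<subseteq> E" and fin: "\<And>\<gamma>. \<gamma> \<in> L \<Longrightarrow> finite {x \<in> X. a \<gamma> x \<notin> X}"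
  obtains Y where "Y \<subseteq> E" "\<And>\<gamma> x. \<gamma> \<in> L \<Longrightarrow> x \<in> Y \<Longrightarrow> a \<gamma> x \<in> Y" "finite (sym_diff X Y)"
proof -
  note L' = subgroup_props[OF L]
  define \<phi> where "\<phi> = (\<lambda>\<gamma>. restrict (a \<gamma>) E)"
  have inv: "a \<gamma> (a (inv \<gamma>) x) = x" "a (inv \<gamma>) (a \<gamma> x) = x" if "\<gamma> \<in> L" "x \<in> E" for \<gamma> x
    using that mul[of \<gamma> "inv \<gamma>" x] mul[of "inv \<gamma>" \<gamma> x] one L'(1,3) by simp_all
  have act: "group_action (G\<lparr>carrier := L\<rparr>) E \<phi>"
    by (rule group_actionI[OF group_restrict[OF L]]) (auto simp: \<phi>_def cl one mul)
  have "finite (sym_diff X (\<phi> \<gamma> ` X))" if g: "\<gamma> \<in> L" for \<gamma>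
  proof -
    have "\<phi> \<gamma> ` X = a \<gamma> ` X" using XE by (auto simp: \<phi>_def image_iff)
    moreover have "X - a \<gamma> ` X \<subseteq> {x \<in> X. a (inv \<gamma>) x \<notin> X}"
      using inv(1)[OF g] XE by (force simp: image_iff)
    moreover have "a \<gamma> ` X - X \<subseteq> a \<gamma> ` {x \<in> X. a \<gamma> x \<notin> X}" by blast
    ultimately show ?thesis using fin[OF g] fin[OF L'(3)[OF g]]
      by (metis (no_types, lifting) finite_Un finite_imageI finite_subset)
  qed
  then have "\<exists>Y\<subseteq>E. (\<forall>\<gamma>\<in>carrier (G\<lparr>carrier := L\<rparr>). \<phi> \<gamma> ` Y = Y) \<and> finite (sym_diff X Y)"
    using act XE by (intro property_FW_imp_FW_on[OF FW, where 'e = 'e, unfolded FW_on_def, rule_format]) simp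
  then obtain Y where Y: "Y \<subseteq> E" "\<forall>\<gamma>\<in>L. \<phi> \<gamma> ` Y = Y" "finite (sym_diff X Y)"
    by auto
  have clY: "a \<gamma> x \<in> Y" if g: "\<gamma> \<in> L" and x: "x \<in> Y" for \<gamma> x
  proof -
    have "\<phi> \<gamma> x \<in> Y" using Y(2) g x by blast
    then show ?thesis using x Y(1) by (auto simp: \<phi>_def)
  qed
  show thesis using Y(1) clY Y(3) by (rule that)
qed

end

context group
begin

text \<open>The group acts on the disjoint union of its coset spaces modulo the \<open>H n\<close>, and commensurates
  the set of the base points: an element lies in almost all \<open>H n\<close> and so fixes almost all base
  points. An invariant set at finite distance contains exactly the base point over some level, which
  is therefore fixed by the group.\<close>

lemma FW_chain:
  assumes L: "subgroup L G" and FW: "FW_subgroup G L"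
    and H: "\<And>n::nat. subgroup (H n) G" "\<And>n. H n \<subseteq> H (Suc n)" "(\<Union>n. H n) = L"
  shows "\<exists>n. H n = L"
proof -
  have HL: "H n \<subseteq> L" for n using H(3) by blast
  have LG: "L \<subseteq> carrier G" using subgroup.subset[OF L] .
  have HG: "H n \<subseteq> carrier G" for n using HL LG by blast
  have mono: "H m \<subseteq> H n" if "m \<le> n" for m n
    using H(2) that by (rule lift_Suc_mono_le)
  define E where "E = (\<Union>n. (\<lambda>g. (n, g <# H n)) ` L)"
  define X where "X = range (\<lambda>n. (n, H n))"
  define a where "a \<gamma> = (\<lambda>(n::nat, C :: 'a set). (n, \<gamma> <# C))" for \<gamma>
  have aE: "a \<gamma> (n, g <# H n) = (n, (\<gamma> \<otimes> g) <# H n)" if "\<gamma> \<in> L" "g \<in> L" for \<gamma> g n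
    using that lcos_m_assoc[OF HG] LG by (auto simp: a_def)
  obtain Y where Y: "Y \<subseteq> E" "\<And>\<gamma> x. \<gamma> \<in> L \<Longrightarrow> x \<in> Y \<Longrightarrow> a \<gamma> x \<in> Y" "finite (sym_diff X Y)"
  proof (rule FW_transfix[OF L FW, of E a X])
    show "a \<gamma> x \<in> E" if "\<gamma> \<in> L" "x \<in> E" for \<gamma> x
      using that aE subgroup_props(2)[OF L] by (force simp: E_def)
    show "a \<one> x = x" if "x \<in> E" for x
      using that aE[OF subgroup_props(4)[OF L]] LG by (auto simp: E_def)
    show "a (\<gamma> \<otimes> \<delta>) x = a \<gamma> (a \<delta> x)" if "\<gamma> \<in> L" "\<delta> \<in> L" "x \<in> E" for \<gamma> \<delta> x
      using that aE subgroup_props(2)[OF L] LG by (auto simp: E_def m_assoc subset_iff)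
    have "H n = \<one> <# H n" for n using HG lcos_mult_one by simp
    then show "X \<subseteq> E" using subgroup_props(4)[OF L] by (fastforce simp: X_def E_def)
    show "finite {x \<in> X. a \<gamma> x \<notin> X}" if g: "\<gamma> \<in> L" for \<gamma>
    proof -
      obtain m where m: "\<gamma> \<in> H m" using g H(3) by blast
      have "a \<gamma> (n, H n) \<in> X" if "n \<ge> m" for n
        using coset_join3[OF _ H(1), of \<gamma> n] mono[OF that] m g LG by (auto simp: a_def X_def)
      then have "n < m" if "a \<gamma> (n, H n) \<notin> X" for n using that not_le by blast
      then have "{x \<in> X. a \<gamma> x \<notin> X} \<subseteq> (\<lambda>n. (n, H n)) ` {..<m}"
        unfolding X_def by blast
      then show ?thesis by (rule finite_subset) simp
    qed
  qed blast
  have "finite (fst ` sym_diff X Y)" using Y(3) by (rule finite_imageI)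
  then obtain N where N: "N \<notin> fst ` sym_diff X Y" using ex_new_if_finite[OF infinite_UNIV_nat] by blast
  then have "(N, H N) \<in> Y" by (force simp: X_def)
  have "g \<in> H N" if g: "g \<in> L" for g
  proof -
    have "(N, g <# H N) \<in> Y" using Y(2)[OF g \<open>(N, H N) \<in> Y\<close>] by (simp add: a_def)
    then have "(N, g <# H N) \<in> X" using N by force
    then have "g <# H N = H N" by (auto simp: X_def)
    moreover have "g \<otimes> \<one> \<in> g <# H N"
      using subgroup.one_closed[OF H(1)] by (force simp: l_coset_def)
    ultimately show ?thesis using g LG by auto
  qed
  then show ?thesis using HL by blast
qed

text \<open>Translations of \<open>\<int>\<close> commensurate the natural numbers, but a set invariant under a nonzero
  translation is not at finite distance from them.\<close>

lemma FW_hom_int_trivial: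
  fixes f :: "'a \<Rightarrow> int"
  assumes L: "subgroup L G" and FW: "FW_subgroup G L"
    and f: "\<And>x y. x \<in> L \<Longrightarrow> y \<in> L \<Longrightarrow> f (x \<otimes> y) = f x + f y" and g: "g \<in> L"
  shows "f g = 0"
proof -
  have one: "f \<one> = 0" using f[of \<one> \<one>] subgroup_props(4)[OF L] by simp
  have fi: "f (inv x) = - f x" if "x \<in> L" for x
    using f[of x "inv x"] that subgroup_props(1,3)[OF L] one by simp
  obtain Y where Y: "\<And>\<gamma> x. \<gamma> \<in> L \<Longrightarrow> x \<in> Y \<Longrightarrow> f \<gamma> + x \<in> Y" "finite (sym_diff {0..} Y)"
  proof (rule FW_transfix[OF L FW, of UNIV "\<lambda>\<gamma> x. f \<gamma> + x" "{0..}"])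
    show "finite {x \<in> {0..}. f \<gamma> + x \<notin> {0..}}" if "\<gamma> \<in> L" for \<gamma>
      by (rule finite_subset[of _ "{0..<- f \<gamma>}"]) auto
  qed (auto simp: one f)
  have "f h \<le> 0" if h: "h \<in> L" for h
  proof (rule ccontr)
    assume pos: "\<not> f h \<le> 0"
    have "infinite {0::int..}" by (simp add: infinite_Ici)
    then have "\<exists>k. k \<in> Y"
      using Y(2) by (cases "Y = {}") auto
    then obtain k where k: "k \<in> Y" ..
    have *: "k - int j * f h \<in> Y" for j
    proof (induction j)
      case (Suc j)
      then show ?case using Y(1)[OF subgroup_props(3)[OF L h] Suc] fi[OF h] by (simp add: algebra_simps)
    qed (use k in simp)
    have "k - int j * f h \<in> sym_diff {0..} Y" if "j > nat k" for j
    proof -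
      have "int j * 1 \<le> int j * f h" using pos by (intro mult_left_mono) auto
      moreover have "k < int j" using that by linarith
      ultimately show ?thesis using *[of j] by auto
    qed
    then have "finite ((\<lambda>j. k - int j * f h) ` {nat k<..})"
      by (intro finite_subset[OF _ Y(2)]) blast
    moreover have "inj_on (\<lambda>j. k - int j * f h) {nat k<..}" using pos by (auto simp: inj_on_def)
    ultimately have "finite {nat k<..}" by (rule finite_imageD)
    then show False by (simp add: infinite_Ioi)
  qed
  then have "f g \<le> 0" "f (inv g) \<le> 0" using g subgroup_props(3)[OF L g] by blast+
  then show ?thesis using fi[OF g] by linarith
qed

text \<open>An action of \<^term>\<open>L\<close> is induced to the action of \<^term>\<open>K\<close> on copies of \<^term>\<open>E\<close>
  indexed by coset representatives.\<close>

lemma FW_fin_index: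
  assumes K: "subgroup K G" and FW: "FW_subgroup G K" and L: "subgroup L G" "L \<subseteq> K" "fin_index G L K"
  shows "FW_subgroup G L"
  unfolding property_FW_def FW_on_def
proof (intro allI impI, elim conjE)
  fix E :: "('a \<times> 'a \<times> nat) set" and \<phi> X
  assume act: "group_action (G\<lparr>carrier := L\<rparr>) E \<phi>" and XE: "X \<subseteq> E"
    and "\<forall>\<gamma>\<in>carrier (G\<lparr>carrier := L\<rparr>). finite (sym_diff X (\<phi> \<gamma> ` X))"
  then have fin: "finite (sym_diff X (\<phi> \<gamma> ` X))" if "\<gamma> \<in> L" for \<gamma> using that by simp
  note Lp = subgroup_props[OF L(1)] and Kp = subgroup_props[OF K]
  interpret A: group_action "G\<lparr>carrier := L\<rparr>" E \<phi> by fact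
  have cmp: "\<phi> (\<gamma> \<otimes> \<delta>) x = \<phi> \<gamma> (\<phi> \<delta> x)" if "\<gamma> \<in> L" "\<delta> \<in> L" "x \<in> E" for \<gamma> \<delta> x
    using A.composition_rule[of x \<gamma> \<delta>] that by simp
  have one: "\<phi> \<one> x = x" if "x \<in> E" for x
    using that fun_cong[OF A.id_eq_one, of x] by simp
  have cl: "\<phi> \<gamma> x \<in> E" if "\<gamma> \<in> L" "x \<in> E" for \<gamma> x
    using that A.element_image by simp
  obtain T where T: "finite T" "T \<subseteq> K" "\<forall>x\<in>K. \<exists>t\<in>T. inv t \<otimes> x \<in> L"
    using L(3) unfolding fin_index_def by blast
  \<comment> \<open>Below, \<open>t x\<close> is the representative of the coset of \<open>x\<close>, chosen to be \<open>\<one>\<close> for \<open>L\<close> itself, and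
    \<open>c \<gamma> r\<close> is the cocycle with values in \<open>L\<close> by which the induced action twists.\<close>
  define f where "f C = (if \<one> \<in> C then \<one> else SOME y. y \<in> C \<inter> T)" for C
  define t where "t x = f (x <# L)" for x
  have mem: "y \<in> x <# L \<longleftrightarrow> inv x \<otimes> y \<in> L" if "x \<in> K" "y \<in> K" for x y
  proof
    assume "inv x \<otimes> y \<in> L"
    then have "x \<otimes> (inv x \<otimes> y) \<in> x <# L" by (auto simp: l_coset_def)
    then show "y \<in> x <# L" using that Kp(1) by simp
  qed (use that Kp(1) Lp(1) in \<open>auto simp: l_coset_def\<close>)
  have t: "t x \<in> K \<and> inv x \<otimes> t x \<in> L \<and> t x \<in> insert \<one> T" if x: "x \<in> K" for x
  proof (cases "\<one> \<in> x <# L")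
    case True
    then show ?thesis using mem[OF x Kp(4)] Kp(4) by (simp add: t_def f_def)
  next
    case False
    obtain s where s: "s \<in> T" "inv s \<otimes> x \<in> L" using T x by blast
    then have "inv (inv s \<otimes> x) \<in> L" using Lp(3) by blast
    then have "inv x \<otimes> s \<in> L" using s T(2) x Kp(1) by (auto simp: inv_mult_group subset_iff)
    moreover have "s \<in> K" using s(1) T(2) by blast
    ultimately have "s \<in> (x <# L) \<inter> T" using s(1) mem[OF x, of s] by blast
    then have "(SOME y. y \<in> (x <# L) \<inter> T) \<in> (x <# L) \<inter> T" by (rule someI)
    then have tx: "t x \<in> x <# L" "t x \<in> T" using False unfolding t_def f_def by auto
    then have "t x \<in> K" using T(2) by blast
    then show ?thesis using tx mem[OF x] by simp
  qed
  have t_eq: "t x = t y" if xy: "x \<in> K" "y \<in> K" "inv x \<otimes> y \<in> L" for x y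
  proof -
    have "y \<in> x <# L" using mem xy by blast
    then have "x <# L = y <# L" using l_repr_independence[of y x L] xy Kp(1) L(1) by blast
    then show ?thesis by (simp add: t_def)
  qed
  have tt: "t (t x) = t x" if "x \<in> K" for x using t_eq[of x "t x"] t that by auto
  have t1: "t \<one> = \<one>" using lcos_mult_one[of L] Lp(1,4) by (auto simp: t_def f_def)
  define c where "c \<gamma> r = inv (t (\<gamma> \<otimes> r)) \<otimes> (\<gamma> \<otimes> r)" for \<gamma> r
  have cL: "c \<gamma> r \<in> L" if "\<gamma> \<in> K" "r \<in> K" for \<gamma> r
  proof -
    have "\<gamma> \<otimes> r \<in> K" using that Kp(2) by blast
    then have "inv (inv (\<gamma> \<otimes> r) \<otimes> t (\<gamma> \<otimes> r)) \<in> L" and "t (\<gamma> \<otimes> r) \<in> carrier G" "\<gamma> \<otimes> r \<in> carrier G"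
      using t Lp(3) Kp(1) by blast+
    then show ?thesis by (simp add: c_def inv_mult_group)
  qed
  define R where "R = t ` K"
  have RK: "R \<subseteq> K" "finite R" using t T(1) by (auto simp: R_def intro: finite_subset[of _ "insert \<one> T"])
  define a where "a \<gamma> = (\<lambda>(r, e). (t (\<gamma> \<otimes> r), \<phi> (c \<gamma> r) e))" for \<gamma>
  have mul: "a (\<gamma> \<otimes> \<delta>) (r, e) = a \<gamma> (a \<delta> (r, e))" if g: "\<gamma> \<in> K" "\<delta> \<in> K" and r: "r \<in> R" and e: "e \<in> E" for \<gamma> \<delta> r e
  proof -
    have "r \<in> K" using r RK(1) by blast
    then have K: "r \<in> K" "\<delta> \<otimes> r \<in> K" "t (\<delta> \<otimes> r) \<in> K" "\<gamma> \<otimes> (\<delta> \<otimes> r) \<in> K" "\<gamma> \<otimes> t (\<delta> \<otimes> r) \<in> K"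
      using g t[of "\<delta> \<otimes> r"] by (simp_all add: Kp(2))
    have Ca: "r \<in> carrier G" "\<gamma> \<in> carrier G" "\<delta> \<in> carrier G" "t (\<delta> \<otimes> r) \<in> carrier G"
      using K g Kp(1) by blast+
    have "inv (\<gamma> \<otimes> (\<delta> \<otimes> r)) \<otimes> (\<gamma> \<otimes> t (\<delta> \<otimes> r)) = inv (\<delta> \<otimes> r) \<otimes> t (\<delta> \<otimes> r)"
      using Ca by (simp add: inv_mult_group m_assoc)
    then have eq: "t (\<gamma> \<otimes> (\<delta> \<otimes> r)) = t (\<gamma> \<otimes> t (\<delta> \<otimes> r))"
      using t_eq[OF K(4,5)] t[OF K(2)] by simp
    have Cb: "t (\<gamma> \<otimes> t (\<delta> \<otimes> r)) \<in> carrier G" using t[OF K(5)] Kp(1) by blast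
    have "c (\<gamma> \<otimes> \<delta>) r = c \<gamma> (t (\<delta> \<otimes> r)) \<otimes> c \<delta> r"
      using Ca Cb eq by (simp add: c_def m_assoc)
    then show ?thesis using eq cmp[OF cL[OF g(1) K(3)] cL[OF g(2) K(1)] e] Ca
      by (simp add: a_def m_assoc)
  qed
  obtain Y where Y: "\<And>\<gamma> x. \<gamma> \<in> K \<Longrightarrow> x \<in> Y \<Longrightarrow> a \<gamma> x \<in> Y" "finite (sym_diff (R \<times> X) Y)"
  proof (rule FW_transfix[OF K FW, of "R \<times> E" a "R \<times> X"])
    show "a \<gamma> x \<in> R \<times> E" if "\<gamma> \<in> K" "x \<in> R \<times> E" for \<gamma> x
      using that Kp(2) RK(1) cl cL unfolding a_def R_def by (auto simp: subset_iff)
    show "a \<one> x = x" if "x \<in> R \<times> E" for x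
      using that tt t Kp(1) one by (auto simp: a_def R_def c_def)
    show "a (\<gamma> \<otimes> \<delta>) x = a \<gamma> (a \<delta> x)" if "\<gamma> \<in> K" "\<delta> \<in> K" "x \<in> R \<times> E" for \<gamma> \<delta> x
      using mul that by auto
    show "R \<times> X \<subseteq> R \<times> E" using XE by blast
    show "finite {x \<in> R \<times> X. a \<gamma> x \<notin> R \<times> X}" if g: "\<gamma> \<in> K" for \<gamma>
    proof (rule finite_subset)
      have cL': "c \<gamma> r \<in> L" if "r \<in> R" for r using cL g RK(1) that by blast
      have tR: "t (\<gamma> \<otimes> r) \<in> R" if "r \<in> R" for r using g RK(1) that Kp(2) by (auto simp: R_def)
      show "{x \<in> R \<times> X. a \<gamma> x \<notin> R \<times> X} \<subseteq> (SIGMA r:R. {e \<in> X. \<phi> (c \<gamma> r) e \<notin> X})"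
        using tR by (auto simp: a_def)
      have "finite {e \<in> X. \<phi> (c \<gamma> r) e \<notin> X}" if r: "r \<in> R" for r
      proof (rule finite_subset)
        show "{e \<in> X. \<phi> (c \<gamma> r) e \<notin> X} \<subseteq> \<phi> (inv (c \<gamma> r)) ` sym_diff X (\<phi> (c \<gamma> r) ` X)"
        proof
          fix e assume e: "e \<in> {e \<in> X. \<phi> (c \<gamma> r) e \<notin> X}"
          then have "e = \<phi> (inv (c \<gamma> r)) (\<phi> (c \<gamma> r) e)"
            using cmp[of "inv (c \<gamma> r)" "c \<gamma> r" e] cL'[OF r] Lp(1,3) one XE by auto
          then show "e \<in> \<phi> (inv (c \<gamma> r)) ` sym_diff X (\<phi> (c \<gamma> r) ` X)" using e by blast
        qed
      qed (use fin[OF cL'[OF r]] in blast)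
      then show "finite (SIGMA r:R. {e \<in> X. \<phi> (c \<gamma> r) e \<notin> X})" using RK(2) by blast
    qed
  qed blast
  have a1: "a l (\<one>, e) = (\<one>, \<phi> l e)" if "l \<in> L" for l e
  proof -
    have "t l = \<one>" using t_eq[of \<one> l] that L(2) Lp(1) Kp(4) t1 by auto
    then show ?thesis using that Lp(1) by (simp add: a_def c_def)
  qed
  define X' where "X' = {e \<in> E. (\<one>, e) \<in> Y}"
  have sub: "\<phi> \<gamma> ` X' \<subseteq> X'" if g: "\<gamma> \<in> L" for \<gamma>
  proof
    fix e assume "e \<in> \<phi> \<gamma> ` X'"
    then obtain d where d: "d \<in> E" "(\<one>, d) \<in> Y" "e = \<phi> \<gamma> d" by (auto simp: X'_def)
    then have "a \<gamma> (\<one>, d) \<in> Y" using Y(1) g L(2) by blast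
    then show "e \<in> X'" using a1[OF g] d cl[OF g] by (simp add: X'_def)
  qed
  have "\<phi> \<gamma> ` X' = X'" if g: "\<gamma> \<in> L" for \<gamma>
  proof
    show "X' \<subseteq> \<phi> \<gamma> ` X'"
    proof
      fix e assume e: "e \<in> X'"
      then have "e = \<phi> \<gamma> (\<phi> (inv \<gamma>) e)" using cmp[of \<gamma> "inv \<gamma>" e] g Lp(1,3) one by (auto simp: X'_def)
      moreover have "\<phi> (inv \<gamma>) e \<in> X'" using sub[OF Lp(3)[OF g]] e by blast
      ultimately show "e \<in> \<phi> \<gamma> ` X'" by blast
    qed
  qed (rule sub[OF g])
  moreover have "finite (sym_diff X X')"
  proof (rule finite_subset)
    have "\<one> \<in> R" using t1 Kp(4) by (force simp: R_def)
    then show "sym_diff X X' \<subseteq> snd ` sym_diff (R \<times> X) Y" using XE by (force simp: X'_def)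
  qed (use Y(2) in blast)
  ultimately show "\<exists>X'\<subseteq>E. (\<forall>\<gamma>\<in>carrier (G\<lparr>carrier := L\<rparr>). \<phi> \<gamma> ` X' = X') \<and> finite (sym_diff X X')"
    by (intro exI[of _ X']) (auto simp: X'_def)
qed

end

lemma (in group) property_FW_image:
  fixes A :: "('h, 'k) monoid_scheme"
  assumes L: "subgroup L G" and FW: "FW_subgroup G L" and A: "group A"
    and h: "\<And>x y. x \<in> L \<Longrightarrow> y \<in> L \<Longrightarrow> h (x \<otimes> y) = h x \<otimes>\<^bsub>A\<^esub> h y" "h ` L = carrier A"
  shows "property_FW A"
  unfolding property_FW_def FW_on_def
proof (intro allI impI, elim conjE)
  fix E :: "('h \<times> 'h \<times> nat) set" and \<phi> X
  assume act: "group_action A E \<phi>" and XE: "X \<subseteq> E"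
    and fin: "\<forall>\<gamma>\<in>carrier A. finite (sym_diff X (\<phi> \<gamma> ` X))"
  interpret A: group_action A E \<phi> by fact
  interpret A: group A by fact
  have cmp: "\<phi> (\<gamma> \<otimes>\<^bsub>A\<^esub> \<delta>) x = \<phi> \<gamma> (\<phi> \<delta> x)" if "\<gamma> \<in> carrier A" "\<delta> \<in> carrier A" "x \<in> E" for \<gamma> \<delta> x
    using A.composition_rule[of x \<gamma> \<delta>] that by simp
  have one: "\<phi> \<one>\<^bsub>A\<^esub> x = x" if "x \<in> E" for x
    using that fun_cong[OF A.id_eq_one, of x] by simp
  have hA: "h x \<in> carrier A" if "x \<in> L" for x using h(2) that by blast
  have "h \<one> \<otimes>\<^bsub>A\<^esub> h \<one> = h \<one>" using h(1)[of \<one> \<one>] subgroup_props(4)[OF L] by simp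
  then have h1: "h \<one> = \<one>\<^bsub>A\<^esub>" using hA[OF subgroup_props(4)[OF L]] by simp
  obtain Y where Y: "Y \<subseteq> E" "\<And>\<gamma> x. \<gamma> \<in> L \<Longrightarrow> x \<in> Y \<Longrightarrow> \<phi> (h \<gamma>) x \<in> Y" "finite (sym_diff X Y)"
  proof (rule FW_transfix[OF L FW, of E "\<lambda>\<gamma>. \<phi> (h \<gamma>)" X])
    show "\<phi> (h \<gamma>) x \<in> E" if "\<gamma> \<in> L" "x \<in> E" for \<gamma> x
      using A.element_image[OF hA[OF that(1)] that(2) refl] .
    show "\<phi> (h \<one>) x = x" if "x \<in> E" for x using one[OF that] h1 by simp
    show "\<phi> (h (\<gamma> \<otimes> \<delta>)) x = \<phi> (h \<gamma>) (\<phi> (h \<delta>) x)" if "\<gamma> \<in> L" "\<delta> \<in> L" "x \<in> E" for \<gamma> \<delta> x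
      using cmp[OF hA[OF that(1)] hA[OF that(2)] that(3)] h(1)[OF that(1,2)] by simp
    show "finite {x \<in> X. \<phi> (h \<gamma>) x \<notin> X}" if g: "\<gamma> \<in> L" for \<gamma>
    proof (rule finite_subset)
      show "{x \<in> X. \<phi> (h \<gamma>) x \<notin> X} \<subseteq> \<phi> (inv\<^bsub>A\<^esub> h \<gamma>) ` sym_diff X (\<phi> (h \<gamma>) ` X)"
      proof
        fix e assume e: "e \<in> {x \<in> X. \<phi> (h \<gamma>) x \<notin> X}"
        then have "e = \<phi> (inv\<^bsub>A\<^esub> h \<gamma>) (\<phi> (h \<gamma>) e)"
          using cmp[of "inv\<^bsub>A\<^esub> h \<gamma>" "h \<gamma>" e] hA[OF g] one XE by auto
        then show "e \<in> \<phi> (inv\<^bsub>A\<^esub> h \<gamma>) ` sym_diff X (\<phi> (h \<gamma>) ` X)" using e by blast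
      qed
    qed (use bspec[OF fin hA[OF g]] in \<open>rule finite_imageI\<close>)
  qed (use XE that in simp_all)
  have sub: "\<phi> a ` Y \<subseteq> Y" if "a \<in> carrier A" for a
  proof -
    have "a \<in> h ` L" using that h(2) by simp
    then obtain \<gamma> where "\<gamma> \<in> L" "a = h \<gamma>" by (elim imageE)
    then show ?thesis using Y(2)[of \<gamma>] by (simp add: image_subset_iff)
  qed
  have "\<phi> a ` Y = Y" if a: "a \<in> carrier A" for a
  proof
    show "Y \<subseteq> \<phi> a ` Y"
    proof
      fix e assume e: "e \<in> Y"
      then have "e = \<phi> a (\<phi> (inv\<^bsub>A\<^esub> a) e)" using cmp[of a "inv\<^bsub>A\<^esub> a" e] a one Y(1) by auto
      moreover have "\<phi> (inv\<^bsub>A\<^esub> a) e \<in> Y" using sub[of "inv\<^bsub>A\<^esub> a"] a e by blast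
      ultimately show "e \<in> \<phi> a ` Y" by blast
    qed
  qed (rule sub[OF a])
  then show "\<exists>X'\<subseteq>E. (\<forall>\<gamma>\<in>carrier A. \<phi> \<gamma> ` X' = X') \<and> finite (sym_diff X X')"
    using Y(1,3) by blast
qed

section \<open>Abelian groups with Property FW are finite\<close>

context comm_group
begin

definition adjoin :: "'a set \<Rightarrow> 'a \<Rightarrow> 'a set" where
  "adjoin M y = {m \<otimes> y [^] k | m k. m \<in> M \<and> k \<in> (UNIV :: int set)}"

lemma subgroup_adjoin:
  assumes M: "subgroup M G" and y: "y \<in> carrier G"
  shows "subgroup (adjoin M y) G" "M \<subseteq> adjoin M y" "y \<in> adjoin M y"
proof -
  note Mp = subgroup_props[OF M]
  have I: "m \<otimes> y [^] (k::int) \<in> adjoin M y" if "m \<in> M" for m k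
    using that by (auto simp: adjoin_def)
  show "subgroup (adjoin M y) G"
  proof (rule subgroupI)
    show "adjoin M y \<subseteq> carrier G" using y Mp(1) by (auto simp: adjoin_def)
    show "adjoin M y \<noteq> {}" using I[OF Mp(4)] by blast
    fix a assume "a \<in> adjoin M y"
    then obtain m k where a: "m \<in> M" "a = m \<otimes> y [^] (k::int)" by (auto simp: adjoin_def)
    have "inv a = inv m \<otimes> y [^] (- k)"
      using a y Mp(1) by (simp add: inv_mult int_pow_neg)
    then show "inv a \<in> adjoin M y" using I[OF Mp(3)[OF a(1)]] by metis
    fix b assume "b \<in> adjoin M y"
    then obtain n l where b: "n \<in> M" "b = n \<otimes> y [^] (l::int)" by (auto simp: adjoin_def)
    have "a \<otimes> b = (m \<otimes> n) \<otimes> y [^] (k + l)"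
      using a b y Mp(1) by (simp add: int_pow_mult m_ac)
    then show "a \<otimes> b \<in> adjoin M y" using I[OF Mp(2)[OF a(1) b(1)]] by metis
  qed
  show "M \<subseteq> adjoin M y" using I[of _ 0] Mp(1) by (force simp: subset_iff)
  show "y \<in> adjoin M y" using I[OF Mp(4), of 1] y by (simp add: int_pow_1)
qed

lemma subgroup_nat_pow_closed: "x \<in> H \<Longrightarrow> subgroup H G \<Longrightarrow> x [^] (n::nat) \<in> H"
  by (induction n) (simp_all add: subgroup_props(2,4))

text \<open>Maximality is used in the form that adjoining any further element forces a product to fall
  into \<^term>\<open>Z\<close>.\<close>

lemma maximal_subgroup_avoiding:
  assumes N: "subgroup N G" "N \<subseteq> L" "N \<inter> Z = {}" and L: "subgroup L G"
  obtains M where "subgroup M G" "N \<subseteq> M" "M \<subseteq> L" "M \<inter> Z = {}"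
    "\<forall>y\<in>L - M. \<exists>m\<in>M. \<exists>k::int. m \<otimes> y [^] k \<in> Z"
proof -
  define S where "S = {M. subgroup M G \<and> N \<subseteq> M \<and> M \<subseteq> L \<and> M \<inter> Z = {}}"
  have "\<exists>M\<in>S. \<forall>X\<in>S. M \<subseteq> X \<longrightarrow> X = M"
  proof (rule subset_Zorn_nonempty)
    show "S \<noteq> {}" using N by (auto simp: S_def)
    fix C assume C: "C \<noteq> {}" "subset.chain S C"
    have CS: "C \<subseteq> S" and lin: "\<And>A B. A \<in> C \<Longrightarrow> B \<in> C \<Longrightarrow> A \<subseteq> B \<or> B \<subseteq> A"
      using C(2) by (auto simp: subset_chain_def)
    have sg: "subgroup A G" if "A \<in> C" for A using that CS by (auto simp: S_def)
    have "subgroup (\<Union>C) G"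
    proof (rule subgroupI)
      show "\<Union>C \<subseteq> carrier G" using sg subgroup.subset by blast
      show "\<Union>C \<noteq> {}" using C(1) sg subgroup.one_closed by blast
      fix a assume "a \<in> \<Union>C"
      then obtain A where A: "A \<in> C" "a \<in> A" by blast
      then show "inv a \<in> \<Union>C" using subgroup_props(3)[OF sg] by blast
      fix b assume "b \<in> \<Union>C"
      then obtain B where B: "B \<in> C" "b \<in> B" by blast
      from lin[OF A(1) B(1)] show "a \<otimes> b \<in> \<Union>C"
      proof
        assume "A \<subseteq> B"
        then show ?thesis using subgroup_props(2)[OF sg[OF B(1)], of a b] A B by blast
      next
        assume "B \<subseteq> A"
        then show ?thesis using subgroup_props(2)[OF sg[OF A(1)], of a b] A B by blast
      qed
    qed
    moreover have "N \<subseteq> \<Union>C" using C(1) CS by (force simp: S_def)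
    moreover have "\<Union>C \<subseteq> L" "\<Union>C \<inter> Z = {}" using CS by (force simp: S_def)+
    ultimately show "\<Union>C \<in> S" by (simp add: S_def)
  qed
  then obtain M where M: "M \<in> S" "\<And>X. X \<in> S \<Longrightarrow> M \<subseteq> X \<Longrightarrow> X = M" by blast
  have M': "subgroup M G" "N \<subseteq> M" "M \<subseteq> L" "M \<inter> Z = {}" using M(1) by (auto simp: S_def)
  have "\<exists>m\<in>M. \<exists>k::int. m \<otimes> y [^] k \<in> Z" if y: "y \<in> L" "y \<notin> M" for y
  proof -
    have yG: "y \<in> carrier G" using y(1) subgroup_props(1)[OF L] by blast
    note adj = subgroup_adjoin[OF M'(1) yG]
    have "adjoin M y \<notin> S" using M(2)[OF _ adj(2)] adj(3) y(2) by blast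
    moreover have "y [^] (k::int) \<in> L" for k
      using y(1) L by (rule subgroup_int_pow_closed[rotated])
    then have "adjoin M y \<subseteq> L"
      using M'(3) subgroup_props(2)[OF L] by (auto simp: adjoin_def)
    ultimately have "adjoin M y \<inter> Z \<noteq> {}" using adj(1,2) M'(2) unfolding S_def by blast
    then show ?thesis by (auto simp: adjoin_def)
  qed
  with M' show thesis using that by blast
qed

text \<open>If \<^term>\<open>x\<close> has infinite order modulo \<^term>\<open>N\<close>, a subgroup maximal among those avoiding
  the positive powers of \<^term>\<open>x\<close> is the kernel of a homomorphism to \<open>\<rat>\<close>. The chain
  argument forces its image to be cyclic, and Property FW forbids nonzero homomorphisms to \<open>\<int>\<close>.\<close>

lemma FW_torsion:
  assumes L: "subgroup L G" and FW: "FW_subgroup G L" and N: "subgroup N G" "N \<subseteq> L" and x: "x \<in> L"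
  shows "\<exists>n\<ge>1. x [^] (n::nat) \<in> N"
proof (rule ccontr)
  assume no: "\<not> ?thesis"
  note Lp = subgroup_props[OF L]
  define Z where "Z = {x [^] n | n::nat. n \<ge> 1}"
  have "N \<inter> Z = {}" using no by (auto simp: Z_def)
  obtain M where M: "subgroup M G" "N \<subseteq> M" "M \<subseteq> L" "M \<inter> Z = {}"
    and max: "\<forall>y\<in>L - M. \<exists>m\<in>M. \<exists>k::int. m \<otimes> y [^] k \<in> Z"
    by (rule maximal_subgroup_avoiding[OF N \<open>N \<inter> Z = {}\<close> L])
  note Mp = subgroup_props[OF M(1)]
  have xG: "x \<in> carrier G" using x Lp(1) by blast
  have pos: "x [^] (n::nat) \<notin> M" if "n \<ge> 1" for n
    using that M(4) by (auto simp: Z_def)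
  have xM: "j = 0" if "x [^] (j::int) \<in> M" for j
  proof (rule ccontr)
    assume "j \<noteq> 0"
    have "x [^] \<bar>j\<bar> \<in> M" using that Mp(3)[OF that] xG by (cases "j \<ge> 0") (auto simp: int_pow_neg)
    then have "x [^] (nat \<bar>j\<bar>) \<in> M" by (metis abs_ge_zero int_nat_eq int_pow_int)
    with pos[of "nat \<bar>j\<bar>"] \<open>j \<noteq> 0\<close> show False by linarith
  qed
  \<comment> \<open>The homomorphism to be constructed takes the value \<open>j / k\<close> at \<open>y\<close> if
    \<open>y\<^sup>k = x\<^sup>j\<close> modulo \<open>M\<close>.\<close>
  define rel where "rel y k j \<longleftrightarrow> k \<ge> 1 \<and> y [^] k \<otimes> x [^] (- j) \<in> M" for y and k j :: int
  have relmul: "y [^] (k * l) \<otimes> x [^] (- (j * l)) \<in> M" if "y [^] k \<otimes> x [^] (- j) \<in> M" "y \<in> L" for y and k j l :: int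
  proof -
    have "(y [^] k \<otimes> x [^] (- j)) [^] l \<in> M" using that(1) M(1) by (rule subgroup_int_pow_closed[rotated])
    moreover have "y \<in> carrier G" using that Lp(1) by blast
    ultimately show ?thesis using xG by (simp add: int_pow_distrib int_pow_pow)
  qed
  have ex: "\<exists>k j. rel y k j" if y: "y \<in> L" for y
  proof (cases "y \<in> M")
    case True
    then have "rel y 1 0" using Mp(1) by (simp add: rel_def int_pow_1)
    then show ?thesis by blast
  next
    case False
    obtain m k n where m: "m \<in> M" "m \<otimes> y [^] (k::int) = x [^] (n::nat)" "n \<ge> 1"
      using max y False unfolding Z_def by blast
    have c: "m \<in> carrier G" "y \<in> carrier G" using m y Mp(1) Lp(1) by blast+
    have "k \<noteq> 0"
    proof
      assume "k = 0"
      then have "x [^] n \<in> M" using m c by simp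
      then show False using pos[OF m(3)] by blast
    qed
    have "y [^] k \<otimes> x [^] (- int n) = inv m"
    proof -
      have "y [^] k = inv m \<otimes> x [^] n" using m(2) c xG by (metis int_pow_closed inv_closed l_inv l_one m_assoc)
      then show ?thesis using c xG by (simp add: int_pow_neg int_pow_int m_assoc)
    qed
    then have *: "y [^] k \<otimes> x [^] (- int n) \<in> M" using Mp(3)[OF m(1)] by simp
    have "rel y (k * sgn k) (int n * sgn k)"
      using relmul[OF * y] \<open>k \<noteq> 0\<close> by (auto simp: rel_def sgn_if)
    then show ?thesis by blast
  qed
  have uniq: "j * l = i * k" if "rel y k j" "rel y l i" "y \<in> L" for y k j l i
  proof -
    have yG: "y \<in> carrier G" using that Lp(1) by blast
    have "y [^] (k * l) \<otimes> x [^] (- (j * l)) \<in> M" "y [^] (l * k) \<otimes> x [^] (- (i * k)) \<in> M"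
      using relmul that unfolding rel_def by blast+
    then have "inv (y [^] (k * l) \<otimes> x [^] (- (j * l))) \<otimes> (y [^] (l * k) \<otimes> x [^] (- (i * k))) \<in> M"
      using Mp(2,3) by simp
    moreover have "inv (y [^] (k * l) \<otimes> x [^] (- (j * l))) \<otimes> (y [^] (l * k) \<otimes> x [^] (- (i * k))) = x [^] (j * l - i * k)"
    proof -
      have "inv (a \<otimes> b) \<otimes> (a \<otimes> c) = inv b \<otimes> c" if "a \<in> carrier G" "b \<in> carrier G" "c \<in> carrier G" for a b c
        using that by (simp add: inv_mult_group m_assoc)
      then show ?thesis
        using yG xG int_pow_mult[OF xG, of "j * l" "- (i * k)"] by (simp add: int_pow_neg mult.commute[of l k])
    qed
    ultimately show ?thesis using xM[of "j * l - i * k"] by simp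
  qed
  define q :: "'a \<Rightarrow> rat" where "q y = (SOME r. \<exists>k j. rel y k j \<and> r = of_int j / of_int k)" for y
  have q: "q y = of_int j / of_int k" if "rel y k j" "y \<in> L" for y k j
  proof -
    have "\<exists>l i. rel y l i \<and> q y = of_int i / of_int l"
      unfolding q_def by (rule someI_ex) (use ex[OF that(2)] in blast)
    then obtain l i where li: "rel y l i" "q y = of_int i / of_int l" by blast
    then have "(of_int (j * l) :: rat) = of_int (i * k)" using uniq[OF that(1) li(1) that(2)] by simp
    moreover have kl: "k \<ge> 1" "l \<ge> 1" using li that(1) by (simp_all add: rel_def)
    ultimately show ?thesis using li(2) by (simp add: frac_eq_eq)
  qed
  have q_add: "q (y \<otimes> z) = q y + q z" if yz: "y \<in> L" "z \<in> L" for y z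
  proof -
    obtain k j l i where r: "rel y k j" "rel z l i" using ex yz by metis
    have c: "y \<in> carrier G" "z \<in> carrier G" using yz Lp(1) by blast+
    have "(y [^] (k * l) \<otimes> x [^] (- (j * l))) \<otimes> (z [^] (l * k) \<otimes> x [^] (- (i * k))) \<in> M"
      using relmul r yz Mp(2) unfolding rel_def by blast
    moreover have "(y [^] (k * l) \<otimes> x [^] (- (j * l))) \<otimes> (z [^] (l * k) \<otimes> x [^] (- (i * k)))
        = (y \<otimes> z) [^] (k * l) \<otimes> x [^] (- (j * l + i * k))"
    proof -
      have "(a \<otimes> b) \<otimes> (d \<otimes> e) = (a \<otimes> d) \<otimes> (b \<otimes> e)"
        if "a \<in> carrier G" "b \<in> carrier G" "d \<in> carrier G" "e \<in> carrier G" for a b d e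
        using that by (simp add: m_ac)
      then show ?thesis
        using c xG int_pow_mult[OF xG, of "- (j * l)" "- (i * k)"]
        by (simp add: int_pow_distrib mult.commute[of l k])
    qed
    ultimately have "rel (y \<otimes> z) (k * l) (j * l + i * k)"
      using r by (simp add: rel_def) (metis mult_pos_pos zero_less_one order_less_le_trans int_one_le_iff_zero_less)
    then have "q (y \<otimes> z) = of_int (j * l + i * k) / of_int (k * l)" using q Lp(2) yz by blast
    also have "\<dots> = q y + q z"
      using q[OF r(1) yz(1)] q[OF r(2) yz(2)] r by (simp add: rel_def field_simps)
    finally show ?thesis .
  qed
  have "rel x 1 1" using xG Mp(4) by (simp add: rel_def int_pow_1 int_pow_neg)
  then have qx: "q x = 1" using q[of x 1 1] x by simp
  have q1: "q \<one> = 0" using q_add[of \<one> \<one>] Lp(4) by simp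
  have qinv: "q (inv y) = - q y" if "y \<in> L" for y
    using q_add[OF that Lp(3)[OF that]] q1 that Lp(1) by simp
  define H where "H n = {y \<in> L. fact n * q y \<in> \<int>}" for n :: nat
  have "\<exists>n. H n = L"
  proof (rule FW_chain[OF L FW])
    show "subgroup (H n) G" for n
    proof (rule subgroupI)
      show "H n \<subseteq> carrier G" using Lp(1) by (auto simp: H_def)
      show "H n \<noteq> {}" using Lp(4) q1 by (auto simp: H_def intro!: exI[of _ \<one>])
    qed (auto simp: H_def q_add qinv distrib_left Lp(2,3))
    show "H n \<subseteq> H (Suc n)" for n
      by (auto simp: H_def mult.assoc distrib_right intro!: Ints_add Ints_mult Ints_of_nat)
    show "(\<Union>n. H n) = L"
    proof
      show "L \<subseteq> (\<Union>n. H n)"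
      proof
        fix y assume y: "y \<in> L"
        obtain k j where r: "rel y k j" using ex[OF y] by blast
        then have k: "k \<ge> 1" by (simp add: rel_def)
        then have "nat k dvd fact (nat k)" by (intro dvd_fact) auto
        then obtain c where c: "fact (nat k) = nat k * c" by (auto simp: dvd_def)
        have "(fact (nat k) :: rat) = of_nat (fact (nat k))" by simp
        also have "\<dots> = of_int k * of_nat c" using k unfolding c by simp
        finally have "fact (nat k) * q y = of_int (j * int c)" using k q[OF r y] by simp
        then have "y \<in> H (nat k)" using y unfolding H_def by (metis (mono_tags, lifting) Ints_of_int mem_Collect_eq)
        then show "y \<in> (\<Union>n. H n)" by blast
      qed
    qed (auto simp: H_def)
  qed
  then obtain n where n: "H n = L" ..
  define f where "f y = \<lfloor>fact n * q y\<rfloor>" for y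
  have f: "of_int (f y) = fact n * q y" if "y \<in> L" for y
    using that n by (auto simp: f_def H_def elim: Ints_cases)
  have "f (y \<otimes> z) = f y + f z" if "y \<in> L" "z \<in> L" for y z
  proof -
    have "(of_int (f (y \<otimes> z)) :: rat) = of_int (f y + f z)"
      using f[OF Lp(2)[OF that]] f[OF that(1)] f[OF that(2)] q_add[OF that] by (simp add: distrib_left)
    then show ?thesis by (simp only: of_int_eq_iff)
  qed
  then have "f x = 0" using FW_hom_int_trivial[OF L FW _ x] by blast
  then show False using f[OF x] qx by simp
qed

text \<open>The elements killed by \<open>n!\<close> modulo \<^term>\<open>N\<close> form an increasing sequence of subgroups, which
  exhausts the group by torsion and hence is stationary.\<close>

lemma FW_bounded_exponent:
  assumes L: "subgroup L G" and FW: "FW_subgroup G L" and N: "subgroup N G" "N \<subseteq> L"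
  obtains m :: nat where "m \<ge> 1" "\<forall>y\<in>L. y [^] m \<in> N"
proof -
  note Lp = subgroup_props[OF L] and Np = subgroup_props[OF N(1)]
  define H where "H n = {y \<in> L. y [^] (fact n :: nat) \<in> N}" for n :: nat
  have pw: "y [^] (a * b) \<in> N" if "y [^] a \<in> N" "y \<in> L" for y and a b :: nat
  proof -
    have "(y [^] a) [^] b \<in> N" using that(1) N(1) by (rule subgroup_nat_pow_closed)
    then show ?thesis using Lp(1)[OF that(2)] by (simp add: nat_pow_pow)
  qed
  have "\<exists>n. H n = L"
  proof (rule FW_chain[OF L FW])
    show "subgroup (H n) G" for n
    proof (rule subgroupI)
      show "H n \<subseteq> carrier G" using Lp(1) by (auto simp: H_def)
      show "H n \<noteq> {}" using Lp(4) Np(4) by (auto simp: H_def intro!: exI[of _ \<one>])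
      show "inv a \<in> H n" if "a \<in> H n" for a
        using that Lp(1,3) Np(3) by (auto simp: H_def nat_pow_inv)
      show "a \<otimes> b \<in> H n" if "a \<in> H n" "b \<in> H n" for a b
        using that Lp(1,2) Np(2) by (auto simp: H_def nat_pow_distrib)
    qed
    show "H n \<subseteq> H (Suc n)" for n
      using pw[of _ "fact n" "Suc n"] by (auto simp: H_def mult.commute)
    show "(\<Union>n. H n) = L"
    proof
      show "L \<subseteq> (\<Union>n. H n)"
      proof
        fix y assume y: "y \<in> L"
        obtain n where n: "n \<ge> 1" "y [^] (n::nat) \<in> N" using FW_torsion[OF L FW N y] by blast
        obtain c where "fact n = n * c" using dvd_fact[OF n(1) order_refl] by (auto simp: dvd_def)
        then have "y \<in> H n" using pw[OF n(2) y, of c] y by (simp add: H_def)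
        then show "y \<in> (\<Union>n. H n)" by blast
      qed
    qed (auto simp: H_def)
  qed
  then obtain n where "H n = L" ..
  then have "\<forall>y\<in>L. y [^] (fact n :: nat) \<in> N" by (auto simp: H_def)
  then show thesis by (intro that[of "fact n"]) simp_all
qed

text \<open>Modulo \<^term>\<open>N\<close> this is a vector space over \<open>\<int>/p\<close>. Were it infinite, it would contain a
  subspace \<open>\<Union>n. B n\<close> of countably infinite dimension; adding the finite-dimensional \<open>B n\<close> to a
  complement \<open>M\<close> of that subspace gives a strictly increasing sequence of proper subspaces
  exhausting it.\<close>

lemma FW_prime_exponent:
  assumes L: "subgroup L G" and FW: "FW_subgroup G L" and N: "subgroup N G" "N \<subseteq> L"
    and p: "prime (p::nat)" "\<forall>y\<in>L. y [^] p \<in> N"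
  shows "fin_index G N L"
proof (rule ccontr)
  assume infinite: "\<not> fin_index G N L"
  note Lp = subgroup_props[OF L] and Np = subgroup_props[OF N(1)]
  define P where "P B \<longleftrightarrow> subgroup B G \<and> N \<subseteq> B \<and> B \<subseteq> L \<and> fin_index G N B" for B
  have pp: "y [^] (int p * k) \<in> N" if "y \<in> L" for y and k :: int
  proof -
    have "(y [^] p) [^] k \<in> N" using p(2) that N(1) by (blast intro: subgroup_int_pow_closed)
    then show ?thesis using Lp(1)[OF that] by (simp add: int_pow_pow int_pow_int[symmetric])
  qed
  have "\<exists>B'. P B' \<and> B \<subseteq> B' \<and> B' \<noteq> B" if B: "P B" for B
  proof -
    have sB: "subgroup B G" "N \<subseteq> B" "B \<subseteq> L" "fin_index G N B" using B by (auto simp: P_def)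
    have "B \<noteq> L" using infinite sB(4) by blast
    then obtain x where x: "x \<in> L" "x \<notin> B" using sB(3) by blast
    have xG: "x \<in> carrier G" using Lp(1) x by blast
    note adj = subgroup_adjoin[OF sB(1) xG]
    have xk: "x [^] k \<in> L" for k :: int using x(1) L by (blast intro: subgroup_int_pow_closed)
    have aL: "adjoin B x \<subseteq> L" using sB(3) xk Lp(2) by (auto simp: adjoin_def)
    have "fin_index G B (adjoin B x)"
      unfolding fin_index_def
    proof (intro exI conjI ballI)
      show "finite ((\<lambda>k. x [^] k) ` {0..<int p})" by simp
      have "x [^] k \<in> adjoin B x" for k :: int
        using adj(1,3) by (blast intro: subgroup_int_pow_closed)
      then show "(\<lambda>k. x [^] k) ` {0..<int p} \<subseteq> adjoin B x" by blast
      fix y assume "y \<in> adjoin B x"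
      then obtain b k where y: "b \<in> B" "y = b \<otimes> x [^] (k::int)" by (auto simp: adjoin_def)
      have bG: "b \<in> carrier G" using y sB(3) Lp(1) by blast
      have "x [^] k = x [^] (k mod int p) \<otimes> x [^] (int p * (k div int p))"
        using int_pow_mult[OF xG, of "k mod int p" "int p * (k div int p)"] by simp
      then have "inv (x [^] (k mod int p)) \<otimes> y = b \<otimes> x [^] (int p * (k div int p))"
        using y(2) bG xG by (simp add: m_lcomm)
      also have "\<dots> \<in> B" using subgroup_props(2)[OF sB(1) y(1)] pp[OF x(1)] sB(2) by blast
      finally have "inv (x [^] (k mod int p)) \<otimes> y \<in> B" .
      moreover have "k mod int p \<in> {0..<int p}" using prime_gt_0_nat[OF p(1)] by simp
      ultimately show "\<exists>t\<in>(\<lambda>k. x [^] k) ` {0..<int p}. inv t \<otimes> y \<in> B" by blast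
    qed
    then have "fin_index G N (adjoin B x)"
      using fin_index_trans[OF sB(4) _ _ adj(2,1)] subgroup.subset[OF adj(1)] by blast
    then have "P (adjoin B x)" using adj(1,2) aL sB(2) by (auto simp: P_def)
    then show ?thesis using adj(2,3) x(2) by blast
  qed
  moreover have "P N" using N fin_index_refl by (auto simp: P_def)
  ultimately obtain B where B: "\<And>n::nat. P (B n)" "\<And>n. B n \<subseteq> B (Suc n) \<and> B (Suc n) \<noteq> B n"
    using dependent_nat_choice[of "\<lambda>_. P" "\<lambda>_ B B'. B \<subseteq> B' \<and> B' \<noteq> B"] by metis
  have Bs: "subgroup (B n) G" "N \<subseteq> B n" "B n \<subseteq> L" for n using B(1)[of n] by (auto simp: P_def)
  obtain M where M: "subgroup M G" "N \<subseteq> M" "M \<subseteq> L" "M \<inter> ((\<Union>n. B n) - N) = {}"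
    and max: "\<forall>y\<in>L - M. \<exists>m\<in>M. \<exists>k::int. m \<otimes> y [^] k \<in> (\<Union>n. B n) - N"
    using maximal_subgroup_avoiding[OF N _ L, of "(\<Union>n. B n) - N"] by blast
  note Mp = subgroup_props[OF M(1)]
  define H where "H n = M <#> B n" for n
  have HI: "m \<otimes> b \<in> H n" if "m \<in> M" "b \<in> B n" for m b n using that by (auto simp: H_def set_mult_def)
  have "\<exists>n. H n = L"
  proof (rule FW_chain[OF L FW])
    show "subgroup (H n) G" for n unfolding H_def using mult_subgroups[OF M(1) Bs(1)] .
    show "H n \<subseteq> H (Suc n)" for n using B(2)[of n] by (auto simp: H_def set_mult_def)
    show "(\<Union>n. H n) = L"
    proof
      show "L \<subseteq> (\<Union>n. H n)"
      proof
        fix y assume y: "y \<in> L"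
        have yG: "y \<in> carrier G" using y Lp(1) by blast
        show "y \<in> (\<Union>n. H n)"
        proof (cases "y \<in> M")
          case True
          then show ?thesis using HI[OF True subgroup.one_closed[OF Bs(1)]] yG by auto
        next
          case False
          obtain m k n where m: "m \<in> M" "m \<otimes> y [^] (k::int) \<in> B n" "m \<otimes> y [^] k \<notin> N"
            using max y False by blast
          have mG: "m \<in> carrier G" using m Mp(1) by blast
          have "\<not> int p dvd k"
          proof
            assume "int p dvd k"
            then obtain l where "k = int p * l" by (auto simp: dvd_def)
            then have "m \<otimes> y [^] k \<in> M" using pp[OF y, of l] M(2) Mp(2)[OF m(1)] by blast
            then show False using m(2,3) M(4) by blast
          qed
          then have "coprime k (int p)" using p(1)
            by (metis coprime_commute prime_imp_coprime prime_nat_int_transfer)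
          then obtain u v where uv: "u * k + v * int p = 1"
            using bezout_int[of k "int p"] by auto
          have "(m \<otimes> y [^] k) [^] u \<in> B n" using m(2) Bs(1) by (blast intro: subgroup_int_pow_closed)
          moreover have "inv (m [^] u) \<otimes> y [^] (int p * v) \<in> M"
            using Mp(2,3) m(1) pp[OF y] M(1,2) by (blast intro: subgroup_int_pow_closed)
          moreover have "(inv (m [^] u) \<otimes> y [^] (int p * v)) \<otimes> (m \<otimes> y [^] k) [^] u = y"
          proof -
            have "(inv a \<otimes> b) \<otimes> (a \<otimes> c) = b \<otimes> c" if "a \<in> carrier G" "b \<in> carrier G" "c \<in> carrier G" for a b c
            proof -
              have "(inv a \<otimes> b) \<otimes> (a \<otimes> c) = inv a \<otimes> (a \<otimes> (b \<otimes> c))" using that by (simp add: m_assoc m_lcomm[of b a c])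
              then show ?thesis using that by simp
            qed
            then have "(inv (m [^] u) \<otimes> y [^] (int p * v)) \<otimes> (m \<otimes> y [^] k) [^] u = y [^] (int p * v) \<otimes> y [^] (k * u)"
              using mG yG by (simp add: int_pow_distrib int_pow_pow)
            also have "\<dots> = y [^] (int p * v + k * u)" using yG by (simp add: int_pow_mult)
            also have "int p * v + k * u = 1" using uv by (simp add: mult.commute)
            finally show ?thesis using yG by (simp add: int_pow_1)
          qed
          ultimately have "y \<in> H n" using HI by metis
          then show ?thesis by blast
        qed
      qed
      show "(\<Union>n. H n) \<subseteq> L" using M(3) Bs(3) Lp(2) by (auto simp: H_def set_mult_def subset_iff)
    qed
  qed
  then obtain n where n: "H n = L" ..
  obtain x where x: "x \<in> B (Suc n)" "x \<notin> B n" using B(2)[of n] by blast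
  then have "x \<in> H n" using n Bs(3) by blast
  then obtain m b where mb: "m \<in> M" "b \<in> B n" "x = m \<otimes> b" by (auto simp: H_def set_mult_def)
  have c: "m \<in> carrier G" "b \<in> carrier G" using mb(1,2) Mp(1) Bs(3) Lp(1) by blast+
  have "b \<in> B (Suc n)" using mb(2) B(2) by blast
  then have "x \<otimes> inv b \<in> B (Suc n)" using x(1) subgroup_props(2,3)[OF Bs(1)[of "Suc n"]] by simp
  then have "m \<in> B (Suc n)" using mb(3) c by (simp add: m_assoc)
  then have "m \<in> B n" using mb(1) M(4) Bs(2) by blast
  then have "x \<in> B n" using mb(2,3) subgroup_props(2)[OF Bs(1)[of n]] by simp
  then show False using x(2) by blast
qed

text \<open>Induction on the exponent: the elements whose power with exponent \<open>m / p\<close> lies in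
  \<^term>\<open>N\<close> form a subgroup modulo which the exponent is \<open>p\<close>, and which has exponent
  \<open>m / p\<close> modulo \<^term>\<open>N\<close>.\<close>

lemma FW_exponent:
  assumes "m \<ge> 1" "subgroup L G" "FW_subgroup G L" "subgroup N G" "N \<subseteq> L" "\<forall>y\<in>L. y [^] (m::nat) \<in> N"
  shows "fin_index G N L"
  using assms
proof (induction m arbitrary: L rule: less_induct)
  case (less m)
  note Lp = subgroup_props[OF less.prems(2)] and Np = subgroup_props[OF less.prems(4)]
  show ?case
  proof (cases "m = 1")
    case True
    have "y \<in> N" if "y \<in> L" for y using less.prems(6) that True Lp(1) by auto
    then show ?thesis using less.prems(5) fin_index_refl[OF less.prems(2)] by (metis subsetI subset_antisym)
  next
    case False
    then obtain p where p: "prime p" "p dvd m" using prime_factor_nat by blast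
    then obtain m' where m': "m = m' * p" by (metis dvd_div_mult_self)
    have "m' \<noteq> 0" using m' less.prems(1) by auto
    then have m'1: "m' \<ge> 1" "m' < m" using m' prime_gt_1_nat[OF p(1)] by simp_all
    define N' where "N' = {y \<in> L. y [^] m' \<in> N}"
    have sN': "subgroup N' G"
    proof (rule subgroupI)
      show "N' \<subseteq> carrier G" using Lp(1) by (auto simp: N'_def)
      show "N' \<noteq> {}" using Lp(4) Np(4) by (auto simp: N'_def intro!: exI[of _ \<one>])
      show "inv a \<in> N'" if "a \<in> N'" for a
        using that Lp(1,3) Np(3) by (auto simp: N'_def nat_pow_inv)
      show "a \<otimes> b \<in> N'" if "a \<in> N'" "b \<in> N'" for a b
        using that Lp(1,2) Np(2) by (auto simp: N'_def nat_pow_distrib)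
    qed
    have N'L: "N' \<subseteq> L" by (auto simp: N'_def)
    have "\<forall>y\<in>L. y [^] p \<in> N'"
    proof
      fix y assume y: "y \<in> L"
      have "(y [^] p) [^] m' \<in> N" using less.prems(6) y Lp(1)[OF y] by (simp add: nat_pow_pow m' mult.commute)
      moreover have "y [^] p \<in> L" using y less.prems(2) by (blast intro: subgroup_nat_pow_closed)
      ultimately show "y [^] p \<in> N'" by (simp add: N'_def)
    qed
    then have fi: "fin_index G N' L"
      using FW_prime_exponent[OF less.prems(2,3) sN' N'L p(1)] by blast
    have "y [^] m' \<in> N" if "y \<in> N" for y
      using that less.prems(4) by (blast intro: subgroup_nat_pow_closed)
    then have "N \<subseteq> N'" using less.prems(5) by (auto simp: N'_def)
    have FWN': "FW_subgroup G N'"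
      using FW_fin_index[OF less.prems(2,3) sN' N'L fi] .
    have "fin_index G N N'"
      by (rule less.IH[OF m'1(2,1) sN' FWN' less.prems(4) \<open>N \<subseteq> N'\<close>]) (simp add: N'_def)
    then show ?thesis
      using fin_index_trans[OF _ fi subgroup.subset[OF less.prems(2)] N'L less.prems(2)] by blast
  qed
qed

theorem FW_imp_finite:
  assumes "property_FW G"
  shows "finite (carrier G)"
proof -
  have L: "subgroup (carrier G) G" by (rule subgroup_self)
  have FW: "FW_subgroup G (carrier G)" using assms by simp
  have N: "subgroup {\<one>} G" "{\<one>} \<subseteq> carrier G" using triv_subgroup by auto
  obtain m :: nat where "m \<ge> 1" "\<forall>y\<in>carrier G. y [^] m \<in> {\<one>}"
    using FW_bounded_exponent[OF L FW N] by metis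
  then have "fin_index G {\<one>} (carrier G)" using FW_exponent[OF _ L FW N] by blast
  then obtain T where T: "finite T" "T \<subseteq> carrier G" "\<forall>x\<in>carrier G. \<exists>t\<in>T. inv t \<otimes> x \<in> {\<one>}"
    unfolding fin_index_def by blast
  have "carrier G \<subseteq> T"
  proof
    fix x assume x: "x \<in> carrier G"
    then obtain t where t: "t \<in> T" "inv t \<otimes> x = \<one>" using T(3) by blast
    then have "t \<otimes> (inv t \<otimes> x) = t" using T(2) by auto
    then show "x \<in> T" using t(1) T(2) x by auto
  qed
  then show ?thesis using T(1) finite_subset by blast
qed

end

text \<open>All uses of Property FW against solvable groups go through this form: the quotient by
  \<^term>\<open>N\<close> is an abelian group with Property FW.\<close>

theorem (in group) FW_commutators_fin_index:
  assumes L: "subgroup L G" and FW: "FW_subgroup G L" and N: "subgroup N G" "N \<subseteq> L"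
    and comm: "\<And>x y. x \<in> L \<Longrightarrow> y \<in> L \<Longrightarrow> x \<otimes> y \<otimes> inv (y \<otimes> x) \<in> N"
  shows "fin_index G N L"
proof -
  note Lp = subgroup_props[OF L] and Np = subgroup_props[OF N(1)]
  let ?L = "G\<lparr>carrier := L\<rparr>"
  interpret L: group ?L by (rule group_restrict[OF L])
  have sNL: "subgroup N ?L" using subgroup_incl[OF N(1) L N(2)] .
  have invL: "inv\<^bsub>?L\<^esub> x = inv x" if "x \<in> L" for x using m_inv_consistent[OF L that] .
  have "N \<lhd> ?L"
    unfolding L.normal_inv_iff
  proof (intro conjI ballI sNL)
    fix x h assume x: "x \<in> carrier ?L" and h: "h \<in> N"
    have c: "x \<in> carrier G" "h \<in> carrier G" "x \<in> L" "h \<in> L" using x h Lp(1) N(2) by auto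
    have "(x \<otimes> h \<otimes> inv (h \<otimes> x)) \<otimes> h \<in> N" using comm[OF c(3,4)] Np(2) h by blast
    moreover have "(x \<otimes> h \<otimes> inv (h \<otimes> x)) \<otimes> h = x \<otimes> h \<otimes> inv x" using c by (simp add: inv_mult_group m_assoc)
    ultimately show "x \<otimes>\<^bsub>?L\<^esub> h \<otimes>\<^bsub>?L\<^esub> inv\<^bsub>?L\<^esub> x \<in> N" using invL c by simp
  qed
  then interpret Q: normal N ?L .
  have car: "carrier (?L Mod N) = (\<lambda>x. N #> x) ` L"
    by (auto simp: FactGroup_def RCOSETS_def r_coset_def)
  have hom: "N #> (x \<otimes> y) = (N #> x) \<otimes>\<^bsub>?L Mod N\<^esub> (N #> y)" if "x \<in> L" "y \<in> L" for x y
    using Q.rcos_sum[of x y] that by (simp add: FactGroup_def r_coset_def set_mult_def)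
  have comm_Q: "comm_group (?L Mod N)"
  proof (rule group.group_comm_groupI[OF Q.factorgroup_is_group])
    fix a b assume "a \<in> carrier (?L Mod N)" "b \<in> carrier (?L Mod N)"
    then obtain x y where xy: "x \<in> L" "y \<in> L" "a = N #> x" "b = N #> y" using car by auto
    have c: "x \<in> carrier G" "y \<in> carrier G" using xy Lp(1) by blast+
    have "x \<otimes> y = (x \<otimes> y \<otimes> inv (y \<otimes> x)) \<otimes> (y \<otimes> x)" using c by (simp add: m_assoc)
    then have "x \<otimes> y \<in> N #> (y \<otimes> x)" using comm[OF xy(1,2)] unfolding r_coset_def by blast
    then have "N #> (y \<otimes> x) = N #> (x \<otimes> y)" using repr_independence[OF _ _ N(1)] c by simp
    then show "a \<otimes>\<^bsub>?L Mod N\<^esub> b = b \<otimes>\<^bsub>?L Mod N\<^esub> a" using hom xy by simp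
  qed
  have "property_FW (?L Mod N)"
    using property_FW_image[OF L FW Q.factorgroup_is_group, of "\<lambda>x. N #> x"] hom car by simp
  then have fin: "finite ((\<lambda>x. N #> x) ` L)" using comm_group.FW_imp_finite[OF comm_Q] car by simp
  have "finite ((\<lambda>x. N #> inv x) ` L)"
    by (rule finite_subset[OF _ fin]) (use Lp(3) in blast)
  then show ?thesis
  proof (rule fin_indexI[rotated])
    fix x y assume xy: "x \<in> L" "y \<in> L" "N #> inv x = N #> inv y"
    have c: "x \<in> carrier G" "y \<in> carrier G" using xy Lp(1) by blast+
    have "\<one> \<otimes> inv x \<in> N #> inv x" using Np(4) unfolding r_coset_def by blast
    then have "inv x \<in> N #> inv y" using xy(3) c by simp
    then obtain n where n: "n \<in> N" "inv x = n \<otimes> inv y" by (auto simp: r_coset_def)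
    then have "inv x \<otimes> y = n" using c Np(1) by (simp add: m_assoc)
    then show "inv x \<otimes> y \<in> N" using n by simp
  qed (use Lp(1) in blast)
qed

section \<open>Homographies\<close>

definition mat2 :: "real \<Rightarrow> real \<Rightarrow> real \<Rightarrow> real \<Rightarrow> real^2^2" where
  "mat2 a b c d = vector [vector [a, b], vector [c, d]]"

lemma mat2_nth [simp]: "mat2 a b c d $ 1 $ 1 = a" "mat2 a b c d $ 1 $ 2 = b"
  "mat2 a b c d $ 2 $ 1 = c" "mat2 a b c d $ 2 $ 2 = d"
  by (simp_all add: mat2_def)

lemma mat2_eqI: "A $ 1 $ 1 = B $ 1 $ 1 \<Longrightarrow> A $ 1 $ 2 = B $ 1 $ 2 \<Longrightarrow> A $ 2 $ 1 = B $ 2 $ 1 \<Longrightarrow>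
  A $ 2 $ 2 = B $ 2 $ 2 \<Longrightarrow> A = (B :: real^2^2)"
  by (simp add: vec_eq_iff forall_2)

lemma mat2_cases: obtains a b c d where "A = mat2 a b c d"
  by (rule that[of "A$1$1" "A$1$2" "A$2$1" "A$2$2"]) (simp add: mat2_eqI)

lemma mat2_eq_iff [simp]: "mat2 a b c d = mat2 a' b' c' d' \<longleftrightarrow> a = a' \<and> b = b' \<and> c = c' \<and> d = d'"
  by (metis mat2_nth)

lemma mat2_mult [simp]: "mat2 a b c d ** mat2 a' b' c' d' =
  mat2 (a * a' + b * c') (a * b' + b * d') (c * a' + d * c') (c * b' + d * d')"
  by (rule mat2_eqI) (simp_all add: matrix_matrix_mult_def sum_2)

lemma det_mat2 [simp]: "det (mat2 a b c d) = a * d - b * c"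
  by (simp add: det_2)

lemma mat_1_mat2: "mat 1 = mat2 1 0 0 1"
  by (rule mat2_eqI) (simp_all add: mat_def)

lemma scaleR_mat2 [simp]: "k *\<^sub>R mat2 a b c d = mat2 (k * a) (k * b) (k * c) (k * d)"
  by (rule mat2_eqI) simp_all

text \<open>The bare \<open>inv\<close> denotes the inverse in a group.\<close>

abbreviation invf :: "('a \<Rightarrow> 'b) \<Rightarrow> 'b \<Rightarrow> 'a" where
  "invf \<equiv> inv_into UNIV"

definition PGL :: "(real option \<Rightarrow> real option) set" where
  "PGL = {homography A | A. det A \<noteq> 0}"

lemma homography_PGL: "det A \<noteq> 0 \<Longrightarrow> homography A \<in> PGL"
  by (auto simp: PGL_def)

lemma homography_comp: "det B \<noteq> 0 \<Longrightarrow> homography A \<circ> homography B = homography (A ** B)"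
  by (simp add: fun_eq_iff homography_mult)

lemma homography_id: "homography (mat 1) = id"
  by (simp add: fun_eq_iff homography_mat_1)

lemma id_PGL [simp, intro]: "id \<in> PGL"
  using homography_PGL[of "mat 1"] by (simp add: homography_id)

lemma PGL_comp [simp, intro]: "f \<in> PGL \<Longrightarrow> g \<in> PGL \<Longrightarrow> f \<circ> g \<in> PGL"
proof -
  assume "f \<in> PGL" "g \<in> PGL"
  then obtain A B where "det A \<noteq> 0" "f = homography A" "det B \<noteq> 0" "g = homography B"
    by (auto simp: PGL_def)
  then show ?thesis using homography_PGL[of "A ** B"] by (simp add: homography_comp det_mul)
qed

lemma homography_inverse:
  assumes "det A \<noteq> 0"
  obtains B where "det B \<noteq> 0" "A ** B = mat 1" "B ** A = mat 1"
    "homography A \<circ> homography B = id" "homography B \<circ> homography A = id"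
proof -
  obtain B where B: "A ** B = mat 1" "B ** A = mat 1"
    using assms by (auto simp: invertible_det_nz[symmetric] invertible_def)
  then have "det A * det B = 1" by (metis det_I det_mul)
  then have "det B \<noteq> 0" by auto
  with B assms show thesis
    by (intro that[of B]) (simp_all add: homography_comp homography_id)
qed

lemma PGL_inverse:
  assumes "f \<in> PGL"
  shows "bij f" "invf f \<in> PGL"
proof -
  obtain A where A: "det A \<noteq> 0" "f = homography A" using assms by (auto simp: PGL_def)
  obtain B where B: "det B \<noteq> 0" "f \<circ> homography B = id" "homography B \<circ> f = id"
    using homography_inverse[OF A(1)] A(2) by metis
  show "bij f" using B(2,3) by (rule o_bij[rotated])
  have "invf f = homography B" using B(2,3) by (metis inv_unique_comp)
  then show "invf f \<in> PGL" using homography_PGL[OF B(1)] by simp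
qed

lemma PGL_inj: "f \<in> PGL \<Longrightarrow> inj f" and PGL_surj: "f \<in> PGL \<Longrightarrow> surj f"
  using PGL_inverse(1) bij_is_inj bij_is_surj by blast+

lemma PGL_inv_comp [simp]: "f \<in> PGL \<Longrightarrow> f \<circ> invf f = id" "f \<in> PGL \<Longrightarrow> invf f \<circ> f = id"
  using PGL_inj PGL_surj by (simp_all add: surj_iff inj_iff)

text \<open>A fixed point in \<open>\<real>\<close> is a root of a quadratic polynomial, whose coefficients vanish if there
  are infinitely many.\<close>

lemma homography_infinite_fixed:
  assumes "infinite {x. homography A x = x}"
  shows "A = A$1$1 *\<^sub>R mat 1"
proof -
  define a b c d where "a = A$1$1" "b = A$1$2" "c = A$2$1" "d = A$2$2"
  define p where "p = [:- b, d - a, c:]"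
  have "{x. homography A x = x} \<subseteq> insert None (Some ` {t. poly p t = 0})"
  proof
    fix x assume x: "x \<in> {x. homography A x = x}"
    show "x \<in> insert None (Some ` {t. poly p t = 0})"
    proof (cases x)
      case (Some t)
      then have "c * t + d \<noteq> 0" "(a * t + b) / (c * t + d) = t"
        using x by (auto simp: homography_def a_b_c_d_def split: if_splits)
      then have "poly p t = 0" by (simp add: p_def field_simps)
      then show ?thesis using Some by blast
    qed simp
  qed
  then have "infinite {t. poly p t = 0}" using assms by (meson finite_imageI finite_insert finite_subset)
  then have "p = 0" using poly_roots_finite by blast
  then have "b = 0" "c = 0" "d = a" by (auto simp: p_def)
  then show ?thesis by (intro mat2_eqI) (auto simp: a_b_c_d_def mat_def)
qed

lemma homography_scaleR: "k \<noteq> 0 \<Longrightarrow> homography (k *\<^sub>R A) = homography A"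
proof
  fix x assume "k \<noteq> 0"
  then have *: "k * u * t + k * v = k * (u * t + v)" for u v t by (simp add: algebra_simps)
  with \<open>k \<noteq> 0\<close> show "homography (k *\<^sub>R A) x = homography A x"
    by (cases x) (simp_all add: homography_def *)
qed

lemma homography_infinite_agree:
  assumes "det A \<noteq> 0" "det B \<noteq> 0" "infinite {x. homography A x = homography B x}"
  shows "\<exists>k. k \<noteq> 0 \<and> A = k *\<^sub>R B"
proof -
  obtain C where C: "det C \<noteq> 0" "B ** C = mat 1" "C ** B = mat 1" "homography C \<circ> homography B = id"
    using homography_inverse[OF assms(2)] by metis
  have "homography (C ** A) x = x" if "homography A x = homography B x" for x
    using that C(4) homography_mult[OF assms(1), of C x] by (metis comp_apply id_apply)
  then have "{x. homography A x = homography B x} \<subseteq> {x. homography (C ** A) x = x}" by blast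
  then have "infinite {x. homography (C ** A) x = x}" using assms(3) finite_subset by blast
  then obtain k where k: "C ** A = k *\<^sub>R mat 1" using homography_infinite_fixed by metis
  then have "A = k *\<^sub>R B"
    using C(2) by (metis matrix_mul_assoc matrix_mul_lid matrix_mul_rid matrix_scalar_ac scalar_matrix_assoc)
  moreover from this have "k \<noteq> 0" using assms(1) by (auto simp: det_2)
  ultimately show ?thesis by blast
qed

lemma homography_eqD: "det A \<noteq> 0 \<Longrightarrow> det B \<noteq> 0 \<Longrightarrow> homography A = homography B \<Longrightarrow> \<exists>k. k \<noteq> 0 \<and> A = k *\<^sub>R B"
proof (rule homography_infinite_agree)
  have "infinite (UNIV :: real option set)"
    using infinite_UNIV_char_0[where 'a = real] by (metis finite_imageD finite_subset inj_Some subset_UNIV)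
  then show "homography A = homography B \<Longrightarrow> infinite {x. homography A x = homography B x}" by simp
qed

lemma PGL_infinite_agree:
  assumes "f \<in> PGL" "g \<in> PGL" "infinite {x. f x = g x}"
  shows "f = g"
proof -
  obtain A B where "det A \<noteq> 0" "f = homography A" "det B \<noteq> 0" "g = homography B"
    using assms(1,2) by (auto simp: PGL_def)
  then show ?thesis using homography_infinite_agree[of A B] homography_scaleR assms(3) by metis
qed

section \<open>Sides of points of the projective line\<close>

text \<open>A side \<open>(x, True)\<close> is the germ of intervals starting at \<^term>\<open>x\<close> in the increasing
  direction of the circle, so that \<open>(None, True)\<close> is a neighbourhood of \<open>-\<infinity>\<close> in \<open>\<real>\<close>.\<close>

type_synonym side = "real option \<times> bool"

definition fl :: "side \<Rightarrow> real option filter" where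
  "fl s = filtermap Some (case s of
      (Some x, b) \<Rightarrow> if b then at_right x else at_left x
    | (None, b) \<Rightarrow> if b then at_bot else at_top)"

lemma fl_simps [simp]:
  "fl (Some x, True) = filtermap Some (at_right x)" "fl (Some x, False) = filtermap Some (at_left x)"
  "fl (None, True) = filtermap Some at_bot" "fl (None, False) = filtermap Some at_top"
  by (simp_all add: fl_def)

lemma side_cases:
  obtains x where "s = (Some x, True)" | x where "s = (Some x, False)" | "s = (None, True)" | "s = (None, False)"
  by (cases s; cases "fst s"; cases "snd s") auto

lemma fl_interval:
  assumes "eventually P (fl s)"
  obtains I where "open I" "connected I" "eventually (\<lambda>y. y \<in> Some ` I) (fl s)" "\<And>r. r \<in> I \<Longrightarrow> P (Some r)"
proof (cases s rule: side_cases)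
  case (1 x)
  then obtain b where "b > x" "\<forall>y>x. y < b \<longrightarrow> P (Some y)"
    using assms by (auto simp: eventually_filtermap eventually_at_right_field)
  then show ?thesis using 1
    by (intro that[of "{x<..<b}"]) (auto simp: eventually_filtermap eventually_at_right_field image_iff)
next
  case (2 x)
  then obtain b where "b < x" "\<forall>y>b. y < x \<longrightarrow> P (Some y)"
    using assms by (auto simp: eventually_filtermap eventually_at_left_field)
  then show ?thesis using 2
    by (intro that[of "{b<..<x}"]) (auto simp: eventually_filtermap eventually_at_left_field image_iff)
next
  case 3
  then obtain b where "\<forall>y<b. P (Some y)"
    using assms by (auto simp: eventually_filtermap eventually_at_bot_dense)
  then show ?thesis using 3
    by (intro that[of "{..<b}"]) (auto simp: eventually_filtermap eventually_at_bot_dense image_iff)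
next
  case 4
  then obtain b where "\<forall>y>b. P (Some y)"
    using assms by (auto simp: eventually_filtermap eventually_at_top_dense)
  then show ?thesis using 4
    by (intro that[of "{b<..}"]) (auto simp: eventually_filtermap eventually_at_top_dense image_iff)
qed

lemma fl_inner: "open I \<Longrightarrow> r \<in> I \<Longrightarrow> eventually (\<lambda>y. y \<in> Some ` I) (fl (Some r, b))"
proof -
  assume "open I" "r \<in> I"
  then have "eventually (\<lambda>y. y \<in> I) (at r)" using eventually_at_topological by blast
  then have "eventually (\<lambda>y. y \<in> I) (at_right r)" "eventually (\<lambda>y. y \<in> I) (at_left r)"
    by (simp_all add: eventually_at_split)
  then show ?thesis by (cases b) (auto simp: eventually_filtermap image_iff)
qed

lemma fl_neq_bot [simp]: "fl s \<noteq> bot"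
  by (cases s rule: side_cases) (simp_all add: filtermap_bot_iff)

text \<open>The set of the reals before a side. It linearly orders the sides, and reduces statements about
  all four kinds of sides to inequalities.\<close>

definition cut :: "side \<Rightarrow> real set" where
  "cut s = (case s of (Some x, b) \<Rightarrow> if b then {..x} else {..<x} | (None, b) \<Rightarrow> if b then {} else UNIV)"

lemma cut_simps [simp]: "cut (Some x, True) = {..x}" "cut (Some x, False) = {..<x}"
  "cut (None, True) = {}" "cut (None, False) = UNIV"
  by (simp_all add: cut_def)

lemma eventually_cut:
  shows "c \<in> cut s \<Longrightarrow> eventually (\<lambda>y. \<exists>r. y = Some r \<and> c < r) (fl s)"
    and "c \<notin> cut s \<Longrightarrow> eventually (\<lambda>y. \<exists>r. y = Some r \<and> r < c) (fl s)"
  by (cases s rule: side_cases;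
      auto simp: eventually_filtermap eventually_at_right_field eventually_at_left_field
        eventually_at_top_dense eventually_at_bot_dense not_le
        intro: exI[of _ c] lt_ex gt_ex order_less_trans le_less_trans less_le_trans)+

lemma cut_inj: "cut s = cut t \<Longrightarrow> s = t"
proof -
  have A: "{..x} \<noteq> {..<y}" "{..x} \<noteq> {}" "{..<x} \<noteq> {}" "{..x} \<noteq> UNIV" "{..<x} \<noteq> UNIV" for x y :: real
  proof -
    show "{..x} \<noteq> {..<y}"
    proof
      assume *: "{..x} = {..<y}"
      then have "x < y" by auto
      then have "(x + y) / 2 \<in> {..<y}" "(x + y) / 2 \<notin> {..x}" by auto
      with * show False by blast
    qed
    show "{..x} \<noteq> {}" by auto
    show "{..<x} \<noteq> {}" using lt_ex by auto
    show "{..x} \<noteq> UNIV" using gt_ex[of x] by (metis UNIV_I atMost_iff not_le)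
    show "{..<x} \<noteq> UNIV" by blast
  qed
  assume "cut s = cut t"
  then show ?thesis
    by (cases s rule: side_cases; cases t rule: side_cases) (simp_all add: A A[symmetric] lessThan_eq_iff)
qed

lemma fl_le_imp_eq:
  assumes "fl s \<le> fl t"
  shows "s = t"
proof (rule cut_inj, rule Set.set_eqI)
  fix c
  have no: False if "eventually (\<lambda>y. \<exists>r. y = Some r \<and> c < r) (fl s)" "eventually (\<lambda>y. \<exists>r. y = Some r \<and> r < c) (fl s)"
    using eventually_conj[OF that] by (auto dest!: eventually_happens)
  show "c \<in> cut s \<longleftrightarrow> c \<in> cut t"
  proof (cases "c \<in> cut t")
    case True
    then have "eventually (\<lambda>y. \<exists>r. y = Some r \<and> c < r) (fl s)" using eventually_cut(1) assms filter_leD by blast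
    then show ?thesis using True no eventually_cut(2)[of c s] by blast
  next
    case False
    then have "eventually (\<lambda>y. \<exists>r. y = Some r \<and> r < c) (fl s)" using eventually_cut(2) assms filter_leD by blast
    then show ?thesis using False no eventually_cut(1)[of c s] by blast
  qed
qed

lemma fl_avoids_point: "eventually (\<lambda>y. y \<noteq> x) (fl s)"
proof (cases x)
  case None
  then show ?thesis by (simp add: fl_def eventually_filtermap)
next
  case (Some c)
  show ?thesis
  proof (cases "c \<in> cut s")
    case True
    from eventually_cut(1)[OF this] show ?thesis by eventually_elim (use Some in auto)
  next
    case False
    from eventually_cut(2)[OF this] show ?thesis by eventually_elim (use Some in auto)
  qed
qed

lemma fl_le_cofinite: "fl s \<le> cofinite"
proof (rule filter_leI)
  fix P :: "real option \<Rightarrow> bool" assume "eventually P cofinite"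
  then have "finite {x. \<not> P x}" by (simp add: eventually_cofinite)
  then have "eventually (\<lambda>y. \<forall>x\<in>{x. \<not> P x}. y \<noteq> x) (fl s)"
    by (rule eventually_ball_finite) (simp add: fl_avoids_point)
  then show "eventually P (fl s)" by eventually_elim auto
qed

lemma fl_infinite: "eventually P (fl s) \<Longrightarrow> infinite {y. P y}"
proof
  assume "eventually P (fl s)" "finite {y. P y}"
  then have "eventually (\<lambda>y. \<not> P y) (fl s)"
    by (intro filter_leD[OF fl_le_cofinite]) (simp add: eventually_cofinite)
  then have "eventually (\<lambda>_. False) (fl s)" using \<open>eventually P (fl s)\<close> by eventually_elim simp
  then show False by (simp add: eventually_False)
qed

lemma PGL_germ_unique:
  assumes "f \<in> PGL" "g \<in> PGL" "eventually (\<lambda>y. f y = g y) (fl s)"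
  shows "f = g"
  using PGL_infinite_agree[OF assms(1,2)] fl_infinite[OF assms(3)] by blast

text \<open>The boolean tells whether the homography preserves the orientation of the circle.\<close>

definition maps_sides :: "bool \<Rightarrow> (real option \<Rightarrow> real option) \<Rightarrow> bool" where
  "maps_sides c g \<longleftrightarrow> (\<forall>x b. filterlim g (fl (g x, b = c)) (fl (x, b)))"

lemma maps_sides_comp:
  assumes "maps_sides c f" "maps_sides d g"
  shows "maps_sides (c = d) (f \<circ> g)"
  unfolding maps_sides_def
proof (intro allI)
  fix x b
  have "filterlim f (fl (f (g x), (b = d) = c)) (fl (g x, b = d))" "filterlim g (fl (g x, b = d)) (fl (x, b))"
    using assms by (simp_all add: maps_sides_def)
  from filterlim_compose[OF this] show "filterlim (f \<circ> g) (fl ((f \<circ> g) x, b = (c = d))) (fl (x, b))"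
    by (cases b; cases c; cases d) (simp_all add: o_def)
qed

lemma filterlim_Some:
  assumes "filterlim h F' F" "eventually (\<lambda>t. g (Some t) = Some (h t)) F"
  shows "filterlim g (filtermap Some F') (filtermap Some F)"
proof -
  have "filterlim (\<lambda>t. Some (h t)) (filtermap Some F') F"
    by (rule filterlim_compose[OF _ assms(1)]) (simp add: filterlim_def)
  then have "filterlim (\<lambda>t. g (Some t)) (filtermap Some F') F"
    by (rule filterlim_cong[THEN iffD1, rotated 3]) (use assms(2) in \<open>auto elim: eventually_mono\<close>)
  then show ?thesis by (simp add: filterlim_filtermap)
qed

lemma affine_maps_sides:
  assumes "a \<noteq> 0"
  shows "maps_sides (a > 0) (homography (mat2 a b 0 1))"
proof -
  let ?h = "\<lambda>t. a * t + b"
  have g: "homography (mat2 a b 0 1) (Some t) = Some (?h t)" "homography (mat2 a b 0 1) None = None" for t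
    by (simp_all add: homography_def)
  have lim: "(?h \<longlongrightarrow> ?h x) (at x within S)" for x S by (intro tendsto_intros)
  have sides: "filterlim ?h (if a > 0 then at_right (?h x) else at_left (?h x)) (at_right x)"
      "filterlim ?h (if a > 0 then at_left (?h x) else at_right (?h x)) (at_left x)" for x
    using assms by (auto simp: filterlim_at lim eventually_at_filter intro!: always_eventually)
  have top: "filterlim ?h (if a > 0 then at_top else at_bot) at_top"
  proof (cases "a > 0")
    case True
    then have "filterlim ?h at_top at_top" by real_asymp
    with True show ?thesis by simp
  next
    case False
    then have "a < 0" using assms by simp
    then have "filterlim ?h at_bot at_top" by real_asymp
    with False show ?thesis by simp
  qed
  have bot: "filterlim ?h (if a > 0 then at_bot else at_top) at_bot"
  proof (cases "a > 0")
    case True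
    then have "filterlim ?h at_bot at_bot" by real_asymp
    with True show ?thesis by simp
  next
    case False
    then have "a < 0" using assms by simp
    then have "filterlim ?h at_top at_bot" by real_asymp
    with False show ?thesis by simp
  qed
  show ?thesis
    unfolding maps_sides_def
  proof (intro allI)
    fix x b'
    show "filterlim (homography (mat2 a b 0 1)) (fl (homography (mat2 a b 0 1) x, b' = (0 < a))) (fl (x, b'))"
      using sides top bot
      by (cases x; cases b'; cases "a > 0") (auto simp: g intro!: filterlim_Some[where h = ?h])
  qed
qed

lemma inversion_maps_sides: "maps_sides False (homography (mat2 0 1 1 0))"
proof -
  let ?g = "homography (mat2 0 1 1 0)" and ?h = "\<lambda>t::real. 1 / t"
  have g: "?g (Some t) = (if t = 0 then None else Some (1 / t))" "?g None = Some 0" for t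
    by (simp_all add: homography_def)
  have ev: "eventually (\<lambda>t. ?g (Some t) = Some (?h t)) F" if "eventually (\<lambda>t. t \<noteq> 0) F" for F
    using that by eventually_elim (simp add: g)
  have fin: "filterlim ?h (at_left (1 / x)) (at_right x) \<and> filterlim ?h (at_right (1 / x)) (at_left x)" if "x \<noteq> 0" for x
  proof -
    have lim: "(?h \<longlongrightarrow> 1 / x) (at x within S)" for S using that by (intro tendsto_intros)
    have *: "1 / t < 1 / x" if "x < t" "x > 0 \<or> t < 0" for x t :: real
      using that by (auto simp: field_simps)
    show ?thesis
    proof (cases "x > 0")
      case True
      then have "\<forall>t>x. t < x + 1 \<longrightarrow> ?h t < 1 / x" "\<forall>t>0. t < x \<longrightarrow> ?h t > 1 / x"
        using *[of x] *[of _ x] by auto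
      then have "eventually (\<lambda>t. ?h t < 1 / x) (at_right x)" "eventually (\<lambda>t. ?h t > 1 / x) (at_left x)"
        using True unfolding eventually_at_right_field eventually_at_left_field
        by (intro exI[of _ "x + 1"] exI[of _ 0]; simp)+
      then show ?thesis using lim by (auto simp: filterlim_at elim: eventually_mono)
    next
      case False
      then have "x < 0" using that by simp
      then have "\<forall>t>x. t < 0 \<longrightarrow> ?h t < 1 / x" "\<forall>t>x - 1. t < x \<longrightarrow> ?h t > 1 / x"
        using *[of x] *[of _ x] by auto
      then have "eventually (\<lambda>t. ?h t < 1 / x) (at_right x)" "eventually (\<lambda>t. ?h t > 1 / x) (at_left x)"
        using \<open>x < 0\<close> unfolding eventually_at_right_field eventually_at_left_field
        by (intro exI[of _ "x - 1"] exI[of _ 0]; simp)+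
      then show ?thesis using lim by (auto simp: filterlim_at elim: eventually_mono)
    qed
  qed
  have zero: "filterlim ?h at_top (at_right 0)" "filterlim ?h at_bot (at_left 0)"
    by real_asymp+
  have infty: "filterlim ?h (at_right 0) at_top" "filterlim ?h (at_left 0) at_bot"
    by real_asymp+
  have nz: "eventually (\<lambda>t::real. t \<noteq> 0) (at x within S)" for x S
  proof (cases "x = 0")
    case True
    then show ?thesis by (auto simp: eventually_at_filter)
  next
    case False
    have "eventually (\<lambda>t. t \<noteq> 0) (nhds x)" using False by (intro t1_space_nhds) simp
    then show ?thesis by (auto simp: eventually_at_filter elim: eventually_mono)
  qed
  have nzi: "eventually (\<lambda>t::real. t \<noteq> 0) at_top" "eventually (\<lambda>t::real. t \<noteq> 0) at_bot"
    using eventually_gt_at_top[of 0] eventually_gt_at_bot[of 0] by (auto elim: eventually_mono)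
  show ?thesis
    unfolding maps_sides_def
  proof (intro allI)
    fix x b
    show "filterlim ?g (fl (?g x, b = False)) (fl (x, b))"
    proof (cases x)
      case None
      then show ?thesis using infty ev[OF nzi(1)] ev[OF nzi(2)]
        by (cases b) (auto simp: g intro!: filterlim_Some[where h = ?h])
    next
      case (Some t)
      then show ?thesis using fin[of t] zero ev[OF nz]
        by (cases b; cases "t = 0") (auto simp: g intro!: filterlim_Some[where h = ?h])
    qed
  qed
qed

text \<open>Every homography is affine, or affine maps on both sides of an inversion.\<close>

lemma PGL_maps_sides: "g \<in> PGL \<Longrightarrow> \<exists>c. maps_sides c g"
proof -
  assume "g \<in> PGL"
  then obtain A where A: "det A \<noteq> 0" "g = homography A" by (auto simp: PGL_def)
  obtain a b c d where m: "A = mat2 a b c d" by (rule mat2_cases)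
  have D: "a * d - b * c \<noteq> 0" using A m by simp
  show ?thesis
  proof (cases "c = 0")
    case True
    then have "d \<noteq> 0" "a \<noteq> 0" using D by auto
    then have "A = d *\<^sub>R mat2 (a / d) (b / d) 0 1" using m True by simp
    then have "g = homography (mat2 (a / d) (b / d) 0 1)" using A(2) homography_scaleR[OF \<open>d \<noteq> 0\<close>] by metis
    then show ?thesis using affine_maps_sides[of "a / d" "b / d"] \<open>d \<noteq> 0\<close> \<open>a \<noteq> 0\<close> by auto
  next
    case False
    let ?e = "(b * c - a * d) / c"
    have "A = mat2 ?e (a / c) 0 1 ** (mat2 0 1 1 0 ** mat2 c d 0 1)"
      using m False by (simp add: field_simps)
    then have "g = homography (mat2 ?e (a / c) 0 1) \<circ> (homography (mat2 0 1 1 0) \<circ> homography (mat2 c d 0 1))"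
      using A(2) False by (simp add: homography_comp)
    moreover have "?e \<noteq> 0" using D False by auto
    ultimately show ?thesis
      using maps_sides_comp[OF affine_maps_sides maps_sides_comp[OF inversion_maps_sides affine_maps_sides]] False
      by blast
  qed
qed

text \<open>The two sides of \<open>x\<close> go to the two sides of \<open>g x\<close>, exchanged if \<open>g\<close> reverses
  orientation.\<close>

definition hact :: "(real option \<Rightarrow> real option) \<Rightarrow> side \<Rightarrow> side" where
  "hact g s = (g (fst s), snd s = (SOME c. maps_sides c g))"

lemma filterlim_hact:
  assumes "g \<in> PGL"
  shows "filterlim g (fl (hact g s)) (fl s)"
proof -
  have "maps_sides (SOME c. maps_sides c g) g" using PGL_maps_sides[OF assms] by (rule someI_ex)
  then show ?thesis by (cases s) (simp add: maps_sides_def hact_def)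
qed

lemma filtermap_hact:
  assumes "g \<in> PGL"
  shows "filtermap g (fl s) = fl (hact g s)"
proof (rule antisym)
  show "filtermap g (fl s) \<le> fl (hact g s)" using filterlim_hact[OF assms] by (simp add: filterlim_def)
  have h: "invf g \<in> PGL" using PGL_inverse(2)[OF assms] .
  let ?t = "hact (invf g) (hact g s)"
  have 1: "filtermap (invf g) (fl (hact g s)) \<le> fl ?t" using filterlim_hact[OF h] by (simp add: filterlim_def)
  have "fl s = filtermap (invf g) (filtermap g (fl s))" using assms by (simp add: filtermap_compose[symmetric])
  also have "\<dots> \<le> filtermap (invf g) (fl (hact g s))" using filterlim_hact[OF assms] by (intro filtermap_mono) (simp add: filterlim_def)
  also note 1
  finally have "s = ?t" by (rule fl_le_imp_eq)
  then have "filtermap (invf g) (fl (hact g s)) \<le> fl s" using 1 by simp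
  then have "filtermap g (filtermap (invf g) (fl (hact g s))) \<le> filtermap g (fl s)" by (rule filtermap_mono)
  then show "fl (hact g s) \<le> filtermap g (fl s)" using assms by (simp add: filtermap_compose[symmetric])
qed

lemma hact_comp: "f \<in> PGL \<Longrightarrow> g \<in> PGL \<Longrightarrow> hact (f \<circ> g) s = hact f (hact g s)"
  by (rule fl_le_imp_eq) (simp add: filtermap_hact[symmetric] filtermap_filtermap o_def flip: filtermap_hact[OF PGL_comp, unfolded o_def])

lemma hact_id [simp]: "hact id s = s"
  by (rule fl_le_imp_eq) (simp add: filtermap_hact[symmetric])

lemma fst_hact [simp]: "fst (hact g s) = g (fst s)"
  by (simp add: hact_def)

abbreviation flip :: "side \<Rightarrow> side" where
  "flip s \<equiv> (fst s, \<not> snd s)"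

lemma hact_flip: "hact g (flip s) = flip (hact g s)"
  by (auto simp: hact_def)

section \<open>Locally constant functions on the set of sides\<close>

text \<open>Local constancy for the topology of the split circle, in which a basic neighbourhood of
  \<open>(x, True)\<close> consists of itself and of the sides of the points of an interval starting at \<open>x\<close>.\<close>

definition LC :: "(side \<Rightarrow> 'a) \<Rightarrow> bool" where
  "LC c \<longleftrightarrow> (\<forall>s. \<forall>\<^sub>F y in fl s. \<forall>b. c (y, b) = c s)"

lemma LC_D: "LC c \<Longrightarrow> \<forall>\<^sub>F y in fl s. \<forall>b. c (y, b) = c s"
  unfolding LC_def by blast

lemma LC_map:
  assumes "LC c"
  shows "LC (\<lambda>s. f (c s))"
  unfolding LC_def
proof
  fix s show "\<forall>\<^sub>F y in fl s. \<forall>b. f (c (y, b)) = f (c s)"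
    using LC_D[OF assms, of s] by eventually_elim simp
qed

lemma LC_map2:
  assumes "LC c" "LC d"
  shows "LC (\<lambda>s. f (c s) (d s))"
  unfolding LC_def
proof
  fix s show "\<forall>\<^sub>F y in fl s. \<forall>b. f (c (y, b)) (d (y, b)) = f (c s) (d s)"
    using LC_D[OF assms(1), of s] LC_D[OF assms(2), of s] by eventually_elim simp
qed

lemma LC_cut: "LC (\<lambda>s. c \<in> cut s)"
  unfolding LC_def
proof
  fix s
  show "\<forall>\<^sub>F y in fl s. \<forall>b. (c \<in> cut (y, b)) = (c \<in> cut s)"
  proof (cases "c \<in> cut s")
    case True
    from eventually_cut(1)[OF this] show ?thesis
      by eventually_elim (use True in \<open>auto simp: cut_def\<close>)
  next
    case False
    from eventually_cut(2)[OF this] show ?thesis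
      by eventually_elim (use False in \<open>auto simp: cut_def\<close>)
  qed
qed

lemma LC_cut_Int:
  assumes "finite F"
  shows "LC (\<lambda>s. cut s \<inter> F)"
  unfolding LC_def
proof
  fix s
  have "\<forall>\<^sub>F y in fl s. \<forall>c\<in>F. \<forall>b. (c \<in> cut (y, b)) = (c \<in> cut s)"
    using LC_D[OF LC_cut] by (intro eventually_ball_finite assms) simp
  then show "\<forall>\<^sub>F y in fl s. \<forall>b. cut (y, b) \<inter> F = cut s \<inter> F"
    by eventually_elim blast
qed

text \<open>The points of a finite set cut the line into intervals, indexed by the points to their left.\<close>

lemma LC_constant_on_cells:
  assumes c: "LC c" and F: "finite F" and pair: "\<And>y. y \<notin> F \<Longrightarrow> c (Some y, True) = c (Some y, False)"
    and st: "cut s \<inter> F = cut t \<inter> F"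
  shows "c s = c t"
proof -
  have inner: "\<exists>r. r \<notin> F \<and> cut (Some r, True) \<inter> F = cut s \<inter> F \<and> c (Some r, True) = c s" for s
  proof -
    have "finite (insert None (Some ` F))" using F by simp
    then have "\<forall>\<^sub>F y in cofinite. y \<notin> insert None (Some ` F)" by (simp add: eventually_cofinite)
    then have "\<forall>\<^sub>F y in fl s. y \<notin> insert None (Some ` F)" by (rule filter_leD[OF fl_le_cofinite])
    then have H: "\<forall>\<^sub>F y in fl s. y \<notin> insert None (Some ` F) \<and> cut (y, True) \<inter> F = cut s \<inter> F \<and> c (y, True) = c s"
      using LC_D[OF c, of s] LC_D[OF LC_cut_Int[OF F], of s] by eventually_elim simp
    then obtain y where "y \<notin> insert None (Some ` F)" "cut (y, True) \<inter> F = cut s \<inter> F" "c (y, True) = c s"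
      using eventually_happens'[OF fl_neq_bot H] by (elim exE conjE)
    then show ?thesis by (cases y) auto
  qed
  define d where "d r = c (Some r, True)" for r
  have eq: "d r = d r'" if r: "r \<notin> F" "r' \<notin> F" "{..r} \<inter> F = {..r'} \<inter> F" "r \<le> r'" for r r'
  proof -
    have noF: "y \<notin> F" if "y \<in> {r..r'}" for y
    proof
      assume "y \<in> F"
      then have "y \<in> {..r} \<inter> F" using r(3) that by auto
      then show False using that \<open>y \<in> F\<close> r(1) by auto
    qed
    have "d constant_on {r..r'}"
    proof (rule locally_constant_imp_constant)
      fix y assume y: "y \<in> {r..r'}"
      have "\<forall>\<^sub>F z in at_right y. d z = d y"
        using LC_D[OF c, of "(Some y, True)"] by (auto simp: eventually_filtermap d_def elim: eventually_mono)
      moreover have "c (Some y, True) = c (Some y, False)" using pair[OF noF[OF y]] .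
      then have "\<forall>\<^sub>F z in at_left y. d z = d y"
        using LC_D[OF c, of "(Some y, False)"] by (auto simp: eventually_filtermap d_def elim: eventually_mono)
      ultimately have "\<forall>\<^sub>F z in at y. d z = d y" by (simp add: eventually_at_split)
      then have "\<forall>\<^sub>F z in nhds y. z \<noteq> y \<longrightarrow> d z = d y" by (simp add: eventually_at_filter)
      then have "\<forall>\<^sub>F z in nhds y. d z = d y" by eventually_elim blast
      then obtain T where T: "open T" "y \<in> T" "\<forall>z\<in>T. d z = d y" unfolding eventually_nhds by blast
      then show "\<exists>T. openin (top_of_set {r..r'}) T \<and> y \<in> T \<and> (\<forall>x\<in>T. d x = d y)"
        using y by (intro exI[of _ "{r..r'} \<inter> T"] conjI openin_open_Int; blast)
    qed simp
    moreover have "r \<in> {r..r'}" "r' \<in> {r..r'}" using r(4) by auto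
    ultimately show ?thesis unfolding constant_on_def by metis
  qed
  obtain r where r: "r \<notin> F" "cut (Some r, True) \<inter> F = cut s \<inter> F" "c (Some r, True) = c s" using inner by blast
  obtain r' where r': "r' \<notin> F" "cut (Some r', True) \<inter> F = cut t \<inter> F" "c (Some r', True) = c t" using inner by blast
  have rr': "{..r} \<inter> F = {..r'} \<inter> F" using r(2) r'(2) st by simp
  have "d r = d r'"
  proof (cases "r \<le> r'")
    case True
    then show ?thesis by (rule eq[OF r(1) r'(1) rr'])
  next
    case False
    then show ?thesis using eq[OF r'(1) r(1) rr'[symmetric]] by simp
  qed
  then show ?thesis using r(3) r'(3) by (simp add: d_def)
qed

text \<open>Actions on sides are locally constant maps followed by homographies.\<close>

lemma LC_hact:
  assumes c: "LC c" and g: "LC g" "\<And>s. g s \<in> PGL"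
  shows "LC (\<lambda>s. c (hact (g s) s))"
  unfolding LC_def
proof
  fix s
  have "\<forall>\<^sub>F z in filtermap (g s) (fl s). \<forall>b. c (z, b) = c (hact (g s) s)"
    using LC_D[OF c, of "hact (g s) s"] filtermap_hact[OF g(2)[of s], of s] by simp
  then have "\<forall>\<^sub>F y in fl s. \<forall>b. c (g s y, b) = c (hact (g s) s)"
    by (simp add: eventually_filtermap)
  then show "\<forall>\<^sub>F y in fl s. \<forall>b. c (hact (g (y, b)) (y, b)) = c (hact (g s) s)"
    using LC_D[OF g(1), of s] by eventually_elim (metis fst_conv fst_hact prod.collapse)
qed

section \<open>One-sided germs of piecewise projective maps\<close>

text \<open>The germ is represented by the homography itself, which it determines since two homographies
  that agree at infinitely many points are equal.\<close>

definition germ :: "(real option \<Rightarrow> real option) \<Rightarrow> side \<Rightarrow> real option \<Rightarrow> real option" where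
  "germ f s = (THE g. g \<in> PGL \<and> (\<forall>\<^sub>F y in fl s. f y = g y))"

lemma germ_eqI:
  assumes "g \<in> PGL" "\<forall>\<^sub>F y in fl s. f y = g y"
  shows "germ f s = g"
  unfolding germ_def
proof (rule the_equality)
  fix h assume h: "h \<in> PGL \<and> (\<forall>\<^sub>F y in fl s. f y = h y)"
  then have "\<forall>\<^sub>F y in fl s. f y = h y" by blast
  then have "\<forall>\<^sub>F y in fl s. h y = g y" using assms(2) by eventually_elim simp
  then show "h = g" using PGL_germ_unique h assms(1) by blast
qed (use assms in blast)

lemma openin_P1_real: "openin P1 V \<Longrightarrow> open {r. Some r \<in> V}"
proof -
  assume "openin P1 V"
  then consider U where "open U" "V = Some ` U" | C where "closed C" "V = insert None (Some ` (UNIV - C))"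
    by (auto simp: P1_def openin_Alexandroff_compactification)
  then show ?thesis
  proof cases
    case 2
    then have "{r. Some r \<in> V} = - C" by auto
    then show ?thesis using 2(1) by (simp add: open_Compl)
  qed (simp add: image_iff)
qed

definition proj_at :: "(real option \<Rightarrow> real option) \<Rightarrow> (real option \<Rightarrow> real option) \<Rightarrow> real \<Rightarrow> bool" where
  "proj_at f g r \<longleftrightarrow> g \<in> PGL \<and> (\<exists>U. open U \<and> r \<in> U \<and> (\<forall>q\<in>U. f (Some q) = g (Some q)))"

lemma pw_projective_proj_at:
  assumes "pw_projective f"
  shows "\<forall>\<^sub>F x in cofinite. \<exists>r g. x = Some r \<and> proj_at f g r"
proof -
  have "\<forall>\<^sub>F x in cofinite. x \<noteq> (None :: real option)" by (simp add: eventually_cofinite)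
  with assms[unfolded pw_projective_def] show ?thesis
  proof eventually_elim
    case (elim x)
    then obtain V A where V: "openin P1 V" "x \<in> V" "det A \<noteq> 0" "\<forall>y\<in>V. f y = homography A y" by blast
    obtain r where r: "x = Some r" using elim by (cases x) auto
    then have "proj_at f (homography A) r"
      unfolding proj_at_def using V openin_P1_real[OF V(1)] homography_PGL[OF V(3)]
      by (intro conjI exI[of _ "{r. Some r \<in> V}"]) auto
    with r show ?case by blast
  qed
qed

lemma proj_at_germ:
  assumes "proj_at f g r"
  shows "germ f (Some r, b) = g"
proof -
  obtain U where U: "g \<in> PGL" "open U" "r \<in> U" "\<forall>q\<in>U. f (Some q) = g (Some q)"
    using assms unfolding proj_at_def by blast
  have "\<forall>\<^sub>F y in fl (Some r, b). y \<in> Some ` U" using fl_inner U by blast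
  then have "\<forall>\<^sub>F y in fl (Some r, b). f y = g y" by eventually_elim (use U in auto)
  then show ?thesis using germ_eqI U(1) by blast
qed

text \<open>Near a side, without the point itself, the map is locally a homography; the homography is
  locally constant on an interval and hence constant.\<close>

lemma germ_props:
  assumes f: "pw_projective f"
  shows germ_PGL: "germ f s \<in> PGL" and germ_eventually: "\<forall>\<^sub>F y in fl s. f y = germ f s y"
proof -
  have "\<forall>\<^sub>F y in fl s. \<exists>r g. y = Some r \<and> proj_at f g r"
    by (rule filter_leD[OF fl_le_cofinite pw_projective_proj_at[OF f]])
  then obtain I where I: "open I" "connected I" "\<forall>\<^sub>F y in fl s. y \<in> Some ` I" "\<And>r. r \<in> I \<Longrightarrow> \<exists>g. proj_at f g r"
    by (rule fl_interval) auto
  define G where "G r = germ f (Some r, True)" for r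
  have G: "proj_at f (G r) r" if "r \<in> I" for r
    using I(4)[OF that] proj_at_germ[of f _ r True] by (auto simp: G_def)
  have "G constant_on I"
  proof (rule locally_constant_imp_constant[OF I(2)])
    fix r assume r: "r \<in> I"
    obtain U where U: "open U" "r \<in> U" "\<forall>q\<in>U. f (Some q) = G r (Some q)" "G r \<in> PGL"
      using G[OF r] unfolding proj_at_def by blast
    then have "proj_at f (G r) q" if "q \<in> U" for q using that unfolding proj_at_def by blast
    then have "G q = G r" if "q \<in> U" for q using proj_at_germ[of f "G r" q True] that by (simp add: G_def)
    then show "\<exists>T. openin (top_of_set I) T \<and> r \<in> T \<and> (\<forall>x\<in>T. G x = G r)"
      using U(1,2) r by (intro exI[of _ "I \<inter> U"] conjI openin_open_Int; blast)
  qed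
  then obtain g where g: "\<And>r. r \<in> I \<Longrightarrow> G r = g" unfolding constant_on_def by blast
  have "I \<noteq> {}"
  proof
    assume "I = {}"
    then show False using eventually_happens'[OF fl_neq_bot I(3)] by (elim exE) simp
  qed
  then have "g \<in> PGL" using G g unfolding proj_at_def by auto
  moreover have "f (Some r) = g (Some r)" if "r \<in> I" for r
    using G[OF that] g[OF that] unfolding proj_at_def by auto
  then have "f y = g y" if "y \<in> Some ` I" for y using that by blast
  then have ev: "\<forall>\<^sub>F y in fl s. f y = g y" by (intro eventually_mono[OF I(3)])
  ultimately have "germ f s = g" by (rule germ_eqI)
  then show "germ f s \<in> PGL" "\<forall>\<^sub>F y in fl s. f y = germ f s y" using \<open>g \<in> PGL\<close> ev by auto
qed

lemma LC_germ:
  assumes f: "pw_projective f"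
  shows "LC (germ f)"
  unfolding LC_def
proof
  fix s
  obtain I where I: "open I" "connected I" "\<forall>\<^sub>F y in fl s. y \<in> Some ` I" "\<And>r. r \<in> I \<Longrightarrow> f (Some r) = germ f s (Some r)"
    by (rule fl_interval[OF germ_eventually[OF f, of s]]) blast
  have "germ f (Some r, b) = germ f s" if "r \<in> I" for r b
    using that I(1,4) germ_PGL[OF f] by (intro proj_at_germ) (auto simp: proj_at_def)
  then have "\<forall>b. germ f (y, b) = germ f s" if "y \<in> Some ` I" for y using that by blast
  with I(3) show "\<forall>\<^sub>F y in fl s. \<forall>b. germ f (y, b) = germ f s" by (rule eventually_mono)
qed

lemma germ_two_sides:
  assumes "pw_projective f"
  shows "finite {x. germ f (x, True) \<noteq> germ f (x, False)}"
proof -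
  have "\<forall>\<^sub>F x in cofinite. germ f (x, True) = germ f (x, False)"
    using pw_projective_proj_at[OF assms] by eventually_elim (auto simp: proj_at_germ)
  then show ?thesis by (simp add: eventually_cofinite)
qed

lemma germ_comp:
  assumes "pw_projective f" "pw_projective g"
  shows "germ (f \<circ> g) s = germ f (hact (germ g s) s) \<circ> germ g s"
proof (rule germ_eqI)
  let ?t = "hact (germ g s) s"
  show "germ f ?t \<circ> germ g s \<in> PGL" using assms germ_PGL by blast
  have "\<forall>\<^sub>F z in filtermap (germ g s) (fl s). f z = germ f ?t z"
    using germ_eventually[OF assms(1), of ?t] filtermap_hact[OF germ_PGL[OF assms(2)], of s s] by simp
  then have "\<forall>\<^sub>F y in fl s. f (germ g s y) = germ f ?t (germ g s y)" by (simp add: eventually_filtermap)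
  then show "\<forall>\<^sub>F y in fl s. (f \<circ> g) y = (germ f ?t \<circ> germ g s) y"
    using germ_eventually[OF assms(2), of s] by eventually_elim simp
qed

lemma germ_cong:
  assumes "pw_projective f" "\<forall>\<^sub>F x in cofinite. f x = f' x"
  shows "germ f' s = germ f s"
proof (rule germ_eqI[OF germ_PGL[OF assms(1)]])
  show "\<forall>\<^sub>F y in fl s. f' y = germ f s y"
    using germ_eventually[OF assms(1), of s] filter_leD[OF fl_le_cofinite assms(2)] by eventually_elim simp
qed

lemma germ_id: "pw_projective f \<Longrightarrow> (\<And>s. germ f s = id) \<Longrightarrow> \<forall>\<^sub>F x in cofinite. f x = x"
proof -
  assume f: "pw_projective f" "\<And>s. germ f s = id"
  from pw_projective_proj_at[OF f(1)] show ?thesis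
  proof eventually_elim
    case (elim x)
    then obtain r g where r: "x = Some r" "proj_at f g r" by blast
    then have "g = id" using proj_at_germ f(2) by metis
    then show ?case using r unfolding proj_at_def by auto
  qed
qed

section \<open>Gluings of sides preserved by a group with Property FW\<close>

lemma invf_invf [simp]: "f \<in> PGL \<Longrightarrow> invf (invf f) = f"
  using PGL_inverse(1) by (rule inv_inv_eq)

lemma invf_comp: "f \<in> PGL \<Longrightarrow> g \<in> PGL \<Longrightarrow> invf (f \<circ> g) = invf g \<circ> invf f"
  using PGL_inverse(1) by (intro o_inv_distrib) auto

lemma invf_PGL [simp, intro]: "f \<in> PGL \<Longrightarrow> invf f \<in> PGL"
  by (rule PGL_inverse(2))

lemma PGL_cancel [simp]: "f \<in> PGL \<Longrightarrow> f \<circ> (invf f \<circ> k) = k" "f \<in> PGL \<Longrightarrow> invf f \<circ> (f \<circ> k) = k"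
  by (simp_all add: o_assoc)

lemmas PGL_group_simps = comp_assoc invf_comp

lemma PGL_right_cancel: "f \<in> PGL \<Longrightarrow> g \<circ> f = k \<circ> f \<longleftrightarrow> g = k"
  by (metis PGL_inv_comp(1) comp_assoc comp_id)

text \<open>What the proof uses about a group of piecewise projective maps: \<^term>\<open>gm \<gamma> s\<close> is the germ of
  \<^term>\<open>\<gamma>\<close> at the side \<^term>\<open>s\<close>. Group elements are maps up to finite sets, hence do not act on
  points, but they have germs and act on sides.\<close>

locale piecewise_group = group G for G (structure) +
  fixes \<Gamma> :: "'a set" and gm :: "'a \<Rightarrow> side \<Rightarrow> real option \<Rightarrow> real option"
  assumes \<Gamma>: "subgroup \<Gamma> G" and FW: "FW_subgroup G \<Gamma>"
    and gm_PGL [simp]: "\<gamma> \<in> \<Gamma> \<Longrightarrow> gm \<gamma> s \<in> PGL"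
    and gm_mult: "\<gamma> \<in> \<Gamma> \<Longrightarrow> \<delta> \<in> \<Gamma> \<Longrightarrow> gm (\<gamma> \<otimes> \<delta>) s = gm \<gamma> (hact (gm \<delta> s) s) \<circ> gm \<delta> s"
    and gm_one [simp]: "gm \<one> s = id"
    and gm_LC: "\<gamma> \<in> \<Gamma> \<Longrightarrow> LC (gm \<gamma>)"
    and gm_sides: "\<gamma> \<in> \<Gamma> \<Longrightarrow> finite {x. gm \<gamma> (x, True) \<noteq> gm \<gamma> (x, False)}"
    and gm_faithful: "\<gamma> \<in> \<Gamma> \<Longrightarrow> (\<And>s. gm \<gamma> s = id) \<Longrightarrow> \<gamma> = \<one>"
begin

definition act :: "'a \<Rightarrow> side \<Rightarrow> side" where
  "act \<gamma> s = hact (gm \<gamma> s) s"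

lemmas \<Gamma>_closed [simp] = subgroup_props[OF \<Gamma>]

lemma gm_act: "\<gamma> \<in> \<Gamma> \<Longrightarrow> \<delta> \<in> \<Gamma> \<Longrightarrow> gm (\<gamma> \<otimes> \<delta>) s = gm \<gamma> (act \<delta> s) \<circ> gm \<delta> s"
  by (simp add: gm_mult act_def)

lemma act_mult: "\<gamma> \<in> \<Gamma> \<Longrightarrow> \<delta> \<in> \<Gamma> \<Longrightarrow> act (\<gamma> \<otimes> \<delta>) s = act \<gamma> (act \<delta> s)"
  by (simp add: act_def gm_mult hact_comp)

lemma gm_id_act: "gm \<gamma> s = id \<Longrightarrow> act \<gamma> s = s"
  by (simp add: act_def)

lemma act_one [simp]: "act \<one> s = s"
  by (simp add: act_def)

lemma act_inv [simp]: "\<gamma> \<in> \<Gamma> \<Longrightarrow> act (inv \<gamma>) (act \<gamma> s) = s" "\<gamma> \<in> \<Gamma> \<Longrightarrow> act \<gamma> (act (inv \<gamma>) s) = s"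
  by (simp_all flip: act_mult)

lemma gm_inv: "\<gamma> \<in> \<Gamma> \<Longrightarrow> gm (inv \<gamma>) (act \<gamma> s) = invf (gm \<gamma> s)"
proof -
  assume g: "\<gamma> \<in> \<Gamma>"
  have "gm (inv \<gamma>) (act \<gamma> s) \<circ> gm \<gamma> s = id" using gm_act[of "inv \<gamma>" \<gamma> s] g by simp
  then have "gm (inv \<gamma>) (act \<gamma> s) \<circ> gm \<gamma> s = invf (gm \<gamma> s) \<circ> gm \<gamma> s" using g by simp
  then show ?thesis using PGL_right_cancel[OF gm_PGL[OF g]] by metis
qed

lemma LC_act: "LC c \<Longrightarrow> \<gamma> \<in> \<Gamma> \<Longrightarrow> LC (\<lambda>s. c (act \<gamma> s))"
  unfolding act_def by (rule LC_hact) (simp_all add: gm_LC)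

text \<open>A gluing \<open>(s, t, g)\<close> says that, crossing the endpoint of the side \<open>s\<close> away from it, one
  enters the side \<open>t\<close>, the projective structures being matched by the homography \<open>g\<close>. The group
  acts on gluings and commensurates the set of those that define the projective line itself. An
  invariant set at finite distance is pruned so that each side is glued to at most one other side;
  the sides affected by this are finitely many and permuted by the group.\<close>

lemma gluing_exists:
  obtains Y where
    "\<forall>s t g. (s, t, g) \<in> Y \<longrightarrow> g \<in> PGL \<and> s \<noteq> t \<and> (t, s, invf g) \<in> Y"
    "\<forall>s t g t' g'. (s, t, g) \<in> Y \<longrightarrow> (s, t', g') \<in> Y \<longrightarrow> t' = t \<and> g' = g"
    "\<forall>\<gamma>\<in>\<Gamma>. \<forall>s t g. (s, t, g) \<in> Y \<longrightarrow> (act \<gamma> s, act \<gamma> t, gm \<gamma> t \<circ> g \<circ> invf (gm \<gamma> s)) \<in> Y"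
    "finite {s. (s, flip s, id) \<notin> Y}"
proof -
  define E :: "(side \<times> side \<times> (real option \<Rightarrow> real option)) set" where "E = UNIV \<times> UNIV \<times> PGL"
  define X where "X = range (\<lambda>s :: side. (s, flip s, id :: real option \<Rightarrow> real option))"
  define a where "a \<gamma> = (\<lambda>(s, t, g). (act \<gamma> s, act \<gamma> t, gm \<gamma> t \<circ> g \<circ> invf (gm \<gamma> s)))" for \<gamma>
  obtain Z where Z: "Z \<subseteq> E" "\<And>\<gamma> x. \<gamma> \<in> \<Gamma> \<Longrightarrow> x \<in> Z \<Longrightarrow> a \<gamma> x \<in> Z" "finite (sym_diff X Z)"
  proof (rule FW_transfix[OF \<Gamma> FW, of E a X])
    show "a \<gamma> x \<in> E" if "\<gamma> \<in> \<Gamma>" "x \<in> E" for \<gamma> x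
      using that by (auto simp: E_def a_def)
    show "a \<one> x = x" if "x \<in> E" for x by (cases x) (simp add: a_def)
    show "a (\<gamma> \<otimes> \<delta>) x = a \<gamma> (a \<delta> x)" if "\<gamma> \<in> \<Gamma>" "\<delta> \<in> \<Gamma>" "x \<in> E" for \<gamma> \<delta> x
      using that by (cases x) (simp add: a_def gm_act act_mult PGL_group_simps)
    show "X \<subseteq> E" by (auto simp: X_def E_def)
    show "finite {x \<in> X. a \<gamma> x \<notin> X}" if g: "\<gamma> \<in> \<Gamma>" for \<gamma>
    proof (rule finite_subset)
      let ?D = "{x. gm \<gamma> (x, True) \<noteq> gm \<gamma> (x, False)}"
      show "{x \<in> X. a \<gamma> x \<notin> X} \<subseteq> (\<lambda>s. (s, flip s, id)) ` (?D \<times> UNIV)"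
      proof
        fix x assume x: "x \<in> {x \<in> X. a \<gamma> x \<notin> X}"
        then obtain s where s: "x = (s, flip s, id)" by (auto simp: X_def)
        have "fst s \<in> ?D"
        proof (rule ccontr)
          assume "fst s \<notin> ?D"
          then have eq: "gm \<gamma> (flip s) = gm \<gamma> s" by (cases s; cases "snd s") auto
          then have "act \<gamma> (flip s) = flip (act \<gamma> s)" using hact_flip[of "gm \<gamma> s" s] by (simp add: act_def)
          then have "a \<gamma> x = (act \<gamma> s, flip (act \<gamma> s), id)" using s eq g by (simp add: a_def)
          then show False using x by (auto simp: X_def)
        qed
        then show "x \<in> (\<lambda>s. (s, flip s, id)) ` (?D \<times> UNIV)" using s by (cases s) (auto simp: image_iff)
      qed
      show "finite ((\<lambda>s. (s, flip s, id)) ` (?D \<times> (UNIV :: bool set)))"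
        using gm_sides[OF g] by (intro finite_imageI finite_cartesian_product) simp_all
    qed
  qed (rule that)
  have ZP: "g \<in> PGL" if "(s, t, g) \<in> Z" for s t g using that Z(1) by (auto simp: E_def)
  \<comment> \<open>A gluing is kept if no other gluing in \<open>Z\<close> starts at either of its sides.\<close>
  define uniq where "uniq s t g \<longleftrightarrow> (\<forall>t' g'. (s, t', g') \<in> Z \<longrightarrow> t' = t \<and> g' = g)" for s t g
  define Y where "Y = {(s, t, g). (s, t, g) \<in> Z \<and> (t, s, invf g) \<in> Z \<and> s \<noteq> t \<and> uniq s t g \<and> uniq t s (invf g)}"
  have Zinv: "(act \<gamma> s, act \<gamma> t, gm \<gamma> t \<circ> g \<circ> invf (gm \<gamma> s)) \<in> Z" if "\<gamma> \<in> \<Gamma>" "(s, t, g) \<in> Z" for \<gamma> s t g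
    using Z(2)[OF that] by (simp add: a_def)
  have uinv: "uniq (act \<gamma> s) (act \<gamma> t) (gm \<gamma> t \<circ> g \<circ> invf (gm \<gamma> s))" if g: "\<gamma> \<in> \<Gamma>" and u: "uniq s t g" for \<gamma> s t g
    unfolding uniq_def
  proof (intro allI impI)
    fix t' g' assume Z': "(act \<gamma> s, t', g') \<in> Z"
    have "(s, act (inv \<gamma>) t', gm (inv \<gamma>) t' \<circ> g' \<circ> gm \<gamma> s) \<in> Z"
      using Zinv[OF _ Z', of "inv \<gamma>"] g by (simp add: gm_inv)
    then have eq: "act (inv \<gamma>) t' = t" "gm (inv \<gamma>) t' \<circ> g' \<circ> gm \<gamma> s = g" using u unfolding uniq_def by blast+
    have t': "t' = act \<gamma> t" using eq(1) g by auto
    have "g = invf (gm \<gamma> t) \<circ> g' \<circ> gm \<gamma> s" using eq(2) t' g by (simp add: gm_inv)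
    then have "gm \<gamma> t \<circ> g \<circ> invf (gm \<gamma> s) = g'" using g by (simp add: comp_assoc)
    then show "t' = act \<gamma> t \<and> g' = gm \<gamma> t \<circ> g \<circ> invf (gm \<gamma> s)" using t' by simp
  qed
  have "\<forall>s t g. (s, t, g) \<in> Y \<longrightarrow> g \<in> PGL \<and> s \<noteq> t \<and> (t, s, invf g) \<in> Y"
    using ZP by (auto simp: Y_def)
  moreover have "\<forall>s t g t' g'. (s, t, g) \<in> Y \<longrightarrow> (s, t', g') \<in> Y \<longrightarrow> t' = t \<and> g' = g"
    unfolding Y_def uniq_def by blast
  moreover have "\<forall>\<gamma>\<in>\<Gamma>. \<forall>s t g. (s, t, g) \<in> Y \<longrightarrow> (act \<gamma> s, act \<gamma> t, gm \<gamma> t \<circ> g \<circ> invf (gm \<gamma> s)) \<in> Y"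
  proof (intro ballI allI impI)
    fix \<gamma> s t g assume g: "\<gamma> \<in> \<Gamma>" and y: "(s, t, g) \<in> Y"
    then have y': "(s, t, g) \<in> Z" "(t, s, invf g) \<in> Z" "s \<noteq> t" "uniq s t g" "uniq t s (invf g)" by (auto simp: Y_def)
    have "g \<in> PGL" using ZP y' by blast
    then have *: "invf (gm \<gamma> t \<circ> g \<circ> invf (gm \<gamma> s)) = gm \<gamma> s \<circ> invf g \<circ> invf (gm \<gamma> t)"
      using g by (simp add: PGL_group_simps)
    have "act \<gamma> s \<noteq> act \<gamma> t" using y'(3) act_inv(1)[OF g] by metis
    then show "(act \<gamma> s, act \<gamma> t, gm \<gamma> t \<circ> g \<circ> invf (gm \<gamma> s)) \<in> Y"
      unfolding Y_def using Zinv[OF g y'(1)] Zinv[OF g y'(2)] uinv[OF g y'(4)] uinv[OF g y'(5)] * by simp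
  qed
  moreover have "finite {s. (s, flip s, id) \<notin> Y}"
  proof (rule finite_subset)
    let ?B = "fst ` sym_diff X Z"
    show "{s. (s, flip s, id) \<notin> Y} \<subseteq> ?B \<union> flip ` ?B"
    proof
      fix s assume s: "s \<in> {s. (s, flip s, id) \<notin> Y}"
      show "s \<in> ?B \<union> flip ` ?B"
      proof (rule ccontr)
        assume no: "s \<notin> ?B \<union> flip ` ?B"
        have nB: "s \<notin> ?B" "flip s \<notin> ?B"
        proof -
          show "s \<notin> ?B" using no by blast
          show "flip s \<notin> ?B"
          proof
            assume "flip s \<in> ?B"
            then have "flip (flip s) \<in> flip ` ?B" by (rule imageI)
            then show False using no by simp
          qed
        qed
        have good: "(u, flip u, id) \<in> Z \<and> uniq u (flip u) id" if "u \<notin> ?B" for u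
        proof -
          have *: "(u, t, g) \<in> X \<longleftrightarrow> (u, t, g) \<in> Z" for t g
          proof (rule ccontr)
            assume "\<not> ?thesis"
            then have "(u, t, g) \<in> sym_diff X Z" by blast
            then have "fst (u, t, g) \<in> ?B" by (rule imageI)
            then show False using that by simp
          qed
          show ?thesis unfolding uniq_def * [symmetric] by (auto simp: X_def)
        qed
        have "s \<noteq> flip s" by (cases s) auto
        then show False using s good[OF nB(1)] good[OF nB(2)] by (auto simp: Y_def)
      qed
    qed
    show "finite (?B \<union> flip ` ?B)" using Z(3) by blast
  qed
  ultimately show thesis by (intro that[of Y])
qed

end

section \<open>Components of the glued curve\<close>

locale glued = piecewise_group +
  fixes Y :: "(side \<times> side \<times> (real option \<Rightarrow> real option)) set"
  assumes Y_PGL: "(s, t, g) \<in> Y \<Longrightarrow> g \<in> PGL" and Y_neq: "(s, t, g) \<in> Y \<Longrightarrow> s \<noteq> t"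
    and Y_sym: "(s, t, g) \<in> Y \<Longrightarrow> (t, s, invf g) \<in> Y"
    and Y_uniq: "(s, t, g) \<in> Y \<Longrightarrow> (s, t', g') \<in> Y \<Longrightarrow> t' = t \<and> g' = g"
    and Y_inv: "\<gamma> \<in> \<Gamma> \<Longrightarrow> (s, t, g) \<in> Y \<Longrightarrow> (act \<gamma> s, act \<gamma> t, gm \<gamma> t \<circ> g \<circ> invf (gm \<gamma> s)) \<in> Y"
    and Y_fin: "finite {s. (s, flip s, id) \<notin> Y}"
begin

text \<open>The exceptional points, where the two sides are not glued in the standard way, together with
  the point at infinity, cut the circle into the cells. A cell is encoded by the exceptional reals
  before it.\<close>

definition F :: "real set" where
  "F = {r. \<exists>b. ((Some r, b), (Some r, \<not> b), id) \<notin> Y}"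

definition cell :: "side \<Rightarrow> real set" where
  "cell s = cut s \<inter> F"

definition ends :: "side set" where
  "ends = insert None (Some ` F) \<times> UNIV"

lemma finite_F: "finite F"
proof (rule finite_subset)
  show "F \<subseteq> the ` fst ` {s. (s, flip s, id) \<notin> Y}"
  proof
    fix r assume "r \<in> F"
    then obtain b where "(Some r, b) \<in> {s. (s, flip s, id) \<notin> Y}" by (auto simp: F_def)
    then have "the (fst (Some r, b)) \<in> the ` fst ` {s. (s, flip s, id) \<notin> Y}" by (intro imageI)
    then show "r \<in> the ` fst ` {s. (s, flip s, id) \<notin> Y}" by simp
  qed
qed (use Y_fin in blast)

lemma LC_cell: "LC cell"
  using LC_cut_Int[OF finite_F] by (simp add: cell_def[abs_def])

lemma cell_subset: "cell s \<subseteq> F"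
  by (simp add: cell_def)

lemma finite_cells: "finite (range cell)"
  by (rule finite_subset[of _ "Pow F"]) (use cell_subset finite_F in auto)

lemma finite_ends: "finite ends"
  using finite_F by (simp add: ends_def)

lemma non_end_glued: "s \<notin> ends \<Longrightarrow> (s, flip s, id) \<in> Y"
  by (cases s; cases "fst s") (auto simp: ends_def F_def)

lemma cell_flip: "s \<notin> ends \<Longrightarrow> cell (flip s) = cell s"
proof -
  assume "s \<notin> ends"
  then obtain r b where s: "s = (Some r, b)" "r \<notin> F" by (cases s; cases "fst s") (auto simp: ends_def)
  have "{..r} \<inter> F = {..<r} \<inter> F" using s(2) by (auto simp: order_le_less)
  then show ?thesis using s by (cases b) (simp_all add: cell_def)
qed

lemma LC_constant_on_cell:
  assumes "LC c" "\<And>s. s \<notin> ends \<Longrightarrow> c (flip s) = c s" "cell s = cell t"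
  shows "c s = c t"
proof (rule LC_constant_on_cells[OF assms(1) finite_F])
  show "cut s \<inter> F = cut t \<inter> F" using assms(3) by (simp add: cell_def)
  fix y assume "y \<notin> F"
  then have "(Some y, False) \<notin> ends" by (auto simp: ends_def)
  then show "c (Some y, True) = c (Some y, False)" using assms(2)[of "(Some y, False)"] by simp
qed

lemma LC_cell_factor: "(\<And>s t. cell s = cell t \<Longrightarrow> c s = c t) \<Longrightarrow> LC c"
proof -
  assume c: "\<And>s t. cell s = cell t \<Longrightarrow> c s = c t"
  have "(\<lambda>s. c (SOME t. cell t = cell s)) = c"
  proof
    fix s
    have "cell (SOME t. cell t = cell s) = cell s" by (rule someI) simp
    then show "c (SOME t. cell t = cell s) = c s" by (rule c)
  qed
  then show ?thesis using LC_map[OF LC_cell, of "\<lambda>C. c (SOME t. cell t = C)"] by simp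
qed

text \<open>Each cell is an interval, hence has two ends.\<close>

lemma card_ends_in_cells:
  assumes "U \<subseteq> range cell"
  shows "card {s \<in> ends. cell s \<in> U} \<le> 2 * card U"
proof -
  have U: "finite U" using assms finite_cells finite_subset by blast
  define E where "E b = {s \<in> ends. cell s \<in> U \<and> snd s = b}" for b
  have le: "card (E b) \<le> card U" for b
  proof (rule card_inj_on_le)
    show "cell ` E b \<subseteq> U" by (auto simp: E_def)
    show "inj_on cell (E b)"
    proof (rule inj_onI)
      fix s t assume st: "s \<in> E b" "t \<in> E b" "cell s = cell t"
      have *: "x = y" if "{..x} \<inter> F = {..y} \<inter> F" "x \<in> F" "y \<in> F" for x y
      proof -
        have "x \<in> {..y} \<inter> F" "y \<in> {..x} \<inter> F" using that by blast+
        then show ?thesis by auto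
      qed
      have **: "x = y" if "{..<x} \<inter> F = {..<y} \<inter> F" "x \<in> F" "y \<in> F" for x y
      proof -
        have "x \<notin> {..<y} \<inter> F" "y \<notin> {..<x} \<inter> F" using that by blast+
        then show ?thesis using that(2,3) by auto
      qed
      have ne: "{..x} \<inter> F \<noteq> {}" "{..<x} \<inter> F \<noteq> F" if "x \<in> F" for x
        using that by auto
      have s: "fst s \<in> insert None (Some ` F)" "snd s = b" and t: "fst t \<in> insert None (Some ` F)" "snd t = b"
        using st by (auto simp: E_def ends_def)
      show "s = t"
        using s t st(3) ne ne[symmetric]
        by (cases s; cases t; cases b) (auto simp: cell_def dest: * **)
    qed
  qed (rule U)
  have "{s \<in> ends. cell s \<in> U} = E True \<union> E False" by (auto simp: E_def)
  then have "card {s \<in> ends. cell s \<in> U} \<le> card (E True) + card (E False)" by (simp add: card_Un_le)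
  then show ?thesis using le[of True] le[of False] by linarith
qed

text \<open>A flat set is a union of components of the total space of the gluing, that is, of pairs
  \<open>(s, B)\<close> where \<open>B\<close> is the germ at \<open>s\<close> of a projective coordinate.\<close>

definition flat :: "(side \<Rightarrow> (real option \<Rightarrow> real option) set) \<Rightarrow> bool" where
  "flat q \<longleftrightarrow> LC q \<and> (\<forall>s t g B. (s, t, g) \<in> Y \<longrightarrow> B \<in> q s \<longleftrightarrow> B \<circ> invf g \<in> q t)"

lemma flatD: "flat q \<Longrightarrow> (s, t, g) \<in> Y \<Longrightarrow> B \<in> q s \<longleftrightarrow> B \<circ> invf g \<in> q t"
  unfolding flat_def by blast

lemma flat_cell: "flat q \<Longrightarrow> cell s = cell t \<Longrightarrow> q s = q t"
proof (rule LC_constant_on_cell)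
  assume q: "flat q"
  then show "LC q" by (simp add: flat_def)
  show "q (flip s) = q s" if "s \<notin> ends" for s
    using flatD[OF q non_end_glued[OF that]] by auto
qed

text \<open>The group acts on flat sets.\<close>

lemma flat_translate:
  assumes q: "flat q" and g: "\<gamma> \<in> \<Gamma>"
  shows "flat (\<lambda>s. {B. B \<circ> invf (gm \<gamma> s) \<in> q (act \<gamma> s)})"
  unfolding flat_def
proof (intro conjI allI impI)
  have "LC (\<lambda>s. q (act \<gamma> s))" using q g by (intro LC_act) (simp_all add: flat_def)
  from LC_map2[OF gm_LC[OF g] this, of "\<lambda>h Q. {B. B \<circ> invf h \<in> Q}"]
  show "LC (\<lambda>s. {B. B \<circ> invf (gm \<gamma> s) \<in> q (act \<gamma> s)})" .
  fix s t h and B :: "real option \<Rightarrow> real option" assume y: "(s, t, h) \<in> Y"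
  have "(B \<circ> invf (gm \<gamma> s)) \<circ> invf (gm \<gamma> t \<circ> h \<circ> invf (gm \<gamma> s)) = (B \<circ> invf h) \<circ> invf (gm \<gamma> t)"
    using g Y_PGL[OF y] by (simp add: PGL_group_simps)
  then show "B \<in> {B. B \<circ> invf (gm \<gamma> s) \<in> q (act \<gamma> s)} \<longleftrightarrow> B \<circ> invf h \<in> {B. B \<circ> invf (gm \<gamma> t) \<in> q (act \<gamma> t)}"
    using flatD[OF q Y_inv[OF g y], of "B \<circ> invf (gm \<gamma> s)"] by simp
qed

text \<open>An element with trivial germ at a side fixes the sides glued to it, with trivial germs.\<close>

lemma flat_trivial_germ:
  assumes g: "\<gamma> \<in> \<Gamma>"
  shows "flat (\<lambda>s. {B. gm \<gamma> s = id})"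
  unfolding flat_def
proof (intro conjI allI impI)
  show "LC (\<lambda>s. {B. gm \<gamma> s = id})" using LC_map[OF gm_LC[OF g], of "\<lambda>h. {B. h = id}"] .
  have imp: "gm \<gamma> t = id" if y: "(s, t, h) \<in> Y" and s: "gm \<gamma> s = id" for s t h
  proof -
    have y': "(s, act \<gamma> t, gm \<gamma> t \<circ> h) \<in> Y" using Y_inv[OF g y] s gm_id_act[OF s] by simp
    then have "gm \<gamma> t \<circ> h = id \<circ> h" using Y_uniq[OF y y'] by simp
    then show ?thesis using PGL_right_cancel[OF Y_PGL[OF y]] by metis
  qed
  fix s t h and B :: "real option \<Rightarrow> real option" assume y: "(s, t, h) \<in> Y"
  show "B \<in> {B. gm \<gamma> s = id} \<longleftrightarrow> B \<circ> invf h \<in> {B. gm \<gamma> t = id}"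
    using imp[OF y] imp[OF Y_sym[OF y]] by blast
qed

end

context glued
begin

text \<open>The data describing the component \<^term>\<open>C\<close> of \<^term>\<open>s0\<close>: a gauge \<^term>\<open>\<beta>\<close> of projective
  coordinates that is compatible with all gluings in \<^term>\<open>C\<close>, with the possible exception of one
  gluing of \<^term>\<open>sx\<close> to \<^term>\<open>tx\<close>. That one closes up the component to a circle with
  holonomy \<^term>\<open>h\<close>.\<close>

definition is_component where
  "is_component s0 C \<beta> h sx tx \<longleftrightarrow>
    s0 \<in> C \<and> LC (\<lambda>s. s \<in> C) \<and> (\<forall>s t g. (s, t, g) \<in> Y \<longrightarrow> (s \<in> C \<longleftrightarrow> t \<in> C)) \<and>
    (\<forall>s. \<beta> s \<in> PGL) \<and> LC \<beta> \<and> finite (range \<beta>) \<and> h \<in> PGL \<and>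
    (\<forall>q s B. flat q \<longrightarrow> s \<in> C \<longrightarrow> (B \<circ> \<beta> s0 \<in> q s0 \<longleftrightarrow> B \<circ> \<beta> s \<in> q s)) \<and>
    (\<forall>s t g. (s, t, g) \<in> Y \<longrightarrow> s \<in> C \<longrightarrow> \<beta> t = \<beta> s \<circ> invf g \<or> h \<noteq> id \<and> ((s, t) = (sx, tx) \<or> (s, t) = (tx, sx))) \<and>
    (h \<noteq> id \<longrightarrow> (\<exists>g. (sx, tx, g) \<in> Y \<and> sx \<in> C \<and> \<beta> sx \<circ> invf g = h \<circ> \<beta> tx))"

text \<open>A spanning tree of the graph with the cells as vertices and the gluings of their ends as
  edges; \<^term>\<open>T\<close> consists of the ends used so far.\<close>

definition gauge_tree where
  "gauge_tree s0 U b T \<longleftrightarrow>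
    U \<subseteq> range cell \<and> cell s0 \<in> U \<and> T \<subseteq> ends \<and> cell ` T \<subseteq> U \<and> card T + 2 = 2 * card U \<and>
    (\<forall>s\<in>T. \<exists>t g. (s, t, g) \<in> Y \<and> t \<in> T \<and> b (cell t) = b (cell s) \<circ> invf g) \<and>
    (\<forall>u. b u \<in> PGL) \<and>
    (\<forall>q s B. flat q \<longrightarrow> cell s \<in> U \<longrightarrow> (B \<circ> b (cell s0) \<in> q s0 \<longleftrightarrow> B \<circ> b (cell s) \<in> q s))"

lemma gauge_tree_start: "gauge_tree s0 {cell s0} (\<lambda>_. id) {}"
  unfolding gauge_tree_def
proof (intro conjI allI impI)
  show "B \<circ> id \<in> q s0 \<longleftrightarrow> B \<circ> id \<in> q s" if "flat q" "cell s \<in> {cell s0}" for q s B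
    using flat_cell[OF that(1), of s s0] that(2) by simp
qed auto

text \<open>A gluing that leaves the tree has both ends unused so far, because a side is glued to at
  most one other side.\<close>

lemma gauge_tree_extend:
  assumes tree: "gauge_tree s0 U b T" and y: "(s, t, g) \<in> Y" and s: "cell s \<in> U" and t: "cell t \<notin> U"
  shows "gauge_tree s0 (insert (cell t) U) (b(cell t := b (cell s) \<circ> invf g)) (insert s (insert t T))"
proof -
  let ?b = "b(cell t := b (cell s) \<circ> invf g)"
  from tree have U: "U \<subseteq> range cell" "cell s0 \<in> U" and T: "T \<subseteq> ends" "cell ` T \<subseteq> U" "card T + 2 = 2 * card U"
    and edge: "\<And>s. s \<in> T \<Longrightarrow> \<exists>t g. (s, t, g) \<in> Y \<and> t \<in> T \<and> b (cell t) = b (cell s) \<circ> invf g"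
    and bP: "\<And>u. b u \<in> PGL"
    and conn: "\<And>q s B. flat q \<Longrightarrow> cell s \<in> U \<Longrightarrow> B \<circ> b (cell s0) \<in> q s0 \<longleftrightarrow> B \<circ> b (cell s) \<in> q s"
    unfolding gauge_tree_def by blast+
  have st: "cell s \<noteq> cell t" using s t by auto
  have sE: "s \<in> ends"
  proof (rule ccontr)
    assume "s \<notin> ends"
    then have "t = flip s" using Y_uniq[OF non_end_glued y] by simp
    then show False using cell_flip[OF \<open>s \<notin> ends\<close>] st by simp
  qed
  have tE: "t \<in> ends"
  proof (rule ccontr)
    assume "t \<notin> ends"
    then have "s = flip t" using Y_uniq[OF non_end_glued Y_sym[OF y]] by simp
    then show False using cell_flip[OF \<open>t \<notin> ends\<close>] st by simp
  qed
  have tT: "t \<notin> T" using t T(2) by blast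
  have sT: "s \<notin> T"
  proof
    assume "s \<in> T"
    then obtain t' g' where "(s, t', g') \<in> Y" "t' \<in> T" using edge by blast
    then show False using Y_uniq[OF y] tT by blast
  qed
  have finU: "finite U" using U(1) finite_cells finite_subset by blast
  have finT: "finite T" using T(1) finite_ends finite_subset by blast
  have bcell: "?b (cell u) = b (cell u)" if "cell u \<in> U" for u using that t by auto
  show ?thesis
    unfolding gauge_tree_def
  proof (intro conjI allI impI ballI)
    show "insert (cell t) U \<subseteq> range cell" "cell s0 \<in> insert (cell t) U" using U by auto
    show "insert s (insert t T) \<subseteq> ends" using sE tE T(1) by simp
    show "cell ` insert s (insert t T) \<subseteq> insert (cell t) U" using s T(2) by auto
    show "card (insert s (insert t T)) + 2 = 2 * card (insert (cell t) U)"
      using T(3) finU finT sT tT Y_neq[OF y] t by simp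
    show "?b u \<in> PGL" for u using bP Y_PGL[OF y] by simp
    show "\<exists>v k. (u, v, k) \<in> Y \<and> v \<in> insert s (insert t T) \<and> ?b (cell v) = ?b (cell u) \<circ> invf k"
      if u: "u \<in> insert s (insert t T)" for u
    proof -
      consider "u = s" | "u = t" | "u \<in> T" using u by blast
      then show ?thesis
      proof cases
        case 1
        then show ?thesis using y st by (intro exI[of _ t] exI[of _ g]) simp
      next
        case 2
        then show ?thesis using Y_sym[OF y] Y_PGL[OF y] st
          by (intro exI[of _ s] exI[of _ "invf g"]) (simp add: comp_assoc)
      next
        case 3
        then obtain v k where v: "(u, v, k) \<in> Y" "v \<in> T" "b (cell v) = b (cell u) \<circ> invf k" using edge by blast
        have "cell u \<in> U" "cell v \<in> U" using 3 v(2) T(2) by blast+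
        then show ?thesis using v bcell by (intro exI[of _ v] exI[of _ k]) simp
      qed
    qed
    fix q u B assume q: "flat q" and u: "cell u \<in> insert (cell t) U"
    have 0: "?b (cell s0) = b (cell s0)" using bcell U(2) by blast
    show "B \<circ> ?b (cell s0) \<in> q s0 \<longleftrightarrow> B \<circ> ?b (cell u) \<in> q u"
    proof (cases "cell u \<in> U")
      case True
      then show ?thesis using conn[OF q True] 0 bcell[OF True] by simp
    next
      case False
      then have ut: "cell u = cell t" using u by simp
      have "B \<circ> b (cell s0) \<in> q s0 \<longleftrightarrow> B \<circ> b (cell s) \<in> q s" using conn[OF q s] .
      also have "\<dots> \<longleftrightarrow> (B \<circ> b (cell s)) \<circ> invf g \<in> q t" using flatD[OF q y] .
      also have "\<dots> \<longleftrightarrow> B \<circ> ?b (cell u) \<in> q u" using flat_cell[OF q ut] ut by (simp add: comp_assoc)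
      finally show ?thesis using 0 by simp
    qed
  qed
qed

text \<open>A maximal tree misses at most two ends, because there are two ends for each cell.\<close>

lemma component_exists: "\<exists>C \<beta> h sx tx. is_component s0 C \<beta> h sx tx"
proof -
  define S where "S = {U. \<exists>b T. gauge_tree s0 U b T}"
  have "S \<subseteq> Pow (range cell)" by (auto simp: S_def gauge_tree_def)
  then have "finite S" using finite_cells by (meson finite_Pow_iff finite_subset)
  moreover have "S \<noteq> {}" using gauge_tree_start[of s0] unfolding S_def by blast
  ultimately have "Max (card ` S) \<in> card ` S" "\<forall>V\<in>S. card V \<le> Max (card ` S)" by simp_all
  then obtain U where U: "U \<in> S" "\<And>V. V \<in> S \<Longrightarrow> card V \<le> card U" by auto
  then obtain b T where tree: "gauge_tree s0 U b T" by (auto simp: S_def)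
  then have Uc: "U \<subseteq> range cell" "cell s0 \<in> U" and T: "T \<subseteq> ends" "cell ` T \<subseteq> U" "card T + 2 = 2 * card U"
    and edge: "\<And>s. s \<in> T \<Longrightarrow> \<exists>t g. (s, t, g) \<in> Y \<and> t \<in> T \<and> b (cell t) = b (cell s) \<circ> invf g"
    and bP: "\<And>u. b u \<in> PGL"
    and conn: "\<And>q s B. flat q \<Longrightarrow> cell s \<in> U \<Longrightarrow> B \<circ> b (cell s0) \<in> q s0 \<longleftrightarrow> B \<circ> b (cell s) \<in> q s"
    unfolding gauge_tree_def by blast+
  have finU: "finite U" using Uc(1) finite_cells finite_subset by blast
  have closed: "cell t \<in> U" if "(s, t, g) \<in> Y" "cell s \<in> U" for s t g
  proof (rule ccontr)
    assume t: "cell t \<notin> U"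
    have "insert (cell t) U \<in> S" using gauge_tree_extend[OF tree that t] by (auto simp: S_def)
    then show False using U(2)[of "insert (cell t) U"] t finU by simp
  qed
  define C where "C = {s. cell s \<in> U}"
  define \<beta> where "\<beta> s = b (cell s)" for s
  \<comment> \<open>The ends outside the tree, at which a gluing may fail to be compatible with the gauge.\<close>
  define R where "R = {s \<in> ends. cell s \<in> U} - T"
  have "T \<subseteq> {s \<in> ends. cell s \<in> U}" using T by blast
  then have "card R = card {s \<in> ends. cell s \<in> U} - card T"
    unfolding R_def by (rule card_Diff_subset[OF finite_subset[OF T(1) finite_ends]])
  then have cardR: "card R \<le> 2" using card_ends_in_cells[OF Uc(1)] T(3) by linarith
  have finR: "finite R" using finite_ends by (simp add: R_def)
  have inR: "s \<in> R" if y: "(s, t, g) \<in> Y" and s: "s \<in> C" and nf: "\<beta> t \<noteq> \<beta> s \<circ> invf g" for s t g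
  proof -
    have "s \<notin> T"
    proof
      assume "s \<in> T"
      then obtain t' g' where *: "(s, t', g') \<in> Y" "b (cell t') = b (cell s) \<circ> invf g'" using edge by blast
      then have "t' = t \<and> g' = g" using Y_uniq[OF y *(1)] by simp
      then show False using *(2) nf by (simp add: \<beta>_def)
    qed
    moreover have "s \<in> ends"
    proof (rule ccontr)
      assume ns: "s \<notin> ends"
      then have "t = flip s" "g = id" using Y_uniq[OF non_end_glued y] by simp_all
      then show False using nf cell_flip[OF ns] by (simp add: \<beta>_def)
    qed
    ultimately show ?thesis using s by (simp add: R_def C_def)
  qed
  have inR2: "t \<in> R" if y: "(s, t, g) \<in> Y" and s: "s \<in> C" and nf: "\<beta> t \<noteq> \<beta> s \<circ> invf g" for s t g
  proof (rule inR[OF Y_sym[OF y]])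
    show "t \<in> C" using closed[OF y] s by (simp add: C_def)
    show "\<beta> s \<noteq> \<beta> t \<circ> invf (invf g)"
    proof
      assume "\<beta> s = \<beta> t \<circ> invf (invf g)"
      then have "\<beta> s \<circ> invf g = \<beta> t" using Y_PGL[OF y] by (simp add: comp_assoc)
      then show False using nf by simp
    qed
  qed
  have base: "s0 \<in> C" "LC (\<lambda>s. s \<in> C)" "\<And>s t g. (s, t, g) \<in> Y \<Longrightarrow> s \<in> C \<longleftrightarrow> t \<in> C"
    "\<And>s. \<beta> s \<in> PGL" "LC \<beta>" "finite (range \<beta>)"
    "\<And>q s B. flat q \<Longrightarrow> s \<in> C \<Longrightarrow> (B \<circ> \<beta> s0 \<in> q s0 \<longleftrightarrow> B \<circ> \<beta> s \<in> q s)"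
  proof -
    show "s0 \<in> C" using Uc(2) by (simp add: C_def)
    show "LC (\<lambda>s. s \<in> C)" by (rule LC_cell_factor) (simp add: C_def)
    show "(s, t, g) \<in> Y \<Longrightarrow> s \<in> C \<longleftrightarrow> t \<in> C" for s t g using closed Y_sym unfolding C_def by blast
    show "\<beta> s \<in> PGL" for s using bP by (simp add: \<beta>_def)
    show "LC \<beta>" by (rule LC_cell_factor) (simp add: \<beta>_def)
    have "range \<beta> = b ` range cell" by (auto simp: \<beta>_def)
    then show "finite (range \<beta>)" using finite_cells by simp
    show "B \<circ> \<beta> s0 \<in> q s0 \<longleftrightarrow> B \<circ> \<beta> s \<in> q s" if "flat q" "s \<in> C" for q s B
      using conn[OF that(1)] that(2) by (simp add: \<beta>_def C_def)
  qed
  show ?thesis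
  proof (cases "\<exists>s t g. (s, t, g) \<in> Y \<and> s \<in> C \<and> \<beta> t \<noteq> \<beta> s \<circ> invf g")
    case False
    then have "is_component s0 C \<beta> id s0 s0"
      unfolding is_component_def using base by blast
    then show ?thesis by blast
  next
    case True
    then obtain sx tx gx where x: "(sx, tx, gx) \<in> Y" "sx \<in> C" "\<beta> tx \<noteq> \<beta> sx \<circ> invf gx" by blast
    have "R = {sx, tx}"
    proof (rule card_seteq[symmetric, OF finR])
      show "{sx, tx} \<subseteq> R" using inR[OF x] inR2[OF x] by simp
      show "card R \<le> card {sx, tx}" using cardR Y_neq[OF x(1)] by simp
    qed
    define h where "h = \<beta> sx \<circ> invf gx \<circ> invf (\<beta> tx)"
    have gx: "gx \<in> PGL" using Y_PGL x(1) by blast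
    have hP: "h \<in> PGL" using base(4) gx by (simp add: h_def)
    have hx: "\<beta> sx \<circ> invf gx = h \<circ> \<beta> tx" using base(4) by (simp add: h_def comp_assoc)
    then have "h \<noteq> id" using x(3) by auto
    moreover have "(s, t) = (sx, tx) \<or> (s, t) = (tx, sx)"
      if "(s, t, g) \<in> Y" "s \<in> C" "\<beta> t \<noteq> \<beta> s \<circ> invf g" for s t g
      using inR[OF that] inR2[OF that] Y_neq[OF that(1)] \<open>R = {sx, tx}\<close> by auto
    ultimately have "is_component s0 C \<beta> h sx tx"
      unfolding is_component_def using base hP x(1,2) hx by blast
    then show ?thesis by blast
  qed
qed

text \<open>Saturated sets are the unions of components.\<close>

definition saturated :: "side set \<Rightarrow> bool" where
  "saturated D \<longleftrightarrow> LC (\<lambda>s. s \<in> D) \<and> (\<forall>s t g. (s, t, g) \<in> Y \<longrightarrow> (s \<in> D \<longleftrightarrow> t \<in> D))"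

lemma saturated_glue: "saturated D \<Longrightarrow> (s, t, g) \<in> Y \<Longrightarrow> s \<in> D \<longleftrightarrow> t \<in> D"
  unfolding saturated_def by blast

lemma saturated_translate:
  assumes D: "saturated D" and g: "\<gamma> \<in> \<Gamma>"
  shows "saturated {s. act \<gamma> s \<in> D}"
  unfolding saturated_def
proof (intro conjI allI impI)
  have "LC (\<lambda>s. act \<gamma> s \<in> D)" using D g by (intro LC_act) (simp_all add: saturated_def)
  then show "LC (\<lambda>s. s \<in> {s. act \<gamma> s \<in> D})" by simp
  show "s \<in> {s. act \<gamma> s \<in> D} \<longleftrightarrow> t \<in> {s. act \<gamma> s \<in> D}" if "(s, t, k) \<in> Y" for s t k
    using saturated_glue[OF D Y_inv[OF g that]] by simp
qed

lemma saturated_cell: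
  assumes "saturated D" "cell s = cell t"
  shows "s \<in> D \<longleftrightarrow> t \<in> D"
proof (rule LC_constant_on_cell[OF _ _ assms(2)])
  show "LC (\<lambda>s. s \<in> D)" using assms(1) by (simp add: saturated_def)
  show "(flip s \<in> D) = (s \<in> D)" if "s \<notin> ends" for s
    using saturated_glue[OF assms(1) non_end_glued[OF that]] by simp
qed

lemma component_saturated: "is_component v C \<beta> h sx tx \<Longrightarrow> v \<in> C \<and> saturated C"
  unfolding is_component_def saturated_def by (elim conjE, intro conjI, assumption+)

text \<open>Membership in a saturated set is a flat set, and flat sets do not distinguish the sides of a
  component.\<close>

lemma component_minimal:
  assumes comp: "is_component v C \<beta> h sx tx" and D: "saturated D" "s \<in> C" "s \<in> D"
  shows "C \<subseteq> D"
proof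
  fix t assume t: "t \<in> C"
  have "flat (\<lambda>s. {B. s \<in> D})"
    unfolding flat_def
  proof (intro conjI allI impI)
    show "LC (\<lambda>s. {B. s \<in> D})" using D(1) LC_map[of "\<lambda>s. s \<in> D" "\<lambda>P. {B. P}"] by (simp add: saturated_def)
  qed (use saturated_glue[OF D(1)] in simp)
  then have *: "id \<circ> \<beta> v \<in> {B. v \<in> D} \<longleftrightarrow> id \<circ> \<beta> s \<in> {B. s \<in> D}" if "s \<in> C" for s
    using comp that unfolding is_component_def by blast
  show "t \<in> D" using *[OF D(2)] *[OF t] D(3) by (simp split: if_splits)
qed

end

section \<open>Centralizers of homographies\<close>

definition PGLg :: "(real option \<Rightarrow> real option) monoid" where
  "PGLg = \<lparr>carrier = PGL, monoid.mult = (\<circ>), one = id\<rparr>"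

lemma PGLg_simps [simp]: "carrier PGLg = PGL" "x \<otimes>\<^bsub>PGLg\<^esub> y = x \<circ> y" "\<one>\<^bsub>PGLg\<^esub> = id"
  by (simp_all add: PGLg_def)

lemma group_PGLg: "group PGLg"
  by (rule groupI) (auto simp: comp_assoc intro!: bexI[of _ "invf _"])

interpretation PGLg: group PGLg
  by (rule group_PGLg)

lemma PGLg_inv [simp]: "f \<in> PGL \<Longrightarrow> inv\<^bsub>PGLg\<^esub> f = invf f"
  by (rule PGLg.inv_equality) auto

abbreviation zpow :: "(real option \<Rightarrow> real option) \<Rightarrow> int \<Rightarrow> real option \<Rightarrow> real option" where
  "zpow h k \<equiv> h [^]\<^bsub>PGLg\<^esub> k"

lemma zpow_PGL [simp]: "h \<in> PGL \<Longrightarrow> zpow h k \<in> PGL"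
  using PGLg.int_pow_closed[of h k] by simp

lemma zpow_add: "h \<in> PGL \<Longrightarrow> zpow h (i + j) = zpow h i \<circ> zpow h j"
  using PGLg.int_pow_mult[of h i j] by simp

lemma zpow_1 [simp]: "h \<in> PGL \<Longrightarrow> zpow h 1 = h"
  using PGLg.int_pow_1[of h] by simp

lemma zpow_neg: "h \<in> PGL \<Longrightarrow> zpow h (- k) = invf (zpow h k)"
  using PGLg.int_pow_neg[of h k] by simp

lemma zpow_zpow: "h \<in> PGL \<Longrightarrow> zpow (zpow h i) j = zpow h (i * j)"
  using PGLg.int_pow_pow[of h i j] by simp

lemma zpow_conj:
  assumes f: "f \<in> PGL" and h: "h \<in> PGL" and k: "k \<in> PGL" and fh: "f \<circ> h = k \<circ> f"
  shows "f \<circ> zpow h n = zpow k n \<circ> f"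
proof -
  have nat: "f \<circ> zpow h (int n) = zpow k (int n) \<circ> f" for n
  proof (induction n)
    case (Suc n)
    have "f \<circ> zpow h (int (Suc n)) = (f \<circ> zpow h (int n)) \<circ> h"
      using zpow_add[OF h, of "int n" 1] h by (simp add: comp_assoc add.commute)
    also have "\<dots> = (zpow k (int n) \<circ> f) \<circ> h" by (simp only: Suc)
    also have "\<dots> = zpow k (int n) \<circ> (k \<circ> f)" by (simp only: comp_assoc fh)
    also have "\<dots> = zpow k (int (Suc n)) \<circ> f"
      using zpow_add[OF k, of "int n" 1] k by (simp add: comp_assoc add.commute)
    finally show ?case .
  qed simp
  show ?thesis
  proof (cases "n \<ge> 0")
    case True
    then show ?thesis using nat[of "nat n"] by simp
  next
    case False
    then obtain m where n: "n = - int m" by (metis int_cases2 le_minus_iff nat_int of_nat_0_le_iff minus_le_iff linear)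
    have "f \<circ> zpow h (- int m) = invf (zpow k (int m)) \<circ> (zpow k (int m) \<circ> f) \<circ> invf (zpow h (int m))"
      using k h zpow_neg[OF h] by (simp add: comp_assoc)
    also have "\<dots> = invf (zpow k (int m)) \<circ> (f \<circ> zpow h (int m)) \<circ> invf (zpow h (int m))" using nat by simp
    also have "\<dots> = zpow k (- int m) \<circ> f" using k h zpow_neg[OF k] by (simp add: comp_assoc)
    finally show ?thesis using n by simp
  qed
qed

definition centralizer_PGL :: "(real option \<Rightarrow> real option) \<Rightarrow> (real option \<Rightarrow> real option) set" where
  "centralizer_PGL h = {g \<in> PGL. g \<circ> h = h \<circ> g}"

text \<open>The homographies given by matrices that commute with \<^term>\<open>B\<close> exactly, while a matrix of an element of \<^term>\<open>centralizer_PGL (homography B)\<close> commutes with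
  \<^term>\<open>B\<close> up to sign only. Together they show that the centralizer is solvable.\<close>

definition centralizer_mat :: "real^2^2 \<Rightarrow> (real option \<Rightarrow> real option) set" where
  "centralizer_mat B = {homography A | A. det A \<noteq> 0 \<and> A ** B = B ** A}"

text \<open>Two matrices representing commuting homographies commute up to sign, by comparing
  determinants.\<close>

lemma commute_up_to_sign:
  assumes "det A \<noteq> 0" "det B \<noteq> 0" "homography A \<circ> homography B = homography B \<circ> homography A"
  obtains k where "k = 1 \<or> k = - 1" "A ** B = k *\<^sub>R (B ** A)"
proof -
  have "homography (A ** B) = homography (B ** A)" using assms by (simp add: homography_comp)
  then obtain k where k: "A ** B = k *\<^sub>R (B ** A)"
    using homography_eqD[of "A ** B" "B ** A"] assms by (auto simp: det_mul)
  have "det (A ** B) = k^2 * det (B ** A)" unfolding k by (simp add: det_2 power2_eq_square algebra_simps)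
  then have "k^2 = 1" using assms by (simp add: det_mul)
  then show thesis using that k by (simp add: power2_eq_1_iff)
qed

lemma matrix_mult_scaleR: "A ** (k *\<^sub>R B) = k *\<^sub>R (A ** B)" "(k *\<^sub>R A) ** B = k *\<^sub>R (A ** B)" for A B :: "real^2^2"
  by (simp_all add: matrix_scalar_ac scalar_matrix_assoc)

text \<open>The signs cancel in a commutator.\<close>

lemma centralizer_commutator:
  assumes B: "det B \<noteq> 0" and f: "f \<in> centralizer_PGL (homography B)" and g: "g \<in> centralizer_PGL (homography B)"
  shows "f \<circ> g \<circ> invf (g \<circ> f) \<in> centralizer_mat B"
proof -
  obtain A1 where A1: "det A1 \<noteq> 0" "f = homography A1" "f \<circ> homography B = homography B \<circ> f"
    using f by (auto simp: centralizer_PGL_def PGL_def)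
  obtain A2 where A2: "det A2 \<noteq> 0" "g = homography A2" "g \<circ> homography B = homography B \<circ> g"
    using g by (auto simp: centralizer_PGL_def PGL_def)
  obtain k1 where k1: "k1 = 1 \<or> k1 = - 1" "A1 ** B = k1 *\<^sub>R (B ** A1)"
    using commute_up_to_sign[OF A1(1) B] A1(2,3) by metis
  obtain k2 where k2: "k2 = 1 \<or> k2 = - 1" "A2 ** B = k2 *\<^sub>R (B ** A2)"
    using commute_up_to_sign[OF A2(1) B] A2(2,3) by metis
  define M N k where "M = A1 ** A2" and "N = A2 ** A1" and "k = k1 * k2"
  have kk: "k * k = 1" using k1(1) k2(1) by (auto simp: k_def)
  have M: "M ** B = k *\<^sub>R (B ** M)"
  proof -
    have "M ** B = A1 ** (A2 ** B)" by (simp add: M_def matrix_mul_assoc)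
    also have "\<dots> = k2 *\<^sub>R ((A1 ** B) ** A2)" by (simp add: k2(2) matrix_mult_scaleR matrix_mul_assoc)
    also have "\<dots> = k *\<^sub>R (B ** M)" by (simp add: k1(2) matrix_mult_scaleR matrix_mul_assoc M_def k_def)
    finally show ?thesis .
  qed
  have N: "N ** B = k *\<^sub>R (B ** N)"
  proof -
    have "N ** B = A2 ** (A1 ** B)" by (simp add: N_def matrix_mul_assoc)
    also have "\<dots> = k1 *\<^sub>R ((A2 ** B) ** A1)" by (simp add: k1(2) matrix_mult_scaleR matrix_mul_assoc)
    also have "\<dots> = k *\<^sub>R (B ** N)" by (simp add: k2(2) matrix_mult_scaleR matrix_mul_assoc N_def k_def)
    finally show ?thesis .
  qed
  have dN: "det N \<noteq> 0" "det M \<noteq> 0" using A1 A2 by (simp_all add: N_def M_def det_mul)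
  obtain N' where N': "det N' \<noteq> 0" "N ** N' = mat 1" "N' ** N = mat 1"
      "homography N \<circ> homography N' = id" "homography N' \<circ> homography N = id"
    by (rule homography_inverse[OF dN(1)])
  have "N' ** (N ** B) ** N' = k *\<^sub>R (N' ** (B ** N) ** N')" unfolding N by (simp add: matrix_mult_scaleR)
  then have "B ** N' = k *\<^sub>R (N' ** B)" using N'(2,3)
    by (metis matrix_mul_assoc matrix_mul_lid matrix_mul_rid)
  then have "k *\<^sub>R (B ** N') = N' ** B" using kk by simp
  then have "(M ** N') ** B = k *\<^sub>R ((M ** B) ** N')"
    by (metis matrix_mul_assoc matrix_mult_scaleR(1))
  also have "\<dots> = B ** (M ** N')" unfolding M using kk by (simp add: matrix_mult_scaleR matrix_mul_assoc)
  finally have comm: "(M ** N') ** B = B ** (M ** N')" .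
  have gf: "g \<circ> f = homography N" "f \<circ> g = homography M" using A1 A2 by (simp_all add: homography_comp M_def N_def)
  have "invf (homography N) = homography N'" using N'(4,5) by (metis inv_unique_comp)
  then have "f \<circ> g \<circ> invf (g \<circ> f) = homography (M ** N')" using N'(1) by (simp add: gf homography_comp)
  then show ?thesis using comm dN N'(1) by (auto simp: centralizer_mat_def det_mul)
qed

text \<open>A matrix commuting with \<^term>\<open>B\<close>, which is not scalar, is a polynomial in \<^term>\<open>B\<close>: off the
  scalars its entries are proportional to those of \<^term>\<open>B\<close>.\<close>

lemma centralizer_mat_abelian:
  assumes B: "homography B \<noteq> id" "det B \<noteq> 0" and f: "f \<in> centralizer_mat B" and g: "g \<in> centralizer_mat B"
  shows "f \<circ> g = g \<circ> f"
proof -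
  obtain p q r s where B': "B = mat2 p q r s" by (rule mat2_cases)
  have ns: "q \<noteq> 0 \<or> r \<noteq> 0 \<or> p - s \<noteq> 0"
  proof (rule ccontr)
    assume "\<not> ?thesis"
    then have "B = p *\<^sub>R mat 1" "p \<noteq> 0" using B' B(2) by (auto simp: mat_1_mat2)
    then show False using B(1) by (metis homography_id homography_scaleR)
  qed
  obtain A1 where A1: "det A1 \<noteq> 0" "f = homography A1" "A1 ** B = B ** A1" using f by (auto simp: centralizer_mat_def)
  obtain A2 where A2: "det A2 \<noteq> 0" "g = homography A2" "A2 ** B = B ** A2" using g by (auto simp: centralizer_mat_def)
  obtain a b c d where m1: "A1 = mat2 a b c d" by (rule mat2_cases)
  obtain a' b' c' d' where m2: "A2 = mat2 a' b' c' d'" by (rule mat2_cases)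
  have e1: "a * p + b * r = p * a + q * c" "a * q + b * s = p * b + q * d" "c * p + d * r = r * a + s * c"
    using A1(3) by (simp_all add: m1 B')
  have e2: "a' * p + b' * r = p * a' + q * c'" "a' * q + b' * s = p * b' + q * d'" "c' * p + d' * r = r * a' + s * c'"
    using A2(3) by (simp_all add: m2 B')
  have 1: "b * r = c * q" "(a - d) * q = b * (p - s)" "(a - d) * r = c * (p - s)"
    using e1 by algebra+
  have 2: "b' * r = c' * q" "(a' - d') * q = b' * (p - s)" "(a' - d') * r = c' * (p - s)"
    using e2 by algebra+
  have "b * c' = b' * c \<and> (a - d) * b' = (a' - d') * b \<and> (a - d) * c' = (a' - d') * c"
  proof -
    have q: ?thesis if "q \<noteq> 0"
    proof -
      have "c = b * r / q" "c' = b' * r / q" "a - d = b * (p - s) / q" "a' - d' = b' * (p - s) / q"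
        using that 1 2 by (simp_all add: field_simps)
      then show ?thesis by simp
    qed
    have r: ?thesis if "r \<noteq> 0"
    proof -
      have "b = c * q / r" "b' = c' * q / r" "a - d = c * (p - s) / r" "a' - d' = c' * (p - s) / r"
        using that 1 2 by (simp_all add: field_simps)
      then show ?thesis by simp
    qed
    have w: ?thesis if "p - s \<noteq> 0"
    proof -
      have "b = (a - d) * q / (p - s)" "b' = (a' - d') * q / (p - s)" "c = (a - d) * r / (p - s)" "c' = (a' - d') * r / (p - s)"
        using that 1 2 by (simp_all add: field_simps)
      then show ?thesis by simp
    qed
    show ?thesis using ns q r w by blast
  qed
  then have "A1 ** A2 = A2 ** A1" by (auto simp: m1 m2 algebra_simps)
  then show ?thesis using A1 A2 by (simp add: homography_comp)
qed

lemma centralizer_mat_props: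
  assumes B: "det B \<noteq> 0"
  shows "centralizer_mat B \<subseteq> centralizer_PGL (homography B)" "homography B \<in> centralizer_mat B"
    "id \<in> centralizer_mat B" "f \<in> centralizer_mat B \<Longrightarrow> g \<in> centralizer_mat B \<Longrightarrow> f \<circ> g \<in> centralizer_mat B"
    "f \<in> centralizer_mat B \<Longrightarrow> invf f \<in> centralizer_mat B"
proof -
  show "centralizer_mat B \<subseteq> centralizer_PGL (homography B)"
  proof
    fix f assume "f \<in> centralizer_mat B"
    then obtain A where A: "f = homography A" "det A \<noteq> 0" "A ** B = B ** A" by (auto simp: centralizer_mat_def)
    then show "f \<in> centralizer_PGL (homography B)"
      using homography_PGL homography_comp[of A B] homography_comp[of B A] B by (auto simp: centralizer_PGL_def)
  qed
  show "homography B \<in> centralizer_mat B" using B by (auto simp: centralizer_mat_def)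
  show "id \<in> centralizer_mat B"
    unfolding centralizer_mat_def using homography_id by (auto intro!: exI[of _ "mat 1"])
  show "f \<circ> g \<in> centralizer_mat B" if fg: "f \<in> centralizer_mat B" "g \<in> centralizer_mat B"
  proof -
    obtain A where A: "f = homography A" "det A \<noteq> 0" "A ** B = B ** A" using fg(1) by (auto simp: centralizer_mat_def)
    obtain C where C: "g = homography C" "det C \<noteq> 0" "C ** B = B ** C" using fg(2) by (auto simp: centralizer_mat_def)
    have "(A ** C) ** B = B ** (A ** C)" using A(3) C(3) by (metis matrix_mul_assoc)
    then show ?thesis using A C homography_comp[OF C(2), of A] unfolding centralizer_mat_def
      by (auto simp: det_mul intro!: exI[of _ "A ** C"])
  qed
  show "invf f \<in> centralizer_mat B" if f: "f \<in> centralizer_mat B"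
  proof -
    obtain A where A: "f = homography A" "det A \<noteq> 0" "A ** B = B ** A" using f by (auto simp: centralizer_mat_def)
    obtain A' where A': "det A' \<noteq> 0" "A ** A' = mat 1" "A' ** A = mat 1"
      "homography A \<circ> homography A' = id" "homography A' \<circ> homography A = id"
      by (rule homography_inverse[OF A(2)])
    have "A' ** (A ** B) ** A' = A' ** (B ** A) ** A'" using A(3) by simp
    then have "A' ** B = B ** A'" using A'(2,3) by (metis matrix_mul_assoc matrix_mul_lid matrix_mul_rid)
    moreover have "invf f = homography A'" using A(1) A'(4,5) by (metis inv_unique_comp)
    ultimately show ?thesis using A'(1) by (auto simp: centralizer_mat_def)
  qed
qed

lemma subgroup_centralizer_mat:
  assumes "det B \<noteq> 0"
  shows "subgroup (centralizer_mat B) PGLg"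
proof (rule PGLg.subgroupI)
  show "centralizer_mat B \<subseteq> carrier PGLg" using homography_PGL by (auto simp: centralizer_mat_def)
  then have P: "f \<in> PGL" if "f \<in> centralizer_mat B" for f using that by auto
  show "centralizer_mat B \<noteq> {}" using centralizer_mat_props(3)[OF assms] by blast
  show "inv\<^bsub>PGLg\<^esub> f \<in> centralizer_mat B" if "f \<in> centralizer_mat B" for f
    using centralizer_mat_props(5)[OF assms that] P[OF that] by simp
  show "f \<otimes>\<^bsub>PGLg\<^esub> g \<in> centralizer_mat B" if "f \<in> centralizer_mat B" "g \<in> centralizer_mat B" for f g
    using centralizer_mat_props(4)[OF assms that] by simp
qed

lemma subgroup_centralizer_PGL:
  assumes h: "h \<in> PGL"
  shows "subgroup (centralizer_PGL h) PGLg"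
proof (rule PGLg.subgroupI)
  show "inv\<^bsub>PGLg\<^esub> f \<in> centralizer_PGL h" if "f \<in> centralizer_PGL h" for f
  proof -
    have f: "f \<in> PGL" "f \<circ> h = h \<circ> f" using that by (auto simp: centralizer_PGL_def)
    have "invf f \<circ> (h \<circ> f) \<circ> invf f = invf f \<circ> (f \<circ> h) \<circ> invf f" using f(2) by simp
    then show ?thesis using f(1) by (simp add: centralizer_PGL_def comp_assoc)
  qed
  show "f \<otimes>\<^bsub>PGLg\<^esub> g \<in> centralizer_PGL h" if "f \<in> centralizer_PGL h" "g \<in> centralizer_PGL h" for f g
    using that by (auto simp: centralizer_PGL_def) (metis comp_assoc)
qed (auto simp: centralizer_PGL_def intro: exI[of _ id])

lemma subgroup_zpow: "h \<in> PGL \<Longrightarrow> subgroup (range (zpow h)) PGLg"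
proof (rule PGLg.subgroupI)
  assume h: "h \<in> PGL"
  show "range (zpow h) \<subseteq> carrier PGLg" using h by auto
  show "inv\<^bsub>PGLg\<^esub> f \<in> range (zpow h)" if f: "f \<in> range (zpow h)" for f
  proof -
    obtain k where "f = zpow h k" using f by blast
    then have "inv\<^bsub>PGLg\<^esub> f = zpow h (- k)" using h zpow_neg by simp
    then show ?thesis by blast
  qed
  show "f \<otimes>\<^bsub>PGLg\<^esub> g \<in> range (zpow h)" if fg: "f \<in> range (zpow h)" "g \<in> range (zpow h)" for f g
  proof -
    obtain j k where "f = zpow h j" "g = zpow h k" using fg by blast
    then have "f \<otimes>\<^bsub>PGLg\<^esub> g = zpow h (j + k)" using zpow_add[OF h] by simp
    then show ?thesis by blast
  qed
qed auto

section \<open>The action on a component\<close>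

text \<open>A component that is preserved by a subgroup with Property FW.\<close>

locale component = glued +
  fixes s0 C \<beta> h sx tx L
  assumes comp: "is_component s0 C \<beta> h sx tx"
    and L: "subgroup L G" "L \<subseteq> \<Gamma>" and FWL: "FW_subgroup G L"
    and pres: "\<gamma> \<in> L \<Longrightarrow> s \<in> C \<Longrightarrow> act \<gamma> s \<in> C"
begin

lemma component_facts:
  "s0 \<in> C" "LC (\<lambda>s. s \<in> C)" "\<forall>s t g. (s, t, g) \<in> Y \<longrightarrow> (s \<in> C \<longleftrightarrow> t \<in> C)"
  "\<forall>s. \<beta> s \<in> PGL" "LC \<beta>" "finite (range \<beta>)" "h \<in> PGL"
  "\<forall>q s B. flat q \<longrightarrow> s \<in> C \<longrightarrow> (B \<circ> \<beta> s0 \<in> q s0 \<longleftrightarrow> B \<circ> \<beta> s \<in> q s)"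
  "\<forall>s t g. (s, t, g) \<in> Y \<longrightarrow> s \<in> C \<longrightarrow> \<beta> t = \<beta> s \<circ> invf g \<or> h \<noteq> id \<and> ((s, t) = (sx, tx) \<or> (s, t) = (tx, sx))"
  "h \<noteq> id \<longrightarrow> (\<exists>g. (sx, tx, g) \<in> Y \<and> sx \<in> C \<and> \<beta> sx \<circ> invf g = h \<circ> \<beta> tx)"
  by (insert comp, unfold is_component_def, (elim conjE, assumption)+)

lemmas s0_C = component_facts(1) and C_LC = component_facts(2) and \<beta>_PGL [simp] = component_facts(4)[rule_format]
  and \<beta>_LC = component_facts(5) and \<beta>_fin = component_facts(6) and h_PGL [simp] = component_facts(7)
  and flat_glue = component_facts(9)[rule_format] and hol = component_facts(10)[rule_format]

lemma C_glue: "(s, t, g) \<in> Y \<Longrightarrow> s \<in> C \<longleftrightarrow> t \<in> C"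
  using component_facts(3) by blast

lemma conn: "flat q \<Longrightarrow> s \<in> C \<Longrightarrow> B \<circ> \<beta> s0 \<in> q s0 \<longleftrightarrow> B \<circ> \<beta> s \<in> q s"
  using component_facts(8) by blast

lemma L_\<Gamma> [simp]: "\<gamma> \<in> L \<Longrightarrow> \<gamma> \<in> \<Gamma>"
  using L(2) by blast

lemmas L_closed [simp] = subgroup_props(2-4)[OF L(1)]

lemma L_carrier: "\<gamma> \<in> L \<Longrightarrow> \<gamma> \<in> carrier G"
  by simp

lemma conn2: "flat q \<Longrightarrow> s \<in> C \<Longrightarrow> t \<in> C \<Longrightarrow> B \<circ> \<beta> s \<in> q s \<longleftrightarrow> B \<circ> \<beta> t \<in> q t"
  using conn by blast

lemma C_minimal:
  assumes "LC (\<lambda>s. s \<in> D)" "\<And>s t g. (s, t, g) \<in> Y \<Longrightarrow> s \<in> D \<longleftrightarrow> t \<in> D" "s \<in> C" "s \<in> D"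
  shows "C \<subseteq> D"
proof (rule component_minimal[OF comp _ assms(3,4)])
  show "saturated D" using assms(1,2) unfolding saturated_def by blast
qed

lemma trivial_germ_spreads:
  assumes "\<gamma> \<in> \<Gamma>" "s \<in> C" "gm \<gamma> s = id" "t \<in> C"
  shows "gm \<gamma> t = id"
proof -
  from conn2[OF flat_trivial_germ[OF assms(1)] assms(2,4), of id] assms(3) show ?thesis by (auto split: if_splits)
qed

text \<open>The exponent of the holonomy picked up by a gluing.\<close>

definition jump :: "side \<Rightarrow> side \<Rightarrow> int" where
  "jump s t = (if h = id then 0 else if (s, t) = (sx, tx) then 1 else if (s, t) = (tx, sx) then - 1 else 0)"

lemma glue_jump:
  assumes y: "(s, t, g) \<in> Y" and s: "s \<in> C"
  shows "\<beta> s \<circ> invf g = zpow h (jump s t) \<circ> \<beta> t"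
proof (cases "h \<noteq> id \<and> ((s, t) = (sx, tx) \<or> (s, t) = (tx, sx))")
  case False
  then have "\<beta> t = \<beta> s \<circ> invf g" "jump s t = 0" using flat_glue[OF y s] by (auto simp: jump_def)
  then show ?thesis by simp
next
  case True
  then obtain k where k: "(sx, tx, k) \<in> Y" "\<beta> sx \<circ> invf k = h \<circ> \<beta> tx" using hol by blast
  have kP: "k \<in> PGL" and ne: "sx \<noteq> tx" using Y_PGL Y_neq k(1) by blast+
  have j: "jump sx tx = 1" "jump tx sx = - 1" using True ne by (auto simp: jump_def)
  consider "s = sx" "t = tx" | "s = tx" "t = sx" using True by blast
  then show ?thesis
  proof cases
    case 1
    have "g = k" using Y_uniq[OF k(1) y[unfolded 1]] by (rule conjunct2)
    then show ?thesis using k(2) by (simp only: 1 j zpow_1 h_PGL)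
  next
    case 2
    have "g = invf k" using Y_uniq[OF Y_sym[OF k(1)] y[unfolded 2]] by (rule conjunct2)
    moreover have "\<beta> sx = h \<circ> \<beta> tx \<circ> k" using arg_cong[OF k(2), of "\<lambda>f. f \<circ> k"] kP by (simp add: comp_assoc)
    then have "invf h \<circ> \<beta> sx = \<beta> tx \<circ> k" by (simp add: comp_assoc)
    ultimately show ?thesis using kP zpow_neg[OF h_PGL, of 1] by (simp add: 2 j)
  qed
qed

text \<open>The germ of \<^term>\<open>\<gamma>\<close>, read in the gauge.\<close>

definition r :: "'a \<Rightarrow> side \<Rightarrow> real option \<Rightarrow> real option" where
  "r \<gamma> s = \<beta> (act \<gamma> s) \<circ> gm \<gamma> s \<circ> invf (\<beta> s)"

lemma r_PGL [simp]: "\<gamma> \<in> \<Gamma> \<Longrightarrow> r \<gamma> s \<in> PGL"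
  by (simp add: r_def)

lemma r_mult: "\<gamma> \<in> \<Gamma> \<Longrightarrow> \<delta> \<in> \<Gamma> \<Longrightarrow> r (\<gamma> \<otimes> \<delta>) s = r \<gamma> (act \<delta> s) \<circ> r \<delta> s"
  by (simp add: r_def gm_act act_mult comp_assoc)

lemma r_one [simp]: "r \<one> s = id"
  by (simp add: r_def)

lemma gm_r: "gm \<gamma> s = invf (\<beta> (act \<gamma> s)) \<circ> r \<gamma> s \<circ> \<beta> s"
  by (simp add: r_def comp_assoc)

text \<open>Continuation across a gluing permutes the coordinates of the form \<open>g \<circ> h\<^sup>k \<circ> \<beta>\<close>: the
  exponent changes by \<open>1\<close> or \<open>- 1\<close> at the exceptional gluing, and by \<open>0\<close> at the others in the component.\<close>

lemma flat_orbit: "flat (\<lambda>s. {B. s \<in> C \<and> (\<exists>k. B = g \<circ> zpow h k \<circ> \<beta> s)})"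
  unfolding flat_def
proof (intro conjI allI impI)
  from LC_map2[OF C_LC \<beta>_LC, of "\<lambda>P b. {B. P \<and> (\<exists>k. B = g \<circ> zpow h k \<circ> b)}"]
  show "LC (\<lambda>s. {B. s \<in> C \<and> (\<exists>k. B = g \<circ> zpow h k \<circ> \<beta> s)})" .
  have imp: "\<exists>k. B \<circ> invf f = g \<circ> zpow h k \<circ> \<beta> t" if y: "(s, t, f) \<in> Y" "s \<in> C" "B = g \<circ> zpow h k \<circ> \<beta> s" for s t f B k
  proof -
    have "B \<circ> invf f = g \<circ> zpow h k \<circ> (\<beta> s \<circ> invf f)" by (simp add: y(3) comp_assoc)
    also have "\<dots> = g \<circ> zpow h (k + jump s t) \<circ> \<beta> t" by (simp add: glue_jump[OF y(1,2)] zpow_add comp_assoc)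
    finally show ?thesis by blast
  qed
  fix s t f and B :: "real option \<Rightarrow> real option" assume y: "(s, t, f) \<in> Y"
  have "B = (B \<circ> invf f) \<circ> invf (invf f)" using Y_PGL[OF y] by (simp add: comp_assoc)
  then show "B \<in> {B. s \<in> C \<and> (\<exists>k. B = g \<circ> zpow h k \<circ> \<beta> s)} \<longleftrightarrow>
      B \<circ> invf f \<in> {B. t \<in> C \<and> (\<exists>k. B = g \<circ> zpow h k \<circ> \<beta> t)}"
    using imp[OF y] imp[OF Y_sym[OF y], of "B \<circ> invf f"] C_glue[OF y]
    by (simp only: mem_Collect_eq) metis
qed

text \<open>Both \<open>\<beta>\<close> and its transport by \<^term>\<open>\<gamma>\<close> are projective coordinates of the component, so
  continuation from a side to another relates them in the same way up to holonomy.\<close>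

lemma r_const_mod_h:
  assumes g: "\<gamma> \<in> L" and s: "s \<in> C" and t: "t \<in> C"
  shows "\<exists>k. r \<gamma> s = zpow h k \<circ> r \<gamma> t"
proof -
  have "\<exists>k. r \<gamma> s0 = zpow h k \<circ> r \<gamma> s" if s: "s \<in> C" for s
  proof -
    let ?q = "\<lambda>s. {B. s \<in> C \<and> (\<exists>k. B = invf (r \<gamma> s0) \<circ> zpow h k \<circ> \<beta> s)}"
    let ?q' = "\<lambda>s. {B. B \<circ> invf (gm \<gamma> s) \<in> ?q (act \<gamma> s)}"
    have fl: "flat ?q'" using flat_translate[OF flat_orbit] g by simp
    have "\<beta> s0 \<circ> invf (gm \<gamma> s0) = invf (r \<gamma> s0) \<circ> zpow h 0 \<circ> \<beta> (act \<gamma> s0)"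
      using g by (simp add: r_def PGL_group_simps)
    then have "id \<circ> \<beta> s0 \<in> ?q' s0" using pres[OF g s0_C] by (simp only: id_comp mem_Collect_eq) blast
    then have "id \<circ> \<beta> s \<in> ?q' s" using conn[OF fl s] by blast
    then obtain k where k: "\<beta> s \<circ> invf (gm \<gamma> s) = invf (r \<gamma> s0) \<circ> zpow h k \<circ> \<beta> (act \<gamma> s)" by auto
    have "invf (r \<gamma> s) = invf (r \<gamma> s0) \<circ> zpow h k"
      using arg_cong[OF k, of "\<lambda>f. f \<circ> invf (\<beta> (act \<gamma> s))"] g
      by (simp add: r_def[of \<gamma> s] PGL_group_simps)
    then have "invf (invf (r \<gamma> s)) = invf (zpow h k) \<circ> r \<gamma> s0" using g by (simp add: invf_comp)
    then have "r \<gamma> s = invf (zpow h k) \<circ> r \<gamma> s0" using g by simp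
    then have "r \<gamma> s0 = zpow h k \<circ> r \<gamma> s" by simp
    then show ?thesis by blast
  qed
  then obtain j k where "r \<gamma> s0 = zpow h j \<circ> r \<gamma> s" "r \<gamma> s0 = zpow h k \<circ> r \<gamma> t" using s t by metis
  then have "invf (zpow h j) \<circ> (zpow h j \<circ> r \<gamma> s) = invf (zpow h j) \<circ> (zpow h k \<circ> r \<gamma> t)" by metis
  then have "r \<gamma> s = zpow h (- j) \<circ> zpow h k \<circ> r \<gamma> t" by (simp add: zpow_neg comp_assoc)
  then have "r \<gamma> s = zpow h (- j + k) \<circ> r \<gamma> t" by (simp only: zpow_add h_PGL)
  then show ?thesis by blast
qed

text \<open>Without holonomy this is the projective transformation by which \<^term>\<open>\<gamma>\<close> acts on the developed
  component; in general it is defined up to powers of \<^term>\<open>h\<close>.\<close>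

definition R :: "'a \<Rightarrow> real option \<Rightarrow> real option" where
  "R \<gamma> = r \<gamma> s0"

lemma R_PGL [simp]: "\<gamma> \<in> \<Gamma> \<Longrightarrow> R \<gamma> \<in> PGL"
  by (simp add: R_def)

lemma R_one [simp]: "R \<one> = id"
  by (simp add: R_def)

lemma R_mult:
  assumes "\<gamma> \<in> L" "\<delta> \<in> L"
  shows "\<exists>k. R (\<gamma> \<otimes> \<delta>) = zpow h k \<circ> R \<gamma> \<circ> R \<delta>"
proof -
  obtain k where "r \<gamma> (act \<delta> s0) = zpow h k \<circ> r \<gamma> s0"
    using r_const_mod_h[OF assms(1) pres[OF assms(2) s0_C] s0_C] by blast
  then show ?thesis using assms by (auto simp: R_def r_mult)
qed

lemma R_inv:
  assumes "\<gamma> \<in> L"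
  shows "\<exists>k. R (inv \<gamma>) = zpow h k \<circ> invf (R \<gamma>)"
proof -
  obtain k where "R (inv \<gamma> \<otimes> \<gamma>) = zpow h k \<circ> R (inv \<gamma>) \<circ> R \<gamma>" using R_mult assms by (metis L_closed(2))
  then have "id = zpow h k \<circ> R (inv \<gamma>) \<circ> R \<gamma>" using assms L_carrier by simp
  then have "invf (zpow h k) \<circ> id \<circ> invf (R \<gamma>) = invf (zpow h k) \<circ> (zpow h k \<circ> R (inv \<gamma>) \<circ> R \<gamma>) \<circ> invf (R \<gamma>)" by simp
  then have "R (inv \<gamma>) = zpow h (- k) \<circ> invf (R \<gamma>)" using assms by (simp add: zpow_neg comp_assoc)
  then show ?thesis by blast
qed

text \<open>Going once around the circle is a loop, which the group maps to loops.\<close>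

lemma loop_flat:
  assumes q: "flat q"
  shows "B \<circ> \<beta> s0 \<in> q s0 \<longleftrightarrow> B \<circ> h \<circ> \<beta> s0 \<in> q s0"
proof (cases "h = id")
  case False
  then obtain g where y: "(sx, tx, g) \<in> Y" "sx \<in> C" "\<beta> sx \<circ> invf g = h \<circ> \<beta> tx" using hol by blast
  have "tx \<in> C" using C_glue[OF y(1)] y(2) by blast
  have "B \<circ> \<beta> s0 \<in> q s0 \<longleftrightarrow> B \<circ> \<beta> sx \<in> q sx" using conn[OF q y(2)] .
  also have "\<dots> \<longleftrightarrow> (B \<circ> \<beta> sx) \<circ> invf g \<in> q tx" using flatD[OF q y(1)] .
  also have "(B \<circ> \<beta> sx) \<circ> invf g = (B \<circ> h) \<circ> \<beta> tx" using y(3) by (simp add: comp_assoc)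
  also have "\<dots> \<in> q tx \<longleftrightarrow> B \<circ> h \<circ> \<beta> s0 \<in> q s0" using conn[OF q \<open>tx \<in> C\<close>] by simp
  finally show ?thesis .
qed simp

lemma R_normalizes:
  assumes g: "\<gamma> \<in> L"
  shows "\<exists>k. R \<gamma> \<circ> h = zpow h k \<circ> R \<gamma>"
proof -
  let ?q = "\<lambda>s. {B. s \<in> C \<and> (\<exists>k. B = invf (R \<gamma>) \<circ> zpow h k \<circ> \<beta> s)}"
  let ?q' = "\<lambda>s. {B. B \<circ> invf (gm \<gamma> s) \<in> ?q (act \<gamma> s)}"
  have fl: "flat ?q'" using flat_translate[OF flat_orbit] g by simp
  have eq: "\<beta> s0 \<circ> invf (gm \<gamma> s0) = invf (R \<gamma>) \<circ> \<beta> (act \<gamma> s0)"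
    using g by (simp add: R_def r_def PGL_group_simps)
  then have "\<beta> s0 \<circ> invf (gm \<gamma> s0) = invf (R \<gamma>) \<circ> zpow h 0 \<circ> \<beta> (act \<gamma> s0)" by simp
  then have "id \<circ> \<beta> s0 \<in> ?q' s0" using pres[OF g s0_C] by (simp only: id_comp mem_Collect_eq) blast
  then have "id \<circ> h \<circ> \<beta> s0 \<in> ?q' s0" using loop_flat[OF fl] by blast
  then obtain k where k: "h \<circ> \<beta> s0 \<circ> invf (gm \<gamma> s0) = invf (R \<gamma>) \<circ> zpow h k \<circ> \<beta> (act \<gamma> s0)" by auto
  have "h \<circ> (\<beta> s0 \<circ> invf (gm \<gamma> s0)) \<circ> invf (\<beta> (act \<gamma> s0)) = invf (R \<gamma>) \<circ> zpow h k"
    using k by (simp add: comp_assoc[symmetric]) (simp add: comp_assoc)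
  then have "h \<circ> invf (R \<gamma>) = invf (R \<gamma>) \<circ> zpow h k" unfolding eq by (simp add: comp_assoc)
  then have "R \<gamma> \<circ> (h \<circ> invf (R \<gamma>)) \<circ> R \<gamma> = R \<gamma> \<circ> (invf (R \<gamma>) \<circ> zpow h k) \<circ> R \<gamma>" by simp
  then have "R \<gamma> \<circ> h = zpow h k \<circ> R \<gamma>" using g by (simp add: comp_assoc)
  then show ?thesis by blast
qed

lemma R_normalizes_inv:
  assumes g: "\<gamma> \<in> L"
  shows "\<exists>k. h \<circ> R \<gamma> = R \<gamma> \<circ> zpow h k"
proof -
  obtain k where k: "R (inv \<gamma>) \<circ> h = zpow h k \<circ> R (inv \<gamma>)" using R_normalizes g by (metis L_closed(2))
  obtain j where j: "R (inv \<gamma>) = zpow h j \<circ> invf (R \<gamma>)" using R_inv[OF g] by blast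
  have zz: "zpow h (- j) \<circ> (zpow h i \<circ> f) = zpow h (i - j) \<circ> f" for i f
    using zpow_add[OF h_PGL, of "- j" i] by (simp add: comp_assoc[symmetric])
  have "zpow h (- j) \<circ> (zpow h j \<circ> (invf (R \<gamma>) \<circ> h)) = zpow h (- j) \<circ> (zpow h k \<circ> (zpow h j \<circ> invf (R \<gamma>)))"
    using k unfolding j by (simp add: comp_assoc)
  then have "invf (R \<gamma>) \<circ> h = zpow h (k - j) \<circ> (zpow h j \<circ> invf (R \<gamma>))" unfolding zz by simp
  then have "invf (R \<gamma>) \<circ> h = zpow h k \<circ> invf (R \<gamma>)"
    using zpow_add[OF h_PGL, of "k - j" j] by (simp add: comp_assoc[symmetric])
  then have "R \<gamma> \<circ> (invf (R \<gamma>) \<circ> h) \<circ> R \<gamma> = R \<gamma> \<circ> (zpow h k \<circ> invf (R \<gamma>)) \<circ> R \<gamma>" by simp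
  then have "h \<circ> R \<gamma> = R \<gamma> \<circ> zpow h k" using g by (simp add: comp_assoc)
  then show ?thesis by blast
qed

text \<open>As \<open>R\<close> is a homomorphism only modulo powers of \<open>h\<close>, preimages are taken of subgroups that
  contain them.\<close>

lemma subgroup_R_preimage:
  assumes D: "subgroup D PGLg" "range (zpow h) \<subseteq> D"
  shows "subgroup {\<gamma> \<in> L. R \<gamma> \<in> D} G"
proof (rule subgroupI)
  note Dp = PGLg.subgroup_props[OF D(1), simplified]
  have z: "zpow h k \<in> D" for k using D(2) by blast
  show "{\<gamma> \<in> L. R \<gamma> \<in> D} \<subseteq> carrier G" using L_carrier by blast
  show "{\<gamma> \<in> L. R \<gamma> \<in> D} \<noteq> {}" using Dp(4) by (auto intro!: exI[of _ \<one>])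
  fix a assume a: "a \<in> {\<gamma> \<in> L. R \<gamma> \<in> D}"
  obtain k where "R (inv a) = zpow h k \<circ> invf (R a)" using R_inv a by blast
  moreover have "inv\<^bsub>PGLg\<^esub> R a \<in> D" using Dp(3) a by blast
  then have "invf (R a) \<in> D" using a by simp
  ultimately show "inv a \<in> {\<gamma> \<in> L. R \<gamma> \<in> D}" using Dp(2) z a by simp
  fix b assume b: "b \<in> {\<gamma> \<in> L. R \<gamma> \<in> D}"
  obtain k where "R (a \<otimes> b) = zpow h k \<circ> R a \<circ> R b" using R_mult a b by blast
  then show "a \<otimes> b \<in> {\<gamma> \<in> L. R \<gamma> \<in> D}" using Dp(2) z a b by simp
qed

lemma R_commutator:
  assumes g: "\<gamma> \<in> L" and d: "\<delta> \<in> L"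
  shows "\<exists>i j. R (\<gamma> \<otimes> \<delta> \<otimes> inv (\<delta> \<otimes> \<gamma>)) = zpow h i \<circ> (R \<gamma> \<circ> R \<delta> \<circ> invf (R \<delta> \<circ> R \<gamma>)) \<circ> zpow h j"
proof -
  let ?c = "\<gamma> \<otimes> \<delta> \<otimes> inv (\<delta> \<otimes> \<gamma>)"
  have cL: "?c \<in> L" "\<delta> \<otimes> \<gamma> \<in> L" using g d by simp_all
  obtain k where k: "R (\<gamma> \<otimes> \<delta>) = zpow h k \<circ> R \<gamma> \<circ> R \<delta>" using R_mult g d by blast
  obtain m where m: "R (\<delta> \<otimes> \<gamma>) = zpow h m \<circ> R \<delta> \<circ> R \<gamma>" using R_mult g d by blast
  obtain l where l: "R (?c \<otimes> (\<delta> \<otimes> \<gamma>)) = zpow h l \<circ> R ?c \<circ> R (\<delta> \<otimes> \<gamma>)" using R_mult cL by blast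
  have "?c \<otimes> (\<delta> \<otimes> \<gamma>) = \<gamma> \<otimes> \<delta>" using g d L_carrier by (simp add: m_assoc)
  then have e: "zpow h k \<circ> R \<gamma> \<circ> R \<delta> = zpow h l \<circ> R ?c \<circ> (zpow h m \<circ> R \<delta> \<circ> R \<gamma>)" using k l m by simp
  have "invf (zpow h l) \<circ> (zpow h k \<circ> R \<gamma> \<circ> R \<delta>) \<circ> invf (R \<delta> \<circ> R \<gamma>) \<circ> invf (zpow h m) = R ?c"
    unfolding e using g d cL by (simp add: PGL_group_simps)
  then have "R ?c = zpow h (- l) \<circ> zpow h k \<circ> (R \<gamma> \<circ> R \<delta> \<circ> invf (R \<delta> \<circ> R \<gamma>)) \<circ> zpow h (- m)"
    by (simp add: zpow_neg comp_assoc)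
  then have "R ?c = zpow h (- l + k) \<circ> (R \<gamma> \<circ> R \<delta> \<circ> invf (R \<delta> \<circ> R \<gamma>)) \<circ> zpow h (- m)"
    by (simp only: zpow_add h_PGL)
  then show ?thesis by blast
qed

text \<open>The automorphisms of a cyclic group commute with each other.\<close>

lemma commutator_centralizes:
  assumes g: "\<gamma> \<in> L" and d: "\<delta> \<in> L"
  shows "R \<gamma> \<circ> R \<delta> \<circ> invf (R \<delta> \<circ> R \<gamma>) \<in> centralizer_PGL h"
proof -
  obtain k where k: "R \<gamma> \<circ> h = zpow h k \<circ> R \<gamma>" using R_normalizes[OF g] by blast
  obtain l where l: "R \<delta> \<circ> h = zpow h l \<circ> R \<delta>" using R_normalizes[OF d] by blast
  obtain k' where k': "h \<circ> R \<gamma> = R \<gamma> \<circ> zpow h k'" using R_normalizes_inv[OF g] by blast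
  obtain l' where l': "h \<circ> R \<delta> = R \<delta> \<circ> zpow h l'" using R_normalizes_inv[OF d] by blast
  define M N where "M = R \<gamma> \<circ> R \<delta>" and "N = R \<delta> \<circ> R \<gamma>"
  have P: "R \<gamma> \<in> PGL" "R \<delta> \<in> PGL" "M \<in> PGL" "N \<in> PGL" using g d by (simp_all add: M_def N_def)
  have conj: "R \<gamma> \<circ> zpow h n = zpow h (k * n) \<circ> R \<gamma>" "R \<delta> \<circ> zpow h n = zpow h (l * n) \<circ> R \<delta>" for n
    using zpow_conj[OF P(1) h_PGL _ k] zpow_conj[OF P(2) h_PGL _ l] by (simp_all add: zpow_zpow)
  have M: "M \<circ> zpow h n = zpow h (k * l * n) \<circ> M" for n
    unfolding M_def by (metis comp_assoc conj mult.assoc)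
  have N: "N \<circ> zpow h n = zpow h (k * l * n) \<circ> N" for n
    unfolding N_def by (metis comp_assoc conj mult.assoc mult.commute)
  have "h \<circ> N = R \<delta> \<circ> (zpow h l' \<circ> R \<gamma>)" unfolding N_def using l' by (metis comp_assoc)
  also have "zpow h l' \<circ> R \<gamma> = R \<gamma> \<circ> zpow h (k' * l')"
  proof -
    have "invf (R \<gamma>) \<circ> h = zpow h k' \<circ> invf (R \<gamma>)"
    proof -
      have "invf (R \<gamma>) \<circ> (h \<circ> R \<gamma>) \<circ> invf (R \<gamma>) = invf (R \<gamma>) \<circ> (R \<gamma> \<circ> zpow h k') \<circ> invf (R \<gamma>)" using k' by simp
      then show ?thesis using P(1) by (simp add: comp_assoc)
    qed
    then have "invf (R \<gamma>) \<circ> zpow h l' = zpow h (k' * l') \<circ> invf (R \<gamma>)"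
      using zpow_conj[of "invf (R \<gamma>)" h "zpow h k'" l'] P(1) by (simp add: zpow_zpow)
    then have "R \<gamma> \<circ> (invf (R \<gamma>) \<circ> zpow h l') \<circ> R \<gamma> = R \<gamma> \<circ> (zpow h (k' * l') \<circ> invf (R \<gamma>)) \<circ> R \<gamma>" by simp
    then show ?thesis using P(1) by (simp add: comp_assoc)
  qed
  also have "R \<delta> \<circ> (R \<gamma> \<circ> zpow h (k' * l')) = N \<circ> zpow h (k' * l')" by (simp add: N_def comp_assoc)
  finally have hN: "h \<circ> N = N \<circ> zpow h (k' * l')" .
  then have "h \<circ> N = zpow h (k * l * (k' * l')) \<circ> N" using N by simp
  then have h: "h = zpow h (k * l * (k' * l'))" using PGL_right_cancel[OF P(4)] by blast
  have "(M \<circ> invf N) \<circ> h = M \<circ> zpow h (k' * l') \<circ> invf N"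
  proof -
    have "invf N \<circ> (h \<circ> N) \<circ> invf N = invf N \<circ> (N \<circ> zpow h (k' * l')) \<circ> invf N" using hN by simp
    then have "invf N \<circ> h = zpow h (k' * l') \<circ> invf N" using P(4) by (simp add: comp_assoc)
    then show ?thesis by (simp add: comp_assoc)
  qed
  also have "\<dots> = zpow h (k * l * (k' * l')) \<circ> M \<circ> invf N" using M by simp
  also have "\<dots> = h \<circ> (M \<circ> invf N)" using h by (simp add: comp_assoc)
  finally show ?thesis using P unfolding centralizer_PGL_def M_def N_def by simp
qed

text \<open>\<open>R\<close> takes values in the normalizer of the cyclic group generated by \<open>h\<close>, which is
  solvable as \<open>h\<close> is not trivial.\<close>

lemma R_in_powers_fin_index:
  assumes nid: "h \<noteq> id"
  shows "subgroup {\<gamma> \<in> L. R \<gamma> \<in> range (zpow h)} G" "fin_index G {\<gamma> \<in> L. R \<gamma> \<in> range (zpow h)} L"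
proof -
  obtain B where B: "det B \<noteq> 0" "h = homography B" using h_PGL by (auto simp: PGL_def)
  define D0 D1 D2 where "D0 = centralizer_PGL h" and "D1 = centralizer_mat B" and "D2 = range (zpow h)"
  have s: "subgroup D0 PGLg" "subgroup D1 PGLg" "subgroup D2 PGLg"
    using subgroup_centralizer_PGL[OF h_PGL] subgroup_centralizer_mat[OF B(1)] subgroup_zpow[OF h_PGL]
    by (simp_all add: D0_def D1_def D2_def)
  have "h \<in> D1" using centralizer_mat_props(2)[OF B(1)] B(2) by (simp add: D1_def)
  then have sub: "D2 \<subseteq> D1" using PGLg.subgroup_int_pow_closed[OF s(2)] by (auto simp: D2_def)
  have sub2: "D1 \<subseteq> D0" using centralizer_mat_props(1)[OF B(1)] B(2) by (simp add: D0_def D1_def)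
  define N where "N D = {\<gamma> \<in> L. R \<gamma> \<in> D}" for D
  have NL: "N D \<subseteq> L" for D by (auto simp: N_def)
  have sN: "subgroup (N D0) G" "subgroup (N D1) G" "subgroup (N D2) G"
    using subgroup_R_preimage s sub sub2 unfolding N_def D2_def by blast+
  have comm: "\<gamma> \<otimes> \<delta> \<otimes> inv (\<delta> \<otimes> \<gamma>) \<in> N D"
    if c: "\<gamma> \<in> L" "\<delta> \<in> L" "R \<gamma> \<circ> R \<delta> \<circ> invf (R \<delta> \<circ> R \<gamma>) \<in> D" "subgroup D PGLg" "D2 \<subseteq> D" for \<gamma> \<delta> D
  proof -
    obtain i j where ij: "R (\<gamma> \<otimes> \<delta> \<otimes> inv (\<delta> \<otimes> \<gamma>)) = zpow h i \<circ> (R \<gamma> \<circ> R \<delta> \<circ> invf (R \<delta> \<circ> R \<gamma>)) \<circ> zpow h j"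
      using R_commutator[OF c(1,2)] by blast
    have "zpow h i \<in> D" "zpow h j \<in> D" using c(5) by (auto simp: D2_def)
    then have "R (\<gamma> \<otimes> \<delta> \<otimes> inv (\<delta> \<otimes> \<gamma>)) \<in> D"
      unfolding ij using PGLg.subgroup_props(2)[OF c(4), simplified] c(3) by blast
    then show ?thesis using c(1,2) by (simp add: N_def)
  qed
  have f0: "fin_index G (N D0) L"
    using FW_commutators_fin_index[OF L(1) FWL sN(1) NL] comm commutator_centralizes s(1) sub sub2
    unfolding D0_def by blast
  have fw0: "FW_subgroup G (N D0)" using FW_fin_index[OF L(1) FWL sN(1) NL f0] .
  have "N D1 \<subseteq> N D0" using sub2 by (auto simp: N_def)
  then have f1: "fin_index G (N D1) (N D0)"
  proof (rule FW_commutators_fin_index[OF sN(1) fw0 sN(2)])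
    fix x y assume "x \<in> N D0" "y \<in> N D0"
    then show "x \<otimes> y \<otimes> inv (y \<otimes> x) \<in> N D1"
      using comm[OF _ _ _ s(2) sub] centralizer_commutator[OF B(1)] B(2) by (simp add: N_def D0_def D1_def)
  qed
  have fw1: "FW_subgroup G (N D1)" using FW_fin_index[OF sN(1) fw0 sN(2) \<open>N D1 \<subseteq> N D0\<close> f1] .
  have "N D2 \<subseteq> N D1" using sub by (auto simp: N_def)
  then have f2: "fin_index G (N D2) (N D1)"
  proof (rule FW_commutators_fin_index[OF sN(2) fw1 sN(3)])
    fix x y assume xy: "x \<in> N D1" "y \<in> N D1"
    then have "R x \<circ> R y = R y \<circ> R x"
      using centralizer_mat_abelian[of B "R x" "R y"] nid B by (simp add: N_def D1_def)
    then have "R x \<circ> R y \<circ> invf (R y \<circ> R x) = id" using xy by (simp add: N_def)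
    moreover have "id \<in> D2" using PGLg.subgroup_props(4)[OF s(3)] by simp
    ultimately show "x \<otimes> y \<otimes> inv (y \<otimes> x) \<in> N D2" using comm[OF _ _ _ s(3)] xy by (simp add: N_def)
  qed
  have "fin_index G (N D2) (N D0)"
    using fin_index_trans[OF f2 f1 subgroup.subset[OF sN(1)] \<open>N D1 \<subseteq> N D0\<close> sN(1)] .
  then have "fin_index G (N D2) L"
    using fin_index_trans[OF _ f0 subgroup.subset[OF L(1)] NL L(1)] by blast
  then show "fin_index G {\<gamma> \<in> L. R \<gamma> \<in> range (zpow h)} L" "subgroup {\<gamma> \<in> L. R \<gamma> \<in> range (zpow h)} G"
    using sN(3) by (simp_all add: N_def D2_def)
qed

text \<open>The germ at \<^term>\<open>s0\<close> is recovered from \<open>R \<gamma>\<close> and the gauge at the image of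
  \<^term>\<open>s0\<close>, and the gauge takes finitely many values.\<close>

lemma finite_germs:
  assumes "S \<subseteq> \<Gamma>" "finite Q" "\<And>\<gamma>. \<gamma> \<in> S \<Longrightarrow> R \<gamma> \<in> Q"
  shows "finite ((\<lambda>\<gamma>. gm \<gamma> s0) ` S)"
proof (rule finite_subset)
  show "(\<lambda>\<gamma>. gm \<gamma> s0) ` S \<subseteq> (\<lambda>(b, x). invf b \<circ> x \<circ> \<beta> s0) ` (range \<beta> \<times> Q)"
  proof
    fix f assume "f \<in> (\<lambda>\<gamma>. gm \<gamma> s0) ` S"
    then obtain \<gamma> where g: "\<gamma> \<in> S" "f = gm \<gamma> s0" by blast
    have "f = invf (\<beta> (act \<gamma> s0)) \<circ> R \<gamma> \<circ> \<beta> s0" using g(2) gm_r by (simp add: R_def)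
    then have "f = (\<lambda>(b, x). invf b \<circ> x \<circ> \<beta> s0) (\<beta> (act \<gamma> s0), R \<gamma>)" by simp
    moreover have "(\<beta> (act \<gamma> s0), R \<gamma>) \<in> range \<beta> \<times> Q" using assms(3)[OF g(1)] by blast
    ultimately show "f \<in> (\<lambda>(b, x). invf b \<circ> x \<circ> \<beta> s0) ` (range \<beta> \<times> Q)" by (rule image_eqI)
  qed
  show "finite ((\<lambda>(b, x). invf b \<circ> x \<circ> \<beta> s0) ` (range \<beta> \<times> Q))" using \<beta>_fin assms(2) by simp
qed

end

context component
begin

lemma LC_r: "\<gamma> \<in> \<Gamma> \<Longrightarrow> LC (r \<gamma>)"
  using LC_map2[OF LC_map2[OF LC_act[OF \<beta>_LC] gm_LC] \<beta>_LC, of \<gamma> \<gamma> "\<lambda>x b. x \<circ> invf b" "\<lambda>a b. a \<circ> b"]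
  by (simp add: r_def[abs_def])

lemma r_glue:
  assumes g: "\<gamma> \<in> L" and y: "(s, t, f) \<in> Y" and s: "s \<in> C"
  shows "r \<gamma> s = zpow h (jump (act \<gamma> s) (act \<gamma> t)) \<circ> r \<gamma> t \<circ> zpow h (- jump s t)"
proof -
  have g': "\<gamma> \<in> \<Gamma>" using g by simp
  let ?j = "jump (act \<gamma> s) (act \<gamma> t)"
  have f: "f \<in> PGL" using Y_PGL[OF y] .
  have "\<beta> (act \<gamma> s) \<circ> invf (gm \<gamma> t \<circ> f \<circ> invf (gm \<gamma> s)) = zpow h ?j \<circ> \<beta> (act \<gamma> t)"
    by (rule glue_jump[OF Y_inv[OF g' y] pres[OF g s]])
  then have "\<beta> (act \<gamma> s) \<circ> gm \<gamma> s \<circ> invf f \<circ> invf (gm \<gamma> t) = zpow h ?j \<circ> \<beta> (act \<gamma> t)"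
    using f g' by (simp add: PGL_group_simps)
  then have "\<beta> (act \<gamma> s) \<circ> gm \<gamma> s \<circ> invf f \<circ> invf (gm \<gamma> t) \<circ> gm \<gamma> t \<circ> f = zpow h ?j \<circ> \<beta> (act \<gamma> t) \<circ> gm \<gamma> t \<circ> f"
    by simp
  then have 1: "\<beta> (act \<gamma> s) \<circ> gm \<gamma> s = zpow h ?j \<circ> \<beta> (act \<gamma> t) \<circ> gm \<gamma> t \<circ> f"
    using f g' by (simp add: comp_assoc)
  have "invf (\<beta> s \<circ> invf f) = invf (zpow h (jump s t) \<circ> \<beta> t)" using glue_jump[OF y s] by simp
  then have 2: "f \<circ> invf (\<beta> s) = invf (\<beta> t) \<circ> zpow h (- jump s t)" using f by (simp add: invf_comp zpow_neg)
  have "r \<gamma> s = zpow h ?j \<circ> \<beta> (act \<gamma> t) \<circ> gm \<gamma> t \<circ> (f \<circ> invf (\<beta> s))"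
    unfolding r_def 1 by (simp add: comp_assoc)
  then show ?thesis unfolding 2 by (simp add: r_def comp_assoc)
qed

text \<open>Suppose that all \<open>R \<gamma>\<close> are powers of \<open>h\<close>, of infinite order. Then \<open>\<gamma>\<close> acts on the line that
  unrolls the circle \<open>C\<close>, and \<open>r \<gamma> s = h\<^sup>\<kappa>\<close> where \<open>\<kappa>\<close> counts the turns that the
  point over \<open>s\<close> makes. It varies by at most 4 with \<open>s\<close>: the only jumps occur at the exceptional
  gluing and at its preimage. The points of the line with the same projective coordinate as
  \<open>s0\<close> form a set that is discrete and invariant, and the group commensurates its upper half. Hence
  no element can move all points in the same direction.\<close>

context
  assumes powers: "\<And>\<gamma>. \<gamma> \<in> L \<Longrightarrow> R \<gamma> \<in> range (zpow h)"
    and inj: "inj (zpow h)"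
begin

definition \<kappa> :: "'a \<Rightarrow> side \<Rightarrow> int" where
  "\<kappa> \<gamma> s = inv_into UNIV (zpow h) (r \<gamma> s)"

lemma r_kappa:
  assumes g: "\<gamma> \<in> L" and s: "s \<in> C"
  shows "r \<gamma> s = zpow h (\<kappa> \<gamma> s)"
proof -
  obtain k where "r \<gamma> s = zpow h k \<circ> R \<gamma>" using r_const_mod_h[OF g s s0_C] by (auto simp: R_def)
  moreover obtain j where "R \<gamma> = zpow h j" using powers[OF g] by blast
  ultimately have "r \<gamma> s = zpow h (k + j)" by (simp add: zpow_add)
  then have "r \<gamma> s \<in> range (zpow h)" by blast
  then show ?thesis unfolding \<kappa>_def by (simp add: f_inv_into_f)
qed

lemma zpow_eq: "zpow h i = zpow h j \<longleftrightarrow> i = j"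
  using inj by (simp add: inj_eq)

lemma kappa_mult:
  assumes "\<gamma> \<in> L" "\<delta> \<in> L" "s \<in> C"
  shows "\<kappa> (\<gamma> \<otimes> \<delta>) s = \<kappa> \<gamma> (act \<delta> s) + \<kappa> \<delta> s"
proof -
  have "zpow h (\<kappa> (\<gamma> \<otimes> \<delta>) s) = r (\<gamma> \<otimes> \<delta>) s" using r_kappa assms by simp
  also have "\<dots> = zpow h (\<kappa> \<gamma> (act \<delta> s)) \<circ> zpow h (\<kappa> \<delta> s)"
    using r_mult[of \<gamma> \<delta> s] assms r_kappa[OF assms(1) pres[OF assms(2,3)]] r_kappa[OF assms(2,3)] by simp
  finally show ?thesis using zpow_eq zpow_add by (metis h_PGL)
qed

lemma kappa_one: "s \<in> C \<Longrightarrow> \<kappa> \<one> s = 0"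
  using r_kappa[of \<one> s] zpow_eq[of "\<kappa> \<one> s" 0] by simp

lemma kappa_glue:
  assumes g: "\<gamma> \<in> L" and y: "(s, t, f) \<in> Y" and s: "s \<in> C"
  shows "\<kappa> \<gamma> s = \<kappa> \<gamma> t + jump (act \<gamma> s) (act \<gamma> t) - jump s t"
proof -
  have t: "t \<in> C" using C_glue[OF y] s by blast
  have "zpow h (\<kappa> \<gamma> s) = zpow h (jump (act \<gamma> s) (act \<gamma> t)) \<circ> zpow h (\<kappa> \<gamma> t) \<circ> zpow h (- jump s t)"
    using r_glue[OF g y s] r_kappa[OF g s] r_kappa[OF g t] by simp
  then have "zpow h (\<kappa> \<gamma> s) = zpow h (jump (act \<gamma> s) (act \<gamma> t) + \<kappa> \<gamma> t + - jump s t)"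
    by (simp only: zpow_add[OF h_PGL])
  then show ?thesis unfolding zpow_eq by linarith
qed

lemma jump_eq_0: "\<not> ((s, t) = (sx, tx) \<or> (s, t) = (tx, sx)) \<Longrightarrow> jump s t = 0"
  by (auto simp: jump_def)

lemma jump_bound: "\<bar>jump s t\<bar> \<le> 1"
  by (simp add: jump_def)

lemma kappa_variation:
  assumes g: "\<gamma> \<in> L" and s: "s \<in> C" and t: "t \<in> C"
  shows "\<kappa> \<gamma> s \<le> \<kappa> \<gamma> t + 4"
proof -
  have g': "\<gamma> \<in> \<Gamma>" using g by simp
  have "h \<noteq> id"
  proof
    assume "h = id"
    then have "zpow h 1 = zpow h 0" by simp
    then show False unfolding zpow_eq by simp
  qed
  then obtain f where y: "(sx, tx, f) \<in> Y" "sx \<in> C" using hol by blast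
  have tx: "tx \<in> C" using C_glue[OF y(1)] y(2) by blast
  define s' t' where "s' = act (inv \<gamma>) sx" and "t' = act (inv \<gamma>) tx"
  have C': "s' \<in> C" "t' \<in> C" using pres[of "inv \<gamma>"] g y(2) tx by (simp_all add: s'_def t'_def)
  have act': "act \<gamma> s' = sx" "act \<gamma> t' = tx" using g' by (simp_all add: s'_def t'_def)
  have y': "(s', t', gm (inv \<gamma>) tx \<circ> f \<circ> invf (gm (inv \<gamma>) sx)) \<in> Y"
    using Y_inv[OF _ y(1), of "inv \<gamma>"] g' by (simp add: s'_def t'_def)
  define A B where "A = {\<kappa> \<gamma> sx, \<kappa> \<gamma> tx}" and "B = {\<kappa> \<gamma> s', \<kappa> \<gamma> t'}"
  have LCk: "LC (\<lambda>s. s \<in> C \<and> \<kappa> \<gamma> s \<in> Q)" for Q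
    using LC_map2[OF C_LC LC_r[OF g'], of "\<lambda>P x. P \<and> inv_into UNIV (zpow h) x \<in> Q"] by (simp add: \<kappa>_def)
  \<comment> \<open>A set of values that contains both or none of the values at each of the two jumps is attained
    on the whole of \<open>C\<close> or nowhere.\<close>
  have all: "\<kappa> \<gamma> u \<in> Q"
    if Q: "\<kappa> \<gamma> sx \<in> Q \<longleftrightarrow> \<kappa> \<gamma> tx \<in> Q" "\<kappa> \<gamma> s' \<in> Q \<longleftrightarrow> \<kappa> \<gamma> t' \<in> Q" and v: "v \<in> C" "\<kappa> \<gamma> v \<in> Q" and u: "u \<in> C" for Q u v
  proof -
    have "C \<subseteq> {s. s \<in> C \<and> \<kappa> \<gamma> s \<in> Q}"
    proof (rule C_minimal[OF _ _ v(1)])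
      show "LC (\<lambda>s. s \<in> {s. s \<in> C \<and> \<kappa> \<gamma> s \<in> Q})" using LCk by simp
      show "v \<in> {s. s \<in> C \<and> \<kappa> \<gamma> s \<in> Q}" using v by simp
      fix a b k assume ab: "(a, b, k) \<in> Y"
      show "a \<in> {s. s \<in> C \<and> \<kappa> \<gamma> s \<in> Q} \<longleftrightarrow> b \<in> {s. s \<in> C \<and> \<kappa> \<gamma> s \<in> Q}"
      proof (cases "a \<in> C")
        case True
        then have b: "b \<in> C" using C_glue[OF ab] by blast
        consider "(a, b) = (sx, tx) \<or> (a, b) = (tx, sx)" | "(act \<gamma> a, act \<gamma> b) = (sx, tx) \<or> (act \<gamma> a, act \<gamma> b) = (tx, sx)"
          | "jump a b = 0" "jump (act \<gamma> a) (act \<gamma> b) = 0"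
          using jump_eq_0[of a b] jump_eq_0[of "act \<gamma> a" "act \<gamma> b"] by argo
        then show ?thesis
        proof cases
          case 1
          then show ?thesis using Q(1) y(2) tx by auto
        next
          case 2
          then have "(a, b) = (s', t') \<or> (a, b) = (t', s')" using g' by (auto simp: s'_def t'_def)
          then show ?thesis using Q(2) C' by auto
        next
          case 3
          then show ?thesis using kappa_glue[OF g ab True] True b by simp
        qed
      next
        case False
        then show ?thesis using C_glue[OF ab] by simp
      qed
    qed
    then show ?thesis using u by blast
  qed
  have near: "\<bar>\<kappa> \<gamma> sx - \<kappa> \<gamma> tx\<bar> \<le> 2" "\<bar>\<kappa> \<gamma> s' - \<kappa> \<gamma> t'\<bar> \<le> 2"
    using kappa_glue[OF g y] kappa_glue[OF g y' C'(1)] jump_bound[of sx tx] jump_bound[of s' t']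
      jump_bound[of "act \<gamma> sx" "act \<gamma> tx"] jump_bound[of "act \<gamma> s'" "act \<gamma> t'"] by linarith+
  have "A \<inter> B \<noteq> {}"
  proof
    assume AB: "A \<inter> B = {}"
    have "\<kappa> \<gamma> s' \<in> A" by (rule all[OF _ _ y(2) _ C'(1)]) (use AB in \<open>auto simp: A_def B_def\<close>)
    then show False using AB by (auto simp: B_def)
  qed
  then obtain c where c: "c \<in> A" "c \<in> B" by blast
  have "\<kappa> \<gamma> u \<in> A \<union> B" if "u \<in> C" for u
    by (rule all[OF _ _ y(2) _ that]) (auto simp: A_def B_def)
  then have close: "\<bar>\<kappa> \<gamma> u - c\<bar> \<le> 2" if "u \<in> C" for u
  proof -
    have "\<kappa> \<gamma> u \<in> A \<or> \<kappa> \<gamma> u \<in> B" using \<open>\<And>u. u \<in> C \<Longrightarrow> \<kappa> \<gamma> u \<in> A \<union> B\<close>[OF that] by blast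
    then show ?thesis
    proof
      assume "\<kappa> \<gamma> u \<in> A"
      then show ?thesis using c(1) near(1) unfolding A_def by (elim insertE emptyE) simp_all
    next
      assume "\<kappa> \<gamma> u \<in> B"
      then show ?thesis using c(2) near(2) unfolding B_def by (elim insertE emptyE) simp_all
    qed
  qed
  show ?thesis using close[OF s] close[OF t] by linarith
qed

text \<open>An element with larger \<open>\<kappa>\<close> at \<^term>\<open>s0\<close> would move all points in the same direction.
  On \<^term>\<open>E\<close>, whose points are sides together with a level, the upper half \<^term>\<open>X\<close> is commensurated,
  and an invariant set \<^term>\<open>Z\<close> at finite distance contains the base point with its descending orbit
  under the element, or misses it with its ascending orbit. Either orbit meets the symmetric
  difference at infinitely many levels.\<close>

lemma kappa_bounded_above:
  assumes g: "\<gamma> \<in> L"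
  shows "\<kappa> \<gamma> s0 \<le> 4"
proof (rule ccontr)
  assume big: "\<not> \<kappa> \<gamma> s0 \<le> 4"
  have pos: "\<kappa> \<gamma> s \<ge> 1" if "s \<in> C" for s using kappa_variation[OF g s0_C that] big by linarith
  define x0 where "x0 = hact (\<beta> s0) s0"
  define E where "E = {(s, k). s \<in> C \<and> hact (zpow h k \<circ> \<beta> s) s = x0}"
  define X where "X = {(s, k) \<in> E. k \<ge> 0}"
  define a where "a \<gamma> = (\<lambda>(s, k). (act \<gamma> s, k - \<kappa> \<gamma> s))" for \<gamma>
  have aE: "a \<gamma> x \<in> E" if g: "\<gamma> \<in> L" and x: "x \<in> E" for \<gamma> x
  proof -
    obtain s k where sk: "x = (s, k)" "s \<in> C" "hact (zpow h k \<circ> \<beta> s) s = x0" using x by (auto simp: E_def)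
    have "zpow h (k - \<kappa> \<gamma> s) \<circ> \<beta> (act \<gamma> s) \<circ> gm \<gamma> s = zpow h (k - \<kappa> \<gamma> s) \<circ> r \<gamma> s \<circ> \<beta> s"
      by (simp add: r_def comp_assoc)
    also have "\<dots> = zpow h k \<circ> \<beta> s"
      using r_kappa[OF g sk(2)] zpow_add[OF h_PGL, of "k - \<kappa> \<gamma> s" "\<kappa> \<gamma> s"] by simp
    finally have "hact (zpow h (k - \<kappa> \<gamma> s) \<circ> \<beta> (act \<gamma> s) \<circ> gm \<gamma> s) s = x0" using sk by simp
    then have "hact (zpow h (k - \<kappa> \<gamma> s) \<circ> \<beta> (act \<gamma> s)) (act \<gamma> s) = x0"
      using g by (simp add: act_def hact_comp)
    then show ?thesis using sk pres[OF g] by (simp add: a_def E_def)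
  qed
  obtain Z where Z: "Z \<subseteq> E" "\<And>\<gamma> x. \<gamma> \<in> L \<Longrightarrow> x \<in> Z \<Longrightarrow> a \<gamma> x \<in> Z" "finite (sym_diff X Z)"
  proof (rule FW_transfix[OF L(1) FWL, of E a X])
    show "a \<gamma> x \<in> E" if "\<gamma> \<in> L" "x \<in> E" for \<gamma> x using aE that .
    show "a \<one> x = x" if "x \<in> E" for x using that kappa_one by (auto simp: E_def a_def)
    show "a (\<gamma> \<otimes> \<delta>) x = a \<gamma> (a \<delta> x)" if "\<gamma> \<in> L" "\<delta> \<in> L" "x \<in> E" for \<gamma> \<delta> x
      using that kappa_mult by (auto simp: E_def a_def act_mult)
    show "X \<subseteq> E" by (auto simp: X_def)
    show "finite {x \<in> X. a \<gamma> x \<notin> X}" if g: "\<gamma> \<in> L" for \<gamma>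
    proof (rule finite_subset)
      let ?f = "\<lambda>(b, k). (hact (invf (zpow h k \<circ> b)) x0, k)"
      show "{x \<in> X. a \<gamma> x \<notin> X} \<subseteq> ?f ` (range \<beta> \<times> {0..<\<kappa> \<gamma> s0 + 4})"
      proof
        fix x assume x: "x \<in> {x \<in> X. a \<gamma> x \<notin> X}"
        then obtain s k where sk: "x = (s, k)" "s \<in> C" "hact (zpow h k \<circ> \<beta> s) s = x0" "k \<ge> 0"
          by (auto simp: X_def E_def)
        have "a \<gamma> x \<in> E" using aE[OF g] x by (auto simp: X_def)
        then have "k < \<kappa> \<gamma> s" using x sk by (auto simp: X_def a_def)
        then have k: "k < \<kappa> \<gamma> s0 + 4" using kappa_variation[OF g sk(2) s0_C] by linarith
        have "hact (invf (zpow h k \<circ> \<beta> s)) x0 = hact (invf (zpow h k \<circ> \<beta> s) \<circ> (zpow h k \<circ> \<beta> s)) s"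
          unfolding sk(3)[symmetric] by (rule hact_comp[symmetric]) simp_all
        also have "\<dots> = s" using PGL_inv_comp(2)[of "zpow h k \<circ> \<beta> s"] by simp
        finally have "x = ?f (\<beta> s, k)" using sk(1) by simp
        then show "x \<in> ?f ` (range \<beta> \<times> {0..<\<kappa> \<gamma> s0 + 4})" by (rule image_eqI) (use k sk(4) in simp)
      qed
      show "finite (?f ` (range \<beta> \<times> {0..<\<kappa> \<gamma> s0 + 4}))" using \<beta>_fin by simp
    qed
  qed (rule that)
  have e0: "(s0, 0) \<in> E" using s0_C by (simp add: E_def x0_def)
  have step: "a \<gamma> x \<in> E \<and> snd (a \<gamma> x) \<le> snd x - 1" if x: "x \<in> E" for x
  proof -
    have "fst x \<in> C" using x by (auto simp: E_def)
    from pos[OF this] aE[OF g x] show ?thesis by (simp add: a_def case_prod_beta)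
  qed
  have pull: "a (inv \<gamma>) x \<in> E \<and> snd (a (inv \<gamma>) x) \<ge> snd x + 1 \<and> a \<gamma> (a (inv \<gamma>) x) = x" if x: "x \<in> E" for x
  proof -
    have 1: "a (inv \<gamma>) x \<in> E" using aE x g by simp
    have sx: "fst x \<in> C" using x by (auto simp: E_def)
    have "\<kappa> (\<gamma> \<otimes> inv \<gamma>) (fst x) = \<kappa> \<gamma> (act (inv \<gamma>) (fst x)) + \<kappa> (inv \<gamma>) (fst x)"
      using kappa_mult[OF g _ sx, of "inv \<gamma>"] g by simp
    then have "\<kappa> \<gamma> (act (inv \<gamma>) (fst x)) + \<kappa> (inv \<gamma>) (fst x) = 0"
      using kappa_one[OF sx] L_carrier[OF g] by simp
    then have "a \<gamma> (a (inv \<gamma>) x) = x" using g by (cases x) (simp add: a_def)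
    then show ?thesis using 1 step[OF 1] by simp
  qed
  show False
  proof (cases "(s0, 0) \<in> Z")
    case True
    define e where "e n = (a \<gamma> ^^ n) (s0, 0)" for n
    have e: "e n \<in> Z \<and> snd (e n) \<le> - int n" for n
    proof (induction n)
      case (Suc n)
      then show ?case using step[of "e n"] Z(1) Z(2)[OF g] by (auto simp: e_def)
    qed (simp add: e_def True)
    have "finite (snd ` sym_diff X Z)" using Z(3) by (rule finite_imageI)
    then obtain m where m: "\<forall>k\<in>snd ` sym_diff X Z. - m \<le> k"
      by (metis (no_types, lifting) Min_le bot.extremum_uniqueI ex_in_conv finite.emptyI minus_minus)
    let ?n = "nat m + 1"
    have "int ?n > 0" "int ?n > m" by linarith+
    then have n: "e ?n \<in> Z" "snd (e ?n) < 0" "snd (e ?n) < - m" using e[of ?n] by linarith+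
    then have "e ?n \<in> sym_diff X Z" by (auto simp: X_def)
    then have "- m \<le> snd (e ?n)" using m by blast
    then show False using n(3) by linarith
  next
    case False
    define e where "e n = (a (inv \<gamma>) ^^ n) (s0, 0)" for n
    have e: "e n \<in> E \<and> e n \<notin> Z \<and> snd (e n) \<ge> int n" for n
    proof (induction n)
      case (Suc n)
      have eS: "e (Suc n) = a (inv \<gamma>) (e n)" by (simp add: e_def)
      note b = pull[of "e n"]
      have "e (Suc n) \<notin> Z" using Z(2)[OF g, of "e (Suc n)"] b Suc unfolding eS by auto
      then show ?case using b Suc unfolding eS by auto
    qed (simp add: e_def False e0)
    have "finite (snd ` sym_diff X Z)" using Z(3) by (rule finite_imageI)
    then obtain m where m: "\<forall>k\<in>snd ` sym_diff X Z. k \<le> m"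
      by (metis (no_types, lifting) Max_ge bot.extremum_uniqueI ex_in_conv finite.emptyI)
    let ?n = "nat m + 1"
    have "snd (e ?n) \<ge> 0" "e ?n \<in> E" using e[of ?n] by linarith+
    then have "e ?n \<in> X" by (auto simp: X_def)
    then have "e ?n \<in> sym_diff X Z" using e[of ?n] by blast
    then have "snd (e ?n) \<le> m" using m by blast
    then show False using e[of ?n] by linarith
  qed
qed

text \<open>Applying the bound to the inverse gives the lower bound, up to the variation of \<open>\<kappa>\<close>.\<close>

lemma finite_germs_infinite_order: "finite ((\<lambda>\<gamma>. gm \<gamma> s0) ` L)"
proof (rule finite_germs[OF L(2), of "zpow h ` {- 8..4}"])
  fix \<gamma> assume g: "\<gamma> \<in> L"
  have "\<kappa> (inv \<gamma> \<otimes> \<gamma>) s0 = \<kappa> (inv \<gamma>) (act \<gamma> s0) + \<kappa> \<gamma> s0"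
    using kappa_mult[OF _ g s0_C, of "inv \<gamma>"] g by simp
  then have "\<kappa> \<gamma> s0 = - \<kappa> (inv \<gamma>) (act \<gamma> s0)" using kappa_one[OF s0_C] L_carrier[OF g] by simp
  moreover have "\<kappa> (inv \<gamma>) (act \<gamma> s0) \<le> \<kappa> (inv \<gamma>) s0 + 4"
    using kappa_variation[of "inv \<gamma>" "act \<gamma> s0" s0] g s0_C pres by simp
  moreover have "\<kappa> (inv \<gamma>) s0 \<le> 4" "\<kappa> \<gamma> s0 \<le> 4" using kappa_bounded_above g by simp_all
  ultimately have "\<kappa> \<gamma> s0 \<in> {- 8..4}" by simp
  moreover have "R \<gamma> = zpow h (\<kappa> \<gamma> s0)" using r_kappa[OF g s0_C] by (simp add: R_def)
  ultimately show "R \<gamma> \<in> zpow h ` {- 8..4}" by blast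
qed simp

end

lemma finite_germs_of_powers:
  assumes powers: "\<And>\<gamma>. \<gamma> \<in> L \<Longrightarrow> R \<gamma> \<in> range (zpow h)"
  shows "finite ((\<lambda>\<gamma>. gm \<gamma> s0) ` L)"
proof (cases "inj (zpow h)")
  case True
  then show ?thesis using finite_germs_infinite_order[OF powers] by blast
next
  case False
  then obtain i j where "zpow h i = zpow h j" "i < j" unfolding inj_def by (metis linorder_neqE)
  then have "zpow h (j - i) = id"
    using zpow_add[OF h_PGL, of j "- i"] zpow_neg[OF h_PGL, of i] by simp
  define n where "n = j - i"
  have n: "n > 0" "zpow h n = id" using \<open>i < j\<close> \<open>zpow h (j - i) = id\<close> by (simp_all add: n_def)
  have "zpow h k \<in> zpow h ` {0..<n}" for k
  proof -
    have "zpow h (n * (k div n)) = id"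
      using zpow_zpow[OF h_PGL, of n "k div n"] n(2) PGLg.int_pow_one[of "k div n"] by simp
    then have "zpow h k = zpow h (k mod n)"
      using zpow_add[OF h_PGL, of "n * (k div n)" "k mod n"] by simp
    then show ?thesis using n(1) by simp
  qed
  then have "range (zpow h) \<subseteq> zpow h ` {0..<n}" by blast
  then have "R \<gamma> \<in> zpow h ` {0..<n}" if "\<gamma> \<in> L" for \<gamma> using powers[OF that] by (rule subsetD)
  then show ?thesis using finite_germs[OF L(2), of "zpow h ` {0..<n}"] by blast
qed

end

lemma (in component) finite_germs_nontrivial_holonomy:
  assumes "h \<noteq> id"
  obtains M where "subgroup M G" "M \<subseteq> L" "fin_index G M L" "finite ((\<lambda>\<gamma>. gm \<gamma> s0) ` M)"
proof -
  define M where "M = {\<gamma> \<in> L. R \<gamma> \<in> range (zpow h)}"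
  have M: "subgroup M G" "M \<subseteq> L" "fin_index G M L"
    using R_in_powers_fin_index[OF assms] by (auto simp: M_def)
  interpret M: component G \<Gamma> gm Y s0 C \<beta> h sx tx M
    by (intro component.intro component_axioms.intro glued_axioms comp M(1) FW_fin_index[OF L(1) FWL M])
      (use M(2) L(2) pres in blast)+
  have "finite ((\<lambda>\<gamma>. gm \<gamma> s0) ` M)"
    by (rule M.finite_germs_of_powers) (simp add: M_def)
  then show thesis using that M by blast
qed

section \<open>Zariski closures of matrix groups\<close>

text \<open>The adjugate, which is the inverse on matrices of determinant 1 and is linear.\<close>

definition adj2 :: "real^2^2 \<Rightarrow> real^2^2" where
  "adj2 A = mat2 (A$2$2) (- A$1$2) (- A$2$1) (A$1$1)"

lemma adj2_mat2 [simp]: "adj2 (mat2 a b c d) = mat2 d (- b) (- c) a"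
  by (simp add: adj2_def)

lemma det_adj2 [simp]: "det (adj2 A) = det A"
  by (simp add: adj2_def det_2)

lemma mult_adj2: "det A = 1 \<Longrightarrow> A ** adj2 A = mat 1" "det A = 1 \<Longrightarrow> adj2 A ** A = mat 1"
  by (rule mat2_cases[of A]; simp add: mat_1_mat2 algebra_simps)+

lemma linear_real_polynomial_compose:
  fixes f :: "real^2^2 \<Rightarrow> real^2^2"
  assumes "real_polynomial_function p" "linear f"
  shows "real_polynomial_function (\<lambda>X. p (f X))"
proof -
  have "polynomial_function f"
    using assms(2) by (intro polynomial_function_bounded_linear) (simp add: linear_conv_bounded_linear)
  from real_polynomial_function_compose[OF this assms(1)] show ?thesis by (simp add: o_def)
qed

lemma linear_mult_left: "linear (\<lambda>X. B ** X)" and linear_mult_right: "linear (\<lambda>X. X ** B)" for B :: "real^2^2"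
  by (rule linearI; simp add: matrix_matrix_mult_def vec_eq_iff forall_2 sum_2 algebra_simps)+

lemma linear_adj2: "linear adj2"
  by (rule linearI) (auto simp: adj2_def intro!: mat2_eqI)

text \<open>The Zariski closure of \<^term>\<open>M\<close> in \<open>SL\<^sub>2\<close>.\<close>

definition Zcl :: "(real^2^2) set \<Rightarrow> (real^2^2) set" where
  "Zcl M = {A. det A = 1 \<and> (\<forall>p. real_polynomial_function p \<and> (\<forall>X\<in>M. p X = 0) \<longrightarrow> p A = 0)}"

lemma ZclD: "A \<in> Zcl M \<Longrightarrow> real_polynomial_function p \<Longrightarrow> (\<And>X. X \<in> M \<Longrightarrow> p X = 0) \<Longrightarrow> p A = 0"
  by (simp add: Zcl_def)

definition matgroup :: "(real^2^2) set \<Rightarrow> bool" where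
  "matgroup M \<longleftrightarrow> mat 1 \<in> M \<and> (\<forall>A\<in>M. det A = 1 \<and> adj2 A \<in> M) \<and> (\<forall>A\<in>M. \<forall>B\<in>M. A ** B \<in> M)"

lemma Zcl_superset: "matgroup M \<Longrightarrow> M \<subseteq> Zcl M"
  by (auto simp: Zcl_def matgroup_def)

text \<open>Right translation by a point of the closure preserves the closure, since translations are
  polynomial maps and left translations by \<^term>\<open>M\<close> preserve \<^term>\<open>M\<close>.\<close>

lemma Zcl_mult:
  assumes M: "matgroup M" and A: "A \<in> Zcl M" and B: "B \<in> Zcl M"
  shows "A ** B \<in> Zcl M"
  unfolding Zcl_def
proof (intro CollectI conjI allI impI)
  show "det (A ** B) = 1" using A B by (simp add: Zcl_def det_mul)
  fix p :: "real^2^2 \<Rightarrow> real" assume p: "real_polynomial_function p \<and> (\<forall>X\<in>M. p X = 0)"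
  have "p (X ** B) = 0" if X: "X \<in> M" for X
  proof (rule ZclD[OF B])
    show "real_polynomial_function (\<lambda>Y. p (X ** Y))"
      using p linear_mult_left by (blast intro: linear_real_polynomial_compose)
    show "p (X ** Y) = 0" if "Y \<in> M" for Y using p X that M by (simp add: matgroup_def)
  qed
  moreover have "real_polynomial_function (\<lambda>X. p (X ** B))"
    by (rule linear_real_polynomial_compose[OF _ linear_mult_right]) (use p in blast)
  ultimately show "p (A ** B) = 0" using ZclD[OF A] by blast
qed

lemma Zcl_adj2:
  assumes M: "matgroup M" and A: "A \<in> Zcl M"
  shows "adj2 A \<in> Zcl M"
  unfolding Zcl_def
proof (intro CollectI conjI allI impI)
  show "det (adj2 A) = 1" using A by (simp add: Zcl_def)
  fix p :: "real^2^2 \<Rightarrow> real" assume p: "real_polynomial_function p \<and> (\<forall>X\<in>M. p X = 0)"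
  show "p (adj2 A) = 0"
  proof (rule ZclD[OF A])
    show "real_polynomial_function (\<lambda>Y. p (adj2 Y))"
      using p linear_adj2 by (blast intro: linear_real_polynomial_compose)
    show "p (adj2 Y) = 0" if "Y \<in> M" for Y using p that M by (simp add: matgroup_def)
  qed
qed

text \<open>Along the diagonal torus a polynomial function is a Laurent polynomial. Vanishing on the powers
  of a hyperbolic element, it vanishes on the torus.\<close>

lemma polynomial_on_torus:
  assumes "real_polynomial_function p"
  shows "\<exists>N q. \<forall>s. s \<noteq> 0 \<longrightarrow> s ^ N * p (mat2 s 0 0 (1 / s)) = poly q s"
  using assms
proof (induction rule: real_polynomial_function.induct)
  case (linear f)
  have "s ^ 1 * f (mat2 s 0 0 (1 / s)) = poly [:f (mat2 0 0 0 1), 0, f (mat2 1 0 0 0):] s" if "s \<noteq> 0" for s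
  proof -
    interpret bounded_linear f by fact
    have "mat2 s 0 0 (1 / s) = s *\<^sub>R mat2 1 0 0 0 + (1 / s) *\<^sub>R mat2 0 0 0 1"
      by (rule mat2_eqI) simp_all
    then have "f (mat2 s 0 0 (1 / s)) = s * f (mat2 1 0 0 0) + (1 / s) * f (mat2 0 0 0 1)"
      by (simp only: add scaleR real_scaleR_def)
    then show ?thesis using that by (simp add: field_simps)
  qed
  then show ?case by blast
next
  case (const c)
  have "s ^ 0 * c = poly [:c:] s" for s by simp
  then show ?case by blast
next
  case (add f g)
  then obtain N q N' q' where *: "\<And>s. s \<noteq> 0 \<Longrightarrow> s ^ N * f (mat2 s 0 0 (1 / s)) = poly q s"
    "\<And>s. s \<noteq> 0 \<Longrightarrow> s ^ N' * g (mat2 s 0 0 (1 / s)) = poly q' s" by blast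
  have "s ^ (N + N') * (f (mat2 s 0 0 (1 / s)) + g (mat2 s 0 0 (1 / s))) = poly (monom 1 N' * q + monom 1 N * q') s"
    if "s \<noteq> 0" for s
    using *[OF that, symmetric] by (simp add: poly_monom power_add algebra_simps)
  then show ?case by blast
next
  case (mult f g)
  then obtain N q N' q' where *: "\<And>s. s \<noteq> 0 \<Longrightarrow> s ^ N * f (mat2 s 0 0 (1 / s)) = poly q s"
    "\<And>s. s \<noteq> 0 \<Longrightarrow> s ^ N' * g (mat2 s 0 0 (1 / s)) = poly q' s" by blast
  have "s ^ (N + N') * (f (mat2 s 0 0 (1 / s)) * g (mat2 s 0 0 (1 / s))) = poly (q * q') s"
    if "s \<noteq> 0" for s
    using *[OF that, symmetric] by (simp add: power_add algebra_simps)
  then show ?case by blast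
qed

lemma torus_in_Zcl:
  assumes M: "matgroup M" and l: "mat2 l 0 0 (1 / l) \<in> M" "l \<noteq> 0" "l\<^sup>2 \<noteq> 1" and s: "s \<noteq> 0"
  shows "mat2 s 0 0 (1 / s) \<in> Zcl M"
  unfolding Zcl_def
proof (intro CollectI conjI allI impI)
  show "det (mat2 s 0 0 (1 / s)) = 1" using s by simp
  fix p :: "real^2^2 \<Rightarrow> real" assume p: "real_polynomial_function p \<and> (\<forall>X\<in>M. p X = 0)"
  obtain N q where q: "\<And>s. s \<noteq> 0 \<Longrightarrow> s ^ N * p (mat2 s 0 0 (1 / s)) = poly q s"
    using polynomial_on_torus p by blast
  have pow: "mat2 (l ^ n) 0 0 (1 / l ^ n) \<in> M" for n
  proof (induction n)
    case 0
    then show ?case using M by (simp add: matgroup_def mat_1_mat2)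
  next
    case (Suc n)
    then have "mat2 l 0 0 (1 / l) ** mat2 (l ^ n) 0 0 (1 / l ^ n) \<in> M" using M l(1) unfolding matgroup_def by blast
    then show ?case by simp
  qed
  have "poly q (l ^ n) = 0" for n using q[of "l ^ n"] l(2) pow[of n] p by simp
  then have "range (\<lambda>n. l ^ n) \<subseteq> {x. poly q x = 0}" by blast
  moreover have "infinite (range (\<lambda>n::nat. l ^ n))"
  proof -
    have "inj (\<lambda>n::nat. l ^ n)"
    proof (rule injI)
      fix m n :: nat assume "l ^ m = l ^ n"
      then have "\<bar>l\<bar> ^ m = \<bar>l\<bar> ^ n" by (metis power_abs)
      moreover have "\<bar>l\<bar> > 0" "\<bar>l\<bar> \<noteq> 1" using l(2,3) by (auto simp: power2_eq_1_iff abs_if split: if_splits)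
      ultimately show "m = n" by (metis power_inject_exp' )
    qed
    then show ?thesis by (simp add: range_inj_infinite)
  qed
  ultimately have "q = 0" using poly_roots_finite finite_subset by blast
  then show "p (mat2 s 0 0 (1 / s)) = 0" using q[OF s] s by simp
qed

text \<open>A group containing a hyperbolic diagonal matrix, and stabilizing neither of the two coordinate
  axes nor their union, is Zariski dense. The closure contains the torus. It also contains an element
  with exactly one zero entry, which conjugates the torus into a Borel subgroup in a different way.
  Hence it contains upper unipotent matrices, and the Bruhat decomposition provides the rest.\<close>

lemma unipotents_in_Zcl:
  assumes M: "matgroup M" and T: "\<forall>s. s \<noteq> 0 \<longrightarrow> mat2 s 0 0 (1 / s) \<in> Zcl M"
    and x: "mat2 a b 0 d \<in> Zcl M" "b \<noteq> 0"
  shows "mat2 1 t 0 1 \<in> Zcl M"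
proof -
  note mult = Zcl_mult[OF M]
  have d: "a * d = 1" using x(1) by (simp add: Zcl_def)
  then have a: "a \<noteq> 0" by auto
  have "mat2 (1 / a) 0 0 (1 / (1 / a)) ** mat2 a b 0 d \<in> Zcl M" using mult[OF T[rule_format, of "1 / a"] x(1)] a by simp
  moreover have "mat2 (1 / a) 0 0 (1 / (1 / a)) ** mat2 a b 0 d = mat2 1 (b / a) 0 1" using a d by simp
  ultimately have u: "mat2 1 (b / a) 0 1 \<in> Zcl M" by (simp only:)
  then have u': "mat2 1 (- (b / a)) 0 1 \<in> Zcl M" using Zcl_adj2[OF M] by fastforce
  have pos: "mat2 1 (k\<^sup>2 * v) 0 1 \<in> Zcl M" if v: "mat2 1 v 0 1 \<in> Zcl M" and k: "k \<noteq> 0" for k v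
  proof -
    have "mat2 k 0 0 (1 / k) ** mat2 1 v 0 1 ** mat2 (1 / k) 0 0 (1 / (1 / k)) \<in> Zcl M"
      using mult[OF mult[OF T[rule_format, OF k] v] T[rule_format, of "1 / k"]] k by simp
    moreover have "mat2 k 0 0 (1 / k) ** mat2 1 v 0 1 ** mat2 (1 / k) 0 0 (1 / (1 / k)) = mat2 1 (k\<^sup>2 * v) 0 1"
      using k by (simp add: power2_eq_square)
    ultimately show ?thesis by (simp only:)
  qed
  define v where "v = b / a"
  have v: "v \<noteq> 0" using x(2) a by (simp add: v_def)
  consider "t = 0" | "t / v > 0" | "- (t / v) > 0"
    using v by (metis divide_eq_0_iff neg_0_less_iff_less linorder_neqE_linordered_idom)
  then show ?thesis
  proof cases
    case 1
    then show ?thesis using T[rule_format, of 1] by simp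
  next
    case 2
    then have "(sqrt (t / v))\<^sup>2 * v = t" "sqrt (t / v) \<noteq> 0" using v real_sqrt_pow2[of "t / v"] by auto
    then show ?thesis using pos[OF u[folded v_def], of "sqrt (t / v)"] by simp
  next
    case 3
    then have "(sqrt (- (t / v)))\<^sup>2 * (- v) = t" "sqrt (- (t / v)) \<noteq> 0"
      using v real_sqrt_pow2[of "- (t / v)"] by auto
    then show ?thesis using pos[OF u'[folded v_def], of "sqrt (- (t / v))"] by simp
  qed
qed

text \<open>Any element outside the upper triangular group yields a matrix with zero diagonal after
  multiplication by upper unipotents on both sides.\<close>

lemma Bruhat:
  assumes M: "matgroup M" and T: "\<forall>s. s \<noteq> 0 \<longrightarrow> mat2 s 0 0 (1 / s) \<in> Zcl M"
    and U: "\<And>t. mat2 1 t 0 1 \<in> Zcl M" and x: "mat2 a b c d \<in> Zcl M" "c \<noteq> 0" and A: "det A = 1"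
  shows "A \<in> Zcl M"
proof -
  note mult = Zcl_mult[OF M]
  obtain p q r s where pq: "A = mat2 p q r s" by (rule mat2_cases)
  have det: "p * s - q * r = 1" using A pq by simp
  have detx: "a * d - b * c = 1" using x by (simp add: Zcl_def)
  show ?thesis
  proof (cases "r = 0")
    case True
    then have p: "p \<noteq> 0" "s = 1 / p" using det by (auto simp: eq_divide_eq mult.commute)
    have "mat2 p 0 0 (1 / p) ** mat2 1 (q / p) 0 1 \<in> Zcl M" using mult[OF T[rule_format, OF p(1)] U] .
    then show ?thesis using pq True p by simp
  next
    case False
    have "mat2 1 (- a / c) 0 1 ** mat2 a b c d ** mat2 1 (- d / c) 0 1 \<in> Zcl M"
      using mult[OF mult[OF U x(1)] U] .
    moreover have "mat2 1 (- a / c) 0 1 ** mat2 a b c d ** mat2 1 (- d / c) 0 1 = mat2 0 (- 1 / c) c 0"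
      using x(2) detx by (simp add: field_simps)
    ultimately have w: "mat2 0 (- 1 / c) c 0 \<in> Zcl M" by (simp only:)
    have cr: "c / r \<noteq> 0" using False x(2) by simp
    have "mat2 1 (p / r) 0 1 ** (mat2 (c / r) 0 0 (1 / (c / r)) ** mat2 0 (- 1 / c) c 0) ** mat2 1 (s / r) 0 1 \<in> Zcl M"
      using mult[OF mult[OF U mult[OF T[rule_format, OF cr] w]] U] .
    moreover have "mat2 1 (p / r) 0 1 ** (mat2 (c / r) 0 0 (1 / (c / r)) ** mat2 0 (- 1 / c) c 0) ** mat2 1 (s / r) 0 1 = A"
      using False x(2) det pq by (simp add: field_simps)
    ultimately show ?thesis by (simp only:)
  qed
qed

lemma corner_zero:
  assumes M: "matgroup M" and T: "\<forall>s. s \<noteq> 0 \<longrightarrow> mat2 s 0 0 (1 / s) \<in> Zcl M"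
    and x: "mat2 a b c 0 \<in> Zcl M" "a \<noteq> 0"
  shows "mat2 1 t 0 1 \<in> Zcl M"
proof -
  have bc: "b * c = - 1" using x(1) by (simp add: Zcl_def)
  have "mat2 a b c 0 ** mat2 2 0 0 (1 / 2) ** adj2 (mat2 a b c 0) \<in> Zcl M"
    using Zcl_mult[OF M Zcl_mult[OF M x(1) T[rule_format, of 2]] Zcl_adj2[OF M x(1)]] by simp
  then have "mat2 (- (b * c) / 2) (- (3 / 2) * a * b) 0 (- 2 * (b * c)) \<in> Zcl M" by (simp add: algebra_simps)
  moreover have "- (3 / 2) * a * b \<noteq> 0" using x(2) bc by auto
  ultimately show ?thesis by (rule unipotents_in_Zcl[OF M T])
qed

lemma corner_zero':
  assumes M: "matgroup M" and T: "\<forall>s. s \<noteq> 0 \<longrightarrow> mat2 s 0 0 (1 / s) \<in> Zcl M"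
    and x: "mat2 0 b c d \<in> Zcl M" "d \<noteq> 0"
  shows "mat2 1 t 0 1 \<in> Zcl M"
  using corner_zero[OF M T, of d "- b" "- c"] Zcl_adj2[OF M x(1)] x(2) by simp

text \<open>Conjugating the torus element with parameter \<open>s\<close> by the given matrix produces a zero entry when
  \<open>s\<^sup>2 = b c / (a d)\<close>. If this ratio is negative, conjugating the element with parameter
  2 gives a matrix for which it is positive.\<close>

lemma no_zero_entries:
  assumes M: "matgroup M" and T: "\<forall>s. s \<noteq> 0 \<longrightarrow> mat2 s 0 0 (1 / s) \<in> Zcl M"
    and x: "mat2 a b c d \<in> Zcl M" "a \<noteq> 0" "b \<noteq> 0" "c \<noteq> 0" "d \<noteq> 0"
  shows "mat2 1 t 0 1 \<in> Zcl M"
proof -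
  have conj: "mat2 (a * d * s - b * c / s) (a * b * (1 / s - s)) (c * d * (s - 1 / s)) (a * d / s - b * c * s) \<in> Zcl M"
    if "mat2 a b c d \<in> Zcl M" "s \<noteq> 0" for a b c d s
  proof -
    have "mat2 a b c d ** mat2 s 0 0 (1 / s) ** adj2 (mat2 a b c d) \<in> Zcl M"
      using Zcl_mult[OF M Zcl_mult[OF M that(1) T[rule_format, OF that(2)]] Zcl_adj2[OF M that(1)]] .
    moreover have "mat2 a b c d ** mat2 s 0 0 (1 / s) ** adj2 (mat2 a b c d) =
      mat2 (a * d * s - b * c / s) (a * b * (1 / s - s)) (c * d * (s - 1 / s)) (a * d / s - b * c * s)"
      by (simp add: algebra_simps)
    ultimately show ?thesis by (simp only:)
  qed
  have positive: "mat2 1 t 0 1 \<in> Zcl M" if x: "mat2 a b c d \<in> Zcl M" and pos: "(a * d) * (b * c) > 0" for a b c d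
  proof -
    define s where "s = sqrt ((b * c) / (a * d))"
    have nz: "a * d \<noteq> 0" "b * c \<noteq> 0" using pos by auto
    have "(b * c) / (a * d) > 0" using pos by (auto simp: zero_less_divide_iff zero_less_mult_iff)
    then have s: "s > 0" "s * s = (b * c) / (a * d)"
      unfolding s_def using real_sqrt_pow2[of "(b * c) / (a * d)"]
      by (simp_all only: real_sqrt_gt_zero power2_eq_square less_imp_le)
    have bc: "b * c = a * d * (s * s)" using s nz by simp
    have det: "a * d - b * c = 1" using x by (simp add: Zcl_def)
    have "a * d * s - b * c / s = 0" using bc s(1) by simp
    then have "mat2 0 (a * b * (1 / s - s)) (c * d * (s - 1 / s)) (a * d / s - b * c * s) \<in> Zcl M"
      using conj[OF x, of s] s(1) by simp
    moreover have "a * d / s - b * c * s \<noteq> 0"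
    proof
      assume "a * d / s - b * c * s = 0"
      then have "a * d = b * c * (s * s)" using s(1) by (simp add: field_simps)
      then have "(s * s) * (s * s) = 1" using bc nz(1) by simp
      then have "(s * s)\<^sup>2 = 1" by (simp add: power2_eq_square)
      then have "s * s = 1" using s(1) by (simp add: power2_eq_1_iff) (metis less_numeral_extra(1) mult_pos_pos neg_less_0_iff_less not_less_iff_gr_or_eq)
      then have "b * c = a * d" using bc by simp
      then show False using det by simp
    qed
    ultimately show ?thesis by (rule corner_zero'[OF M T])
  qed
  have nz: "a * d \<noteq> 0" "b * c \<noteq> 0" using x by simp_all
  show ?thesis
  proof (cases "(a * d) * (b * c) > 0")
    case True
    then show ?thesis using positive x(1) by blast
  next
    case False
    then have neg: "(a * d) * (b * c) < 0" using nz by (metis linorder_neqE_linordered_idom mult_eq_0_iff)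
    have det: "a * d - b * c = 1" using x by (simp add: Zcl_def)
    define a' b' c' d' where "a' = a * d * 2 - b * c / 2" and "b' = a * b * (1 / 2 - 2)"
      and "c' = c * d * (2 - 1 / 2)" and "d' = a * d / 2 - b * c * 2"
    have x': "mat2 a' b' c' d' \<in> Zcl M" using conj[OF x(1), of 2] by (simp only: a'_def b'_def c'_def d'_def)
    have "a' * d' = (a * d - b * c)\<^sup>2 - (9 / 4) * ((a * d) * (b * c))"
      by (simp add: a'_def d'_def power2_eq_square algebra_simps)
    then have "a' * d' = 1 - (9 / 4) * ((a * d) * (b * c))" unfolding det by simp
    then have "a' * d' > 1" using neg by linarith
    moreover have "a' * d' - b' * c' = 1" using x' by (simp add: Zcl_def)
    ultimately have "(a' * d') * (b' * c') > 0" by simp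
    then show ?thesis using positive x' by blast
  qed
qed

lemma Zcl_full:
  assumes M: "matgroup M" and T: "\<forall>s. s \<noteq> 0 \<longrightarrow> mat2 s 0 0 (1 / s) \<in> Zcl M"
    and upper: "mat2 a1 b1 c1 d1 \<in> M" "c1 \<noteq> 0" and lower: "mat2 a2 b2 c2 d2 \<in> M" "b2 \<noteq> 0"
    and mono: "mat2 a b c d \<in> M" "b \<noteq> 0 \<or> c \<noteq> 0" "a \<noteq> 0 \<or> d \<noteq> 0" and A: "det A = 1"
  shows "A \<in> Zcl M"
proof -
  note sub = subsetD[OF Zcl_superset[OF M]]
  note mult = Zcl_mult[OF M]
  have x: "mat2 a b c d \<in> Zcl M" using sub mono(1) .
  have det: "a * d - b * c = 1" using x by (simp add: Zcl_def)
  have key: "A \<in> Zcl M" if "\<And>t. mat2 1 t 0 1 \<in> Zcl M"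
    using Bruhat[OF M T that sub[OF upper(1)] upper(2) A] by blast
  consider "d = 0" "a \<noteq> 0" | "a = 0" "d \<noteq> 0" | "c = 0" "b \<noteq> 0" | "b = 0" "c \<noteq> 0"
    | "a \<noteq> 0" "b \<noteq> 0" "c \<noteq> 0" "d \<noteq> 0" using mono(2,3) by blast
  then show ?thesis
  proof cases
    case 1
    then show ?thesis using key corner_zero[OF M T] x by blast
  next
    case 2
    then show ?thesis using key corner_zero'[OF M T] x by blast
  next
    case 3
    then show ?thesis using key unipotents_in_Zcl[OF M T] x by blast
  next
    case 4
    have low: "mat2 1 0 t 1 \<in> Zcl M" for t
    proof -
      have ad: "a * d = 1" using det 4 by simp
      then have a: "a \<noteq> 0" "d \<noteq> 0" by auto
      have "mat2 (1 / a) 0 0 (1 / (1 / a)) ** mat2 a 0 c d \<in> Zcl M" using mult[OF T[rule_format, of "1 / a"] x[unfolded 4]] a by simp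
      moreover have "mat2 (1 / a) 0 0 (1 / (1 / a)) ** mat2 a 0 c d = mat2 1 0 (a * c) 1" using ad a by simp
      ultimately have l: "mat2 1 0 (a * c) 1 \<in> Zcl M" by (simp only:)
      then have l': "mat2 1 0 (- (a * c)) 1 \<in> Zcl M" using Zcl_adj2[OF M l] by simp
      have pos: "mat2 1 0 (v / (k * k)) 1 \<in> Zcl M" if v: "mat2 1 0 v 1 \<in> Zcl M" and k: "k \<noteq> 0" for k v
      proof -
        have "mat2 k 0 0 (1 / k) ** mat2 1 0 v 1 ** mat2 (1 / k) 0 0 (1 / (1 / k)) \<in> Zcl M"
          using mult[OF mult[OF T[rule_format, OF k] v] T[rule_format, of "1 / k"]] k by simp
        moreover have "mat2 k 0 0 (1 / k) ** mat2 1 0 v 1 ** mat2 (1 / k) 0 0 (1 / (1 / k)) = mat2 1 0 (v / (k * k)) 1"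
          using k by simp
        ultimately show ?thesis by (simp only:)
      qed
      define v where "v = a * c"
      have v: "v \<noteq> 0" using a 4 by (simp add: v_def)
      consider "t = 0" | "v / t > 0" | "- (v / t) > 0"
        using v by (metis divide_eq_0_iff neg_0_less_iff_less linorder_neqE_linordered_idom)
      then show ?thesis
      proof cases
        case 1
        then show ?thesis using T[rule_format, of 1] by simp
      next
        case 2
        define k where "k = sqrt (v / t)"
        have "k * k = v / t" "k \<noteq> 0" "t \<noteq> 0" using 2 real_sqrt_pow2[of "v / t"] by (auto simp: k_def power2_eq_square)
        then show ?thesis using pos[OF l[folded v_def], of k] v by simp
      next
        case 3
        define k where "k = sqrt (- (v / t))"
        have "k * k = - v / t" "k \<noteq> 0" "t \<noteq> 0" using 3 real_sqrt_pow2[of "- (v / t)"] by (auto simp: k_def power2_eq_square)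
        then show ?thesis using pos[OF l'[folded v_def], of k] v by simp
      qed
    qed
    have y: "mat2 a2 b2 c2 d2 \<in> Zcl M" using sub lower(1) .
    have det2: "a2 * d2 - b2 * c2 = 1" using y by (simp add: Zcl_def)
    have "mat2 1 0 (- d2 / b2) 1 ** mat2 a2 b2 c2 d2 ** mat2 1 0 ((1 - a2) / b2) 1 \<in> Zcl M"
      using mult[OF mult[OF low y] low] .
    moreover have "mat2 1 0 (- d2 / b2) 1 ** mat2 a2 b2 c2 d2 ** mat2 1 0 ((1 - a2) / b2) 1 = mat2 1 b2 (- 1 / b2) 0"
      using lower(2) det2 by (simp add: field_simps)
    ultimately have "mat2 1 b2 (- 1 / b2) 0 \<in> Zcl M" by (simp only:)
    then show ?thesis using key corner_zero[OF M T] by (metis one_neq_zero)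
  next
    case 5
    then show ?thesis using key no_zero_entries[OF M T] x by blast
  qed
qed

text \<open>The trace of the group commutator of \<open>A\<close> and \<open>B\<close> exceeds 2 by
  \<open>- det (A B - B A)\<close>. This matrix has trace 0 and is orthogonal to \<open>A\<close> for the trace form, and
  \<open>- det\<close> is positive on the nonzero matrices of this kind because the discriminant of the elliptic
  matrix \<open>A\<close> is negative.\<close>

lemma elliptic_commutator:
  assumes A: "a * d - b * c = (1::real)" and B: "p * s - q * r = 1" and ell: "(a + d)\<^sup>2 < 4"
    and nc: "mat2 a b c d ** mat2 p q r s \<noteq> mat2 p q r s ** mat2 a b c d"
  shows "(let X = mat2 a b c d ** mat2 p q r s ** (mat2 d (- b) (- c) a ** mat2 s (- q) (- r) p) in X$1$1 + X$2$2) > 2"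
proof -
  define u v w e where "u = b * r - c * q" and "v = q * (a - d) - b * (p - s)" and "w = r * (a - d) - c * (p - s)" and "e = a - d"
  have "(let X = mat2 a b c d ** mat2 p q r s ** (mat2 d (- b) (- c) a ** mat2 s (- q) (- r) p) in X$1$1 + X$2$2)
      = 2 * (a * d - b * c) * (p * s - q * r) + (u * u - v * w)"
    by (simp add: Let_def u_def v_def w_def algebra_simps)
  then have tr: "(let X = mat2 a b c d ** mat2 p q r s ** (mat2 d (- b) (- c) a ** mat2 s (- q) (- r) p) in X$1$1 + X$2$2) = 2 + (u * u - v * w)"
    using A B by simp
  have disc: "e * e + 4 * (b * c) < 0"
  proof -
    have "(a + d)\<^sup>2 = e * e + 4 * (b * c) + 4 * (a * d - b * c)" by (simp add: e_def power2_eq_square algebra_simps)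
    then show ?thesis using ell A by simp
  qed
  moreover have "0 \<le> e * e" by simp
  ultimately have bc: "b * c < 0" by linarith
  have rel: "b * w = e * u + c * v" by (simp add: u_def v_def w_def e_def algebra_simps)
  have "- 4 * (b * c) * (u * u - v * w) = - 4 * (b * c) * (u * u) + 4 * (c * v) * (b * w)" by (simp add: algebra_simps)
  also have "\<dots> = (2 * (c * v) + e * u)\<^sup>2 + - (e * e + 4 * (b * c)) * (u * u)"
    unfolding rel by (simp add: power2_eq_square algebra_simps)
  finally have eq: "- 4 * (b * c) * (u * u - v * w) = (2 * (c * v) + e * u)\<^sup>2 + - (e * e + 4 * (b * c)) * (u * u)" .
  have "\<not> (u = 0 \<and> v = 0)"
  proof
    assume uv: "u = 0 \<and> v = 0"
    then have "w = 0" using rel bc by auto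
    have "mat2 a b c d ** mat2 p q r s = mat2 p q r s ** mat2 a b c d"
      using uv \<open>w = 0\<close> by (simp add: u_def v_def w_def algebra_simps)
    then show False using nc by blast
  qed
  then have "(2 * (c * v) + e * u)\<^sup>2 + - (e * e + 4 * (b * c)) * (u * u) > 0"
  proof (cases "u = 0")
    case True
    then have "2 * (c * v) + e * u \<noteq> 0" using \<open>\<not> (u = 0 \<and> v = 0)\<close> bc by auto
    then show ?thesis using True by simp
  next
    case False
    then have "u * u > 0" by (metis not_real_square_gt_zero)
    moreover have "- (e * e + 4 * (b * c)) > 0" using disc by linarith
    ultimately have "- (e * e + 4 * (b * c)) * (u * u) > 0" by (rule mult_pos_pos[rotated])
    then show ?thesis by (metis add_nonneg_pos zero_le_power2)
  qed
  then have "- 4 * (b * c) * (u * u - v * w) > 0" using eq by linarith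
  moreover have "- 4 * (b * c) > 0" using bc by linarith
  ultimately have "u * u - v * w > 0" using zero_less_mult_pos by blast
  then show ?thesis using tr by linarith
qed

text \<open>The columns of \<^term>\<open>P\<close> are an eigenvector and its rotation by a right angle.\<close>

lemma eigenvector_conjugate:
  fixes A :: "real^2^2"
  assumes A: "det A = 1" and tr: "(A$1$1 + A$2$2)\<^sup>2 \<ge> 4"
  obtains P P' l b where "P ** P' = mat 1" "P' ** P = mat 1" "P' ** A ** P = mat2 l b 0 (1 / l)" "l \<noteq> 0"
    "l + 1 / l = A$1$1 + A$2$2"
proof -
  obtain a b c d where m: "A = mat2 a b c d" by (rule mat2_cases)
  have det: "a * d - b * c = 1" using A m by simp
  define \<tau> where "\<tau> = a + d"
  have tr': "\<tau>\<^sup>2 \<ge> 4" using tr by (simp add: m \<tau>_def)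
  define l where "l = (\<tau> + sqrt (\<tau>\<^sup>2 - 4)) / 2"
  have "2 * l - \<tau> = sqrt (\<tau>\<^sup>2 - 4)" by (simp add: l_def field_simps)
  then have "(2 * l - \<tau>)\<^sup>2 = \<tau>\<^sup>2 - 4" using tr' by simp
  then have l: "l * l - \<tau> * l + 1 = 0" by (simp add: power2_eq_square algebra_simps)
  have l0: "l \<noteq> 0" using l by auto
  have lt: "l + 1 / l = \<tau>" using l l0 by (simp add: field_simps)
  obtain v1 v2 where v: "v1 \<noteq> 0 \<or> v2 \<noteq> 0" "a * v1 + b * v2 = l * v1" "c * v1 + d * v2 = l * v2"
  proof -
    have char: "(a - l) * (d - l) = b * c" using l det by (simp add: \<tau>_def algebra_simps)
    consider "b \<noteq> 0 \<or> l \<noteq> a" | "c \<noteq> 0 \<or> l \<noteq> d" | "b = 0" "c = 0" "l = a" "l = d" by blast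
    then show thesis
    proof cases
      case 1
      then show thesis using char by (intro that[of b "l - a"]) (auto simp: algebra_simps)
    next
      case 2
      then show thesis using char by (intro that[of "l - d" c]) (auto simp: algebra_simps)
    next
      case 3
      then show thesis by (intro that[of 1 0]) auto
    qed
  qed
  define D where "D = v1 * v1 + v2 * v2"
  have D: "D \<noteq> 0" using v(1) by (simp add: D_def sum_squares_eq_zero_iff)
  define P where "P = mat2 v1 (- v2) v2 v1"
  define P' where "P' = mat2 (v1 / D) (v2 / D) (- v2 / D) (v1 / D)"
  have PP': "P ** P' = mat 1" "P' ** P = mat 1"
    using D by (simp_all add: P_def P'_def mat_1_mat2 D_def divide_simps)
  define B where "B = P' ** A ** P"
  have B1: "B $ 1 $ 1 = l" "B $ 2 $ 1 = 0"
  proof -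
    have e: "A ** P = mat2 (l * v1) (- a * v2 + b * v1) (l * v2) (- c * v2 + d * v1)"
      using v(2,3) by (simp add: m P_def)
    then have "B = P' ** mat2 (l * v1) (- a * v2 + b * v1) (l * v2) (- c * v2 + d * v1)"
      by (simp add: B_def matrix_mul_assoc[symmetric])
    then have "B $ 1 $ 1 = l * D / D" "B $ 2 $ 1 = 0" by (simp_all add: P'_def D_def add_divide_distrib algebra_simps)
    then show "B $ 1 $ 1 = l" "B $ 2 $ 1 = 0" using D by simp_all
  qed
  have "det B = det A * (det P' * det P)" by (simp add: B_def det_mul)
  also have "det P' * det P = 1" using PP'(2) by (metis det_I det_mul)
  finally have "det B = 1" using A by simp
  then have "B $ 2 $ 2 = 1 / l" using B1 l0 by (simp add: det_2 field_simps)
  then have "B = mat2 l (B $ 1 $ 2) 0 (1 / l)" using B1 by (intro mat2_eqI) simp_all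
  then show thesis using PP' l0 lt by (intro that[of P P' l "B $ 1 $ 2"]) (simp_all add: B_def m \<tau>_def)
qed

lemma homography_inverse_pair:
  assumes P: "P ** P' = mat 1" "P' ** P = mat 1"
  shows "det P' * det P = 1" "det P \<noteq> 0" "det P' \<noteq> 0" "homography P \<in> PGL"
    "homography P \<circ> homography P' = id" "homography P' \<circ> homography P = id"
    "invf (homography P) = homography P'"
proof -
  show dd: "det P' * det P = 1" using P(2) by (metis det_I det_mul)
  then show nz: "det P \<noteq> 0" "det P' \<noteq> 0" by auto
  then show "homography P \<in> PGL" by (simp add: homography_PGL)
  show hP: "homography P \<circ> homography P' = id" "homography P' \<circ> homography P = id"
    using P nz homography_id by (simp_all add: homography_comp)
  then show "invf (homography P) = homography P'" by (metis inv_unique_comp)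
qed

lemma homography_commutator:
  assumes "det A \<noteq> 0" "det B \<noteq> 0" "A ** B = C ** (B ** A)"
  shows "homography A \<circ> homography B \<circ> invf (homography B \<circ> homography A) = homography C"
proof -
  have N: "homography B \<circ> homography A \<in> PGL" using assms by (simp add: homography_PGL)
  have "homography A \<circ> homography B = homography C \<circ> (homography B \<circ> homography A)"
    using assms homography_comp[of "B ** A" C] by (simp add: homography_comp det_mul)
  then show ?thesis using PGL_inv_comp(1)[OF N] by (metis comp_assoc comp_id)
qed

section \<open>Images of groups with Property FW in \<open>PSL\<^sub>2(\<real>)\<close>\<close>

context group
begin

definition PGL_hom :: "'a set \<Rightarrow> ('a \<Rightarrow> real option \<Rightarrow> real option) \<Rightarrow> bool" where
  "PGL_hom L R \<longleftrightarrow> (\<forall>\<gamma>\<in>L. R \<gamma> \<in> PGL) \<and> (\<forall>\<gamma>\<in>L. \<forall>\<delta>\<in>L. R (\<gamma> \<otimes> \<delta>) = R \<gamma> \<circ> R \<delta>)"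

lemma PGL_hom_props:
  assumes R: "PGL_hom L R" and L: "subgroup L G"
  shows "\<And>\<gamma>. \<gamma> \<in> L \<Longrightarrow> R \<gamma> \<in> PGL" "\<And>\<gamma> \<delta>. \<gamma> \<in> L \<Longrightarrow> \<delta> \<in> L \<Longrightarrow> R (\<gamma> \<otimes> \<delta>) = R \<gamma> \<circ> R \<delta>"
    "R \<one> = id" "\<And>\<gamma>. \<gamma> \<in> L \<Longrightarrow> R (inv \<gamma>) = invf (R \<gamma>)"
proof -
  note Lp = subgroup_props[OF L]
  show P: "\<And>\<gamma>. \<gamma> \<in> L \<Longrightarrow> R \<gamma> \<in> PGL" and mult: "\<And>\<gamma> \<delta>. \<gamma> \<in> L \<Longrightarrow> \<delta> \<in> L \<Longrightarrow> R (\<gamma> \<otimes> \<delta>) = R \<gamma> \<circ> R \<delta>"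
    using R by (simp_all add: PGL_hom_def)
  have "R \<one> \<circ> R \<one> = id \<circ> R \<one>" using mult[of \<one> \<one>] Lp(4) by simp
  then show one: "R \<one> = id" using PGL_right_cancel[OF P[OF Lp(4)]] by blast
  fix \<gamma> assume g: "\<gamma> \<in> L"
  have "R (inv \<gamma>) \<circ> R \<gamma> = invf (R \<gamma>) \<circ> R \<gamma>" using mult[OF Lp(3)[OF g] g] g Lp(1) P one by simp
  then show "R (inv \<gamma>) = invf (R \<gamma>)" using PGL_right_cancel[OF P[OF g]] by blast
qed

lemma subgroup_hom_preimage:
  assumes R: "PGL_hom L R" and L: "subgroup L G" and D: "subgroup D PGLg"
  shows "subgroup {\<gamma> \<in> L. R \<gamma> \<in> D} G"
proof (rule subgroupI)
  note Lp = subgroup_props[OF L] and Rp = PGL_hom_props[OF R L] and Dp = PGLg.subgroup_props[OF D, simplified]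
  show "{\<gamma> \<in> L. R \<gamma> \<in> D} \<subseteq> carrier G" using Lp(1) by blast
  show "{\<gamma> \<in> L. R \<gamma> \<in> D} \<noteq> {}" using Lp(4) Rp(3) Dp(4) by auto
  show "inv a \<in> {\<gamma> \<in> L. R \<gamma> \<in> D}" if a: "a \<in> {\<gamma> \<in> L. R \<gamma> \<in> D}" for a
    using a Lp(3) Rp(1,4) Dp(3)[of "R a"] by simp
  show "a \<otimes> b \<in> {\<gamma> \<in> L. R \<gamma> \<in> D}" if "a \<in> {\<gamma> \<in> L. R \<gamma> \<in> D}" "b \<in> {\<gamma> \<in> L. R \<gamma> \<in> D}" for a b
    using that Lp(2) Rp(2) Dp(2) by simp
qed

lemma finite_image_of_fin_index:
  assumes R: "PGL_hom L R" and L: "subgroup L G" and Z: "fin_index G Z L" "Z \<subseteq> L" and fin: "finite (R ` Z)"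
  shows "finite (R ` L)"
proof -
  note Lp = subgroup_props[OF L] and Rp = PGL_hom_props[OF R L]
  obtain T where T: "finite T" "T \<subseteq> L" "\<forall>x\<in>L. \<exists>t\<in>T. inv t \<otimes> x \<in> Z"
    using Z(1) unfolding fin_index_def by blast
  have "R ` L \<subseteq> (\<lambda>(t, f). R t \<circ> f) ` (T \<times> R ` Z)"
  proof (rule image_subsetI)
    fix x assume x: "x \<in> L"
    then obtain t where t: "t \<in> T" "inv t \<otimes> x \<in> Z" using T(3) by blast
    then have tL: "t \<in> L" "inv t \<otimes> x \<in> L" using T(2) Z(2) by blast+
    have "x = t \<otimes> (inv t \<otimes> x)" using Lp(1)[OF x] Lp(1)[OF tL(1)] by (simp add: m_assoc[symmetric])
    then have "R x = R t \<circ> R (inv t \<otimes> x)" using Rp(2)[OF tL] by simp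
    then have "R x = (\<lambda>(t, f). R t \<circ> f) (t, R (inv t \<otimes> x))" by simp
    moreover have "(t, R (inv t \<otimes> x)) \<in> T \<times> R ` Z" using t by blast
    ultimately show "R x \<in> (\<lambda>(t, f). R t \<circ> f) ` (T \<times> R ` Z)" by (rule image_eqI)
  qed
  moreover have "finite ((\<lambda>(t, f). R t \<circ> f) ` (T \<times> R ` Z))" using T(1) fin by blast
  ultimately show ?thesis by (rule finite_subset)
qed

text \<open>The elements mapped into \<^term>\<open>D\<close> have finite index because the quotient is abelian, and
  among them those mapped to the identity for the same reason.\<close>

lemma FW_metabelian_image:
  assumes R: "PGL_hom L R" and L: "subgroup L G" and FW: "FW_subgroup G L" and D: "subgroup D PGLg"
    and c1: "\<And>\<gamma> \<delta>. \<gamma> \<in> L \<Longrightarrow> \<delta> \<in> L \<Longrightarrow> R \<gamma> \<circ> R \<delta> \<circ> invf (R \<delta> \<circ> R \<gamma>) \<in> D"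
    and c2: "\<And>f g. f \<in> D \<Longrightarrow> g \<in> D \<Longrightarrow> f \<circ> g = g \<circ> f"
  shows "finite (R ` L)"
proof -
  note Lp = subgroup_props[OF L] and Rp = PGL_hom_props[OF R L]
  define N where "N E = {\<gamma> \<in> L. R \<gamma> \<in> E}" for E
  have triv: "subgroup {id} PGLg" using PGLg.triv_subgroup by simp
  have sN: "subgroup (N D) G" "subgroup (N {id}) G"
    using subgroup_hom_preimage[OF R L D] subgroup_hom_preimage[OF R L triv] unfolding N_def by blast+
  have comm: "R (\<gamma> \<otimes> \<delta> \<otimes> inv (\<delta> \<otimes> \<gamma>)) = R \<gamma> \<circ> R \<delta> \<circ> invf (R \<delta> \<circ> R \<gamma>)" if "\<gamma> \<in> L" "\<delta> \<in> L" for \<gamma> \<delta>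
    using that Rp(2,4) Lp(2,3) by simp
  have NL: "N D \<subseteq> L" by (auto simp: N_def)
  have f1: "fin_index G (N D) L"
    by (rule FW_commutators_fin_index[OF L FW sN(1) NL]) (use c1 comm Lp(2,3) in \<open>simp add: N_def\<close>)
  have FW1: "FW_subgroup G (N D)" using FW_fin_index[OF L FW sN(1) NL f1] .
  have "id \<in> D" using PGLg.subgroup_props(4)[OF D] by simp
  then have sub: "N {id} \<subseteq> N D" by (auto simp: N_def)
  have f2: "fin_index G (N {id}) (N D)"
  proof (rule FW_commutators_fin_index[OF sN(1) FW1 sN(2) sub])
    fix x y assume xy: "x \<in> N D" "y \<in> N D"
    then have xL: "x \<in> L" "y \<in> L" "R x \<circ> R y = R y \<circ> R x" using c2 by (simp_all add: N_def)
    then have "R (x \<otimes> y \<otimes> inv (y \<otimes> x)) = id" using comm Rp(1) by simp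
    then show "x \<otimes> y \<otimes> inv (y \<otimes> x) \<in> N {id}" using xL Lp(2,3) by (simp add: N_def)
  qed
  have "fin_index G (N {id}) L"
    using fin_index_trans[OF f2 f1 subgroup.subset[OF L] NL L] .
  then show ?thesis by (rule finite_image_of_fin_index[OF R L _ _]) (auto intro: finite_subset[of _ "{id}"] simp: N_def)
qed

lemma FW_image_in_centralizer:
  assumes R: "PGL_hom L R" and L: "subgroup L G" and FW: "FW_subgroup G L"
    and h: "h \<in> PGL" "h \<noteq> id" "\<And>\<gamma>. \<gamma> \<in> L \<Longrightarrow> R \<gamma> \<circ> h = h \<circ> R \<gamma>"
  shows "finite (R ` L)"
proof -
  obtain B where B: "det B \<noteq> 0" "h = homography B" using h(1) by (auto simp: PGL_def)
  show ?thesis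
  proof (rule FW_metabelian_image[OF R L FW subgroup_centralizer_mat[OF B(1)]])
    fix \<gamma> \<delta> assume "\<gamma> \<in> L" "\<delta> \<in> L"
    then have "R \<gamma> \<in> centralizer_PGL (homography B)" "R \<delta> \<in> centralizer_PGL (homography B)"
      using h(3) B(2) PGL_hom_props(1)[OF R L] by (simp_all add: centralizer_PGL_def)
    then show "R \<gamma> \<circ> R \<delta> \<circ> invf (R \<delta> \<circ> R \<gamma>) \<in> centralizer_mat B"
      by (rule centralizer_commutator[OF B(1)])
  qed (use centralizer_mat_abelian[of B] B h(2) in blast)
qed

lemma FW_image_upper:
  assumes R: "PGL_hom L R" and L: "subgroup L G" and FW: "FW_subgroup G L"
    and up: "\<And>\<gamma>. \<gamma> \<in> L \<Longrightarrow> \<exists>a b d. a * d \<noteq> 0 \<and> R \<gamma> = homography (mat2 a b 0 d)"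
  shows "finite (R ` L)"
proof (rule FW_metabelian_image[OF R L FW])
  define D where "D = range (\<lambda>b. homography (mat2 1 b 0 1))"
  have comp: "homography (mat2 1 b 0 1) \<circ> homography (mat2 1 c 0 1) = homography (mat2 1 (b + c) 0 1)" for b c
    by (simp add: homography_comp add.commute)
  have inv: "invf (homography (mat2 1 b 0 1)) = homography (mat2 1 (- b) 0 1)" for b
  proof -
    have "homography (mat2 1 b 0 1) \<circ> homography (mat2 1 (- b) 0 1) = id"
      "homography (mat2 1 (- b) 0 1) \<circ> homography (mat2 1 b 0 1) = id"
      using comp[of b "- b"] comp[of "- b" b] homography_id by (simp_all add: mat_1_mat2)
    then show ?thesis by (metis inv_unique_comp)
  qed
  have P: "homography (mat2 1 b 0 1) \<in> PGL" for b by (simp add: homography_PGL)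
  show "subgroup D PGLg"
  proof (rule PGLg.subgroupI)
    show "inv\<^bsub>PGLg\<^esub> f \<in> D" if "f \<in> D" for f using that inv P by (auto simp: D_def)
    show "f \<otimes>\<^bsub>PGLg\<^esub> g \<in> D" if "f \<in> D" "g \<in> D" for f g using that comp by (auto simp: D_def)
  qed (use P in \<open>auto simp: D_def\<close>)
  show "f \<circ> g = g \<circ> f" if "f \<in> D" "g \<in> D" for f g using that comp by (auto simp: D_def add.commute)
  fix \<gamma> \<delta> assume "\<gamma> \<in> L" "\<delta> \<in> L"
  then obtain a b d a' b' d' where m: "a * d \<noteq> 0" "R \<gamma> = homography (mat2 a b 0 d)"
    "a' * d' \<noteq> 0" "R \<delta> = homography (mat2 a' b' 0 d')" using up by metis
  define t where "t = (a * b' + b * d' - (a' * b + b' * d)) / (d * d')"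
  have e: "mat2 a b 0 d ** mat2 a' b' 0 d' = mat2 1 t 0 1 ** (mat2 a' b' 0 d' ** mat2 a b 0 d)"
    using m(1,3) by (simp add: t_def field_simps)
  have "det (mat2 a b 0 d) \<noteq> 0" "det (mat2 a' b' 0 d') \<noteq> 0" using m by simp_all
  then have "R \<gamma> \<circ> R \<delta> \<circ> invf (R \<delta> \<circ> R \<gamma>) = homography (mat2 1 t 0 1)"
    using homography_commutator[OF _ _ e] m by simp
  then show "R \<gamma> \<circ> R \<delta> \<circ> invf (R \<delta> \<circ> R \<gamma>) \<in> D" by (simp add: D_def)
qed

lemma FW_image_monomial:
  assumes R: "PGL_hom L R" and L: "subgroup L G" and FW: "FW_subgroup G L"
    and mono: "\<And>\<gamma>. \<gamma> \<in> L \<Longrightarrow> \<exists>a d. a * d \<noteq> 0 \<and> (R \<gamma> = homography (mat2 a 0 0 d) \<or> R \<gamma> = homography (mat2 0 a d 0))"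
  shows "finite (R ` L)"
proof (rule FW_metabelian_image[OF R L FW])
  define D where "D = {homography (mat2 a 0 0 d) | a d. a * d \<noteq> 0}"
  have comp: "homography (mat2 a 0 0 d) \<circ> homography (mat2 a' 0 0 d') = homography (mat2 (a * a') 0 0 (d * d'))"
    if "a' * d' \<noteq> 0" for a d a' d'
    using that by (simp add: homography_comp)
  have inv: "invf (homography (mat2 a 0 0 d)) = homography (mat2 (1 / a) 0 0 (1 / d))" if "a * d \<noteq> 0" for a d
  proof -
    have "homography (mat2 a 0 0 d) \<circ> homography (mat2 (1 / a) 0 0 (1 / d)) = id"
      "homography (mat2 (1 / a) 0 0 (1 / d)) \<circ> homography (mat2 a 0 0 d) = id"
      using that homography_id by (simp_all add: homography_comp mat_1_mat2)
    then show ?thesis by (metis inv_unique_comp)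
  qed
  have P: "f \<in> PGL" if "f \<in> D" for f using that homography_PGL by (auto simp: D_def)
  show "subgroup D PGLg"
  proof (rule PGLg.subgroupI)
    show "D \<subseteq> carrier PGLg" using P by auto
    have "homography (mat2 1 0 0 1) \<in> D" by (force simp: D_def)
    then show "D \<noteq> {}" by blast
    show "inv\<^bsub>PGLg\<^esub> f \<in> D" if f: "f \<in> D" for f
    proof -
      obtain a d where ad: "a * d \<noteq> 0" "f = homography (mat2 a 0 0 d)" using f by (auto simp: D_def)
      have "(1 / a) * (1 / d) \<noteq> 0" using ad(1) by simp
      then have "homography (mat2 (1 / a) 0 0 (1 / d)) \<in> D" unfolding D_def by blast
      then show ?thesis using inv[OF ad(1)] ad(2) P[OF f] by simp
    qed
    show "f \<otimes>\<^bsub>PGLg\<^esub> g \<in> D" if fg: "f \<in> D" "g \<in> D" for f g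
    proof -
      obtain a d where ad: "a * d \<noteq> 0" "f = homography (mat2 a 0 0 d)" using fg(1) by (auto simp: D_def)
      obtain a' d' where ad': "a' * d' \<noteq> 0" "g = homography (mat2 a' 0 0 d')" using fg(2) by (auto simp: D_def)
      have "(a * a') * (d * d') \<noteq> 0" using ad(1) ad'(1) by simp
      then have "homography (mat2 (a * a') 0 0 (d * d')) \<in> D" unfolding D_def by blast
      then show ?thesis using comp[OF ad'(1), of a d] ad(2) ad'(2) by simp
    qed
  qed
  show "f \<circ> g = g \<circ> f" if "f \<in> D" "g \<in> D" for f g
    using that comp by (auto simp: D_def mult.commute)
  fix \<gamma> \<delta> assume gd: "\<gamma> \<in> L" "\<delta> \<in> L"
  obtain A where A: "R \<gamma> = homography A" "\<exists>a d. a * d \<noteq> 0 \<and> (A = mat2 a 0 0 d \<or> A = mat2 0 a d 0)" using mono[OF gd(1)] by blast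
  obtain B where B: "R \<delta> = homography B" "\<exists>a d. a * d \<noteq> 0 \<and> (B = mat2 a 0 0 d \<or> B = mat2 0 a d 0)" using mono[OF gd(2)] by blast
  have "\<exists>p q. p * q \<noteq> 0 \<and> A ** B = mat2 p 0 0 q ** (B ** A)"
  proof -
    obtain a d where a: "a * d \<noteq> 0" "A = mat2 a 0 0 d \<or> A = mat2 0 a d 0" using A(2) by blast
    obtain p q where p: "p * q \<noteq> 0" "B = mat2 p 0 0 q \<or> B = mat2 0 p q 0" using B(2) by blast
    consider "A = mat2 a 0 0 d" "B = mat2 p 0 0 q" | "A = mat2 0 a d 0" "B = mat2 p 0 0 q"
      | "A = mat2 a 0 0 d" "B = mat2 0 p q 0" | "A = mat2 0 a d 0" "B = mat2 0 p q 0" using a(2) p(2) by blast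
    then show ?thesis
    proof cases
      case 1
      then show ?thesis by (intro exI[of _ 1]) simp
    next
      case 2
      then show ?thesis using a(1) p(1) by (intro exI[of _ "q / p"] exI[of _ "p / q"]) simp
    next
      case 3
      then show ?thesis using a(1) p(1) by (intro exI[of _ "a / d"] exI[of _ "d / a"]) simp
    next
      case 4
      then show ?thesis using a(1) p(1) by (intro exI[of _ "a * q / (p * d)"] exI[of _ "d * p / (q * a)"]) simp
    qed
  qed
  then obtain p q where pq: "p * q \<noteq> 0" "A ** B = mat2 p 0 0 q ** (B ** A)" by blast
  have dets: "det A \<noteq> 0" "det B \<noteq> 0" using A(2) B(2) by auto
  then have "R \<gamma> \<circ> R \<delta> \<circ> invf (R \<delta> \<circ> R \<gamma>) = homography (mat2 p 0 0 q)"
    using homography_commutator[OF dets pq(2)] A(1) B(1) by simp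
  then show "R \<gamma> \<circ> R \<delta> \<circ> invf (R \<delta> \<circ> R \<gamma>) \<in> D" using pq(1) by (auto simp: D_def)
qed

text \<open>All matrices of determinant 1 that represent elements of the image. Both signs are included, so
  no lift of the homomorphism to \<open>SL\<^sub>2\<close> is needed.\<close>

definition mats :: "'a set \<Rightarrow> ('a \<Rightarrow> real option \<Rightarrow> real option) \<Rightarrow> (real^2^2) set" where
  "mats L R = {A. det A = 1 \<and> homography A \<in> R ` L}"

lemma matgroup_mats:
  assumes R: "PGL_hom L R" and L: "subgroup L G"
  shows "matgroup (mats L R)"
  unfolding matgroup_def
proof (intro conjI ballI)
  note Lp = subgroup_props[OF L] and Rp = PGL_hom_props[OF R L]
  show "mat 1 \<in> mats L R" unfolding mats_def using Lp(4) Rp(3) homography_id by (auto intro: image_eqI[of _ _ \<one>])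
  fix A assume A: "A \<in> mats L R"
  then obtain \<gamma> where g: "\<gamma> \<in> L" "homography A = R \<gamma>" and d: "det A = 1" by (auto simp: mats_def)
  show "det A = 1" by (rule d)
  have "homography A \<circ> homography (adj2 A) = id" "homography (adj2 A) \<circ> homography A = id"
    using mult_adj2[OF d] d homography_id by (simp_all add: homography_comp)
  then have "homography (adj2 A) = invf (R \<gamma>)" using g(2) by (metis inv_unique_comp)
  then have "homography (adj2 A) = R (inv \<gamma>)" using Rp(4)[OF g(1)] by simp
  then show "adj2 A \<in> mats L R" using d Lp(3)[OF g(1)] by (simp add: mats_def)
  fix B assume "B \<in> mats L R"
  then obtain \<delta> where h: "\<delta> \<in> L" "homography B = R \<delta>" and e: "det B = 1" by (auto simp: mats_def)
  have "homography (A ** B) = R (\<gamma> \<otimes> \<delta>)" using g h e Rp(2) by (simp add: homography_comp[symmetric])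
  then show "A ** B \<in> mats L R" using d e Lp(2)[OF g(1) h(1)] by (simp add: mats_def det_mul)
qed

lemma PGL_hom_conj:
  assumes R: "PGL_hom L R" and p: "p \<in> PGL"
  shows "PGL_hom L (\<lambda>\<gamma>. invf p \<circ> R \<gamma> \<circ> p)"
  using R p by (simp add: PGL_hom_def comp_assoc)

lemma finite_image_conj:
  assumes R: "PGL_hom L R" and p: "p \<in> PGL" and fin: "finite ((\<lambda>\<gamma>. invf p \<circ> R \<gamma> \<circ> p) ` L)"
  shows "finite (R ` L)"
proof -
  have "R ` L = (\<lambda>f. p \<circ> f \<circ> invf p) ` (\<lambda>\<gamma>. invf p \<circ> R \<gamma> \<circ> p) ` L"
    using p by (simp add: image_image comp_assoc)
  then show ?thesis using fin by simp
qed

lemma mats_conj: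
  assumes P: "P ** P' = mat 1" "P' ** P = mat 1" and A: "A \<in> mats L R"
  shows "P' ** A ** P \<in> mats L (\<lambda>\<gamma>. invf (homography P) \<circ> R \<gamma> \<circ> homography P)"
proof -
  note PP = homography_inverse_pair[OF P]
  note nz = PP(2,3) and inv = PP(7)
  obtain \<gamma> where g: "\<gamma> \<in> L" "homography A = R \<gamma>" "det A = 1" using A by (auto simp: mats_def)
  have "homography (P' ** A ** P) = homography P' \<circ> homography A \<circ> homography P"
    using nz g(3) by (simp add: homography_comp det_mul)
  then have "homography (P' ** A ** P) = invf (homography P) \<circ> R \<gamma> \<circ> homography P"
    using inv g(2) by simp
  moreover have "det (P' ** A ** P) = 1" using PP(1) g(3) by (simp add: det_mul mult.commute)
  ultimately show ?thesis using g(1) by (simp add: mats_def)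
qed

lemma image_mats:
  assumes "\<forall>\<gamma>\<in>L. \<exists>A. det A = 1 \<and> R \<gamma> = homography A" "\<gamma> \<in> L"
  shows "\<exists>A\<in>mats L R. R \<gamma> = homography A \<and> det A = 1"
  using assms unfolding mats_def by (metis (mono_tags, lifting) image_eqI mem_Collect_eq)

text \<open>The stabilizers of a point and of a pair of points are solvable, so an infinite image is not
  contained in those of the fixed points of the hyperbolic element.\<close>

lemma dense_hyperbolic:
  assumes R: "PGL_hom L R" and L: "subgroup L G" and FW: "FW_subgroup G L"
    and SL: "\<forall>\<gamma>\<in>L. \<exists>A. det A = 1 \<and> R \<gamma> = homography A"
    and inf: "infinite (R ` L)" and l: "mat2 l 0 0 (1 / l) \<in> mats L R" "l \<noteq> 0" "l\<^sup>2 \<noteq> 1" and X: "det X = 1"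
  shows "X \<in> Zcl (mats L R)"
proof -
  have M: "matgroup (mats L R)" by (rule matgroup_mats[OF R L])
  have T: "\<forall>s. s \<noteq> 0 \<longrightarrow> mat2 s 0 0 (1 / s) \<in> Zcl (mats L R)" using torus_in_Zcl[OF M l] by blast
  have up: "\<exists>a b c d. mat2 a b c d \<in> mats L R \<and> c \<noteq> 0"
  proof (rule ccontr)
    assume no: "\<not> ?thesis"
    have "finite (R ` L)"
    proof (rule FW_image_upper[OF R L FW])
      fix \<gamma> assume g: "\<gamma> \<in> L"
      obtain A where A: "A \<in> mats L R" "R \<gamma> = homography A" "det A = 1" using image_mats[OF SL g] by blast
      obtain a b c d where m: "A = mat2 a b c d" by (rule mat2_cases)
      have "c = 0" using no A(1) m by blast
      then show "\<exists>a b d. a * d \<noteq> 0 \<and> R \<gamma> = homography (mat2 a b 0 d)" using A m by (intro exI[of _ a] exI[of _ b] exI[of _ d]) auto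
    qed
    then show False using inf by blast
  qed
  have low: "\<exists>a b c d. mat2 a b c d \<in> mats L R \<and> b \<noteq> 0"
  proof (rule ccontr)
    assume no: "\<not> ?thesis"
    \<comment> \<open>Conjugation by the inversion makes lower triangular matrices upper triangular.\<close>
    let ?w = "homography (mat2 0 1 1 0)"
    have w: "?w \<in> PGL" by (simp add: homography_PGL)
    have "?w \<circ> ?w = id" using homography_id by (simp add: homography_comp mat_1_mat2)
    then have iw: "invf ?w = ?w" by (metis inv_unique_comp)
    have "finite ((\<lambda>\<gamma>. invf ?w \<circ> R \<gamma> \<circ> ?w) ` L)"
    proof (rule FW_image_upper[OF PGL_hom_conj[OF R w] L FW])
      fix \<gamma> assume g: "\<gamma> \<in> L"
      obtain A where A: "A \<in> mats L R" "R \<gamma> = homography A" "det A = 1" using image_mats[OF SL g] by blast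
      obtain a b c d where m: "A = mat2 a b c d" by (rule mat2_cases)
      have "b = 0" using no A(1) m by blast
      then have "invf ?w \<circ> R \<gamma> \<circ> ?w = homography (mat2 d c 0 a)" "d * a \<noteq> 0"
        using A m unfolding iw by (auto simp: homography_comp)
      then show "\<exists>a b d. a * d \<noteq> 0 \<and> invf ?w \<circ> R \<gamma> \<circ> ?w = homography (mat2 a b 0 d)" by blast
    qed
    then show False using inf finite_image_conj[OF R w] by blast
  qed
  have mono: "\<exists>a b c d. mat2 a b c d \<in> mats L R \<and> (b \<noteq> 0 \<or> c \<noteq> 0) \<and> (a \<noteq> 0 \<or> d \<noteq> 0)"
  proof (rule ccontr)
    assume no: "\<not> ?thesis"
    have "finite (R ` L)"
    proof (rule FW_image_monomial[OF R L FW])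
      fix \<gamma> assume g: "\<gamma> \<in> L"
      obtain A where A: "A \<in> mats L R" "R \<gamma> = homography A" "det A = 1" using image_mats[OF SL g] by blast
      obtain a b c d where m: "A = mat2 a b c d" by (rule mat2_cases)
      have det: "a * d - b * c = 1" using A(3) m by simp
      consider "b = 0" "c = 0" | "a = 0" "d = 0" using no A(1) m by blast
      then show "\<exists>a d. a * d \<noteq> 0 \<and> (R \<gamma> = homography (mat2 a 0 0 d) \<or> R \<gamma> = homography (mat2 0 a d 0))"
      proof cases
        case 1
        then show ?thesis using A(2) m det by (intro exI[of _ a] exI[of _ d]) auto
      next
        case 2
        then show ?thesis using A(2) m det by (intro exI[of _ b] exI[of _ c]) auto
      qed
    qed
    then show False using inf by blast
  qed
  from up low mono show ?thesis using Zcl_full[OF M T _ _ _ _ _ _ _ X] by blast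
qed

lemma Zcl_conj:
  assumes P: "P ** P' = mat 1" "P' ** P = mat 1"
    and X: "P' ** X ** P \<in> Zcl (mats L (\<lambda>\<gamma>. invf (homography P) \<circ> R \<gamma> \<circ> homography P))" and d: "det X = 1"
  shows "X \<in> Zcl (mats L R)"
  unfolding Zcl_def
proof (intro CollectI conjI allI impI d)
  fix p :: "real^2^2 \<Rightarrow> real" assume p: "real_polynomial_function p \<and> (\<forall>X\<in>mats L R. p X = 0)"
  let ?R = "\<lambda>\<gamma>. invf (homography P) \<circ> R \<gamma> \<circ> homography P"
  note hP = homography_inverse_pair(5,6)[OF P]
  have PP: "homography P \<in> PGL" "homography P' \<in> PGL"
    using homography_inverse_pair(4)[OF P] homography_inverse_pair(4)[OF P(2,1)] by blast+
  have iP: "invf (homography P) = homography P'" "invf (homography P') = homography P"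
    using homography_inverse_pair(7)[OF P] homography_inverse_pair(7)[OF P(2,1)] by blast+
  have "(\<lambda>\<gamma>. invf (homography P') \<circ> ?R \<gamma> \<circ> homography P') = R"
    using iP hP PP by (simp add: comp_assoc) (simp add: o_assoc hP)
  then have back': "P ** Y ** P' \<in> mats L R" if "Y \<in> mats L ?R" for Y
    using mats_conj[OF P(2,1) that] by simp
  have "p (P ** (P' ** X ** P) ** P') = 0"
  proof (rule ZclD[OF X])
    show "real_polynomial_function (\<lambda>Y. p (P ** Y ** P'))"
      using linear_real_polynomial_compose[OF linear_real_polynomial_compose[OF _ linear_mult_right] linear_mult_left] p
      by blast
    show "p (P ** Y ** P') = 0" if "Y \<in> mats L ?R" for Y using back'[OF that] p by blast
  qed
  moreover have "P ** (P' ** X ** P) ** P' = X"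
    using P(1) by (metis matrix_mul_assoc matrix_mul_lid matrix_mul_rid)
  ultimately show "p X = 0" by simp
qed

text \<open>A hyperbolic element of the image is diagonal in suitable coordinates. Without hyperbolic
  elements, an elliptic element commutes with the whole image, as a commutator with it would be
  hyperbolic otherwise. If all nontrivial elements are parabolic, they fix the fixed point of one
  of them, as is seen from the traces of the products with its first two powers. In both cases the
  image is solvable and hence finite.\<close>

theorem FW_infinite_image_dense:
  assumes R: "PGL_hom L R" and L: "subgroup L G" and FW: "FW_subgroup G L"
    and SL: "\<forall>\<gamma>\<in>L. \<exists>A. det A = 1 \<and> R \<gamma> = homography A"
    and inf: "infinite (R ` L)" and X: "det X = 1"
  shows "X \<in> Zcl (mats L R)"
proof (cases "\<exists>A\<in>mats L R. (A$1$1 + A$2$2)\<^sup>2 > 4")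
  case True
  then obtain A where A: "A \<in> mats L R" "(A$1$1 + A$2$2)\<^sup>2 > 4" by blast
  then have dA: "det A = 1" by (simp add: mats_def)
  obtain P P' l b where P: "P ** P' = mat 1" "P' ** P = mat 1" "P' ** A ** P = mat2 l b 0 (1 / l)" "l \<noteq> 0"
    "l + 1 / l = A$1$1 + A$2$2"
    using eigenvector_conjugate[OF dA] A(2) by (metis less_imp_le)
  have l2: "l\<^sup>2 \<noteq> 1"
  proof
    assume "l\<^sup>2 = 1"
    then have "l = 1 \<or> l = - 1" by (simp add: power2_eq_1_iff)
    then have "(l + 1 / l)\<^sup>2 = 4" by auto
    then show False using A(2) P(5) by simp
  qed
  then have nz: "l - 1 / l \<noteq> 0" using P(4) by (simp add: field_simps power2_eq_square)
  \<comment> \<open>Conjugation by the unipotent matrix with this entry removes \<open>b\<close>.\<close>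
  define t where "t = - b / (l - 1 / l)"
  define Q Q' where "Q = P ** mat2 1 t 0 1" and "Q' = mat2 1 (- t) 0 1 ** P'"
  have u: "mat2 1 t 0 1 ** mat2 1 (- t) 0 1 = mat 1" "mat2 1 (- t) 0 1 ** mat2 1 t 0 1 = mat 1" by (simp_all add: mat_1_mat2)
  have Q: "Q ** Q' = mat 1" "Q' ** Q = mat 1"
    unfolding Q_def Q'_def using u P(1,2) by (metis matrix_mul_assoc matrix_mul_lid matrix_mul_rid)+
  have "Q' ** A ** Q = mat2 1 (- t) 0 1 ** (P' ** A ** P) ** mat2 1 t 0 1"
    unfolding Q_def Q'_def by (simp only: matrix_mul_assoc)
  also have "\<dots> = mat2 l (b + t * (l - 1 / l)) 0 (1 / l)" unfolding P(3) by (simp add: algebra_simps)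
  also have "b + t * (l - 1 / l) = 0" using nz by (simp add: t_def)
  finally have QA: "Q' ** A ** Q = mat2 l 0 0 (1 / l)" .
  note QQ = homography_inverse_pair[OF Q]
  have q: "det Q \<noteq> 0" "homography Q \<in> PGL" using QQ by blast+
  let ?R = "\<lambda>\<gamma>. invf (homography Q) \<circ> R \<gamma> \<circ> homography Q"
  have "Q' ** X ** Q \<in> Zcl (mats L ?R)"
  proof (rule dense_hyperbolic[OF PGL_hom_conj[OF R q(2)] L FW _ _ _ P(4) l2])
    show "mat2 l 0 0 (1 / l) \<in> mats L ?R" using mats_conj[OF Q A(1)] QA by simp
    show "infinite (?R ` L)" using inf finite_image_conj[OF R q(2)] by blast
    show "det (Q' ** X ** Q) = 1" using QQ(1) X by (simp add: det_mul mult.commute)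
    show "\<forall>\<gamma>\<in>L. \<exists>A. det A = 1 \<and> ?R \<gamma> = homography A"
    proof
      fix \<gamma> assume g: "\<gamma> \<in> L"
      obtain B where B: "R \<gamma> = homography B" "det B = 1" using image_mats[OF SL g] by blast
      have "?R \<gamma> = homography (Q' ** B ** Q)" unfolding QQ(7) using B q(1) by (simp add: homography_comp det_mul)
      moreover have "det (Q' ** B ** Q) = 1" using QQ(1) B(2) by (simp add: det_mul mult.commute)
      ultimately show "\<exists>A. det A = 1 \<and> ?R \<gamma> = homography A" by blast
    qed
  qed
  then show ?thesis by (rule Zcl_conj[OF Q _ X])
next
  case nohyp: False
  have M: "matgroup (mats L R)" by (rule matgroup_mats[OF R L])
  have "finite (R ` L)"
  proof (cases "\<exists>A\<in>mats L R. (A$1$1 + A$2$2)\<^sup>2 < 4")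
    case True
    then obtain A where A: "A \<in> mats L R" "(A$1$1 + A$2$2)\<^sup>2 < 4" by blast
    obtain a b c d where m: "A = mat2 a b c d" by (rule mat2_cases)
    have dA: "a * d - b * c = 1" using A(1) m by (simp add: mats_def)
    have comm: "A ** B = B ** A" if B: "B \<in> mats L R" for B
    proof (rule ccontr)
      assume nc: "A ** B \<noteq> B ** A"
      obtain p q r s where n: "B = mat2 p q r s" by (rule mat2_cases)
      have dB: "p * s - q * r = 1" using B n by (simp add: mats_def)
      let ?X = "A ** B ** (adj2 A ** adj2 B)"
      have "?X \<in> mats L R" using M A(1) B by (simp add: matgroup_def)
      then have "(?X$1$1 + ?X$2$2)\<^sup>2 \<le> 4" using nohyp by (metis not_le)
      moreover have "(a + d)\<^sup>2 < 4" "mat2 a b c d ** mat2 p q r s \<noteq> mat2 p q r s ** mat2 a b c d"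
        using A(2) nc m n by simp_all
      then have "?X$1$1 + ?X$2$2 > 2"
        using elliptic_commutator[OF dA dB] unfolding m n adj2_mat2 Let_def by blast
      then have "(?X$1$1 + ?X$2$2)\<^sup>2 > 2\<^sup>2" by (intro power_strict_mono) auto
      ultimately show False by simp
    qed
    have "homography A \<noteq> id"
    proof
      assume "homography A = id"
      then have "homography A = homography (mat 1)" by (simp add: homography_id)
      then obtain k where k: "A = k *\<^sub>R mat 1" using homography_eqD[of A "mat 1"] m dA by auto
      then have "a = k" "d = k" "b = 0" "c = 0" using m by (simp_all add: mat_1_mat2)
      then show False using dA A(2) m by (simp add: power2_eq_square)
    qed
    moreover have "homography A \<in> PGL" using m dA by (simp add: homography_PGL)
    moreover have "R \<gamma> \<circ> homography A = homography A \<circ> R \<gamma>" if g: "\<gamma> \<in> L" for \<gamma>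
    proof -
      obtain B where B: "B \<in> mats L R" "R \<gamma> = homography B" "det B = 1" using image_mats[OF SL g] by blast
      then show ?thesis using comm[OF B(1)] m dA by (simp add: homography_comp)
    qed
    ultimately show ?thesis using FW_image_in_centralizer[OF R L FW] by blast
  next
    case noell: False
    have tr: "(A$1$1 + A$2$2)\<^sup>2 = 4" if "A \<in> mats L R" for A
      using nohyp noell that by (meson linorder_neqE_linordered_idom)
    show ?thesis
    proof (cases "\<forall>\<gamma>\<in>L. R \<gamma> = id")
      case True
      then have "R ` L \<subseteq> {id}" by auto
      then show ?thesis using finite_subset by blast
    next
      case False
      then obtain \<gamma> where g: "\<gamma> \<in> L" "R \<gamma> \<noteq> id" by blast
      obtain A where A: "A \<in> mats L R" "R \<gamma> = homography A" "det A = 1" using image_mats[OF SL g(1)] by blast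
      obtain P P' l b where P: "P ** P' = mat 1" "P' ** P = mat 1" "P' ** A ** P = mat2 l b 0 (1 / l)" "l \<noteq> 0"
        "l + 1 / l = A$1$1 + A$2$2"
        using eigenvector_conjugate[OF A(3)] tr[OF A(1)] by (metis order_refl)
      have "(l + 1 / l)\<^sup>2 = 4" using tr[OF A(1)] P(5) by simp
      then have "(l - 1 / l)\<^sup>2 = 0" using P(4) by (simp add: power2_eq_square field_simps)
      then have l: "1 / l = l" "l * l = 1" using P(4) by (simp_all add: field_simps)
      note PP = homography_inverse_pair[OF P(1,2)]
      have p: "det P \<noteq> 0" "homography P \<in> PGL" "det P' \<noteq> 0" using PP by blast+
      note hP = PP(5,6) and iP = PP(7)
      let ?R = "\<lambda>\<gamma>. invf (homography P) \<circ> R \<gamma> \<circ> homography P"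
      have M': "matgroup (mats L ?R)" by (rule matgroup_mats[OF PGL_hom_conj[OF R p(2)] L])
      have T: "mat2 l b 0 l \<in> mats L ?R" using mats_conj[OF P(1,2) A(1)] P(3) l by simp
      have "b \<noteq> 0"
      proof
        assume "b = 0"
        then have "P' ** A ** P = l *\<^sub>R mat 1" using P(3) l by (simp add: mat_1_mat2)
        then have "A = l *\<^sub>R mat 1"
          using P(1) by (metis matrix_mul_assoc matrix_mul_lid matrix_mul_rid matrix_mult_scaleR(1,2))
        then show False using g(2) A(2) homography_scaleR[OF P(4)] homography_id by metis
      qed
      have "finite (?R ` L)"
      proof (rule FW_image_upper[OF PGL_hom_conj[OF R p(2)] L FW])
        fix \<delta> assume d: "\<delta> \<in> L"
        obtain B where B: "B \<in> mats L R" "R \<delta> = homography B" "det B = 1" using image_mats[OF SL d] by blast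
        obtain u v w x where m: "P' ** B ** P = mat2 u v w x" by (rule mat2_cases)
        have mM: "mat2 u v w x \<in> mats L ?R" using mats_conj[OF P(1,2) B(1)] m by simp
        have trR: "(Z$1$1 + Z$2$2)\<^sup>2 = 4" if Z: "Z \<in> mats L ?R" for Z
        proof -
          have back': "P ** Z ** P' \<in> mats L R"
          proof -
            have "(\<lambda>\<gamma>. invf (homography P') \<circ> ?R \<gamma> \<circ> homography P') = R"
            proof
              fix \<gamma>
              have "invf (homography P') = homography P" using homography_inverse_pair(7)[OF P(2,1)] .
              then show "invf (homography P') \<circ> ?R \<gamma> \<circ> homography P' = R \<gamma>"
                using hP p(2) unfolding iP by (metis comp_assoc comp_id id_comp)
            qed
            then show ?thesis using mats_conj[OF P(2,1) Z] by simp
          qed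
          obtain p1 q1 r1 s1 where PP: "P = mat2 p1 q1 r1 s1" by (rule mat2_cases)
          obtain p2 q2 r2 s2 where PP': "P' = mat2 p2 q2 r2 s2" by (rule mat2_cases)
          obtain z1 z2 z3 z4 where ZZ: "Z = mat2 z1 z2 z3 z4" by (rule mat2_cases)
          have e: "p2 * p1 + q2 * r1 = 1" "p2 * q1 + q2 * s1 = 0" "r2 * p1 + s2 * r1 = 0" "r2 * q1 + s2 * s1 = 1"
            using P(2) by (simp_all add: PP PP' mat_1_mat2)
          have "(P ** Z ** P') $ 1 $ 1 + (P ** Z ** P') $ 2 $ 2
            = z1 * (p2 * p1 + q2 * r1) + z3 * (p2 * q1 + q2 * s1) + z2 * (r2 * p1 + s2 * r1) + z4 * (r2 * q1 + s2 * s1)"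
            by (simp add: PP PP' ZZ algebra_simps)
          also have "\<dots> = Z$1$1 + Z$2$2" unfolding e by (simp add: ZZ)
          finally show ?thesis using tr[OF back'] by simp
        qed
        have 0: "(u + x)\<^sup>2 = 4" using trR[OF mM] by simp
        have 1: "(l * u + b * w + l * x)\<^sup>2 = 4"
        proof -
          have "mat2 l b 0 l ** mat2 u v w x \<in> mats L ?R" using M' T mM unfolding matgroup_def by blast
          from trR[OF this] show ?thesis by (simp add: algebra_simps)
        qed
        have 2: "(u + 2 * l * b * w + x)\<^sup>2 = 4"
        proof -
          have "mat2 l b 0 l ** (mat2 l b 0 l ** mat2 u v w x) \<in> mats L ?R" using M' T mM unfolding matgroup_def by blast
          then have "(l * (l * u + b * w) + b * (l * w) + l * (l * x))\<^sup>2 = 4" using trR by fastforce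
          moreover have "l * (l * u + b * w) + b * (l * w) + l * (l * x) = (l * l) * u + 2 * l * b * w + (l * l) * x"
            by (simp add: algebra_simps)
          ultimately show ?thesis using l(2) by simp
        qed
        \<comment> \<open>With \<open>\<tau> = u + x\<close> and \<open>y = l b w\<close>, the squares of \<open>\<tau>\<close>, \<open>\<tau> + y\<close> and \<open>\<tau> + 2 y\<close> agree, so \<open>y = 0\<close>.\<close>
        define y \<tau> where "y = l * b * w" and "\<tau> = u + x"
        have "(l * u + b * w + l * x)\<^sup>2 = (l * l) * (\<tau> + y)\<^sup>2"
        proof -
          have "l * (\<tau> + y) = l * u + (l * l) * (b * w) + l * x" by (simp add: y_def \<tau>_def algebra_simps)
          then have "l * u + b * w + l * x = l * (\<tau> + y)" using l(2) by simp
          then show ?thesis by (simp add: power2_eq_square)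
        qed
        then have 1: "(\<tau> + y)\<^sup>2 = 4" using 1 l(2) by simp
        have 2: "(\<tau> + 2 * y)\<^sup>2 = 4" using 2 by (simp add: y_def \<tau>_def algebra_simps)
        have "2 * (y * y) = (\<tau> + 2 * y)\<^sup>2 - 2 * (\<tau> + y)\<^sup>2 + \<tau>\<^sup>2" by (simp add: power2_eq_square algebra_simps)
        then have "y = 0" using 0 1 2 by (simp add: \<tau>_def)
        then have w: "w = 0" using \<open>b \<noteq> 0\<close> P(4) by (simp add: y_def)
        have "?R \<delta> = homography (P' ** B ** P)" unfolding iP using B p by (simp add: homography_comp det_mul)
        moreover have "u * x \<noteq> 0" using mM w by (auto simp: mats_def)
        ultimately show "\<exists>a b d. a * d \<noteq> 0 \<and> ?R \<delta> = homography (mat2 a b 0 d)" using m w by metis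
      qed
      then show ?thesis using finite_image_conj[OF R p(2)] by blast
    qed
  qed
  then show ?thesis using inf by blast
qed

end

section \<open>Projective representations of a subgroup of finite index\<close>

lemma det_scaleR_2: "det (k *\<^sub>R A) = k\<^sup>2 * det A" for A :: "real^2^2"
  by (simp add: det_2 power2_eq_square algebra_simps)

lemma homography_pos:
  fixes A :: "real^2^2"
  assumes "det A > 0"
  obtains B where "det B = 1" "homography A = homography B"
proof
  let ?k = "1 / sqrt (det A)"
  have "det (?k *\<^sub>R A) = ?k\<^sup>2 * det A" by (rule det_scaleR_2)
  also have "\<dots> = 1" using assms by (simp add: power_divide)
  finally show "det (?k *\<^sub>R A) = 1" .
  show "homography A = homography (?k *\<^sub>R A)" using assms by (simp add: homography_scaleR)
qed

lemma PGL_inverse_matrix: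
  assumes "det A \<noteq> 0"
  obtains B where "det B * det A = 1" "invf (homography A) = homography B"
proof -
  obtain B where B: "A ** B = mat 1" "B ** A = mat 1"
    using assms invertible_det_nz[of A] unfolding invertible_def by blast
  from homography_inverse_pair(1,7)[OF B] show thesis by (rule that)
qed

text \<open>The image of \<open>SL\<^sub>2\<close> in the group of homographies, which is a copy of \<open>PSL\<^sub>2\<close> and has
  index 2.\<close>

definition PGL_pos :: "(real option \<Rightarrow> real option) set" where
  "PGL_pos = {homography A | A. det A = 1}"

lemma PGL_posI: "det A > 0 \<Longrightarrow> homography A \<in> PGL_pos"
  unfolding PGL_pos_def by (erule homography_pos) blast

lemma PGL_pos_div:
  assumes "f \<in> PGL" "g \<in> PGL" "f \<in> PGL_pos \<longleftrightarrow> g \<in> PGL_pos"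
  shows "invf f \<circ> g \<in> PGL_pos"
proof -
  obtain A where A: "det A \<noteq> 0" "f = homography A" using assms(1) by (auto simp: PGL_def)
  obtain B where B: "det B \<noteq> 0" "g = homography B" using assms(2) by (auto simp: PGL_def)
  have "\<exists>A B. f = homography A \<and> g = homography B \<and> det A * det B > 0"
  proof (cases "f \<in> PGL_pos")
    case True
    then have "g \<in> PGL_pos" using assms(3) by blast
    with True obtain A B where "det A = 1" "f = homography A" "det B = 1" "g = homography B"
      unfolding PGL_pos_def by blast
    then have "f = homography A \<and> g = homography B \<and> det A * det B > 0" by simp
    then show ?thesis by blast
  next
    case False
    then have "g \<notin> PGL_pos" using assms(3) by blast
    then have "\<not> det A > 0" "\<not> det B > 0" using False PGL_posI A(2) B(2) by blast+
    then have "det A * det B > 0" using A(1) B(1) by (intro mult_neg_neg) auto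
    then show ?thesis using A(2) B(2) by blast
  qed
  then obtain A B where AB: "f = homography A" "g = homography B" "det A * det B > 0" by blast
  then have nz: "det A \<noteq> 0" "det B \<noteq> 0" by auto
  obtain A' where A': "det A' * det A = 1" "invf (homography A) = homography A'" using PGL_inverse_matrix[OF nz(1)] .
  have "invf f \<circ> g = homography (A' ** B)" using AB A' nz(2) by (simp add: homography_comp)
  moreover have "det A' = 1 / det A" using A'(1) nz(1) by (simp add: field_simps)
  then have "det (A' ** B) = (det A * det B) / (det A)\<^sup>2" using nz(1) by (simp add: det_mul power2_eq_square)
  then have "det (A' ** B) > 0" using AB(3) nz(1) by simp
  ultimately show ?thesis using PGL_posI by simp
qed

lemma id_PGL_pos [simp]: "id \<in> PGL_pos"
  using homography_id unfolding PGL_pos_def by (auto intro!: exI[of _ "mat 1"])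

lemma PGL_pos_PGL: "f \<in> PGL_pos \<Longrightarrow> f \<in> PGL"
  by (auto simp: PGL_pos_def homography_PGL)

lemma PGL_pos_inv: "f \<in> PGL_pos \<Longrightarrow> invf f \<in> PGL_pos"
  using PGL_pos_div[of f id] PGL_pos_PGL[of f] PGL_pos_PGL[OF id_PGL_pos] by simp

lemma subgroup_PGL_pos: "subgroup PGL_pos PGLg"
proof (rule PGLg.subgroupI)
  show "PGL_pos \<subseteq> carrier PGLg" using PGL_pos_PGL by auto
  show "PGL_pos \<noteq> {}" using id_PGL_pos by blast
  show "inv\<^bsub>PGLg\<^esub> f \<in> PGL_pos" if "f \<in> PGL_pos" for f
    using PGL_pos_inv[OF that] PGL_pos_PGL[OF that] by simp
  show "f \<otimes>\<^bsub>PGLg\<^esub> g \<in> PGL_pos" if f: "f \<in> PGL_pos" and g: "g \<in> PGL_pos" for f g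
    using PGL_pos_div[of "invf f" g] PGL_pos_inv[OF f] PGL_pos_PGL[OF f] PGL_pos_PGL[OF g] f g by simp
qed

context component
begin

text \<open>Whatever the holonomy is, a subgroup of finite index has a homomorphism to \<open>PSL\<^sub>2\<close> that knows
  the action on the component up to finitely many choices of the germ at the base point: the trivial
  homomorphism if the holonomy is nontrivial, and \<^term>\<open>R\<close> otherwise.\<close>

lemma component_hom:
  obtains M Q where "subgroup M G" "M \<subseteq> L" "fin_index G M L" "PGL_hom M Q" "Q ` M \<subseteq> PGL_pos"
    "\<forall>S\<subseteq>M. finite (Q ` S) \<longrightarrow> finite ((\<lambda>\<gamma>. gm \<gamma> s0) ` S)"
proof (cases "h = id")
  case True
  have z: "zpow h k = id" for k using True PGLg.int_pow_one[of k] by simp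
  have R: "PGL_hom L R"
    unfolding PGL_hom_def
  proof (intro conjI ballI)
    show "R \<gamma> \<in> PGL" if "\<gamma> \<in> L" for \<gamma> using that by simp
    show "R (\<gamma> \<otimes> \<delta>) = R \<gamma> \<circ> R \<delta>" if "\<gamma> \<in> L" "\<delta> \<in> L" for \<gamma> \<delta>
      using R_mult[OF that] by (simp add: z)
  qed
  note Rp = PGL_hom_props[OF R L(1)]
  define M where "M = {\<gamma> \<in> L. R \<gamma> \<in> PGL_pos}"
  have MsubL: "M \<subseteq> L" by (auto simp: M_def)
  have fi: "fin_index G M L"
  proof (rule fin_indexI[where f = "\<lambda>\<gamma>. R \<gamma> \<in> PGL_pos"])
    show "L \<subseteq> carrier G" using L_carrier by blast
    show "finite ((\<lambda>\<gamma>. R \<gamma> \<in> PGL_pos) ` L)" by simp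
    fix x y assume x: "x \<in> L" and y: "y \<in> L" and eq: "(R x \<in> PGL_pos) = (R y \<in> PGL_pos)"
    have "R (inv x \<otimes> y) = invf (R x) \<circ> R y" using Rp(2,4) x y L_closed(2) by simp
    then show "inv x \<otimes> y \<in> M"
      using PGL_pos_div[OF Rp(1)[OF x] Rp(1)[OF y] eq] x y by (simp add: M_def)
  qed
  show thesis
  proof (rule that[OF _ MsubL fi, of R])
    show "subgroup M G" unfolding M_def by (rule subgroup_hom_preimage[OF R L(1) subgroup_PGL_pos])
    show "PGL_hom M R" using R MsubL unfolding PGL_hom_def by blast
    show "R ` M \<subseteq> PGL_pos" by (auto simp: M_def)
    show "\<forall>S\<subseteq>M. finite (R ` S) \<longrightarrow> finite ((\<lambda>\<gamma>. gm \<gamma> s0) ` S)"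
    proof (intro allI impI)
      fix S assume "S \<subseteq> M" "finite (R ` S)"
      then have S: "S \<subseteq> \<Gamma>" "finite (R ` S)" using MsubL L(2) by simp_all
      show "finite ((\<lambda>\<gamma>. gm \<gamma> s0) ` S)" by (rule finite_germs[OF S imageI])
    qed
  qed
next
  case False
  then obtain M where M: "subgroup M G" "M \<subseteq> L" "fin_index G M L" "finite ((\<lambda>\<gamma>. gm \<gamma> s0) ` M)"
    by (rule finite_germs_nontrivial_holonomy)
  show thesis
  proof (rule that[OF M(1-3), of "\<lambda>_. id"])
    show "PGL_hom M (\<lambda>_. id)" using PGL_pos_PGL[OF id_PGL_pos] by (simp add: PGL_hom_def)
    show "\<forall>S\<subseteq>M. finite ((\<lambda>_. id :: real option \<Rightarrow> real option) ` S) \<longrightarrow> finite ((\<lambda>\<gamma>. gm \<gamma> s0) ` S)"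
      using M(4) by (meson finite_subset image_mono)
  qed auto
qed

end

context glued
begin

text \<open>The group permutes the finitely many components. The component into which an element maps a given
  one takes finitely many values, and elements for which all these agree lie in the same coset.\<close>

lemma preserved_components:
  assumes V: "finite V" and comp: "\<And>v. v \<in> V \<Longrightarrow> is_component v (C v) (\<beta> v) (h v) (sx v) (tx v)"
    and cover: "\<And>s. \<exists>v\<in>V. s \<in> C v"
  defines "L \<equiv> {\<gamma> \<in> \<Gamma>. \<forall>v\<in>V. \<forall>s\<in>C v. act \<gamma> s \<in> C v}"
  shows "subgroup L G" "fin_index G L \<Gamma>"
proof -
  have sat: "saturated (C v)" and vC: "v \<in> C v" if "v \<in> V" for v using component_saturated[OF comp[OF that]] by blast+
  have maps: "act \<gamma> t \<in> C w" if "\<gamma> \<in> \<Gamma>" "v \<in> V" "w \<in> V" "s \<in> C v" "act \<gamma> s \<in> C w" "t \<in> C v" for \<gamma> v w s t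
    using component_minimal[OF comp[OF that(2)] saturated_translate[OF sat[OF that(3)] that(1)], of s] that by blast
  have inv: "act (inv \<gamma>) t \<in> C v" if "\<gamma> \<in> \<Gamma>" "v \<in> V" "w \<in> V" "s \<in> C v" "act \<gamma> s \<in> C w" "t \<in> C w" for \<gamma> v w s t
    by (rule maps[OF _ that(3,2,5) _ that(6)]) (use that in simp_all)
  show "subgroup L G"
  proof (rule subgroupI)
    show "L \<subseteq> carrier G" by (auto simp: L_def)
    show "L \<noteq> {}" unfolding L_def by (auto intro!: exI[of _ \<one>])
    show "inv \<gamma> \<in> L" if g: "\<gamma> \<in> L" for \<gamma>
    proof -
      have "act (inv \<gamma>) s \<in> C v" if "v \<in> V" "s \<in> C v" for v s
        by (rule inv[OF _ that(1,1) vC[OF that(1)] _ that(2)]) (use g vC[OF that(1)] that(1) in \<open>auto simp: L_def\<close>)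
      then show ?thesis using g by (simp add: L_def)
    qed
    show "\<gamma> \<otimes> \<delta> \<in> L" if "\<gamma> \<in> L" "\<delta> \<in> L" for \<gamma> \<delta>
      using that by (simp add: L_def act_mult)
  qed
  obtain w where w: "\<And>s. w s \<in> V \<and> s \<in> C (w s)" using cover by metis
  show "fin_index G L \<Gamma>"
  proof (rule fin_indexI[where f = "\<lambda>\<gamma>. \<lambda>v\<in>V. w (act \<gamma> v)"])
    show "\<Gamma> \<subseteq> carrier G" by auto
    have "(\<lambda>\<gamma>. \<lambda>v\<in>V. w (act \<gamma> v)) ` \<Gamma> \<subseteq> (\<Pi>\<^sub>E v\<in>V. V)" using w by (intro image_subsetI) (simp add: PiE_iff)
    then show "finite ((\<lambda>\<gamma>. \<lambda>v\<in>V. w (act \<gamma> v)) ` \<Gamma>)" using finite_PiE[OF V] V by (meson finite_subset)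
    fix x y assume x: "x \<in> \<Gamma>" and y: "y \<in> \<Gamma>" and eq: "(\<lambda>v\<in>V. w (act x v)) = (\<lambda>v\<in>V. w (act y v))"
    have "act (inv x \<otimes> y) s \<in> C v" if v: "v \<in> V" and s: "s \<in> C v" for v s
    proof -
      have e: "w (act x v) = w (act y v)" using fun_cong[OF eq, of v] v by simp
      have "act y s \<in> C (w (act x v))" using maps[OF y v _ vC[OF v] _ s] w e by metis
      then have "act (inv x) (act y s) \<in> C v" using inv[OF x v _ vC[OF v]] w by blast
      then show ?thesis using x y by (simp add: act_mult)
    qed
    then show "inv x \<otimes> y \<in> L" using x y by (simp add: L_def)
  qed
qed

text \<open>An element is determined by its germs at one side of each component, because a trivial germ
  spreads over the component.\<close>

lemma projective_representations:
  obtains \<Lambda> and V :: "side set" and Q where "subgroup \<Lambda> G" "\<Lambda> \<subseteq> \<Gamma>" "fin_index G \<Lambda> \<Gamma>"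
    "\<forall>k\<in>\<Gamma>. \<forall>x\<in>\<Lambda>. k \<otimes> x \<otimes> inv k \<in> \<Lambda>"
    "finite V" "\<forall>v\<in>V. PGL_hom \<Lambda> (Q v)" "\<forall>v\<in>V. Q v ` \<Lambda> \<subseteq> PGL_pos"
    "\<forall>S\<subseteq>\<Lambda>. (\<forall>v\<in>V. finite (Q v ` S)) \<longrightarrow> finite S"
proof -
  have "\<forall>v. \<exists>C \<beta> h sx tx. is_component v C \<beta> h sx tx" using component_exists by blast
  then obtain C \<beta> h sx tx where comp: "\<And>v. is_component v (C v) (\<beta> v) (h v) (sx v) (tx v)" by metis
  \<comment> \<open>One side in each cell. Components are unions of cells, so those of these sides cover
    everything.\<close>
  define V where "V = (\<lambda>c. SOME s. cell s = c) ` range cell"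
  have V: "finite V" using finite_cells by (simp add: V_def)
  have cover: "\<exists>v\<in>V. s \<in> C v" for s
  proof
    let ?v = "SOME v. cell v = cell s"
    show "?v \<in> V" unfolding V_def by blast
    have "cell ?v = cell s" by (rule someI) (rule refl)
    then show "s \<in> C ?v" using component_saturated[OF comp] saturated_cell by blast
  qed
  define L where "L = {\<gamma> \<in> \<Gamma>. \<forall>v\<in>V. \<forall>s\<in>C v. act \<gamma> s \<in> C v}"
  have L: "subgroup L G" "fin_index G L \<Gamma>" using preserved_components[OF V comp cover] unfolding L_def by blast+
  have L\<Gamma>: "L \<subseteq> \<Gamma>" by (auto simp: L_def)
  have FWL: "FW_subgroup G L" by (rule FW_fin_index[OF \<Gamma> FW L(1) L\<Gamma> L(2)])
  have component: "component G \<Gamma> gm Y v (C v) (\<beta> v) (h v) (sx v) (tx v) L" if "v \<in> V" for v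
    by (intro component.intro component_axioms.intro glued_axioms comp L FWL L\<Gamma>) (use that in \<open>auto simp: L_def\<close>)
  have "\<exists>M Q. subgroup M G \<and> M \<subseteq> L \<and> fin_index G M L \<and> PGL_hom M Q \<and> Q ` M \<subseteq> PGL_pos \<and>
      (\<forall>S\<subseteq>M. finite (Q ` S) \<longrightarrow> finite ((\<lambda>\<gamma>. gm \<gamma> v) ` S))" if "v \<in> V" for v
    by (rule component.component_hom[OF component[OF that]]) blast
  then obtain M Q where M: "\<And>v. v \<in> V \<Longrightarrow> subgroup (M v) G \<and> M v \<subseteq> L \<and> fin_index G (M v) L"
    and Q: "\<And>v. v \<in> V \<Longrightarrow> PGL_hom (M v) (Q v)" "\<And>v. v \<in> V \<Longrightarrow> Q v ` M v \<subseteq> PGL_pos"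
    and fin: "\<And>v. v \<in> V \<Longrightarrow> \<forall>S\<subseteq>M v. finite (Q v ` S) \<longrightarrow> finite ((\<lambda>\<gamma>. gm \<gamma> v) ` S)"
    by metis
  define K where "K = L \<inter> (\<Inter>v\<in>V. M v)"
  have K: "subgroup K G" "fin_index G K L" using fin_index_INT[OF V L(1), of M] M unfolding K_def by simp_all
  have "fin_index G K \<Gamma>" by (rule fin_index_trans[OF K(2) L(2) _ L\<Gamma> \<Gamma>]) auto
  moreover have "K \<subseteq> \<Gamma>" using L\<Gamma> by (auto simp: K_def)
  ultimately obtain \<Lambda> where \<Lambda>: "subgroup \<Lambda> G" "\<Lambda> \<subseteq> K" "fin_index G \<Lambda> \<Gamma>"
    "\<And>k x. k \<in> \<Gamma> \<Longrightarrow> x \<in> \<Lambda> \<Longrightarrow> k \<otimes> x \<otimes> inv k \<in> \<Lambda>"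
    using fin_index_normal_core[OF _ K(1) \<Gamma>] by blast
  have \<Lambda>M: "\<Lambda> \<subseteq> M v" if "v \<in> V" for v using \<Lambda>(2) that by (auto simp: K_def)
  have \<Lambda>\<Gamma>: "\<Lambda> \<subseteq> \<Gamma>" using \<Lambda>(2) L\<Gamma> by (auto simp: K_def)
  have det: "\<gamma> = \<delta>" if g: "\<gamma> \<in> \<Gamma>" "\<delta> \<in> \<Gamma>" and eq: "\<And>v. v \<in> V \<Longrightarrow> gm \<gamma> v = gm \<delta> v" for \<gamma> \<delta>
  proof -
    have "gm (inv \<delta> \<otimes> \<gamma>) s = id" for s
    proof -
      obtain v where v: "v \<in> V" "s \<in> C v" using cover by blast
      have "act \<gamma> v = act \<delta> v" by (simp add: act_def eq[OF v(1)])
      then have "gm (inv \<delta> \<otimes> \<gamma>) v = id" using g gm_inv[of \<delta> v] by (simp add: gm_act eq[OF v(1)])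
      moreover have "v \<in> C v" using component_saturated[OF comp] by blast
      ultimately show ?thesis
        using component.trivial_germ_spreads[OF component[OF v(1)], of "inv \<delta> \<otimes> \<gamma>" v s] g v(2) by simp
    qed
    then have "inv \<delta> \<otimes> \<gamma> = \<one>" using gm_faithful[of "inv \<delta> \<otimes> \<gamma>"] g by simp
    then have "\<delta> \<otimes> (inv \<delta> \<otimes> \<gamma>) = \<delta> \<otimes> \<one>" by simp
    then show ?thesis using g by (simp add: m_assoc[symmetric])
  qed
  show thesis
  proof (rule that[OF \<Lambda>(1) \<Lambda>\<Gamma> \<Lambda>(3) _ V, of Q])
    show "\<forall>k\<in>\<Gamma>. \<forall>x\<in>\<Lambda>. k \<otimes> x \<otimes> inv k \<in> \<Lambda>" using \<Lambda>(4) by blast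
    show "\<forall>v\<in>V. PGL_hom \<Lambda> (Q v)" using Q(1) \<Lambda>M unfolding PGL_hom_def by blast
    show "\<forall>v\<in>V. Q v ` \<Lambda> \<subseteq> PGL_pos" using Q(2) \<Lambda>M by blast
    show "\<forall>S\<subseteq>\<Lambda>. (\<forall>v\<in>V. finite (Q v ` S)) \<longrightarrow> finite S"
    proof (intro allI impI)
      fix S assume S: "S \<subseteq> \<Lambda>" and f: "\<forall>v\<in>V. finite (Q v ` S)"
      have f': "finite ((\<lambda>\<gamma>. gm \<gamma> v) ` S)" if "v \<in> V" for v
        using fin[OF that] S \<Lambda>M[OF that] f that by blast
      let ?f = "\<lambda>\<gamma>. \<lambda>v\<in>V. gm \<gamma> v"
      have "?f ` S \<subseteq> (\<Pi>\<^sub>E v\<in>V. (\<lambda>\<gamma>. gm \<gamma> v) ` S)" by auto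
      then have "finite (?f ` S)" using finite_PiE[OF V f'] by (meson finite_subset)
      moreover have "inj_on ?f S"
      proof (rule inj_onI)
        fix x y assume xy: "x \<in> S" "y \<in> S" and e: "?f x = ?f y"
        show "x = y"
        proof (rule det)
          show "x \<in> \<Gamma>" "y \<in> \<Gamma>" using xy S \<Lambda>\<Gamma> by blast+
          show "gm x v = gm y v" if "v \<in> V" for v using fun_cong[OF e, of v] that by simp
        qed
      qed
      ultimately show "finite S" by (rule finite_imageD)
    qed
  qed
qed

end

section \<open>The finite normal subgroup\<close>

context group
begin

lemma finite_class_centralizer:
  assumes L: "subgroup L G" and w: "w \<in> L" and fin: "finite ((\<lambda>x. x \<otimes> w \<otimes> inv x) ` L)"
  shows "subgroup {x \<in> L. x \<otimes> w = w \<otimes> x} G" "fin_index G {x \<in> L. x \<otimes> w = w \<otimes> x} L"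
proof -
  note Lp = subgroup_props[OF L]
  have wG: "w \<in> carrier G" using Lp(1)[OF w] .
  show "subgroup {x \<in> L. x \<otimes> w = w \<otimes> x} G"
  proof (rule subgroupI)
    show "{x \<in> L. x \<otimes> w = w \<otimes> x} \<subseteq> carrier G" using Lp(1) by blast
    show "{x \<in> L. x \<otimes> w = w \<otimes> x} \<noteq> {}" using Lp(4) wG by (auto intro!: exI[of _ \<one>])
    fix x assume x: "x \<in> {x \<in> L. x \<otimes> w = w \<otimes> x}"
    then have xL: "x \<in> L" "x \<otimes> w = w \<otimes> x" by simp_all
    have xG: "x \<in> carrier G" using Lp(1)[OF xL(1)] .
    have "inv x \<otimes> (x \<otimes> w) \<otimes> inv x = inv x \<otimes> (w \<otimes> x) \<otimes> inv x" using xL(2) by simp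
    then have "w \<otimes> inv x = inv x \<otimes> w" using xG wG by (simp add: m_assoc)
    then show "inv x \<in> {x \<in> L. x \<otimes> w = w \<otimes> x}" using Lp(3)[OF xL(1)] by simp
    fix y assume y: "y \<in> {x \<in> L. x \<otimes> w = w \<otimes> x}"
    then have yL: "y \<in> L" "y \<otimes> w = w \<otimes> y" by simp_all
    have yG: "y \<in> carrier G" using Lp(1)[OF yL(1)] .
    have "x \<otimes> y \<otimes> w = x \<otimes> w \<otimes> y" using xG yG wG yL(2) by (simp add: m_assoc)
    also have "\<dots> = w \<otimes> (x \<otimes> y)" using xG yG wG xL(2) by (simp add: m_assoc)
    finally show "x \<otimes> y \<in> {x \<in> L. x \<otimes> w = w \<otimes> x}" using Lp(2)[OF xL(1) yL(1)] by simp
  qed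
  show "fin_index G {x \<in> L. x \<otimes> w = w \<otimes> x} L"
  proof (rule fin_indexI[OF _ fin])
    show "L \<subseteq> carrier G" using Lp(1) by blast
    fix x y assume x: "x \<in> L" and y: "y \<in> L" and e: "x \<otimes> w \<otimes> inv x = y \<otimes> w \<otimes> inv y"
    have xG: "x \<in> carrier G" "y \<in> carrier G" using Lp(1) x y by blast+
    have "inv x \<otimes> (y \<otimes> w \<otimes> inv y) \<otimes> y = inv x \<otimes> (x \<otimes> w \<otimes> inv x) \<otimes> y" using e by simp
    then have "inv x \<otimes> y \<otimes> w = w \<otimes> (inv x \<otimes> y)" using xG wG by (simp add: m_assoc)
    then show "inv x \<otimes> y \<in> {x \<in> L. x \<otimes> w = w \<otimes> x}" using Lp(2)[OF Lp(3)[OF x] y] by simp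
  qed
qed

text \<open>The finite joint kernel consists of the elements with finite conjugacy class: an element with
  finite class commutes with a subgroup of finite index, whose image is infinite and hence has trivial
  centralizer. This description shows that the kernel is normal in the larger group.\<close>

lemma finite_class_iff_kernel:
  assumes L: "subgroup L G" and FW: "FW_subgroup G L"
    and Q: "\<And>v. v \<in> N \<Longrightarrow> PGL_hom L (Q v)" "\<And>v. v \<in> N \<Longrightarrow> infinite (Q v ` L)"
    and W: "finite {\<gamma> \<in> L. \<forall>v\<in>N. Q v \<gamma> = id}" and w: "w \<in> L"
  shows "finite ((\<lambda>x. x \<otimes> w \<otimes> inv x) ` L) \<longleftrightarrow> (\<forall>v\<in>N. Q v w = id)"
proof
  note Lp = subgroup_props[OF L]
  assume fin: "finite ((\<lambda>x. x \<otimes> w \<otimes> inv x) ` L)"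
  define Z where "Z = {x \<in> L. x \<otimes> w = w \<otimes> x}"
  have Z: "subgroup Z G" "fin_index G Z L" using finite_class_centralizer[OF L w fin] by (simp_all add: Z_def)
  have ZL: "Z \<subseteq> L" by (auto simp: Z_def)
  have FWZ: "FW_subgroup G Z" by (rule FW_fin_index[OF L FW Z(1) ZL Z(2)])
  show "\<forall>v\<in>N. Q v w = id"
  proof
    fix v assume v: "v \<in> N"
    note Qp = PGL_hom_props[OF Q(1)[OF v] L]
    show "Q v w = id"
    proof (rule ccontr)
      assume nid: "Q v w \<noteq> id"
      have "PGL_hom Z (Q v)" using Q(1)[OF v] ZL unfolding PGL_hom_def by blast
      moreover have "Q v x \<circ> Q v w = Q v w \<circ> Q v x" if "x \<in> Z" for x
      proof -
        have x: "x \<in> L" "x \<otimes> w = w \<otimes> x" using that by (simp_all add: Z_def)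
        show ?thesis using Qp(2)[OF x(1) w] Qp(2)[OF w x(1)] x(2) by simp
      qed
      ultimately have "finite (Q v ` Z)" by (rule FW_image_in_centralizer[OF _ Z(1) FWZ Qp(1)[OF w] nid])
      then have "finite (Q v ` L)" by (rule finite_image_of_fin_index[OF Q(1)[OF v] L Z(2) ZL])
      then show False using Q(2)[OF v] by simp
    qed
  qed
next
  note Lp = subgroup_props[OF L]
  assume k: "\<forall>v\<in>N. Q v w = id"
  have "(\<lambda>x. x \<otimes> w \<otimes> inv x) ` L \<subseteq> {\<gamma> \<in> L. \<forall>v\<in>N. Q v \<gamma> = id}"
  proof (intro image_subsetI CollectI conjI ballI)
    fix x assume x: "x \<in> L"
    show "x \<otimes> w \<otimes> inv x \<in> L" using Lp(2)[OF Lp(2)[OF x w] Lp(3)[OF x]] .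
    fix v assume v: "v \<in> N"
    note Qp = PGL_hom_props[OF Q(1)[OF v] L]
    have "Q v (x \<otimes> w \<otimes> inv x) = Q v x \<circ> Q v w \<circ> invf (Q v x)"
      using Qp(2)[OF Lp(2)[OF x w] Lp(3)[OF x]] Qp(2)[OF x w] Qp(4)[OF x] by simp
    then show "Q v (x \<otimes> w \<otimes> inv x) = id" using k v Qp(1)[OF x] by simp
  qed
  then show "finite ((\<lambda>x. x \<otimes> w \<otimes> inv x) ` L)" using W by (rule finite_subset)
qed

lemma conjugate_finite_class:
  assumes \<Gamma>: "subgroup \<Gamma> G" and L: "subgroup L G" "L \<subseteq> \<Gamma>"
    and norm: "\<And>k x. k \<in> \<Gamma> \<Longrightarrow> x \<in> L \<Longrightarrow> k \<otimes> x \<otimes> inv k \<in> L"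
    and k: "k \<in> \<Gamma>" and w: "w \<in> L" and fin: "finite ((\<lambda>x. x \<otimes> w \<otimes> inv x) ` L)"
  shows "finite ((\<lambda>x. x \<otimes> (k \<otimes> w \<otimes> inv k) \<otimes> inv x) ` L)"
proof (rule finite_subset)
  show "(\<lambda>x. x \<otimes> (k \<otimes> w \<otimes> inv k) \<otimes> inv x) ` L \<subseteq> (\<lambda>z. k \<otimes> z \<otimes> inv k) ` (\<lambda>x. x \<otimes> w \<otimes> inv x) ` L"
  proof (rule image_subsetI)
    fix x assume x: "x \<in> L"
    have G: "x \<in> carrier G" "w \<in> carrier G" "k \<in> carrier G"
      using subgroup_props(1)[OF L(1)] subgroup_props(1)[OF \<Gamma>] x w k by blast+
    have y: "inv k \<otimes> x \<otimes> k \<in> L" using norm[OF subgroup_props(3)[OF \<Gamma> k] x] G by simp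
    have "x \<otimes> (k \<otimes> w \<otimes> inv k) \<otimes> inv x = k \<otimes> ((inv k \<otimes> x \<otimes> k) \<otimes> w \<otimes> inv (inv k \<otimes> x \<otimes> k)) \<otimes> inv k"
      using G by (simp add: m_assoc inv_mult_group)
    then show "x \<otimes> (k \<otimes> w \<otimes> inv k) \<otimes> inv x \<in> (\<lambda>z. k \<otimes> z \<otimes> inv k) ` (\<lambda>x. x \<otimes> w \<otimes> inv x) ` L"
      using y by blast
  qed
  show "finite ((\<lambda>z. k \<otimes> z \<otimes> inv k) ` (\<lambda>x. x \<otimes> w \<otimes> inv x) ` L)" using fin by (rule finite_imageI)
qed

text \<open>The representations with infinite image suffice: on their joint kernel the others take finitely
  many values anyway, so it is finite. There is at least one because the group is infinite.\<close>

lemma dense_representations: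
  assumes \<Gamma>: "subgroup \<Gamma> G" "FW_subgroup G \<Gamma>" "infinite \<Gamma>"
    and L: "subgroup L G" "L \<subseteq> \<Gamma>" "fin_index G L \<Gamma>"
    and norm: "\<And>k x. k \<in> \<Gamma> \<Longrightarrow> x \<in> L \<Longrightarrow> k \<otimes> x \<otimes> inv k \<in> L"
    and V: "finite V" and Q: "\<And>v. v \<in> V \<Longrightarrow> PGL_hom L (Q v)" "\<And>v. v \<in> V \<Longrightarrow> Q v ` L \<subseteq> PGL_pos"
    and fin: "\<And>S. S \<subseteq> L \<Longrightarrow> (\<forall>v\<in>V. finite (Q v ` S)) \<Longrightarrow> finite S"
  obtains N where "finite N" "N \<noteq> {}" "N \<subseteq> V" "finite {\<gamma> \<in> L. \<forall>v\<in>N. Q v \<gamma> = id}"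
    "\<forall>k\<in>\<Gamma>. \<forall>w\<in>{\<gamma> \<in> L. \<forall>v\<in>N. Q v \<gamma> = id}. k \<otimes> w \<otimes> inv k \<in> {\<gamma> \<in> L. \<forall>v\<in>N. Q v \<gamma> = id}"
    "\<forall>v\<in>N. \<forall>X. det X = 1 \<longrightarrow> X \<in> Zcl (mats L (Q v))"
proof -
  define N where "N = {v \<in> V. infinite (Q v ` L)}"
  define W where "W = {\<gamma> \<in> L. \<forall>v\<in>N. Q v \<gamma> = id}"
  have FWL: "FW_subgroup G L" by (rule FW_fin_index[OF \<Gamma>(1,2) L])
  have NV: "N \<subseteq> V" and inf: "\<And>v. v \<in> N \<Longrightarrow> infinite (Q v ` L)" by (auto simp: N_def)
  have QN: "\<And>v. v \<in> N \<Longrightarrow> PGL_hom L (Q v)" using Q(1) NV by blast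
  have Wfin: "finite W"
  proof (rule fin)
    show "W \<subseteq> L" by (auto simp: W_def)
    show "\<forall>v\<in>V. finite (Q v ` W)"
    proof
      fix v assume v: "v \<in> V"
      show "finite (Q v ` W)"
      proof (cases "v \<in> N")
        case True
        then have "Q v ` W \<subseteq> {id}" by (auto simp: W_def)
        then show ?thesis by (rule finite_subset) simp
      next
        case False
        then have "finite (Q v ` L)" using v by (simp add: N_def)
        moreover have "Q v ` W \<subseteq> Q v ` L" by (auto simp: W_def)
        ultimately show ?thesis by (meson finite_subset)
      qed
    qed
  qed
  have FC: "finite ((\<lambda>x. x \<otimes> w \<otimes> inv x) ` L) \<longleftrightarrow> (\<forall>v\<in>N. Q v w = id)" if "w \<in> L" for w
    using finite_class_iff_kernel[OF L(1) FWL _ _ Wfin[unfolded W_def] that] QN inf by simp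
  show thesis
  proof (rule that[of N, folded W_def])
    show "finite N" using V NV finite_subset by blast
    show "N \<noteq> {}"
    proof
      assume "N = {}"
      then have "finite L" using Wfin by (simp add: W_def)
      obtain T where T: "finite T" "T \<subseteq> \<Gamma>" "\<forall>x\<in>\<Gamma>. \<exists>t\<in>T. inv t \<otimes> x \<in> L"
        using L(3) unfolding fin_index_def by blast
      have "\<Gamma> \<subseteq> (\<lambda>(t, y). t \<otimes> y) ` (T \<times> L)"
      proof
        fix x assume x: "x \<in> \<Gamma>"
        then obtain t where t: "t \<in> T" "inv t \<otimes> x \<in> L" using T(3) by blast
        have "x \<in> carrier G" "t \<in> carrier G" using subgroup_props(1)[OF \<Gamma>(1)] x t(1) T(2) by blast+
        then have "x = (\<lambda>(t, y). t \<otimes> y) (t, inv t \<otimes> x)" by (simp add: m_assoc[symmetric])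
        then show "x \<in> (\<lambda>(t, y). t \<otimes> y) ` (T \<times> L)" using t by blast
      qed
      moreover have "finite ((\<lambda>(t, y). t \<otimes> y) ` (T \<times> L))" using T(1) \<open>finite L\<close> by blast
      ultimately show False using \<Gamma>(3) finite_subset by blast
    qed
    show "N \<subseteq> V" by (rule NV)
    show "finite W" by (rule Wfin)
    show "\<forall>k\<in>\<Gamma>. \<forall>w\<in>W. k \<otimes> w \<otimes> inv k \<in> W"
    proof (intro ballI)
      fix k w assume k: "k \<in> \<Gamma>" and w: "w \<in> W"
      then have wL: "w \<in> L" "finite ((\<lambda>x. x \<otimes> w \<otimes> inv x) ` L)" using FC[of w] by (simp_all add: W_def)
      have kw: "k \<otimes> w \<otimes> inv k \<in> L" using norm[OF k wL(1)] .
      show "k \<otimes> w \<otimes> inv k \<in> W"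
        using FC[OF kw] conjugate_finite_class[OF \<Gamma>(1) L(1,2) norm k wL] kw by (simp add: W_def)
    qed
    show "\<forall>v\<in>N. \<forall>X. det X = 1 \<longrightarrow> X \<in> Zcl (mats L (Q v))"
    proof (intro ballI allI impI)
      fix v and X :: "real^2^2" assume v: "v \<in> N" and X: "det X = 1"
      have "\<forall>\<gamma>\<in>L. \<exists>A. det A = 1 \<and> Q v \<gamma> = homography A"
        using Q(2)[of v] v NV unfolding PGL_pos_def by blast
      then show "X \<in> Zcl (mats L (Q v))"
        using FW_infinite_image_dense[OF QN[OF v] L(1) FWL] inf[OF v] X by blast
    qed
  qed
qed

end

section \<open>Germs of elements of \<open>PC_Proj\<close>\<close>

text \<open>The germs of a class are those of its piecewise projective representatives, all of which have
  the same germs.\<close>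

definition cgerm :: "(real option \<Rightarrow> real option) set \<Rightarrow> side \<Rightarrow> real option \<Rightarrow> real option" where
  "cgerm c = germ (SOME f. f \<in> PC_maps \<and> pw_projective f \<and> c = PC_rel `` {f})"

lemma PC_Proj_repr:
  assumes "c \<in> PC_Proj"
  obtains f where "f \<in> PC_maps" "pw_projective f" "c = PC_rel `` {f}" "cgerm c = germ f"
proof -
  obtain g where g: "g \<in> c" "pw_projective g" "c \<in> carrier PC" using assms by (auto simp: PC_Proj_def)
  then obtain h where h: "h \<in> PC_maps" "c = PC_rel `` {h}" by (auto elim: PC_carrierE)
  then have "g \<in> PC_maps" "(h, g) \<in> PC_rel" using g(1) by (auto simp: PC_rel_def)
  then have "g \<in> PC_maps \<and> pw_projective g \<and> c = PC_rel `` {g}"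
    using g(2) h(2) equiv_class_eq[OF equiv_PC_rel] by blast
  then have "\<exists>f. f \<in> PC_maps \<and> pw_projective f \<and> c = PC_rel `` {f}" by blast
  from someI_ex[OF this] show thesis by (intro that[of "SOME f. f \<in> PC_maps \<and> pw_projective f \<and> c = PC_rel `` {f}"]) (simp_all add: cgerm_def)
qed

lemma cgerm_eq:
  assumes f: "f \<in> PC_maps" "pw_projective f"
  shows "cgerm (PC_rel `` {f}) = germ f"
proof -
  have "f \<in> PC_rel `` {f}" using f by (simp add: PC_rel_def)
  then have "PC_rel `` {f} \<in> PC_Proj" using f PC_class_in_carrier unfolding PC_Proj_def by blast
  then obtain g where g: "g \<in> PC_maps" "pw_projective g" "PC_rel `` {f} = PC_rel `` {g}" "cgerm (PC_rel `` {f}) = germ g"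
    by (rule PC_Proj_repr)
  then have "(f, g) \<in> PC_rel" using eq_equiv_class[OF g(3) equiv_PC_rel] by blast
  then have "\<forall>\<^sub>F x in cofinite. f x = g x" by (simp add: PC_rel_def)
  then have "germ g = germ f" using germ_cong[OF f(2)] by blast
  then show ?thesis using g(4) by simp
qed

lemma pw_projective_id: "pw_projective id"
proof -
  have "\<forall>x :: real option. \<exists>V A. openin P1 V \<and> x \<in> V \<and> det A \<noteq> 0 \<and> (\<forall>y\<in>V. id y = homography A y)"
    by (intro allI exI[of _ UNIV] exI[of _ "mat 1"]) (use openin_topspace[of P1] in \<open>simp add: homography_mat_1\<close>)
  then show ?thesis unfolding pw_projective_def by simp
qed

lemma germ_of_id: "germ id s = id"
proof (rule germ_eqI)
  show "id \<in> PGL" using homography_PGL[of "mat 1"] homography_id by simp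
qed simp

lemma piecewise_group_PC:
  assumes \<Gamma>: "subgroup \<Gamma> PC" "\<Gamma> \<subseteq> PC_Proj" and FW: "property_FW (PC_restrict \<Gamma>)"
  shows "piecewise_group PC \<Gamma> cgerm"
proof (intro piecewise_group.intro piecewise_group_axioms.intro group_PC \<Gamma>(1))
  have one: "\<one>\<^bsub>PC\<^esub> = PC_rel `` {id}" by (simp add: PC_def)
  have one': "cgerm \<one>\<^bsub>PC\<^esub> = germ id" unfolding one by (rule cgerm_eq[OF id_PC_maps pw_projective_id])
  show "FW_subgroup PC \<Gamma>" using FW by simp
  show "cgerm \<one>\<^bsub>PC\<^esub> s = id" for s using one' germ_of_id by simp
  fix c assume "c \<in> \<Gamma>"
  then have "c \<in> PC_Proj" using \<Gamma>(2) by blast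
  then obtain f where f: "f \<in> PC_maps" "pw_projective f" "c = PC_rel `` {f}" "cgerm c = germ f" by (rule PC_Proj_repr)
  show "cgerm c s \<in> PGL" for s using f(2,4) germ_PGL by simp
  show "LC (cgerm c)" using LC_germ[OF f(2)] f(4) by simp
  show "finite {x. cgerm c (x, True) \<noteq> cgerm c (x, False)}" using germ_two_sides[OF f(2)] f(4) by simp
  show "c = \<one>\<^bsub>PC\<^esub>" if "\<And>s. cgerm c s = id"
  proof -
    have "\<forall>\<^sub>F x in cofinite. f x = x" using germ_id[OF f(2)] that f(4) by simp
    then have "(f, id) \<in> PC_rel" using f(1) id_PC_maps by (simp add: PC_rel_def)
    then show ?thesis using equiv_class_eq[OF equiv_PC_rel] f(3) one by simp
  qed
  fix d s assume "d \<in> \<Gamma>"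
  then have "d \<in> PC_Proj" using \<Gamma>(2) by blast
  then obtain g where g: "g \<in> PC_maps" "pw_projective g" "d = PC_rel `` {g}" "cgerm d = germ g" by (rule PC_Proj_repr)
  have "c \<otimes>\<^bsub>PC\<^esub> d = PC_rel `` {f \<circ> g}" using PC_mult f(1,3) g(1,3) by simp
  moreover have "f \<circ> g \<in> PC_maps" "pw_projective (f \<circ> g)"
    using f g by (simp_all add: PC_maps_compose pw_projective_compose)
  ultimately have "cgerm (c \<otimes>\<^bsub>PC\<^esub> d) = germ (f \<circ> g)" using cgerm_eq by simp
  then show "cgerm (c \<otimes>\<^bsub>PC\<^esub> d) s = cgerm c (hact (cgerm d s) s) \<circ> cgerm d s"
    using germ_comp[OF f(2) g(2), of s] f(4) g(4) by simp
qed

section \<open>Homographies as elements of \<open>PSL\<^sub>2\<close>\<close>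

text \<open>The two matrices of determinant 1 that represent the homography, which form a coset of
  \<open>{1, -1}\<close>.\<close>

definition psl :: "(real option \<Rightarrow> real option) \<Rightarrow> (real^2^2) set" where
  "psl f = {A. det A = 1 \<and> homography A = f}"

lemma minus_mat_1_mult: "- mat 1 ** A = - A" "A ** - mat 1 = - A" for A :: "real^2^2"
  by (simp_all add: vec_eq_iff forall_2 sum_2 matrix_matrix_mult_def mat_def)

lemma psl_homography:
  assumes "det A = 1"
  shows "psl (homography A) = {mat 1, - mat 1} #>\<^bsub>SL2\<^esub> A"
proof -
  have "{mat 1, - mat 1} #>\<^bsub>SL2\<^esub> A = {A, - A}"
    by (auto simp: r_coset_def SL2_def minus_mat_1_mult)
  moreover have "psl (homography A) = {A, - A}"
  proof (intro equalityI subsetI)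
    fix B assume "B \<in> psl (homography A)"
    then have B: "det B = 1" "homography B = homography A" by (simp_all add: psl_def)
    then obtain k where k: "B = k *\<^sub>R A" using homography_eqD[of B A] assms by auto
    then have "k\<^sup>2 = 1" using B(1) assms by (simp add: det_scaleR_2)
    then have "k = 1 \<or> k = - 1" by (simp add: power2_eq_1_iff)
    then show "B \<in> {A, - A}" using k by auto
  next
    fix B assume "B \<in> {A, - A}"
    moreover have "det (- A) = 1" "homography (- A) = homography A"
      using det_scaleR_2[of "- 1" A] homography_scaleR[of "- 1" A] assms by simp_all
    ultimately show "B \<in> psl (homography A)" using assms by (auto simp: psl_def)
  qed
  ultimately show ?thesis by simp
qed

lemma normal_center_SL2: "{mat 1, - mat 1} \<lhd> SL2"
proof -
  interpret group SL2 by (rule group_SL2)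
  have d: "det (- mat 1 :: real^2^2) = 1" by (simp add: det_2 mat_def)
  have "subgroup {mat 1, - mat 1} SL2"
  proof (rule subgroupI)
    fix a assume a: "a \<in> {mat 1, - mat 1 :: real^2^2}"
    have "inv\<^bsub>SL2\<^esub> a = a" using a d minus_mat_1_mult by (intro inv_equality) (auto simp: SL2_def)
    then show "inv\<^bsub>SL2\<^esub> a \<in> {mat 1, - mat 1}" using a by simp
  qed (auto simp: SL2_def d minus_mat_1_mult)
  then show ?thesis
    by (rule normalI) (auto simp: r_coset_def l_coset_def SL2_def minus_mat_1_mult)
qed

lemma carrier_PSL2: "carrier PSL2 = psl ` PGL_pos"
proof -
  have "carrier PSL2 = (\<lambda>A. {mat 1, - mat 1} #>\<^bsub>SL2\<^esub> A) ` {A. det A = 1}"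
    by (simp add: PSL2_def carrier_FactGroup) (simp add: SL2_def)
  also have "\<dots> = (\<lambda>A. psl (homography A)) ` {A. det A = 1}"
    by (rule image_cong) (simp_all add: psl_homography)
  also have "\<dots> = psl ` PGL_pos"
    by (auto simp: PGL_pos_def)
  finally show ?thesis .
qed

lemma psl_mult:
  assumes "f \<in> PGL_pos" "g \<in> PGL_pos"
  shows "psl (f \<circ> g) = psl f \<otimes>\<^bsub>PSL2\<^esub> psl g"
proof -
  interpret normal "{mat 1, - mat 1}" SL2 by (rule normal_center_SL2)
  obtain A B where A: "det A = 1" "f = homography A" and B: "det B = 1" "g = homography B"
    using assms unfolding PGL_pos_def by blast
  have "psl (f \<circ> g) = {mat 1, - mat 1} #>\<^bsub>SL2\<^esub> (A \<otimes>\<^bsub>SL2\<^esub> B)"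
    using A B psl_homography[of "A ** B"] by (simp add: homography_comp det_mul SL2_def)
  also have "\<dots> = ({mat 1, - mat 1} #>\<^bsub>SL2\<^esub> A) <#>\<^bsub>SL2\<^esub> ({mat 1, - mat 1} #>\<^bsub>SL2\<^esub> B)"
    by (rule rcos_sum[symmetric]) (use A B in \<open>simp_all add: SL2_def\<close>)
  finally show ?thesis using A B by (simp add: psl_homography PSL2_def)
qed

lemma inj_on_psl: "inj_on psl PGL_pos"
proof (rule inj_onI)
  fix f g assume f: "f \<in> PGL_pos" and eq: "psl f = psl g"
  obtain A where "det A = 1" "f = homography A" using f unfolding PGL_pos_def by blast
  then have "A \<in> psl g" using eq by (auto simp: psl_def)
  then show "f = g" using \<open>f = homography A\<close> by (simp add: psl_def)
qed

lemma one_PSL2: "\<one>\<^bsub>PSL2\<^esub> = psl id"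
proof -
  have "psl id = {mat 1, - mat 1} #>\<^bsub>SL2\<^esub> mat 1" using psl_homography[of "mat 1"] by (simp add: homography_id)
  also have "\<dots> = {mat 1, - mat 1}" by (auto simp: r_coset_def SL2_def)
  finally show ?thesis by (simp add: PSL2_def)
qed

context group
begin

text \<open>Regular functions on \<open>PSL\<^sub>2\<close> pull back to polynomials on \<open>SL\<^sub>2\<close>.\<close>

lemma Zariski_dense_psl:
  assumes pos: "Q ` L \<subseteq> PGL_pos" and dense: "\<And>X. det X = 1 \<Longrightarrow> X \<in> Zcl (mats L Q)"
  shows "Zariski_dense_PSL2 ((\<lambda>\<gamma>. psl (Q \<gamma>)) ` L)"
  unfolding Zariski_dense_PSL2_def
proof (intro conjI allI impI)
  show "(\<lambda>\<gamma>. psl (Q \<gamma>)) ` L \<subseteq> carrier PSL2" using pos by (auto simp: carrier_PSL2)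
  fix Z assume Z: "Zariski_closed_PSL2 Z \<and> (\<lambda>\<gamma>. psl (Q \<gamma>)) ` L \<subseteq> Z"
  then obtain \<F> where F: "\<forall>F\<in>\<F>. regular_PSL2 F" "Z = {x \<in> carrier PSL2. \<forall>F\<in>\<F>. F x = 0}"
    unfolding Zariski_closed_PSL2_def by blast
  have "F x = 0" if F': "F \<in> \<F>" and x: "x \<in> carrier PSL2" for F x
  proof -
    obtain p where p: "real_polynomial_function p"
      and Fp: "\<And>A. det A = 1 \<Longrightarrow> F (psl (homography A)) = p A"
      using F(1) F' unfolding regular_PSL2_def by (auto simp: SL2_def psl_homography)
    obtain X where X: "det X = 1" "x = psl (homography X)" using x by (auto simp: carrier_PSL2 PGL_pos_def)
    have "p X = 0"
    proof (rule ZclD[OF dense[OF X(1)] p])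
      fix A assume "A \<in> mats L Q"
      then obtain \<gamma> where "\<gamma> \<in> L" "homography A = Q \<gamma>" "det A = 1" by (auto simp: mats_def)
      then have "psl (homography A) \<in> Z" using Z by auto
      then have "F (psl (homography A)) = 0" using F(2) F' by simp
      then show "p A = 0" using Fp[OF \<open>det A = 1\<close>] by simp
    qed
    then show ?thesis using Fp[OF X(1)] X(2) by simp
  qed
  then show "Z = carrier PSL2" using F(2) by blast
qed

lemma psl_product_hom:
  assumes L: "subgroup L G" and Q: "\<And>i. i \<in> I \<Longrightarrow> PGL_hom L (Q i)" "\<And>i. i \<in> I \<Longrightarrow> Q i ` L \<subseteq> PGL_pos"
  defines "\<Phi> \<equiv> \<lambda>\<gamma>. \<lambda>i\<in>I. psl (Q i \<gamma>)"
  shows "group_hom (G\<lparr>carrier := L\<rparr>) (product_group I (\<lambda>_. PSL2)) \<Phi>"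
    "kernel (G\<lparr>carrier := L\<rparr>) (product_group I (\<lambda>_. PSL2)) \<Phi> = {\<gamma> \<in> L. \<forall>i\<in>I. Q i \<gamma> = id}"
proof -
  have pos: "Q i \<gamma> \<in> PGL_pos" if "i \<in> I" "\<gamma> \<in> L" for i \<gamma> using Q(2) that by blast
  have "\<Phi> \<in> hom (G\<lparr>carrier := L\<rparr>) (product_group I (\<lambda>_. PSL2))"
  proof (rule homI)
    show "\<Phi> \<gamma> \<in> carrier (product_group I (\<lambda>_. PSL2))" if "\<gamma> \<in> carrier (G\<lparr>carrier := L\<rparr>)" for \<gamma>
      using that pos by (simp add: \<Phi>_def carrier_PSL2)
    show "\<Phi> (\<gamma> \<otimes>\<^bsub>G\<lparr>carrier := L\<rparr>\<^esub> \<delta>) = \<Phi> \<gamma> \<otimes>\<^bsub>product_group I (\<lambda>_. PSL2)\<^esub> \<Phi> \<delta>"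
      if "\<gamma> \<in> carrier (G\<lparr>carrier := L\<rparr>)" "\<delta> \<in> carrier (G\<lparr>carrier := L\<rparr>)" for \<gamma> \<delta>
    proof -
      have "psl (Q i (\<gamma> \<otimes> \<delta>)) = psl (Q i \<gamma>) \<otimes>\<^bsub>PSL2\<^esub> psl (Q i \<delta>)" if "i \<in> I" for i
        using PGL_hom_props(2)[OF Q(1)[OF that] L] psl_mult pos that \<open>\<gamma> \<in> carrier (G\<lparr>carrier := L\<rparr>)\<close>
          \<open>\<delta> \<in> carrier (G\<lparr>carrier := L\<rparr>)\<close> by simp
      then show ?thesis by (simp add: \<Phi>_def fun_eq_iff restrict_def)
    qed
  qed
  then show "group_hom (G\<lparr>carrier := L\<rparr>) (product_group I (\<lambda>_. PSL2)) \<Phi>"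
    by (intro group_hom.intro group_hom_axioms.intro group_restrict[OF L] product_group group_PSL2)
  have "psl (Q i \<gamma>) = psl id \<longleftrightarrow> Q i \<gamma> = id" if "i \<in> I" "\<gamma> \<in> L" for i \<gamma>
    by (rule inj_on_eq_iff[OF inj_on_psl pos[OF that] id_PGL_pos])
  then show "kernel (G\<lparr>carrier := L\<rparr>) (product_group I (\<lambda>_. PSL2)) \<Phi> = {\<gamma> \<in> L. \<forall>i\<in>I. Q i \<gamma> = id}"
    by (auto simp: kernel_def \<Phi>_def one_PSL2 fun_eq_iff restrict_def)
qed

lemma normal_restrictI:
  assumes "subgroup \<Gamma> G" "subgroup N G" "N \<subseteq> \<Gamma>" "\<forall>k\<in>\<Gamma>. \<forall>x\<in>N. k \<otimes> x \<otimes> inv k \<in> N"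
  shows "N \<lhd> G\<lparr>carrier := \<Gamma>\<rparr>"
proof -
  interpret H: group "G\<lparr>carrier := \<Gamma>\<rparr>" by (rule group_restrict[OF assms(1)])
  have "subgroup N (G\<lparr>carrier := \<Gamma>\<rparr>)" by (rule subgroup_incl[OF assms(2,1,3)])
  then show ?thesis
    using assms(4) m_inv_consistent[OF assms(1)] by (simp add: H.normal_inv_iff)
qed

lemma finite_rcosets_restrict:
  assumes "subgroup \<Gamma> G" "N \<lhd> G\<lparr>carrier := \<Gamma>\<rparr>" "fin_index G N \<Gamma>"
  shows "finite (rcosets\<^bsub>G\<lparr>carrier := \<Gamma>\<rparr>\<^esub> N)"
proof -
  interpret N: normal N "G\<lparr>carrier := \<Gamma>\<rparr>" by fact
  obtain T where T: "finite T" "T \<subseteq> \<Gamma>" "\<forall>x\<in>\<Gamma>. \<exists>t\<in>T. inv t \<otimes> x \<in> N"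
    using assms(3) unfolding fin_index_def by blast
  have "rcosets\<^bsub>G\<lparr>carrier := \<Gamma>\<rparr>\<^esub> N \<subseteq> (\<lambda>t. N #>\<^bsub>G\<lparr>carrier := \<Gamma>\<rparr>\<^esub> t) ` T"
  proof
    fix C assume "C \<in> rcosets\<^bsub>G\<lparr>carrier := \<Gamma>\<rparr>\<^esub> N"
    then obtain x where x: "x \<in> \<Gamma>" "C = N #>\<^bsub>G\<lparr>carrier := \<Gamma>\<rparr>\<^esub> x" by (auto simp: RCOSETS_def)
    then obtain t where t: "t \<in> T" "inv t \<otimes> x \<in> N" using T(3) by blast
    have t\<Gamma>: "t \<in> \<Gamma>" using t T(2) by blast
    have "t \<in> carrier G" "x \<in> carrier G" using subgroup_props(1)[OF assms(1)] t\<Gamma> x(1) by blast+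
    then have xt: "x = t \<otimes> (inv t \<otimes> x)" by (simp add: m_assoc[symmetric])
    have "x \<in> t <#\<^bsub>G\<lparr>carrier := \<Gamma>\<rparr>\<^esub> N" using t(2) xt by (auto simp: l_coset_def)
    also have "t <#\<^bsub>G\<lparr>carrier := \<Gamma>\<rparr>\<^esub> N = N #>\<^bsub>G\<lparr>carrier := \<Gamma>\<rparr>\<^esub> t" using N.coset_eq t\<Gamma> by simp
    finally have "N #>\<^bsub>G\<lparr>carrier := \<Gamma>\<rparr>\<^esub> t = C"
      using N.repr_independence[OF _ _ N.subgroup_axioms] t\<Gamma> x(2) by simp
    then show "C \<in> (\<lambda>t. N #>\<^bsub>G\<lparr>carrier := \<Gamma>\<rparr>\<^esub> t) ` T" using t(1) by blast
  qed
  then show ?thesis using T(1) by (meson finite_imageI finite_subset)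
qed

end

section \<open>Groups of piecewise projective maps with Property FW\<close>

theorem theorem1p1:
  fixes \<Gamma> :: "(real option \<Rightarrow> real option) set set"
  assumes "subgroup \<Gamma> PC" and "\<Gamma> \<subseteq> PC_Proj"
    and "infinite \<Gamma>"
    and "property_FW (PC_restrict \<Gamma>)"
  shows "\<exists>(n::nat) W \<Lambda> \<phi>. n \<ge> 1 \<and>
    W \<subseteq> \<Lambda> \<and> \<Lambda> \<subseteq> \<Gamma> \<and>
    finite W \<and> W \<lhd> PC_restrict \<Gamma> \<and>
    \<Lambda> \<lhd> PC_restrict \<Gamma> \<and> finite (rcosets\<^bsub>PC_restrict \<Gamma>\<^esub> \<Lambda>) \<and>
    \<phi> \<in> hom (PC_restrict \<Lambda> Mod W) (product_group {1..n} (\<lambda>_. PSL2)) \<and>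
    inj_on \<phi> (carrier (PC_restrict \<Lambda> Mod W)) \<and>
    (\<forall>i\<in>{1..n}. Zariski_dense_PSL2 ((\<lambda>\<gamma>. \<phi> (W #>\<^bsub>PC_restrict \<Lambda>\<^esub> \<gamma>) i) ` \<Lambda>))"
proof -
  interpret piecewise_group PC \<Gamma> cgerm using piecewise_group_PC assms(1,2,4) .
  obtain Y where Y:
    "\<forall>s t g. (s, t, g) \<in> Y \<longrightarrow> g \<in> PGL \<and> s \<noteq> t \<and> (t, s, invf g) \<in> Y"
    "\<forall>s t g t' g'. (s, t, g) \<in> Y \<longrightarrow> (s, t', g') \<in> Y \<longrightarrow> t' = t \<and> g' = g"
    "\<forall>\<gamma>\<in>\<Gamma>. \<forall>s t g. (s, t, g) \<in> Y \<longrightarrow> (act \<gamma> s, act \<gamma> t, cgerm \<gamma> t \<circ> g \<circ> invf (cgerm \<gamma> s)) \<in> Y"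
    "finite {s. (s, flip s, id) \<notin> Y}"
    by (rule gluing_exists)
  interpret glued PC \<Gamma> cgerm Y
    by (intro glued.intro glued_axioms.intro piecewise_group_axioms) (use Y in blast)+
  obtain \<Lambda> and V :: "side set" and Q where \<Lambda>: "subgroup \<Lambda> PC" "\<Lambda> \<subseteq> \<Gamma>" "fin_index PC \<Lambda> \<Gamma>"
    "\<forall>k\<in>\<Gamma>. \<forall>x\<in>\<Lambda>. k \<otimes>\<^bsub>PC\<^esub> x \<otimes>\<^bsub>PC\<^esub> inv\<^bsub>PC\<^esub> k \<in> \<Lambda>"
    and V: "finite V" "\<forall>v\<in>V. PGL_hom \<Lambda> (Q v)" "\<forall>v\<in>V. Q v ` \<Lambda> \<subseteq> PGL_pos"
    "\<forall>S\<subseteq>\<Lambda>. (\<forall>v\<in>V. finite (Q v ` S)) \<longrightarrow> finite S"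
    by (rule projective_representations)
  obtain N where N: "finite N" "N \<noteq> {}" "N \<subseteq> V" "finite {\<gamma> \<in> \<Lambda>. \<forall>v\<in>N. Q v \<gamma> = id}"
    "\<forall>k\<in>\<Gamma>. \<forall>w\<in>{\<gamma> \<in> \<Lambda>. \<forall>v\<in>N. Q v \<gamma> = id}. k \<otimes>\<^bsub>PC\<^esub> w \<otimes>\<^bsub>PC\<^esub> inv\<^bsub>PC\<^esub> k \<in> {\<gamma> \<in> \<Lambda>. \<forall>v\<in>N. Q v \<gamma> = id}"
    "\<forall>v\<in>N. \<forall>X. det X = 1 \<longrightarrow> X \<in> Zcl (mats \<Lambda> (Q v))"
    by (rule dense_representations[OF \<Gamma> FW assms(3) \<Lambda>(1-3) \<Lambda>(4)[rule_format] V(1) V(2)[rule_format] V(3)[rule_format]])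
      (use V(4) in blast)+
  define W where "W = {\<gamma> \<in> \<Lambda>. \<forall>v\<in>N. Q v \<gamma> = id}"
  define n where "n = card N"
  obtain e where e: "bij_betw e {1..n} N" using ex_bij_betw_nat_finite_1[OF N(1)] unfolding n_def by blast
  have eN: "e i \<in> N" if "i \<in> {1..n}" for i using e that by (rule bij_betwE[rule_format])
  have eV: "e i \<in> V" if "i \<in> {1..n}" for i using eN[OF that] N(3) by blast
  let ?P = "product_group {1..n} (\<lambda>_. PSL2)"
  define \<Phi> where "\<Phi> = (\<lambda>\<gamma>. \<lambda>i\<in>{1..n}. psl (Q (e i) \<gamma>))"
  have hyp: "PGL_hom \<Lambda> (Q (e i))" "Q (e i) ` \<Lambda> \<subseteq> PGL_pos" if "i \<in> {1..n}" for i
    using V(2,3) eV[OF that] by blast+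
  interpret H: group_hom "PC_restrict \<Lambda>" ?P \<Phi>
    unfolding \<Phi>_def by (rule psl_product_hom(1)[OF \<Lambda>(1) hyp])
  have "kernel (PC_restrict \<Lambda>) ?P \<Phi> = {\<gamma> \<in> \<Lambda>. \<forall>i\<in>{1..n}. Q (e i) \<gamma> = id}"
    unfolding \<Phi>_def by (rule psl_product_hom(2)[OF \<Lambda>(1) hyp])
  also have "\<dots> = W" using bij_betw_imp_surj_on[OF e] by (auto simp: W_def)
  finally have kernel: "kernel (PC_restrict \<Lambda>) ?P \<Phi> = W" .
  define \<phi> where "\<phi> = (\<lambda>C. the_elem (\<Phi> ` C))"
  have \<phi>: "\<phi> (W #>\<^bsub>PC_restrict \<Lambda>\<^esub> \<gamma>) = \<Phi> \<gamma>" if g: "\<gamma> \<in> \<Lambda>" for \<gamma>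
  proof -
    have "\<Phi> ` (W #>\<^bsub>PC_restrict \<Lambda>\<^esub> \<gamma>) = {\<Phi> \<gamma>}"
    proof -
      have "\<Phi> (w \<otimes>\<^bsub>PC\<^esub> \<gamma>) = \<Phi> \<gamma>" if "w \<in> W" for w
      proof -
        have w: "w \<in> \<Lambda>" "\<Phi> w = \<one>\<^bsub>?P\<^esub>" using that unfolding kernel[symmetric] kernel_def by simp_all
        show ?thesis using H.hom_mult[of w \<gamma>] w g H.hom_closed[of \<gamma>] H.H.l_one[of "\<Phi> \<gamma>"]
          by (simp del: mult_product_group one_product_group carrier_product_group)
      qed
      moreover have "\<one>\<^bsub>PC\<^esub> \<in> W"
        using subgroup_props(4)[OF \<Lambda>(1)] PGL_hom_props(3)[OF _ \<Lambda>(1)] V(2) N(3) by (auto simp: W_def)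
      moreover have "\<Phi> (\<one>\<^bsub>PC\<^esub> \<otimes>\<^bsub>PC\<^esub> \<gamma>) = \<Phi> \<gamma>" using subgroup_props(1)[OF \<Lambda>(1) g] by simp
      ultimately show ?thesis by (auto simp: r_coset_def image_iff)
    qed
    then show ?thesis by (simp add: \<phi>_def)
  qed
  have Wsub: "subgroup W PC"
    using incl_subgroup[OF \<Lambda>(1)] H.subgroup_kernel unfolding kernel by blast
  have WL: "W \<subseteq> \<Lambda>" by (auto simp: W_def)
  have normal: "W \<lhd> PC_restrict \<Gamma>" "\<Lambda> \<lhd> PC_restrict \<Gamma>"
    using normal_restrictI[OF \<Gamma> Wsub] normal_restrictI[OF \<Gamma> \<Lambda>(1,2,4)] WL \<Lambda>(2) N(5) unfolding W_def by blast+
  show ?thesis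
  proof (rule exI[of _ n], rule exI[of _ W], rule exI[of _ \<Lambda>], rule exI[of _ \<phi>], intro conjI ballI WL \<Lambda>(2) normal)
    show "n \<ge> 1" using N(1,2) by (simp add: n_def Suc_le_eq card_gt_0_iff)
    show "finite W" using N(4) by (simp add: W_def)
    show "finite (rcosets\<^bsub>PC_restrict \<Gamma>\<^esub> \<Lambda>)" by (rule finite_rcosets_restrict[OF \<Gamma> normal(2) \<Lambda>(3)])
    show "\<phi> \<in> hom (PC_restrict \<Lambda> Mod W) ?P" using H.FactGroup_hom unfolding kernel \<phi>_def .
    show "inj_on \<phi> (carrier (PC_restrict \<Lambda> Mod W))" using H.FactGroup_inj_on unfolding kernel \<phi>_def .
    fix i assume i: "i \<in> {1..n}"
    have "(\<lambda>\<gamma>. \<phi> (W #>\<^bsub>PC_restrict \<Lambda>\<^esub> \<gamma>) i) ` \<Lambda> = (\<lambda>\<gamma>. psl (Q (e i) \<gamma>)) ` \<Lambda>"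
    proof (rule image_cong[OF refl])
      show "\<phi> (W #>\<^bsub>PC_restrict \<Lambda>\<^esub> \<gamma>) i = psl (Q (e i) \<gamma>)" if "\<gamma> \<in> \<Lambda>" for \<gamma>
        unfolding \<phi>[OF that] using i by (simp add: \<Phi>_def)
    qed
    moreover have "Zariski_dense_PSL2 ((\<lambda>\<gamma>. psl (Q (e i) \<gamma>)) ` \<Lambda>)"
      by (rule Zariski_dense_psl[OF hyp(2)[OF i]]) (use N(6) eN[OF i] in blast)
    ultimately show "Zariski_dense_PSL2 ((\<lambda>\<gamma>. \<phi> (W #>\<^bsub>PC_restrict \<Lambda>\<^esub> \<gamma>) i) ` \<Lambda>)" by simp
  qed
qed

end
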